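(* Let $d\ge1$ and let $\mu=\varrho(t,x)\,dt\,dx$ be a measure on $(0,1)\times\mathbb{R}^d$ such that for every $t\in[0,1)$ the function $x\mapsto\varrho(t,x)$ is a probability density on $\mathbb{R}^d$; put $\mu_t=\varrho(t,\cdot)\,dx$. Suppose that $\mu$ satisfies the weak parabolic equation $L^*\mu=0$ with initial condition $\mu_0=\varrho(0,\cdot)\,dx$ at $t=0$. Assume: (i) the matrix mapping $A=(a^{ij})$ is uniformly bounded, $A(t,x)\ge\alpha\cdot I$ for all $(t,x)$ with some constant $\alpha>0$, and the functions $x\mapsto a^{ij}(t,x)$ are Lipschitzian with constant $\lambda$ (for all $t$, $i,j$); (ii) $|b|\in L^2(\mu)$; (iii) the function $\Lambda(x):=\ln\max(|x|,1)$ is in $L^2(\mu)$; (iv) $\mu_0$ has finite entropy; (v) $\sup_{t\in[0,1)}\|b(t,\cdot)\|_{L^d(\mu_t)}<\infty$; (vi) $\varrho(0,\cdot)\in L^p(\mathbb{R}^d)$ for all $p\in[1,+\infty)$. Then $\varrho\in L^{p,q}([0,\tau]\times\mathbb{R}^d)$ for all $p,q\in[1,+\infty)$ and $\tau\in(0,1)$.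
   Context: The coefficients $a^{ij}$ and $b^i$ ($1\le i,j\le d$) are Borel functions on $[0,1]\times\mathbb{R}^d$, the matrix $A(t,x)=(a^{ij}(t,x))$ is symmetric and nonnegative, $b=(b^i)$, and (summation over repeated indices) $$Lu(t,x)=\frac{\partial u(t,x)}{\partial t}+a^{ij}(t,x)\partial_{x_i}\partial_{x_j}u(t,x)+b^i(t,x)\partial_{x_i}u(t,x).$$ A Borel probability measure $\mu(dt\,dx)=\mu_t(dx)\,dt$ on $(0,1)\times\mathbb{R}^d$, given by a family of Borel measures $(\mu_t)_{t\in[0,1)}$ on $\mathbb{R}^d$, satisfies the weak parabolic equation $L^*\mu=0$ if $a^{ij}$ and $b^i$ are $\mu$-integrable on every compact set in $(0,1)\times\mathbb{R}^d$ and $$\int_0^1\int_{\mathbb{R}^d}Lu(t,x)\,\mu_t(dx)\,dt=0\quad\text{for every }u\in C_0^\infty((0,1)\times\mathbb{R}^d).$$ It satisfies the initial condition $\mu_0=\nu$ at $t=0$ if $\lim_{t\to0}\int\zeta\,d\mu_t=\int\zeta\,d\nu$ for all $\zeta\in C_0^\infty(\mathbb{R}^d)$. A nonnegative measure $\mu_0=\varrho_0\,dx$ on $\mathbb{R}^d$ has finite entropy if $\varrho_0\ln\varrho_0\in L^1(\mathbb{R}^d)$, where $0\ln0:=0$. For $1\le p,q<\infty$, $L^{p,q}([0,\tau]\times\mathbb{R}^d)$ is the space of measurable $f$ with $\int_0^\tau\big(\int_{\mathbb{R}^d}|f(t,x)|^p\,dx\big)^{q/p}dt<\infty$ (first exponent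 for $x$, second for $t$). *)

theory Defs
  imports "HOL-Probability.Probability_Measure"
begin

section \<open>Test functions\<close>

text \<open>All iterated directional derivatives of \<open>f\<close> of order less than \<open>k\<close> are differentiable and those
  of order \<open>k\<close> are continuous. On Euclidean spaces, requiring this for every \<open>k\<close> gives \<open>C\<^sup>\<infinity>\<close>.\<close>

primrec times_diff :: "nat \<Rightarrow> ('a::real_normed_vector \<Rightarrow> 'b::real_normed_vector) \<Rightarrow> bool" where
  "times_diff 0 f \<longleftrightarrow> continuous_on UNIV f"
| "times_diff (Suc k) f \<longleftrightarrow>
     (\<forall>x. f differentiable (at x)) \<and> (\<forall>v. times_diff k (\<lambda>x. frechet_derivative f (at x) v))"

definition smooth :: "('a::real_normed_vector \<Rightarrow> 'b::real_normed_vector) \<Rightarrow> bool" where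
  "smooth f \<longleftrightarrow> (\<forall>k. times_diff k f)"

text \<open>A test function on an open set \<open>\<Omega>\<close> is identified with its extension by zero to the whole
  space, which is again smooth.\<close>

definition test_functions :: "'a::euclidean_space set \<Rightarrow> ('a \<Rightarrow> real) set" where
  "test_functions \<Omega> = {u. smooth u \<and> compact (closure {z. u z \<noteq> 0}) \<and> closure {z. u z \<noteq> 0} \<subseteq> \<Omega>}"

section \<open>The parabolic operator\<close>

text \<open>Points of \<open>\<real> \<times> \<real>\<^sup>d\<close> are pairs \<open>(t, x)\<close>, and \<open>d\<close> is \<open>CARD('n)\<close>.\<close>

definition d_t :: "(real \<times> (real^'n) \<Rightarrow> real) \<Rightarrow> real \<times> (real^'n) \<Rightarrow> real" where
  "d_t u z = frechet_derivative u (at z) (1, 0)"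

definition d_x :: "'n::finite \<Rightarrow> (real \<times> (real^'n) \<Rightarrow> real) \<Rightarrow> real \<times> (real^'n) \<Rightarrow> real" where
  "d_x i u z = frechet_derivative u (at z) (0, axis i 1)"

definition L_op :: "(real \<Rightarrow> real^'n \<Rightarrow> real^'n^'n) \<Rightarrow> (real \<Rightarrow> real^'n \<Rightarrow> real^'n) \<Rightarrow>
    (real \<times> (real^'n) \<Rightarrow> real) \<Rightarrow> real \<Rightarrow> real^'n \<Rightarrow> real" where
  "L_op a b u t x = d_t u (t, x)
     + (\<Sum>i\<in>UNIV. \<Sum>j\<in>UNIV. a t x $ i $ j * d_x i (d_x j u) (t, x))
     + (\<Sum>i\<in>UNIV. b t x $ i * d_x i u (t, x))"

definition parabolic_coefficients ::
    "(real \<Rightarrow> real^'n \<Rightarrow> real^'n^'n) \<Rightarrow> (real \<Rightarrow> real^'n \<Rightarrow> real^'n) \<Rightarrow> bool" where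
  "parabolic_coefficients a b \<longleftrightarrow>
     (\<forall>i j. (\<lambda>(t, x). a t x $ i $ j) \<in> borel_measurable (restrict_space borel ({0..1} \<times> UNIV))) \<and>
     (\<forall>i. (\<lambda>(t, x). b t x $ i) \<in> borel_measurable (restrict_space borel ({0..1} \<times> UNIV))) \<and>
     (\<forall>t\<in>{0..1}. \<forall>x. transpose (a t x) = a t x \<and> (\<forall>\<xi>. 0 \<le> \<xi> \<bullet> (a t x *v \<xi>)))"

section \<open>Measures\<close>

definition prob_density :: "('a::euclidean_space \<Rightarrow> real) \<Rightarrow> bool" where
  "prob_density f \<longleftrightarrow> f \<in> borel_measurable borel \<and> (\<forall>x. 0 \<le> f x) \<and>
     prob_space (density lborel (\<lambda>x. ennreal (f x)))"

text \<open>The underlying space is \<open>(0,1) \<times> \<real>\<^sup>d\<close> itself, so measurability and integrability with respect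
  to this measure do not involve values of the coefficients or of \<open>\<rho>\<close> at other times.\<close>

definition spacetime_measure :: "(real \<Rightarrow> real^'n \<Rightarrow> real) \<Rightarrow> (real \<times> (real^'n)) measure" where
  "spacetime_measure \<rho> =
     density (restrict_space lborel ({0<..<1} \<times> UNIV)) (\<lambda>(t, x). ennreal (\<rho> t x))"

definition time_slice :: "(real \<Rightarrow> real^'n \<Rightarrow> real) \<Rightarrow> real \<Rightarrow> (real^'n) measure" where
  "time_slice \<rho> t = density lborel (\<lambda>x. ennreal (\<rho> t x))"

text \<open>\<open>disintegrates \<mu> m\<close> is the relation \<open>\<mu>(dt dx) = m\<^sub>t(dx) dt\<close> on \<open>(0,1) \<times> \<real>\<^sup>d\<close>.\<close>

definition disintegrates :: "(real \<times> (real^'n)) measure \<Rightarrow> (real \<Rightarrow> (real^'n) measure) \<Rightarrow> bool" where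
  "disintegrates \<mu> m \<longleftrightarrow>
     sets \<mu> = sets (restrict_space borel ({0<..<1} \<times> UNIV)) \<and>
     (\<forall>t\<in>{0..<1}. sets (m t) = sets borel) \<and>
     (\<forall>E\<in>sets \<mu>. emeasure \<mu> E = (\<integral>\<^sup>+t\<in>{0<..<1}. emeasure (m t) (Pair t -` E) \<partial>lborel))"

definition weak_parabolic_solution ::
    "(real \<Rightarrow> real^'n \<Rightarrow> real^'n^'n) \<Rightarrow> (real \<Rightarrow> real^'n \<Rightarrow> real^'n) \<Rightarrow>
     (real \<times> (real^'n)) measure \<Rightarrow> (real \<Rightarrow> (real^'n) measure) \<Rightarrow> bool" where
  "weak_parabolic_solution a b \<mu> m \<longleftrightarrow>
     prob_space \<mu> \<and> disintegrates \<mu> m \<and>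
     (\<forall>K. compact K \<and> K \<subseteq> {0<..<1} \<times> UNIV \<longrightarrow>
        (\<forall>i j. set_integrable \<mu> K (\<lambda>(t, x). a t x $ i $ j)) \<and>
        (\<forall>i. set_integrable \<mu> K (\<lambda>(t, x). b t x $ i))) \<and>
     (\<forall>u\<in>test_functions ({0<..<1} \<times> UNIV).
        (LINT t:{0<..<1}|lborel. (LINT x|m t. L_op a b u t x)) = 0)"

definition has_initial_condition ::
    "(real \<Rightarrow> (real^'n) measure) \<Rightarrow> (real^'n) measure \<Rightarrow> bool" where
  "has_initial_condition m \<nu> \<longleftrightarrow>
     (\<forall>\<zeta>\<in>test_functions UNIV. ((\<lambda>t. LINT x|m t. \<zeta> x) \<longlongrightarrow> (LINT x|\<nu>. \<zeta> x)) (at_right 0))"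

text \<open>Entropy of the measure with Lebesgue density \<open>f\<close>; \<open>0 * ln 0 = 0\<close> holds in HOL.\<close>

definition finite_entropy :: "('a::euclidean_space \<Rightarrow> real) \<Rightarrow> bool" where
  "finite_entropy f \<longleftrightarrow> integrable lborel (\<lambda>x. f x * ln (f x))"

section \<open>Lebesgue spaces\<close>

text \<open>Powers of extended nonnegative reals, used only for exponents \<open>r > 0\<close>.\<close>

definition epowr :: "ennreal \<Rightarrow> real \<Rightarrow> ennreal" where
  "epowr c r = (if c = \<infinity> then \<infinity> else ennreal (enn2real c powr r))"

definition Lp_norm :: "real \<Rightarrow> 'a measure \<Rightarrow> ('a \<Rightarrow> 'b::real_normed_vector) \<Rightarrow> ennreal" where
  "Lp_norm p M f = epowr (\<integral>\<^sup>+x. ennreal (norm (f x) powr p) \<partial>M) (1 / p)"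

definition Lp_space :: "real \<Rightarrow> 'a measure \<Rightarrow> ('a \<Rightarrow> 'b::real_normed_vector) set" where
  "Lp_space p M = {f \<in> borel_measurable M. Lp_norm p M f < \<infinity>}"

text \<open>The mixed space \<open>L\<^sup>p\<^sup>,\<^sup>q([0,\<tau>] \<times> \<real>\<^sup>d)\<close>: exponent \<open>p\<close> in space, \<open>q\<close> in time.\<close>

definition Lpq_space :: "real \<Rightarrow> real \<Rightarrow> real \<Rightarrow> (real \<Rightarrow> 'a::euclidean_space \<Rightarrow> real) set" where
  "Lpq_space p q \<tau> = {f.
     (\<lambda>(t, x). f t x) \<in> borel_measurable (restrict_space borel ({0..\<tau>} \<times> UNIV)) \<and>
     (\<integral>\<^sup>+t\<in>{0..\<tau>}. epowr (\<integral>\<^sup>+x. ennreal (\<bar>f t x\<bar> powr p) \<partial>lborel) (q / p) \<partial>lborel) < \<infinity>}"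

end

theory Submission
  imports Defs "HOL-Probability.Distributions"
begin

text \<open>The proof compares \<open>\<rho>\<close> with Gaussian kernels. Freeze the matrix \<open>A\<close> at a point \<open>x\<^sub>0\<close> and test the weak
  equation with the fundamental solution \<open>Q\<close> of the backward equation \<open>\<partial>\<^sub>t Q + tr (A(t, x\<^sub>0) D\<^sup>2 Q) = 0\<close>
  with pole at \<open>(T, x\<^sub>0)\<close>. Since \<open>A\<close> is Lipschitz, \<open>\<bar>A(t, x) - A(t, x\<^sub>0)\<bar> \<bar>D\<^sup>2 Q\<bar>\<close> has, like \<open>\<bar>b\<bar> \<bar>\<nabla> Q\<bar>\<close>, only
  a singularity \<open>(T - t)\<^bsup>-1/2\<^esup>\<close> times a Gaussian kernel \<open>k\<close>. Hence, almost everywhere,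
  \<open>\<rho>(T, x) \<le> K (k\<^sub>T * \<rho>(0, \<cdot>))(x) + K \<integral>\<^sub>0\<^sup>T (T - t)\<^bsup>-1/2\<^esup> (k\<^bsub>T-t\<^esub> * ((1 + \<bar>b\<bar>) \<rho>)(t, \<cdot>))(x) dt\<close>.
  If \<open>\<rho>(t, \<cdot>)\<close> is bounded in \<open>L\<^sup>p\<close> uniformly in \<open>t\<close>, the bound on \<open>b\<close> in \<open>L\<^sup>d(\<mu>\<^sub>t)\<close> controls \<open>(1 + \<bar>b\<bar>) \<rho>\<close> in \<open>L\<^sup>r\<close> with
  \<open>1/r = 1/d + (1 - 1/d)/p\<close>, and the smoothing of the kernels improves \<open>p\<close> to \<open>p (1 + 1/d)\<close>. Starting from
  \<open>p = 1\<close>, all exponents are reached.\<close>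

section \<open>Smooth functions\<close>

text \<open>Neither the density nor the coefficients have regularity in time, so the Duhamel bound
  is never taken at a point. The pole is smeared to a Gaussian of covariance \<delta>, the terminal
  time is averaged over a short window, and both are removed only after integration against a
  continuous test function. This forces the constants of the bound to be independent of \<delta>, of
  T and of the continuous matrix standing in for \<open>A(., x0)\<close>. The prefactor of the
  kernel is controlled through conservation of mass instead of determinants. The factor 1 + 1/d has
  this origin: heat kernels carry L^r into L^P at the cost (T - t)^(-d/2 (1/r - 1/P)), and together
  with (T - t)^(-1/2) this is integrable in time if 1/r - 1/P < 1/d. For d > 1 the relation that
  defines r turns this into P < p d/(d - 1). The factor 1 + 1/d lies strictly below d/(d - 1) and
  does not depend on p, so its powers reach every exponent.\<close>

lemma frechet_derivative_eqI: "(f has_derivative f') (at x) \<Longrightarrow> frechet_derivative f (at x) = f'"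
  using frechet_derivative_at by metis

lemma times_diff_SucI:
  assumes "\<And>x. (f has_derivative (\<lambda>v. D v x)) (at x)" "\<And>v. times_diff k (D v)"
  shows "times_diff (Suc k) f"
  using assms frechet_derivative_eqI[OF assms(1)]
  by (auto simp: differentiable_def)

lemma times_diff_Suc_has_derivative:
  "times_diff (Suc k) f \<Longrightarrow> (f has_derivative frechet_derivative f (at x)) (at x)"
  by (simp add: frechet_derivative_works[symmetric])

lemma times_diff_SucD: "times_diff (Suc k) f \<Longrightarrow> times_diff k f"
proof (induction k arbitrary: f)
  case 0
  then show ?case
    by (auto intro!: continuous_at_imp_continuous_on differentiable_imp_continuous_within)
qed auto

lemma times_diff_const: "times_diff k (\<lambda>_. c)"
proof (induction k arbitrary: c)
  case (Suc k)
  show ?case by (rule times_diff_SucI[where D="\<lambda>_ _. 0"]) (use Suc in auto)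
qed auto

lemma times_diff_add: "times_diff k f \<Longrightarrow> times_diff k g \<Longrightarrow> times_diff k (\<lambda>x. f x + g x)"
proof (induction k arbitrary: f g)
  case (Suc k)
  show ?case
    by (rule times_diff_SucI[where D="\<lambda>v x. frechet_derivative f (at x) v + frechet_derivative g (at x) v"])
      (use Suc times_diff_Suc_has_derivative in \<open>auto intro!: has_derivative_add simp: frechet_derivative_works[symmetric]\<close>)
qed (auto intro!: continuous_intros)

lemma times_diff_mult:
  fixes f g :: "'a::real_normed_vector \<Rightarrow> real"
  shows "times_diff k f \<Longrightarrow> times_diff k g \<Longrightarrow> times_diff k (\<lambda>x. f x * g x)"
proof (induction k arbitrary: f g)
  case (Suc k)
  show ?case
  proof (rule times_diff_SucI[where D="\<lambda>v x. f x * frechet_derivative g (at x) v + frechet_derivative f (at x) v * g x"])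
    show "((\<lambda>x. f x * g x) has_derivative
          (\<lambda>v. f x * frechet_derivative g (at x) v + frechet_derivative f (at x) v * g x)) (at x)" for x
      by (rule has_derivative_mult; rule times_diff_Suc_has_derivative) (use Suc in auto)
    show "times_diff k (\<lambda>x. f x * frechet_derivative g (at x) v + frechet_derivative f (at x) v * g x)" for v
      by (intro times_diff_add Suc.IH times_diff_SucD[OF Suc.prems(1)] times_diff_SucD[OF Suc.prems(2)])
        (use Suc.prems in auto)
  qed
qed (auto intro!: continuous_intros)

lemma times_diff_bounded_linear: "bounded_linear f \<Longrightarrow> times_diff k f"
proof (cases k)
  case (Suc j)
  assume "bounded_linear f"
  then show ?thesis unfolding Suc
    by (intro times_diff_SucI[where D="\<lambda>v x. f v"] bounded_linear_imp_has_derivative times_diff_const)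
qed (auto simp: linear_continuous_on)

text \<open>With a scalar outer function the chain rule yields a product of functions of lower
  order, so the induction closes with \<open>times_diff_mult\<close>.\<close>

lemma times_diff_compose:
  fixes g :: "real \<Rightarrow> real" and f :: "'a::real_normed_vector \<Rightarrow> real"
  shows "times_diff k g \<Longrightarrow> times_diff k f \<Longrightarrow> times_diff k (\<lambda>x. g (f x))"
proof (induction k arbitrary: f g)
  case 0
  then show ?case by (auto intro: continuous_on_compose2)
next
  case (Suc k)
  let ?D = "\<lambda>v x. frechet_derivative f (at x) v * frechet_derivative g (at (f x)) 1"
  show ?case
  proof (rule times_diff_SucI[where D="?D"])
    fix x
    have g: "(g has_derivative frechet_derivative g (at (f x))) (at (f x))"
      and f: "(f has_derivative frechet_derivative f (at x)) (at x)"
      using Suc.prems times_diff_Suc_has_derivative by blast+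
    have "frechet_derivative g (at (f x)) r = r * frechet_derivative g (at (f x)) 1" for r
      using linear_scale[OF has_derivative_linear[OF g], of r 1] by (simp only: real_scaleR_def mult_1_right)
    then have eq: "(\<lambda>v. ?D v x) = (\<lambda>v. frechet_derivative g (at (f x)) (frechet_derivative f (at x) v))"
      by metis
    show "((\<lambda>x. g (f x)) has_derivative (\<lambda>v. ?D v x)) (at x)"
      by (rule has_derivative_eq_rhs[OF has_derivative_compose[OF f g] eq[symmetric]])
  next
    show "times_diff k (\<lambda>x. ?D v x)" for v
    proof (rule times_diff_mult)
      show "times_diff k (\<lambda>x. frechet_derivative f (at x) v)"
        using Suc.prems by simp
      show "times_diff k (\<lambda>x. frechet_derivative g (at (f x)) 1)"
        by (rule Suc.IH[of "\<lambda>y. frechet_derivative g (at y) 1" f])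
          (use Suc.prems times_diff_SucD in auto)
    qed
  qed
qed

lemma times_diff_cmult_real: "times_diff k (\<lambda>x. c * f x)" if "times_diff k f"
  for f :: "'a::real_normed_vector \<Rightarrow> real"
  by (rule times_diff_mult[OF times_diff_const that])

section \<open>A smooth bump built from exp (-1/s)\<close>

definition flat :: "nat \<Rightarrow> real \<Rightarrow> real" where
  "flat m s = (if s > 0 then inverse s ^ m * exp (- inverse s) else 0)"

lemma flat_nonneg: "0 \<le> flat m s" by (simp add: flat_def)

lemma exp_ge_power_over_fact: "0 \<le> x \<Longrightarrow> x ^ n / fact n \<le> exp (x::real)"
proof -
  assume "0 \<le> x"
  then have "(\<Sum>k\<in>{n}. x ^ k /\<^sub>R fact k) \<le> exp x"
    unfolding exp_def by (intro sum_le_suminf summable_exp_generic) auto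
  then show ?thesis by (simp add: divide_inverse mult.commute)
qed

text \<open>A single term of the exponential series at 1/s outweighs the singular power. As
  \<open>j\<close> is free, every \<open>flat m\<close> vanishes to infinite order at 0.\<close>

lemma flat_le: "flat m s \<le> fact (m + j) * \<bar>s\<bar> ^ j"
proof (cases "s > 0")
  case True
  let ?x = "inverse s"
  have "?x ^ (m + j) / fact (m + j) \<le> exp ?x"
    using True by (intro exp_ge_power_over_fact) auto
  then have "?x ^ m * ?x ^ j \<le> fact (m + j) * exp ?x"
    by (simp add: pos_divide_le_eq power_add mult.commute)
  then have "(?x ^ m * ?x ^ j) * (s ^ j * exp (- ?x)) \<le> (fact (m + j) * exp ?x) * (s ^ j * exp (- ?x))"
    using True by (intro mult_right_mono) auto
  moreover have "(?x ^ m * ?x ^ j) * (s ^ j * exp (- ?x)) = ?x ^ m * exp (- ?x) * (?x * s) ^ j"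
    by (simp only: power_mult_distrib mult_ac)
  moreover have "(fact (m + j) * exp ?x) * (s ^ j * exp (- ?x)) = fact (m + j) * s ^ j * (exp ?x * exp (- ?x))"
    by (simp only: mult_ac)
  moreover have "exp ?x * exp (- ?x) = 1" by (simp add: exp_minus)
  moreover have "?x * s = 1" using True by simp
  ultimately have "?x ^ m * exp (- ?x) \<le> fact (m + j) * s ^ j" by simp
  then show ?thesis using True by (simp add: flat_def)
qed (simp add: flat_def)

text \<open>The powers of 1/s belong to the family so that differentiation does not leave it; this
  is what lets the induction in \<open>times_diff_flat\<close> run over all \<open>m\<close> at
  once.\<close>

lemma flat_has_derivative:
  "(flat m has_real_derivative (flat (m + 2) s - real m * flat (m + 1) s)) (at s)"
proof -
  consider "s > 0" | "s < 0" | "s = 0" by linarith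
  then show ?thesis
  proof cases
    case 1
    have "((\<lambda>s. inverse s ^ m * exp (- inverse s)) has_real_derivative
       (flat (m + 2) s - real m * flat (m + 1) s)) (at s)"
    proof -
      let ?y = "inverse s"
      have y: "(inverse has_real_derivative - (?y * ?y)) (at s)"
        using DERIV_inverse[of s] 1 by (simp add: power2_eq_square numeral_2_eq_2)
      have "((\<lambda>y. y ^ m * exp (- y)) has_real_derivative
          (real m * ?y ^ (m - 1) * exp (- ?y) - ?y ^ m * exp (- ?y))) (at ?y)"
        by (auto intro!: derivative_eq_intros simp: algebra_simps)
      from DERIV_chain2[OF this y]
      have "((\<lambda>s. inverse s ^ m * exp (- inverse s)) has_real_derivative
          (real m * ?y ^ (m - 1) * exp (- ?y) - ?y ^ m * exp (- ?y)) * (- (?y * ?y))) (at s)" .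
      moreover have "(real m * ?y ^ (m - 1) * exp (- ?y) - ?y ^ m * exp (- ?y)) * (- (?y * ?y))
          = flat (m + 2) s - real m * flat (m + 1) s"
        using 1 by (cases m) (simp_all add: flat_def algebra_simps)
      ultimately show ?thesis by simp
    qed
    moreover have "\<forall>\<^sub>F x in nhds s. flat m x = inverse x ^ m * exp (- inverse x)"
      using eventually_nhds_in_open[of "{0<..}" s] 1 by (auto elim!: eventually_mono simp: flat_def)
    ultimately show ?thesis by (subst DERIV_cong_ev) auto
  next
    case 2
    have "((\<lambda>s. 0) has_real_derivative (flat (m + 2) s - real m * flat (m + 1) s)) (at s)"
      using 2 by (auto simp: flat_def)
    moreover have "\<forall>\<^sub>F x in nhds s. flat m x = 0"
      using eventually_nhds_in_open[of "{..<0}" s] 2 by (auto elim!: eventually_mono simp: flat_def)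
    ultimately show ?thesis by (subst DERIV_cong_ev) auto
  next
    case 3
    have "((\<lambda>h. (flat m h - flat m 0) / (h - 0)) \<longlongrightarrow> 0) (at 0)"
    proof (rule Lim_null_comparison)
      show "((\<lambda>h::real. fact (m+2) * \<bar>h\<bar>) \<longlongrightarrow> 0) (at 0)"
        by (auto intro!: tendsto_eq_intros)
      have "norm ((flat m h - flat m 0) / (h - 0)) \<le> fact (m+2) * \<bar>h\<bar>" if "h \<noteq> 0" for h
      proof -
        have "norm ((flat m h - flat m 0) / (h - 0)) = flat m h / \<bar>h\<bar>"
          using flat_nonneg[of m h] by (simp add: flat_def[of m 0] abs_divide)
        \<comment> \<open>\<open>flat_le\<close> with \<open>j = 2\<close> leaves one power of |h|
          after the division.\<close>
        also have "\<dots> \<le> (fact (m+2) * \<bar>h\<bar>^2) / \<bar>h\<bar>"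
          by (intro divide_right_mono flat_le) auto
        also have "\<dots> = fact (m+2) * \<bar>h\<bar>" using that by (simp only: power2_eq_square) (metis abs_eq_0 nonzero_mult_div_cancel_right mult.assoc)
        finally show ?thesis .
      qed
      then show "\<forall>\<^sub>F h in at (0::real). norm ((flat m h - flat m 0) / (h - 0)) \<le> fact (m+2) * \<bar>h\<bar>"
        by (simp only: eventually_at) (metis zero_less_one)
    qed
    then show ?thesis using 3 by (simp add: has_field_derivative_iff flat_def)
  qed
qed

lemma times_diff_flat: "times_diff k (flat m)"
proof (induction k arbitrary: m)
  case 0
  show ?case using DERIV_isCont[OF flat_has_derivative[of m]]
    by (simp only: times_diff.simps) (rule continuous_at_imp_continuous_on, blast)
next
  case (Suc k)
  show ?case
  proof (rule times_diff_SucI[where D="\<lambda>v s. v * (flat (m + 2) s + (- real m) * flat (m + 1) s)"])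
    show "(flat m has_derivative (\<lambda>v. v * (flat (m + 2) x + (- real m) * flat (m + 1) x))) (at x)" for x
      by (rule has_derivative_eq_rhs[OF flat_has_derivative[of m x, unfolded has_field_derivative_def]])
        (simp add: fun_eq_iff)
    show "times_diff k (\<lambda>s. v * (flat (m + 2) s + (- real m) * flat (m + 1) s))" for v
      by (intro times_diff_cmult_real times_diff_add Suc.IH)
  qed
qed

definition bump :: "real \<Rightarrow> 'a::euclidean_space \<Rightarrow> real" where
  "bump r z = flat 0 (r\<^sup>2 - z \<bullet> z)"

lemma times_diff_inner_self: "times_diff k (\<lambda>z::'a::euclidean_space. z \<bullet> z)"
proof (cases k)
  case (Suc j)
  show ?thesis unfolding Suc
    by (rule times_diff_SucI[where D="\<lambda>v x. 2 * (v \<bullet> x)"])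
      (auto intro!: derivative_eq_intros times_diff_bounded_linear
         bounded_linear_const_mult bounded_linear_inner_right simp: inner_commute)
qed (auto intro!: continuous_intros)

lemma smooth_bump: "smooth (bump r)"
proof -
  have "times_diff k (\<lambda>z::'a. flat 0 (r\<^sup>2 + (-1) * (z \<bullet> z)))" for k
    by (rule times_diff_compose[where g="flat 0", OF times_diff_flat])
      (intro times_diff_add times_diff_const times_diff_cmult_real times_diff_inner_self)
  then show ?thesis by (simp add: smooth_def bump_def[abs_def])
qed

lemma smooth_continuous: "smooth f \<Longrightarrow> continuous_on UNIV f"
  by (metis smooth_def times_diff.simps(1))

lemma smooth_has_derivative: "smooth f \<Longrightarrow> (f has_derivative frechet_derivative f (at x)) (at x)"
  by (meson smooth_def times_diff_Suc_has_derivative)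

lemma smooth_frechet_derivative: "smooth f \<Longrightarrow> smooth (\<lambda>x. frechet_derivative f (at x) v)"
  by (metis smooth_def times_diff.simps(2))

lemma bump_nonneg: "0 \<le> bump r z" by (simp add: bump_def flat_nonneg)

lemma bump_eq_0: "0 < r \<Longrightarrow> r \<le> norm z \<Longrightarrow> bump r z = 0"
  using power_mono[of r "norm z" 2] by (simp add: bump_def flat_def power2_norm_eq_inner)

lemma bump_pos: "norm z < r \<Longrightarrow> 0 < bump r z"
  using power_strict_mono[of "norm z" r 2] by (simp add: bump_def flat_def power2_norm_eq_inner)

section \<open>Integration on Euclidean spaces\<close>

lemma integrable_lborel_translate:
  fixes f :: "'a::euclidean_space \<Rightarrow> real"
  assumes "integrable lborel f" shows "integrable lborel (\<lambda>z. f (c + z))"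
  using assms integrable_distr[of "(+) c" lborel borel f] by (simp add: lborel_distr_plus)

lemma integral_lborel_translate:
  fixes f :: "'a::euclidean_space \<Rightarrow> real"
  assumes [measurable]: "f \<in> borel_measurable borel" shows "(\<integral>z. f (c + z) \<partial>lborel) = (\<integral>z. f z \<partial>lborel)"
  using integral_distr[of "(+) c" lborel borel f] by (simp add: lborel_distr_plus)

lemma integrable_compact_support:
  fixes f :: "'a::euclidean_space \<Rightarrow> real"
  assumes "continuous_on UNIV f" "compact K" "\<And>z. z \<notin> K \<Longrightarrow> f z = 0"
  shows "integrable lborel f"
proof -
  have "integrable lborel (\<lambda>x. indicator K x *\<^sub>R f x)"
    using assms by (intro borel_integrable_compact) (auto intro: continuous_on_subset)
  moreover have "(\<lambda>x. indicator K x *\<^sub>R f x) = f"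
    using assms(3) by (auto simp: fun_eq_iff indicator_def)
  ultimately show ?thesis by simp
qed

text \<open>Directional derivatives are assumed only at s = 0, but for all base points. Moving the
  base point gives them along the whole line, as the fundamental theorem of calculus
  requires.\<close>

lemma has_real_derivative_line_shift:
  fixes G :: "'a::real_normed_vector \<Rightarrow> real"
  assumes "\<And>z. ((\<lambda>s. G (z + s *\<^sub>R v)) has_real_derivative g z) (at 0)"
  shows "((\<lambda>s. G (z + s *\<^sub>R v)) has_real_derivative g (z + s *\<^sub>R v)) (at s)"
proof -
  have "((\<lambda>h. G ((z + s *\<^sub>R v) + h *\<^sub>R v)) has_real_derivative g (z + s *\<^sub>R v)) (at 0)"
    by (rule assms)
  then have "((\<lambda>h. G (z + (h + s) *\<^sub>R v)) has_real_derivative g (z + s *\<^sub>R v)) (at 0)"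
    by (simp add: algebra_simps)
  then show ?thesis
    using DERIV_shift[of "\<lambda>s. G (z + s *\<^sub>R v)" _ 0 s] by simp
qed

text \<open>Translation invariance replaces Fubini in coordinates: the integral of \<open>G (z + v) - G z\<close> vanishes
  and is the average over \<open>s \<in> [0,1]\<close> of the integrals of \<open>g (z + s v)\<close>.\<close>

lemma integral_directional_derivative_eq_0:
  fixes G g :: "'a::euclidean_space \<Rightarrow> real"
  assumes G: "integrable lborel G" and g: "integrable lborel g" and cont: "continuous_on UNIV g"
    and deriv: "\<And>z. ((\<lambda>s. G (z + s *\<^sub>R v)) has_real_derivative g z) (at 0)"
  shows "(\<integral>z. g z \<partial>lborel) = 0"
proof -
  have [measurable]: "G \<in> borel_measurable borel" "g \<in> borel_measurable borel"
    using G g by auto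
  let ?f = "\<lambda>s z. indicator {0..1::real} s * g (s *\<^sub>R v + z)"
  have ftc: "(\<integral>s. ?f s z \<partial>lborel) = G (v + z) - G z" for z
  proof -
    have "(\<integral>s. indicator {0..1} s *\<^sub>R g (z + s *\<^sub>R v) \<partial>lborel) = G (z + 1 *\<^sub>R v) - G (z + 0 *\<^sub>R v)"
    proof (rule integral_FTC_Icc)
      show "((\<lambda>s. G (z + s *\<^sub>R v)) has_vector_derivative g (z + s *\<^sub>R v)) (at s within {0..1})" for s
        using has_real_derivative_line_shift[OF deriv, of z s]
        by (simp add: has_real_derivative_iff_has_vector_derivative has_vector_derivative_at_within)
      show "continuous_on {0..1} (\<lambda>s. g (z + s *\<^sub>R v))"
        by (intro continuous_on_compose2[OF cont] continuous_intros) auto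
    qed simp
    then show ?thesis by (simp add: add.commute)
  qed
  have inner: "(\<integral>z. ?f s z \<partial>lborel) = indicator {0..1} s * (\<integral>z. g z \<partial>lborel)" for s
    by (simp add: integral_lborel_translate)
  have int: "integrable (lborel \<Otimes>\<^sub>M lborel) (\<lambda>(s, z). ?f s z)"
  proof (rule lborel_pair.Fubini_integrable)
    have "(\<integral>z. norm (?f s z) \<partial>lborel) = indicator {0..1} s * (\<integral>z. norm (g z) \<partial>lborel)" for s
      using integral_lborel_translate[of "\<lambda>z. norm (g z)" "s *\<^sub>R v"] by (simp add: abs_mult)
    then show "integrable lborel (\<lambda>s. \<integral>z. norm (case (s, z) of (s, z) \<Rightarrow> ?f s z) \<partial>lborel)"
      by (simp add: integrable_real_mult_indicator)
    show "AE s in lborel. integrable lborel (\<lambda>z. case (s, z) of (s, z) \<Rightarrow> ?f s z)"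
      using g by (auto intro!: integrable_lborel_translate)
  qed measurable
  have "(\<integral>z. (\<integral>s. ?f s z \<partial>lborel) \<partial>lborel) = (\<integral>s. (\<integral>z. ?f s z \<partial>lborel) \<partial>lborel)"
    by (rule lborel_pair.Fubini_integral[OF int])
  also have "\<dots> = (\<integral>z. g z \<partial>lborel)"
    unfolding inner by simp
  finally have "(\<integral>z. g z \<partial>lborel) = (\<integral>z. G (v + z) - G z \<partial>lborel)"
    by (simp add: ftc)
  also have "\<dots> = 0"
    using G by (simp add: integrable_lborel_translate integral_lborel_translate)
  finally show ?thesis .
qed

section \<open>Mollification\<close>

definition conv :: "('a::euclidean_space \<Rightarrow> real) \<Rightarrow> ('a \<Rightarrow> real) \<Rightarrow> 'a \<Rightarrow> real" where
  "conv f \<phi> z = (\<integral>w. f w * \<phi> (z - w) \<partial>lborel)"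

context
  fixes f :: "'a::euclidean_space \<Rightarrow> real" and K
  assumes f: "continuous_on UNIV f" "compact K" "\<And>z. z \<notin> K \<Longrightarrow> f z = 0"
begin

text \<open>As an integral over one fixed box, the convolution is open to Leibniz's rule for
  parameter integrals.\<close>

lemma conv_eq_integral_cbox:
  assumes "K \<subseteq> cbox a b" "continuous_on UNIV \<phi>"
  shows "conv f \<phi> z = integral (cbox a b) (\<lambda>w. f w * \<phi> (z - w))"
proof -
  have c: "continuous_on UNIV (\<lambda>w. f w * \<phi> (z - w))"
    by (intro continuous_intros f continuous_on_compose2[OF assms(2)]) auto
  have "set_integrable lborel (cbox a b) (\<lambda>w. f w * \<phi> (z - w))"
    unfolding set_integrable_def
    by (intro borel_integrable_compact continuous_on_subset[OF c]) auto
  then have "(LINT w:cbox a b|lborel. f w * \<phi> (z - w)) = integral (cbox a b) (\<lambda>w. f w * \<phi> (z - w))"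
    by (rule set_borel_integral_eq_integral)
  moreover have "(LINT w:cbox a b|lborel. f w * \<phi> (z - w)) = conv f \<phi> z"
    unfolding set_lebesgue_integral_def conv_def
    using f(3) assms(1) by (intro Bochner_Integration.integral_cong) (auto simp: indicator_def)
  ultimately show ?thesis by simp
qed

lemma conv_has_derivative:
  assumes \<phi>: "smooth \<phi>"
  shows "(conv f \<phi> has_derivative (\<lambda>v. conv f (\<lambda>x. frechet_derivative \<phi> (at x) v) z)) (at z)"
proof -
  obtain a where a: "K \<subseteq> cbox (-a) a"
    using bounded_subset_cbox_symmetric[OF compact_imp_bounded[OF f(2)]] by blast
  \<comment> \<open>\<open>leibniz_rule\<close> integrates the derivative as an operator, so it is
    packaged as a bounded linear function.\<close>
  define D where "D y = Blinfun (frechet_derivative \<phi> (at y))" for y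
  have D: "blinfun_apply (D y) = frechet_derivative \<phi> (at y)" for y
    unfolding D_def by (rule bounded_linear_Blinfun_apply)
      (rule has_derivative_bounded_linear[OF smooth_has_derivative[OF \<phi>]])
  have Dc: "continuous_on UNIV D"
    by (rule continuous_on_blinfun_componentwise)
      (auto simp: D intro!: smooth_continuous smooth_frechet_derivative \<phi>)
  let ?fx = "\<lambda>z w. f w *\<^sub>R D (z - w)"
  have c: "continuous_on UNIV (?fx z)" for z
    by (intro continuous_intros f continuous_on_compose2[OF Dc]) auto
  have "((\<lambda>z. integral (cbox (-a) a) (\<lambda>w. f w * \<phi> (z - w))) has_derivative
      integral (cbox (-a) a) (?fx z)) (at z within UNIV)"
  proof (rule leibniz_rule)
    fix x t
    have "(\<phi> has_derivative D (x - t)) (at (x - t))"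
      using smooth_has_derivative[OF \<phi>] by (simp add: D)
    moreover have "((\<lambda>x. x - t) has_derivative (\<lambda>v. v)) (at x)"
      by (auto intro!: derivative_eq_intros)
    ultimately have "((\<lambda>x. \<phi> (x - t)) has_derivative D (x - t)) (at x)"
      using has_derivative_compose[of "\<lambda>x. x - t" "\<lambda>v. v" x UNIV \<phi>] by simp
    from has_derivative_mult_right[OF this, of "f t"]
    show "((\<lambda>x. f t * \<phi> (x - t)) has_derivative blinfun_apply (f t *\<^sub>R D (x - t))) (at x within UNIV)"
      by (rule has_derivative_eq_rhs) (simp add: fun_eq_iff blinfun.scaleR_left)
  next
    show "(\<lambda>w. f w * \<phi> (x - w)) integrable_on cbox (-a) a" for x
      by (intro integrable_continuous continuous_intros continuous_on_subset[OF f(1)]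
          continuous_on_compose2[OF smooth_continuous[OF \<phi>]]) auto
    show "continuous_on (UNIV \<times> cbox (-a) a) (\<lambda>(x, t). f t *\<^sub>R D (x - t))"
      unfolding split_beta
      by (intro continuous_intros continuous_on_compose2[OF f(1)] continuous_on_compose2[OF Dc]) auto
  qed auto
  moreover have "blinfun_apply (integral (cbox (-a) a) (?fx z)) v = conv f (\<lambda>x. frechet_derivative \<phi> (at x) v) z" for v
  proof -
    have "?fx z integrable_on cbox (-a) a"
      by (intro integrable_continuous continuous_on_subset[OF c]) auto
    then have "blinfun_apply (integral (cbox (-a) a) (?fx z)) v = integral (cbox (-a) a) (\<lambda>w. blinfun_apply (?fx z w) v)"
      using integral_linear[OF \<open>?fx z integrable_on cbox (-a) a\<close> blinfun.bounded_linear_left[of v]]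
      by (simp add: o_def)
    also have "\<dots> = integral (cbox (-a) a) (\<lambda>w. f w * frechet_derivative \<phi> (at (z - w)) v)"
      by (simp add: blinfun.scaleR_left D)
    also have "\<dots> = conv f (\<lambda>x. frechet_derivative \<phi> (at x) v) z"
      by (rule conv_eq_integral_cbox[symmetric, OF a])
        (intro smooth_continuous smooth_frechet_derivative \<phi>)
    finally show ?thesis .
  qed
  then have "blinfun_apply (integral (cbox (-a) a) (?fx z)) = (\<lambda>v. conv f (\<lambda>x. frechet_derivative \<phi> (at x) v) z)"
    by auto
  moreover have "conv f \<phi> = (\<lambda>z. integral (cbox (-a) a) (\<lambda>w. f w * \<phi> (z - w)))"
    using conv_eq_integral_cbox[OF a smooth_continuous[OF \<phi>]] by auto
  ultimately show ?thesis by simp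
qed

lemma smooth_conv:
  assumes "smooth \<phi>" shows "smooth (conv f \<phi>)"
proof -
  have "times_diff k (conv f \<phi>)" for k using assms
  proof (induction k arbitrary: \<phi>)
    case 0
    have "isCont (conv f \<phi>) x" for x
      using conv_has_derivative[OF 0] has_derivative_continuous by blast
    then show ?case by (simp add: continuous_at_imp_continuous_on)
  next
    case (Suc k)
    show ?case
      by (rule times_diff_SucI[OF conv_has_derivative[OF Suc.prems]])
        (rule Suc.IH[OF smooth_frechet_derivative[OF Suc.prems]])
  qed
  then show ?thesis by (simp add: smooth_def)
qed

text \<open>Integration by parts: \<open>f w * \<phi> (z - w)\<close> has compact support, so its
  derivative along \<open>v\<close> integrates to 0. Hence the derivative may fall on
  \<open>f\<close>, for which one continuous directional derivative suffices.\<close>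

lemma frechet_derivative_conv:
  assumes "smooth \<phi>" and f': "continuous_on UNIV f'" "\<And>z. z \<notin> K \<Longrightarrow> f' z = 0"
    and deriv: "\<And>z. ((\<lambda>s. f (z + s *\<^sub>R v)) has_real_derivative f' z) (at 0)"
  shows "frechet_derivative (conv f \<phi>) (at z) v = conv f' \<phi> z"
proof -
  let ?D = "\<lambda>x. frechet_derivative \<phi> (at x) v"
  have \<phi>c: "continuous_on UNIV \<phi>" and Dc: "continuous_on UNIV ?D"
    using assms(1) smooth_continuous smooth_frechet_derivative by blast+
  have i1: "integrable lborel (\<lambda>w. f w * \<phi> (z - w))" and i2: "integrable lborel (\<lambda>w. f' w * \<phi> (z - w))"
    and i3: "integrable lborel (\<lambda>w. f w * ?D (z - w))"
    by (rule integrable_compact_support[OF _ f(2)];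
        auto simp: f(3) f'(2) intro!: continuous_intros f(1) f'(1) continuous_on_compose2[OF \<phi>c] continuous_on_compose2[OF Dc])+
  have "(\<integral>w. f' w * \<phi> (z - w) - f w * ?D (z - w) \<partial>lborel) = 0"
  proof (rule integral_directional_derivative_eq_0[where v=v])
    show "continuous_on UNIV (\<lambda>w. f' w * \<phi> (z - w) - f w * ?D (z - w))"
      by (intro continuous_intros f(1) f'(1) continuous_on_compose2[OF \<phi>c] continuous_on_compose2[OF Dc]) auto
    fix w
    have "(\<phi> has_derivative frechet_derivative \<phi> (at (z - w))) (at (z - (w + 0 *\<^sub>R v)))"
      using smooth_has_derivative[OF assms(1)] by simp
    moreover have "((\<lambda>s. z - (w + s *\<^sub>R v)) has_derivative (\<lambda>s. - (s *\<^sub>R v))) (at 0)"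
      by (auto intro!: derivative_eq_intros)
    ultimately have "((\<lambda>s. \<phi> (z - (w + s *\<^sub>R v))) has_derivative (\<lambda>s. frechet_derivative \<phi> (at (z - w)) (- (s *\<^sub>R v)))) (at 0)"
      using has_derivative_compose[of "\<lambda>s. z - (w + s *\<^sub>R v)" _ 0 UNIV \<phi>] by blast
    moreover have lin: "linear (frechet_derivative \<phi> (at (z - w)))"
      using smooth_has_derivative[OF assms(1)] has_derivative_linear by blast
    ultimately have "((\<lambda>s. \<phi> (z - (w + s *\<^sub>R v))) has_real_derivative - ?D (z - w)) (at 0)"
      unfolding has_field_derivative_def
      by (elim has_derivative_eq_rhs) (simp add: fun_eq_iff linear_neg[OF lin] linear_scale[OF lin])
    from DERIV_mult[OF deriv[of w] this]
    show "((\<lambda>s. f (w + s *\<^sub>R v) * \<phi> (z - (w + s *\<^sub>R v))) has_real_derivative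
       f' w * \<phi> (z - w) - f w * ?D (z - w)) (at 0)"
      by (simp add: algebra_simps)
  qed (use i1 i2 i3 in auto)
  then have "conv f ?D z = conv f' \<phi> z"
    using i2 i3 by (simp add: conv_def)
  moreover have "frechet_derivative (conv f \<phi>) (at z) = (\<lambda>v. conv f (\<lambda>x. frechet_derivative \<phi> (at x) v) z)"
    by (rule frechet_derivative_eqI[OF conv_has_derivative[OF assms(1)]])
  ultimately show ?thesis by simp
qed

end

lemma lborel_reflect: "distr lborel borel (\<lambda>x. c - x) = (lborel :: 'a::euclidean_space measure)"
  using lborel_affine[of "-1" c] by (simp add: density_1)

lemma integral_lborel_reflect:
  fixes f :: "'a::euclidean_space \<Rightarrow> real"
  assumes [measurable]: "f \<in> borel_measurable borel" shows "(\<integral>z. f (c - z) \<partial>lborel) = (\<integral>z. f z \<partial>lborel)"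
  using integral_distr[of "\<lambda>x. c - x" lborel borel f] by (simp add: lborel_reflect)

lemma integrable_lborel_reflect:
  fixes f :: "'a::euclidean_space \<Rightarrow> real"
  assumes "integrable lborel f" shows "integrable lborel (\<lambda>z. f (c - z))"
  using assms integrable_distr[of "\<lambda>x. c - x" lborel borel f] by (simp add: lborel_reflect)

lemma integrable_bump: "0 < r \<Longrightarrow> integrable lborel (bump r :: 'a::euclidean_space \<Rightarrow> real)"
  by (rule integrable_compact_support[of _ "cball 0 r"])
    (auto simp: smooth_continuous smooth_bump bump_eq_0)

text \<open>Otherwise the bump would vanish almost everywhere, and the open ball on which it is
  positive would be a null set.\<close>

lemma integral_bump_pos:
  assumes "0 < r" shows "0 < (\<integral>z. bump r z \<partial>(lborel :: 'a::euclidean_space measure))"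
proof (rule ccontr)
  assume "\<not> ?thesis"
  then have "(\<integral>z. bump r z \<partial>(lborel :: 'a measure)) = 0"
    by (intro antisym integral_nonneg_AE) (simp_all add: bump_nonneg)
  then have "AE z in (lborel :: 'a measure). bump r z = 0"
    using integral_nonneg_eq_0_iff_AE[OF integrable_bump[OF assms, where 'a='a]] by (simp add: bump_nonneg)
  then have "AE z in (lborel :: 'a measure). z \<notin> ball 0 r"
  proof eventually_elim
    case (elim z)
    then show ?case using bump_pos[of z r] by (auto simp: dist_norm)
  qed
  then have "emeasure lborel (ball (0::'a) r) = 0"
    by (subst (asm) AE_iff_measurable[where N="ball 0 r"]) auto
  then have "ball (0::'a) r \<in> null_sets lebesgue"
    by (intro null_sets_completionI) (simp add: null_sets_def)
  then show False
    using open_not_negligible[of "ball (0::'a) r"] assms by (simp add: negligible_iff_null_sets)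
qed

definition mol :: "real \<Rightarrow> 'a::euclidean_space \<Rightarrow> real" where
  "mol r z = inverse (\<integral>w. bump r w \<partial>(lborel :: 'a measure)) * bump r z"

lemma smooth_mol: "smooth (mol r)"
  unfolding mol_def[abs_def] using smooth_bump[of r] times_diff_cmult_real by (auto simp: smooth_def)

lemma mol_nonneg: "0 < r \<Longrightarrow> 0 \<le> mol r z"
  using integral_bump_pos[of r, where 'a='a] by (simp add: mol_def bump_nonneg)

lemma mol_eq_0: "0 < r \<Longrightarrow> r \<le> norm z \<Longrightarrow> mol r z = 0"
  by (simp add: mol_def bump_eq_0)

lemma integrable_mol: "0 < r \<Longrightarrow> integrable lborel (mol r)"
  unfolding mol_def[abs_def] by (intro integrable_mult_right integrable_bump)

lemma integral_mol: "0 < r \<Longrightarrow> (\<integral>z. mol r z \<partial>(lborel :: 'a::euclidean_space measure)) = 1"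
  using integral_bump_pos[of r, where 'a='a] by (simp add: mol_def[abs_def])

context
  fixes f :: "'a::euclidean_space \<Rightarrow> real" and K
  assumes f: "continuous_on UNIV f" "compact K" "\<And>z. z \<notin> K \<Longrightarrow> f z = 0"
begin

text \<open>\<open>mol r\<close> is a probability density on the ball of radius \<open>r\<close>, so
  the convolution averages values of \<open>f\<close> near \<open>z\<close>. The choice
  \<open>c = 0\<close> gives uniform bounds, \<open>c = f z\<close> gives convergence.\<close>

lemma conv_mol_close:
  assumes r: "0 < r" and e: "\<And>w. norm (z - w) < r \<Longrightarrow> \<bar>f w - c\<bar> \<le> e"
  shows "\<bar>conv f (mol r) z - c\<bar> \<le> e"
proof -
  have mc: "continuous_on UNIV (mol r :: 'a \<Rightarrow> real)"
    by (intro smooth_continuous smooth_mol)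
  have i1: "integrable lborel (\<lambda>w. f w * mol r (z - w))"
    by (rule integrable_compact_support[OF _ f(2)])
      (auto simp: f(3) intro!: continuous_intros f(1) continuous_on_compose2[OF mc])
  have i2: "integrable lborel (\<lambda>w. mol r (z - w))"
    by (rule integrable_lborel_reflect[OF integrable_mol[OF r]])
  have 1: "(\<integral>w. mol r (z - w) \<partial>lborel) = 1"
    using integral_lborel_reflect[of "mol r" z] integral_mol[OF r, where 'a='a] integrable_mol[OF r, where 'a='a]
    by auto
  have "conv f (mol r) z - c = (\<integral>w. f w * mol r (z - w) - c * mol r (z - w) \<partial>lborel)"
    using i1 i2 1 by (simp add: conv_def)
  also have "\<bar>\<dots>\<bar> \<le> (\<integral>w. e * mol r (z - w) \<partial>lborel)"
  proof (rule integral_abs_bound_integral)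
    fix w
    show "\<bar>f w * mol r (z - w) - c * mol r (z - w)\<bar> \<le> e * mol r (z - w)"
    proof (cases "norm (z - w) < r")
      case True
      have "\<bar>f w * mol r (z - w) - c * mol r (z - w)\<bar> = \<bar>f w - c\<bar> * mol r (z - w)"
        using mol_nonneg[OF r, of "z - w"] by (simp add: left_diff_distrib[symmetric] abs_mult)
      also have "\<dots> \<le> e * mol r (z - w)"
        by (intro mult_right_mono e True mol_nonneg r)
      finally show ?thesis .
    qed (simp add: mol_eq_0[OF r])
  qed (use i1 i2 in auto)
  also have "\<dots> = e" using 1 by simp
  finally show ?thesis .
qed

lemma conv_mol_bounded:
  assumes "0 < r" and "\<And>w. \<bar>f w\<bar> \<le> e" shows "\<bar>conv f (mol r) z\<bar> \<le> e"
  using conv_mol_close[of r z 0 e] assms by simp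

lemma conv_mol_tendsto:
  assumes r: "\<And>n. 0 < r n" "r \<longlonglongrightarrow> 0"
  shows "(\<lambda>n. conv f (mol (r n)) z) \<longlonglongrightarrow> f z"
proof (rule LIMSEQ_I)
  fix e :: real assume e: "0 < e"
  have "isCont f z" using f(1) by (simp add: continuous_on_eq_continuous_at)
  then obtain d where d: "d > 0" "\<And>w. norm (w - z) < d \<Longrightarrow> norm (f w - f z) < e / 2"
    using e by (metis (no_types) half_gt_zero isCont_iff LIM_eq continuous_at_eps_delta dist_norm)
  obtain N where N: "\<And>n. n \<ge> N \<Longrightarrow> norm (r n - 0) < d"
    using LIMSEQ_D[OF r(2) d(1)] by blast
  have "norm (conv f (mol (r n)) z - f z) < e" if "n \<ge> N" for n
  proof -
    have "r n < d" using N[OF that] by simp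
    then have "\<bar>conv f (mol (r n)) z - f z\<bar> \<le> e / 2"
      by (intro conv_mol_close r) (use d(2) in \<open>auto simp: norm_minus_commute intro!: less_imp_le\<close>)
    then show ?thesis using e by simp
  qed
  then show "\<exists>no. \<forall>n\<ge>no. norm (conv f (mol (r n)) z - f z) < e" by blast
qed

lemma conv_mol_support:
  assumes "0 < r" "conv f (mol r) z \<noteq> 0" shows "\<exists>w\<in>K. norm (z - w) \<le> r"
proof (rule ccontr)
  assume *: "\<not> ?thesis"
  have "f w * mol r (z - w) = 0" for w
    using * f(3) mol_eq_0[OF assms(1), of "z - w"] by (cases "w \<in> K") (auto simp: not_le less_imp_le)
  then have "(\<lambda>w. f w * mol r (z - w)) = (\<lambda>_. 0)" by auto
  then show False using assms(2) by (simp add: conv_def)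
qed

lemma conv_mol_test_function:
  assumes "0 < r" "(\<Union>w\<in>K. cball w r) \<subseteq> \<Omega>"
  shows "conv f (mol r) \<in> test_functions \<Omega>"
proof -
  \<comment> \<open>The Minkowski sum of \<open>K\<close> and a closed ball is compact and contains
    the support of the mollified function.\<close>
  let ?K = "{x + y |x y. x \<in> K \<and> y \<in> cball 0 r}"
  have c: "compact ?K" using compact_sums[OF f(2), of "cball 0 r"] by simp
  have sub: "{z. conv f (mol r) z \<noteq> 0} \<subseteq> ?K"
  proof clarify
    fix z assume "conv f (mol r) z \<noteq> 0"
    then obtain w where "w \<in> K" "norm (z - w) \<le> r" using conv_mol_support assms by blast
    then show "\<exists>x y. z = x + y \<and> x \<in> K \<and> y \<in> cball 0 r"
      by (intro exI[of _ w] exI[of _ "z - w"]) (auto simp: dist_norm norm_minus_commute)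
  qed
  then have sub2: "closure {z. conv f (mol r) z \<noteq> 0} \<subseteq> ?K"
    by (intro closure_minimal compact_imp_closed c)
  have c2: "compact (closure {z. conv f (mol r) z \<noteq> 0})"
    using compact_Int_closed[OF c closed_closure, of "{z. conv f (mol r) z \<noteq> 0}"]
    unfolding Int_absorb1[OF sub2] .
  have "?K \<subseteq> (\<Union>w\<in>K. cball w r)" by (auto simp: dist_norm)
  then show ?thesis
    using smooth_conv[OF f smooth_mol] sub2 c2 assms(2) by (auto simp: test_functions_def)
qed

end

section \<open>The weak equation for a wider class of test functions\<close>

lemma nn_integral_prod_lborel:
  fixes f :: "real \<Rightarrow> real^'n::finite \<Rightarrow> ennreal"
  assumes "(\<lambda>z. f (fst z) (snd z)) \<in> borel_measurable borel"
  shows "(\<integral>\<^sup>+z. f (fst z) (snd z) \<partial>lborel) = (\<integral>\<^sup>+t. \<integral>\<^sup>+x. f t x \<partial>lborel \<partial>lborel)"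
  using lborel.nn_integral_fst[of "\<lambda>z. f (fst z) (snd z)" lborel] assms
  by (simp add: lborel_prod borel_prod)

lemma frechet_derivative_eq_0_outside:
  assumes "closed K" "\<And>x. x \<notin> K \<Longrightarrow> f x = 0" "x \<notin> K"
  shows "frechet_derivative f (at x) v = 0"
proof -
  have "((\<lambda>_. 0) has_derivative (\<lambda>_. 0)) (at x)" by simp
  then have "(f has_derivative (\<lambda>_. 0)) (at x)"
    by (rule has_derivative_transform_within_open[where s="- K"]) (use assms in auto)
  then show ?thesis by (simp add: frechet_derivative_eqI)
qed

lemma bounded_of_compact_support:
  fixes f :: "'a::euclidean_space \<Rightarrow> real"
  assumes "continuous_on UNIV f" "compact K" "\<And>z. z \<notin> K \<Longrightarrow> f z = 0"
  shows "\<exists>E\<ge>0. \<forall>z. \<bar>f z\<bar> \<le> E"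
proof -
  have "bounded (f ` K)"
    by (intro compact_imp_bounded compact_continuous_image continuous_on_subset[OF assms(1)] assms) auto
  then obtain b where "\<And>z. z \<in> K \<Longrightarrow> \<bar>f z\<bar> \<le> b" by (auto simp: bounded_real)
  then have "\<bar>f z\<bar> \<le> max b 0" for z using assms(3)[of z] by (cases "z \<in> K") (auto simp: le_max_iff_disj)
  then show ?thesis by (intro exI[of _ "max b 0"]) auto
qed

text \<open>The coefficients and the density are extended to all times: \<open>R\<close> and \<open>B\<close> by zero outside \<open>(0,1)\<close>, and
  \<open>A\<close> by a multiple of the identity.\<close>

locale drift_density =
  fixes A :: "real \<Rightarrow> real^'n::finite \<Rightarrow> real^'n^'n" and B :: "real \<Rightarrow> real^'n \<Rightarrow> real^'n"
    and R :: "real \<Rightarrow> real^'n \<Rightarrow> real" and r0 :: "real^'n \<Rightarrow> real" and C lam \<alpha> M1 :: real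
  assumes A_meas: "\<And>i j. (\<lambda>z. A (fst z) (snd z) $ i $ j) \<in> borel_measurable borel"
    and B_meas: "\<And>i. (\<lambda>z. B (fst z) (snd z) $ i) \<in> borel_measurable borel"
    and R_meas: "(\<lambda>z. R (fst z) (snd z)) \<in> borel_measurable borel"
    and R_nonneg: "\<And>t x. 0 \<le> R t x"
    and R_eq_0: "\<And>t x. t \<notin> {0<..<1} \<Longrightarrow> R t x = 0"
    and R_prob: "\<And>t. t \<in> {0<..<1} \<Longrightarrow> (\<integral>\<^sup>+x. ennreal (R t x) \<partial>lborel) = 1"
    and r0_meas: "r0 \<in> borel_measurable borel" and r0_nonneg: "\<And>x. 0 \<le> r0 x"
    and r0_prob: "(\<integral>\<^sup>+x. ennreal (r0 x) \<partial>lborel) = 1"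
    and A_sym: "\<And>t x. transpose (A t x) = A t x"
    and A_bound: "\<And>t x i j. \<bar>A t x $ i $ j\<bar> \<le> C"
    and A_elliptic: "\<And>t x \<xi>. \<alpha> * (\<xi> \<bullet> \<xi>) \<le> \<xi> \<bullet> (A t x *v \<xi>)"
    and alpha_pos: "0 < \<alpha>"
    and A_lipschitz: "\<And>t x y i j. \<bar>A t x $ i $ j - A t y $ i $ j\<bar> \<le> lam * norm (x - y)"
    and lam_nonneg: "0 \<le> lam"
    and M1_nonneg: "0 \<le> M1"
    and BR_bound: "\<And>t. (\<integral>\<^sup>+x. ennreal (norm (B t x) * R t x) \<partial>lborel) \<le> ennreal M1"
begin

lemma C_nonneg: "0 \<le> C"
  using A_bound[of undefined undefined undefined undefined] abs_ge_zero order_trans by blast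

lemma B_meas_vec: "(\<lambda>z. B (fst z) (snd z)) \<in> borel_measurable borel"
  using B_meas by (subst borel_measurable_euclidean_space) (auto simp: Basis_vec_def inner_axis)

lemma R_slice_meas [measurable]: "R t \<in> borel_measurable borel"
  using measurable_compose[OF _ R_meas, of "Pair t" borel] by simp

lemma B_slice_meas [measurable]: "B t \<in> borel_measurable borel"
  using measurable_compose[OF _ B_meas_vec, of "Pair t" borel] by simp

lemma R_le_1: "(\<integral>\<^sup>+x. ennreal (R t x) \<partial>lborel) \<le> 1"
  using R_prob[of t] R_eq_0[of t] by (cases "t \<in> {0<..<1}") auto

lemma R_slice_integrable: "integrable lborel (R t)"
  by (intro integrableI_nonneg) (auto simp: R_nonneg intro!: le_less_trans[OF R_le_1])

lemma R_integral_le_1: "(\<integral>x. R t x \<partial>lborel) \<le> 1"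
  using R_le_1[of t] R_nonneg nn_integral_eq_integral[OF R_slice_integrable, of t] by simp

lemma R_integrable: "integrable lborel (\<lambda>z. R (fst z) (snd z))"
proof (rule integrableI_nonneg)
  have "(\<integral>\<^sup>+z. ennreal (R (fst z) (snd z)) \<partial>lborel) = (\<integral>\<^sup>+t. \<integral>\<^sup>+x. ennreal (R t x) \<partial>lborel \<partial>lborel)"
    using R_meas by (intro nn_integral_prod_lborel) measurable
  also have "\<dots> \<le> (\<integral>\<^sup>+t. indicator {0<..<1::real} t \<partial>lborel)"
    using R_le_1 R_eq_0 by (intro nn_integral_mono) (auto simp: indicator_def)
  finally show "(\<integral>\<^sup>+z. ennreal (R (fst z) (snd z)) \<partial>lborel) < \<infinity>"
    by (simp add: order.strict_trans1)
qed (use R_meas R_nonneg in auto)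

lemma BR_integrable: "integrable lborel (\<lambda>z. norm (B (fst z) (snd z)) * R (fst z) (snd z))"
proof (rule integrableI_nonneg)
  have [measurable]: "(\<lambda>z. norm (B (fst z) (snd z)) * R (fst z) (snd z)) \<in> borel_measurable borel"
    using B_meas_vec R_meas by measurable
  have "(\<integral>\<^sup>+z. ennreal (norm (B (fst z) (snd z)) * R (fst z) (snd z)) \<partial>lborel)
     = (\<integral>\<^sup>+t. \<integral>\<^sup>+x. ennreal (norm (B t x) * R t x) \<partial>lborel \<partial>lborel)"
    by (intro nn_integral_prod_lborel) measurable
  also have "\<dots> \<le> (\<integral>\<^sup>+t. ennreal M1 * indicator {0<..<1::real} t \<partial>lborel)"
    using BR_bound R_eq_0 by (intro nn_integral_mono) (auto simp: indicator_def)
  also have "\<dots> = ennreal M1" by (simp add: nn_integral_cmult)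
  finally show "(\<integral>\<^sup>+z. ennreal (norm (B (fst z) (snd z)) * R (fst z) (snd z)) \<partial>lborel) < \<infinity>"
    by (simp add: order.strict_trans1)
qed (use B_meas_vec R_meas R_nonneg in auto)

text \<open>The operator L with the derivatives as independent arguments. In this form each
  derivative can be replaced by its own limit, without differentiability of the limit function in
  the sense of Frechet.\<close>

definition generator :: "(real \<times> (real^'n) \<Rightarrow> real) \<Rightarrow> ('n \<Rightarrow> real \<times> (real^'n) \<Rightarrow> real) \<Rightarrow>
    ('n \<Rightarrow> 'n \<Rightarrow> real \<times> (real^'n) \<Rightarrow> real) \<Rightarrow> real \<times> (real^'n) \<Rightarrow> real" where
  "generator vt vx vxx z = vt z
     + (\<Sum>i\<in>UNIV. \<Sum>j\<in>UNIV. A (fst z) (snd z) $ i $ j * vxx i j z)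
     + (\<Sum>i\<in>UNIV. B (fst z) (snd z) $ i * vx i z)"

text \<open>The bound is affine in |B|, hence integrable against \<open>R\<close> by
  \<open>R_integrable\<close> and \<open>BR_integrable\<close>. It is the dominating function of
  every limit passage in the test function.\<close>

lemma generator_bound:
  assumes "\<bar>vt z\<bar> \<le> E" "\<And>i. \<bar>vx i z\<bar> \<le> E" "\<And>i j. \<bar>vxx i j z\<bar> \<le> E" "0 \<le> E"
  shows "\<bar>generator vt vx vxx z\<bar> \<le> E + real CARD('n)^2 * C * E + real CARD('n) * E * norm (B (fst z) (snd z))"
proof -
  have 1: "\<bar>\<Sum>i\<in>UNIV. \<Sum>j\<in>UNIV. A (fst z) (snd z) $ i $ j * vxx i j z\<bar> \<le> (\<Sum>i\<in>(UNIV::'n set). \<Sum>j\<in>(UNIV::'n set). C * E)"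
    by (intro order_trans[OF sum_abs] sum_mono)
      (auto simp: abs_mult intro!: mult_mono A_bound assms C_nonneg)
  have 2: "\<bar>\<Sum>i\<in>UNIV. B (fst z) (snd z) $ i * vx i z\<bar> \<le> (\<Sum>i\<in>(UNIV::'n set). norm (B (fst z) (snd z)) * E)"
    by (intro order_trans[OF sum_abs] sum_mono)
      (auto simp: abs_mult intro!: mult_mono component_le_norm_cart assms)
  have "(\<Sum>i\<in>(UNIV::'n set). \<Sum>j\<in>(UNIV::'n set). C * E) = real CARD('n)^2 * C * E"
    "(\<Sum>i\<in>(UNIV::'n set). norm (B (fst z) (snd z)) * E) = real CARD('n) * E * norm (B (fst z) (snd z))"
    by (simp_all add: power2_eq_square)
  then show ?thesis using assms(1) 1 2 unfolding generator_def by linarith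
qed

lemma generator_measurable:
  assumes "vt \<in> borel_measurable borel" "\<And>i. vx i \<in> borel_measurable borel" "\<And>i j. vxx i j \<in> borel_measurable borel"
  shows "generator vt vx vxx \<in> borel_measurable borel"
  unfolding generator_def[abs_def]
  by (intro borel_measurable_add borel_measurable_sum borel_measurable_times assms A_meas B_meas)

lemma L_op_eq_generator:
  "L_op A B u (fst z) (snd z) = generator (d_t u) (\<lambda>i. d_x i u) (\<lambda>i j. d_x i (d_x j u)) z"
  by (simp add: L_op_def generator_def)

lemma L_op_measurable:
  assumes "u \<in> test_functions \<Omega>" shows "(\<lambda>z. L_op A B u (fst z) (snd z)) \<in> borel_measurable borel"
proof -
  have "smooth u" using assms by (simp add: test_functions_def)
  then show ?thesis unfolding L_op_eq_generator d_t_def[abs_def] d_x_def[abs_def]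
    by (intro generator_measurable borel_measurable_continuous_onI smooth_continuous smooth_frechet_derivative)
qed

lemma L_op_integrable:
  assumes u: "u \<in> test_functions \<Omega>"
  shows "integrable lborel (\<lambda>z. L_op A B u (fst z) (snd z) * R (fst z) (snd z))"
proof -
  define K where "K = closure {z. u z \<noteq> 0}"
  have su: "smooth u" and K: "compact K" using u by (auto simp: test_functions_def K_def)
  have uK: "u z = 0" if "z \<notin> K" for z using that closure_subset[of "{z. u z \<noteq> 0}"] by (auto simp: K_def)
  have closed: "closed K" using K by (rule compact_imp_closed)
  have st: "smooth (d_t u)" and sx: "smooth (d_x i u)" and sxx: "smooth (d_x i (d_x j u))" for i j
    unfolding d_t_def[abs_def] d_x_def[abs_def] by (intro smooth_frechet_derivative su)+
  have tK: "d_t u z = 0" if "z \<notin> K" for z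
    unfolding d_t_def by (rule frechet_derivative_eq_0_outside[OF closed]) (use that uK in auto)
  have xK: "d_x i u z = 0" if "z \<notin> K" for i z
    unfolding d_x_def by (rule frechet_derivative_eq_0_outside[OF closed]) (use that uK in auto)
  have xxK: "d_x i (d_x j u) z = 0" if "z \<notin> K" for i j z
    unfolding d_x_def[of i "d_x j u"] by (rule frechet_derivative_eq_0_outside[OF closed]) (use that xK in auto)
  obtain Et where Et: "\<And>z. \<bar>d_t u z\<bar> \<le> Et" using bounded_of_compact_support[OF smooth_continuous[OF st] K tK] by blast
  obtain Ex where Ex: "\<And>i z. \<bar>d_x i u z\<bar> \<le> Ex i" using bounded_of_compact_support[OF smooth_continuous[OF sx] K xK] by metis
  obtain Exx where Exx: "\<And>i j z. \<bar>d_x i (d_x j u) z\<bar> \<le> Exx i j"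
    using bounded_of_compact_support[OF smooth_continuous[OF sxx] K xxK] by metis
  define E where "E = Max (insert Et (range Ex \<union> range (\<lambda>(i, j). Exx i j)))"
  have "Et \<le> E" "Ex i \<le> E" "Exx i j \<le> E" for i j
    unfolding E_def by (rule Max_ge; force)+
  then have E: "\<bar>d_t u z\<bar> \<le> E" "\<bar>d_x i u z\<bar> \<le> E" "\<bar>d_x i (d_x j u) z\<bar> \<le> E" for i j z
    using Et Ex Exx order_trans by blast+
  have E0: "0 \<le> E" using E(1) abs_ge_zero order_trans by blast
  let ?w = "\<lambda>z. (E + real CARD('n)^2 * C * E) * R (fst z) (snd z)
    + real CARD('n) * E * (norm (B (fst z) (snd z)) * R (fst z) (snd z))"
  show ?thesis unfolding L_op_eq_generator
  proof (rule Bochner_Integration.integrable_bound[where f="?w"])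
    show "integrable lborel ?w"
      using R_integrable BR_integrable by (intro Bochner_Integration.integrable_add integrable_mult_right)
    show "(\<lambda>z. generator (d_t u) (\<lambda>i. d_x i u) (\<lambda>i j. d_x i (d_x j u)) z * R (fst z) (snd z)) \<in> borel_measurable lborel"
      using L_op_measurable[OF u] R_meas by (simp add: L_op_eq_generator)
    show "AE z in lborel. norm (generator (d_t u) (\<lambda>i. d_x i u) (\<lambda>i j. d_x i (d_x j u)) z * R (fst z) (snd z)) \<le> norm (?w z)"
    proof (rule AE_I2)
      fix z
      have "\<bar>generator (d_t u) (\<lambda>i. d_x i u) (\<lambda>i j. d_x i (d_x j u)) z\<bar> * R (fst z) (snd z) \<le>
        (E + real CARD('n)^2 * C * E + real CARD('n) * E * norm (B (fst z) (snd z))) * R (fst z) (snd z)"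
        by (intro mult_right_mono generator_bound E E0 R_nonneg)
      then show "norm (generator (d_t u) (\<lambda>i. d_x i u) (\<lambda>i j. d_x i (d_x j u)) z * R (fst z) (snd z)) \<le> norm (?w z)"
        by (simp add: abs_mult R_nonneg algebra_simps)
    qed
  qed
qed

text \<open>Connects the iterated integral of the weak equation with the space-time integral used
  from here on.\<close>

lemma L_op_integral_iterated:
  assumes "u \<in> test_functions \<Omega>"
  shows "(\<integral>z. L_op A B u (fst z) (snd z) * R (fst z) (snd z) \<partial>lborel) = (\<integral>t. \<integral>x. L_op A B u t x * R t x \<partial>lborel \<partial>lborel)"
  using lborel_pair.integral_fst'[of "\<lambda>z. L_op A B u (fst z) (snd z) * R (fst z) (snd z)"] L_op_integrable[OF assms]
  by (simp add: lborel_prod)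

end

section \<open>Test functions of class C^{1,2} without compact support in space\<close>

locale parabolic_density = drift_density A B R r0 C lam \<alpha> M1
  for A :: "real \<Rightarrow> real^'n::finite \<Rightarrow> real^'n^'n" and B R r0 C lam \<alpha> M1 +
  assumes weak: "\<And>u. u \<in> test_functions ({0<..<1} \<times> UNIV) \<Longrightarrow>
      (\<integral>z. L_op A B u (fst z) (snd z) * R (fst z) (snd z) \<partial>lborel) = 0"
    and init: "\<And>\<zeta>. \<zeta> \<in> test_functions UNIV \<Longrightarrow>
      ((\<lambda>t. \<integral>x. \<zeta> x * R t x \<partial>lborel) \<longlongrightarrow> (\<integral>x. \<zeta> x * r0 x \<partial>lborel)) (at_right 0)"
begin

text \<open>The class of test functions is enlarged twice, by mollification and by spatial cutoff;
  both times pointwise convergence of the derivatives under a uniform bound is enough.\<close>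

lemma generator_tendsto_0:
  assumes lim: "\<And>z. (\<lambda>n. vt n z) \<longlonglongrightarrow> vt' z" "\<And>i z. (\<lambda>n. vx n i z) \<longlonglongrightarrow> vx' i z"
      "\<And>i j z. (\<lambda>n. vxx n i j z) \<longlonglongrightarrow> vxx' i j z"
    and bd: "\<And>n z. \<bar>vt n z\<bar> \<le> E" "\<And>n i z. \<bar>vx n i z\<bar> \<le> E" "\<And>n i j z. \<bar>vxx n i j z\<bar> \<le> E"
    and meas: "\<And>n. vt n \<in> borel_measurable borel" "\<And>n i. vx n i \<in> borel_measurable borel"
      "\<And>n i j. vxx n i j \<in> borel_measurable borel"
      "vt' \<in> borel_measurable borel" "\<And>i. vx' i \<in> borel_measurable borel"
      "\<And>i j. vxx' i j \<in> borel_measurable borel"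
    and zero: "\<And>n. (\<integral>z. generator (vt n) (vx n) (vxx n) z * R (fst z) (snd z) \<partial>lborel) = 0"
  shows "(\<integral>z. generator vt' vx' vxx' z * R (fst z) (snd z) \<partial>lborel) = 0"
proof -
  have E: "0 \<le> E" using bd(1) abs_ge_zero order_trans by blast
  let ?w = "\<lambda>z. (E + real CARD('n)^2 * C * E) * R (fst z) (snd z)
    + real CARD('n) * E * (norm (B (fst z) (snd z)) * R (fst z) (snd z))"
  have "(\<lambda>n. \<integral>z. generator (vt n) (vx n) (vxx n) z * R (fst z) (snd z) \<partial>lborel)
    \<longlonglongrightarrow> (\<integral>z. generator vt' vx' vxx' z * R (fst z) (snd z) \<partial>lborel)"
  proof (rule integral_dominated_convergence[where w="?w"])
    show "integrable lborel ?w"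
      using R_integrable BR_integrable by (intro Bochner_Integration.integrable_add integrable_mult_right)
    show "AE z in lborel. (\<lambda>n. generator (vt n) (vx n) (vxx n) z * R (fst z) (snd z))
        \<longlonglongrightarrow> generator vt' vx' vxx' z * R (fst z) (snd z)"
      unfolding generator_def by (intro AE_I2 tendsto_intros lim)
    show "AE z in lborel. norm (generator (vt n) (vx n) (vxx n) z * R (fst z) (snd z)) \<le> ?w z" for n
    proof (rule AE_I2)
      fix z
      have "\<bar>generator (vt n) (vx n) (vxx n) z\<bar> * R (fst z) (snd z) \<le>
        (E + real CARD('n)^2 * C * E + real CARD('n) * E * norm (B (fst z) (snd z))) * R (fst z) (snd z)"
        by (intro mult_right_mono generator_bound bd E R_nonneg)
      then show "norm (generator (vt n) (vx n) (vxx n) z * R (fst z) (snd z)) \<le> ?w z"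
        by (simp add: abs_mult R_nonneg algebra_simps)
    qed
  qed (use generator_measurable[OF meas(1-3)] generator_measurable[OF meas(4-6)] R_meas in auto)
  then show ?thesis using zero by (simp add: LIMSEQ_const_iff)
qed

text \<open>The mollified function is an admissible test function, and by
  \<open>frechet_derivative_conv\<close> its derivatives are the mollified derivatives, which
  converge boundedly.\<close>

lemma weak_C12_compact:
  fixes v vt :: "real \<times> (real^'n) \<Rightarrow> real"
  assumes K: "compact K" "K \<subseteq> {0<..<1} \<times> UNIV"
    and cont: "continuous_on UNIV v" "continuous_on UNIV vt" "\<And>i. continuous_on UNIV (vx i)"
      "\<And>i j. continuous_on UNIV (vxx i j)"
    and supp: "\<And>z. z \<notin> K \<Longrightarrow> v z = 0" "\<And>z. z \<notin> K \<Longrightarrow> vt z = 0" "\<And>z i. z \<notin> K \<Longrightarrow> vx i z = 0"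
      "\<And>z i j. z \<notin> K \<Longrightarrow> vxx i j z = 0"
    and deriv: "\<And>z. ((\<lambda>s. v (z + s *\<^sub>R (1, 0))) has_real_derivative vt z) (at 0)"
      "\<And>z i. ((\<lambda>s. v (z + s *\<^sub>R (0, axis i 1))) has_real_derivative vx i z) (at 0)"
      "\<And>z i j. ((\<lambda>s. vx j (z + s *\<^sub>R (0, axis i 1))) has_real_derivative vxx i j z) (at 0)"
  shows "(\<integral>z. generator vt vx vxx z * R (fst z) (snd z) \<partial>lborel) = 0"
proof -
  have "open ({0<..<1::real} \<times> (UNIV :: (real^'n) set))" by (intro open_Times) auto
  \<comment> \<open>Mollifying with a radius of at most \<open>e\<close> keeps the support inside
    the open time interval.\<close>
  then obtain e where e: "e > 0" "(\<Union>w\<in>K. cball w e) \<subseteq> {0<..<1} \<times> UNIV"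
    using compact_subset_open_imp_cball_epsilon_subset[OF K(1) _ K(2)] by blast
  define r where "r n = e / real (Suc n)" for n
  have r: "0 < r n" "r n \<le> e" for n using e(1) by (auto simp: r_def divide_le_eq)
  have rl: "r \<longlonglongrightarrow> 0" unfolding r_def by (rule lim_const_over_n[THEN LIMSEQ_Suc])
  obtain Et where Et: "\<And>z. \<bar>vt z\<bar> \<le> Et" using bounded_of_compact_support[OF cont(2) K(1) supp(2)] by blast
  obtain Ex where Ex: "\<And>i z. \<bar>vx i z\<bar> \<le> Ex i" using bounded_of_compact_support[OF cont(3) K(1) supp(3)] by metis
  obtain Exx where Exx: "\<And>i j z. \<bar>vxx i j z\<bar> \<le> Exx i j" using bounded_of_compact_support[OF cont(4) K(1) supp(4)] by metis
  define E where "E = \<bar>Et\<bar> + (\<Sum>i\<in>UNIV. \<bar>Ex i\<bar>) + (\<Sum>i\<in>UNIV. \<Sum>j\<in>UNIV. \<bar>Exx i j\<bar>)"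
  have nn: "0 \<le> (\<Sum>i\<in>UNIV. \<bar>Ex i\<bar>)" "0 \<le> (\<Sum>i\<in>UNIV. \<Sum>j\<in>UNIV. \<bar>Exx i j\<bar>)"
    by (intro sum_nonneg; simp)+
  have E1: "\<bar>vt z\<bar> \<le> E" for z unfolding E_def using Et[of z] nn by linarith
  have E2: "\<bar>vx i z\<bar> \<le> E" for i z
  proof -
    have "\<bar>Ex i\<bar> \<le> (\<Sum>i\<in>UNIV. \<bar>Ex i\<bar>)" by (rule member_le_sum) auto
    then show ?thesis unfolding E_def using Ex[of i z] nn by linarith
  qed
  have E3: "\<bar>vxx i j z\<bar> \<le> E" for i j z
  proof -
    have "\<bar>Exx i j\<bar> \<le> (\<Sum>j\<in>UNIV. \<bar>Exx i j\<bar>)" by (rule member_le_sum) auto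
    also have "\<dots> \<le> (\<Sum>i\<in>UNIV. \<Sum>j\<in>UNIV. \<bar>Exx i j\<bar>)"
      by (rule member_le_sum[where f="\<lambda>i. \<Sum>j\<in>UNIV. \<bar>Exx i j\<bar>"]) (auto intro: sum_nonneg)
    finally show ?thesis unfolding E_def using Exx[of i j z] nn by linarith
  qed
  have sm: "smooth (mol (r n))" for n by (rule smooth_mol)
  have meas: "conv f (mol (r n)) \<in> borel_measurable borel"
    if "continuous_on UNIV f" "\<And>z. z \<notin> K \<Longrightarrow> f z = 0" for f :: "real \<times> (real^'n) \<Rightarrow> real" and n
    by (intro borel_measurable_continuous_onI smooth_continuous smooth_conv[OF that(1) K(1) that(2)] sm)
  show ?thesis
  proof (rule generator_tendsto_0[where vt="\<lambda>n. conv vt (mol (r n))" and vx="\<lambda>n i. conv (vx i) (mol (r n))"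
        and vxx="\<lambda>n i j. conv (vxx i j) (mol (r n))" and E=E])
    fix n
    let ?u = "conv v (mol (r n))"
    have "(\<Union>w\<in>K. cball w (r n)) \<subseteq> (\<Union>w\<in>K. cball w e)" by (intro UN_mono subset_cball r order_refl)
    then have sub: "(\<Union>w\<in>K. cball w (r n)) \<subseteq> {0<..<1} \<times> UNIV" using e(2) by (rule order_trans)
    have "?u \<in> test_functions ({0<..<1} \<times> UNIV)"
      by (rule conv_mol_test_function[OF cont(1) K(1) _ r(1) sub]) (rule supp(1))
    from weak[OF this] have w: "(\<integral>z. L_op A B ?u (fst z) (snd z) * R (fst z) (snd z) \<partial>lborel) = 0" .
    have dt: "d_t ?u z = conv vt (mol (r n)) z" for z
      unfolding d_t_def by (rule frechet_derivative_conv[OF cont(1) K(1) supp(1) sm cont(2) supp(2) deriv(1)])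
    have dx: "d_x i ?u = conv (vx i) (mol (r n))" for i
      unfolding d_x_def[abs_def]
      by (rule ext, rule frechet_derivative_conv[OF cont(1) K(1) supp(1) sm cont(3) supp(3) deriv(2)])
    have dxx: "d_x i (conv (vx j) (mol (r n))) z = conv (vxx i j) (mol (r n)) z" for i j z
      unfolding d_x_def by (rule frechet_derivative_conv[OF cont(3) K(1) supp(3) sm cont(4) supp(4) deriv(3)])
    have "L_op A B ?u (fst z) (snd z) = generator (conv vt (mol (r n))) (\<lambda>i. conv (vx i) (mol (r n)))
        (\<lambda>i j. conv (vxx i j) (mol (r n))) z" for z
      unfolding L_op_def generator_def dx prod.collapse dt dxx by (rule refl)
    with w show "(\<integral>z. generator (conv vt (mol (r n))) (\<lambda>i. conv (vx i) (mol (r n)))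
        (\<lambda>i j. conv (vxx i j) (mol (r n))) z * R (fst z) (snd z) \<partial>lborel) = 0"
      by (simp only:)
  next
    show "(\<lambda>n. conv vt (mol (r n)) z) \<longlonglongrightarrow> vt z" for z
      by (rule conv_mol_tendsto[OF cont(2) K(1) supp(2) r(1) rl])
    show "(\<lambda>n. conv (vx i) (mol (r n)) z) \<longlonglongrightarrow> vx i z" for i z
      by (rule conv_mol_tendsto[OF cont(3) K(1) supp(3) r(1) rl])
    show "(\<lambda>n. conv (vxx i j) (mol (r n)) z) \<longlonglongrightarrow> vxx i j z" for i j z
      by (rule conv_mol_tendsto[OF cont(4) K(1) supp(4) r(1) rl])
    show "\<bar>conv vt (mol (r n)) z\<bar> \<le> E" for n z
      by (rule conv_mol_bounded[OF cont(2) K(1) supp(2) r(1) E1])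
    show "\<bar>conv (vx i) (mol (r n)) z\<bar> \<le> E" for n i z
      by (rule conv_mol_bounded[OF cont(3) K(1) supp(3) r(1) E2])
    show "\<bar>conv (vxx i j) (mol (r n)) z\<bar> \<le> E" for n i j z
      by (rule conv_mol_bounded[OF cont(4) K(1) supp(4) r(1) E3])
  qed (intro meas cont supp borel_measurable_continuous_onI; assumption)+
qed

end

lemma smooth_has_directional_derivative:
  assumes "smooth f"
  shows "((\<lambda>s. f (x + s *\<^sub>R v)) has_real_derivative frechet_derivative f (at x) v) (at 0)"
proof -
  have f: "(f has_derivative frechet_derivative f (at x)) (at (x + 0 *\<^sub>R v))"
    using smooth_has_derivative[OF assms] by simp
  have "((\<lambda>s. x + s *\<^sub>R v) has_derivative (\<lambda>s. s *\<^sub>R v)) (at 0)"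
    by (auto intro!: derivative_eq_intros)
  from has_derivative_compose[OF this f]
  have "((\<lambda>s. f (x + s *\<^sub>R v)) has_derivative (\<lambda>s. frechet_derivative f (at x) (s *\<^sub>R v))) (at 0)" .
  moreover have "linear (frechet_derivative f (at x))"
    using smooth_has_derivative[OF assms] has_derivative_linear by blast
  ultimately show ?thesis
    unfolding has_field_derivative_def
    by (elim has_derivative_eq_rhs) (simp add: fun_eq_iff linear_scale)
qed

lemma DERIV_scaled_argument:
  fixes g :: "'a::real_normed_vector \<Rightarrow> real"
  assumes "((\<lambda>s. g (c *\<^sub>R x + s *\<^sub>R v)) has_real_derivative d) (at 0)"
  shows "((\<lambda>s. g (c *\<^sub>R (x + s *\<^sub>R v))) has_real_derivative c * d) (at 0)"
proof -
  have "((\<lambda>s. c * s) has_real_derivative c) (at 0)" by (auto intro!: derivative_eq_intros)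
  from DERIV_chain2[OF _ this, of "\<lambda>s. g (c *\<^sub>R x + s *\<^sub>R v)" d] assms
  show ?thesis by (simp add: scaleR_add_right mult.commute)
qed

context parabolic_density begin

text \<open>Gaussian kernels do not vanish for large x. They become admissible after multiplication
  by a cutoff \<open>h (c n x)\<close> that spreads out as \<open>c n\<close> tends to 0; all
  derivatives stay bounded.\<close>

lemma weak_C12:
  fixes v vt :: "real \<times> (real^'n) \<Rightarrow> real"
  assumes s: "0 < s1" "s2 < 1"
    and cont: "continuous_on UNIV v" "continuous_on UNIV vt" "\<And>i. continuous_on UNIV (vx i)"
      "\<And>i j. continuous_on UNIV (vxx i j)"
    and supp: "\<And>z. fst z \<notin> {s1..s2} \<Longrightarrow> v z = 0" "\<And>z. fst z \<notin> {s1..s2} \<Longrightarrow> vt z = 0"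
      "\<And>z i. fst z \<notin> {s1..s2} \<Longrightarrow> vx i z = 0" "\<And>z i j. fst z \<notin> {s1..s2} \<Longrightarrow> vxx i j z = 0"
    and bd: "\<And>z. \<bar>v z\<bar> \<le> E" "\<And>z. \<bar>vt z\<bar> \<le> E" "\<And>i z. \<bar>vx i z\<bar> \<le> E" "\<And>i j z. \<bar>vxx i j z\<bar> \<le> E"
    and deriv: "\<And>z. ((\<lambda>s. v (z + s *\<^sub>R (1, 0))) has_real_derivative vt z) (at 0)"
      "\<And>z i. ((\<lambda>s. v (z + s *\<^sub>R (0, axis i 1))) has_real_derivative vx i z) (at 0)"
      "\<And>z i j. ((\<lambda>s. vx j (z + s *\<^sub>R (0, axis i 1))) has_real_derivative vxx i j z) (at 0)"
  shows "(\<integral>z. generator vt vx vxx z * R (fst z) (snd z) \<partial>lborel) = 0"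
proof -
  \<comment> \<open>Normalised to \<open>h 0 = 1\<close>, so that \<open>h (c n x)\<close> tends to
    1 at every x.\<close>
  define h where "h x = bump 1 x / bump 1 (0::real^'n)" for x :: "real^'n"
  have h0: "h 0 = 1" using bump_pos[of "0::real^'n" 1] by (simp add: h_def)
  have "times_diff k (\<lambda>x. inverse (bump 1 (0::real^'n)) * bump 1 (x::real^'n))" for k
    using smooth_bump by (intro times_diff_cmult_real) (auto simp: smooth_def)
  then have sh: "smooth h"
    by (simp add: smooth_def h_def[abs_def] divide_inverse mult.commute)
  define hx where "hx i x = frechet_derivative h (at x) (axis i 1)" for i x
  define hxx where "hxx i j x = frechet_derivative (hx j) (at x) (axis i 1)" for i j x
  have shx: "smooth (hx i)" for i unfolding hx_def[abs_def] by (rule smooth_frechet_derivative[OF sh])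
  have shxx: "smooth (hxx i j)" for i j unfolding hxx_def[abs_def] by (rule smooth_frechet_derivative[OF shx])
  have hK: "h x = 0" if "x \<notin> cball 0 1" for x using that by (simp add: h_def bump_eq_0)
  have hxK: "hx i x = 0" if "x \<notin> cball 0 1" for i x unfolding hx_def
    by (rule frechet_derivative_eq_0_outside[of "cball 0 1"]) (use that hK in auto)
  have hxxK: "hxx i j x = 0" if "x \<notin> cball 0 1" for i j x unfolding hxx_def
    by (rule frechet_derivative_eq_0_outside[of "cball 0 1"]) (use that hxK in auto)
  have "\<exists>E\<ge>0. \<forall>z. \<bar>h z\<bar> \<le> E"
    by (rule bounded_of_compact_support[OF smooth_continuous[OF sh] compact_cball[of 0 1]]) (rule hK)
  then obtain H where H: "H \<ge> 0" "\<And>x. \<bar>h x\<bar> \<le> H" by blast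
  have "\<exists>E\<ge>0. \<forall>z. \<bar>hx i z\<bar> \<le> E" for i
    by (rule bounded_of_compact_support[OF smooth_continuous[OF shx] compact_cball[of 0 1]]) (rule hxK)
  then obtain Hx where Hx: "\<And>i x. \<bar>hx i x\<bar> \<le> Hx i" by metis
  have "\<exists>E\<ge>0. \<forall>z. \<bar>hxx i j z\<bar> \<le> E" for i j
    by (rule bounded_of_compact_support[OF smooth_continuous[OF shxx] compact_cball[of 0 1]]) (rule hxxK)
  then obtain Hxx where Hxx: "\<And>i j x. \<bar>hxx i j x\<bar> \<le> Hxx i j" by metis
  define G where "G = H + Max (range Hx) + Max (range (\<lambda>(i, j). Hxx i j))"
  have Hx0: "0 \<le> Hx i" for i using Hx[of i 0] by linarith
  have Hxx0: "0 \<le> Hxx i j" for i j using Hxx[of i j 0] by linarith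
  have mx: "Hx i \<le> Max (range Hx)" for i by (rule Max_ge) auto
  have mxx: "Hxx i j \<le> Max (range (\<lambda>(i, j). Hxx i j))" for i j by (rule Max_ge) auto
  have mx0: "0 \<le> Max (range Hx)" "0 \<le> Max (range (\<lambda>(i, j). Hxx i j))"
    using mx Hx0 mxx Hxx0 order_trans by blast+
  have G1: "\<bar>h x\<bar> \<le> G" for x using H(2)[of x] mx0 unfolding G_def by linarith
  have G2: "\<bar>hx i x\<bar> \<le> G" for i x using Hx[of i x] mx[of i] H(1) mx0 unfolding G_def by linarith
  have G3: "\<bar>hxx i j x\<bar> \<le> G" for i j x using Hxx[of i j x] mxx[of i j] H(1) mx0 unfolding G_def by linarith
  have G0: "0 \<le> G" using G1[of 0] by linarith
  have E0: "0 \<le> E" using bd(1) abs_ge_zero order_trans by blast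
  define c where "c n = inverse (real (Suc n))" for n
  have c: "0 < c n" "c n \<le> 1" for n by (auto simp: c_def inverse_le_1_iff)
  have cl: "c \<longlonglongrightarrow> 0" unfolding c_def by (rule LIMSEQ_inverse_real_of_nat)
  define w where "w n z = v z * h (c n *\<^sub>R snd z)" for n z
  define wt where "wt n z = vt z * h (c n *\<^sub>R snd z)" for n z
  \<comment> \<open>Every derivative that falls on the cutoff brings a factor \<open>c n\<close>, so
    these terms disappear in the limit.\<close>
  define wx where "wx n i z = vx i z * h (c n *\<^sub>R snd z) + v z * (c n * hx i (c n *\<^sub>R snd z))" for n i z
  define wxx where "wxx n i j z = (vxx i j z * h (c n *\<^sub>R snd z) + vx j z * (c n * hx i (c n *\<^sub>R snd z)))
    + (vx i z * (c n * hx j (c n *\<^sub>R snd z)) + v z * (c n * (c n * hxx i j (c n *\<^sub>R snd z))))" for n i j z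
  have hs: "continuous_on UNIV (\<lambda>z :: real \<times> (real^'n). k (c n *\<^sub>R snd z))" if "smooth k" for k :: "real^'n \<Rightarrow> real" and n
    by (intro continuous_on_compose2[OF smooth_continuous[OF that]] continuous_intros) auto
  have wc: "continuous_on UNIV (w n)" "continuous_on UNIV (wt n)" "continuous_on UNIV (wx n i)"
     "continuous_on UNIV (wxx n i j)" for n i j
    unfolding w_def[abs_def] wt_def[abs_def] wx_def[abs_def] wxx_def[abs_def]
    by (intro continuous_intros cont hs sh shx shxx)+
  have hd: "((\<lambda>s. k (c n *\<^sub>R snd (z + s *\<^sub>R (0, axis i 1)))) has_real_derivative
      c n * frechet_derivative k (at (c n *\<^sub>R snd z)) (axis i 1)) (at 0)"
    if "smooth k" for k :: "real^'n \<Rightarrow> real" and n i and z :: "real \<times> (real^'n)"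
    using DERIV_scaled_argument[OF smooth_has_directional_derivative[OF that], of "c n" "snd z" "axis i 1"] by simp
  have bnd: "\<bar>x * y\<bar> \<le> E * G" if "\<bar>x\<bar> \<le> E" "\<bar>y\<bar> \<le> G" for x y
    unfolding abs_mult using that by (intro mult_mono E0) auto
  have cG: "\<bar>c n * y\<bar> \<le> G" if "\<bar>y\<bar> \<le> G" for y n
    using mult_mono[OF c(2)[of n] that] c(1)[of n] by (simp add: abs_mult)
  show ?thesis
  \<comment> \<open>The second derivatives consist of four products, each bounded by
    \<open>E * G\<close>.\<close>
  proof (rule generator_tendsto_0[where vt=wt and vx=wx and vxx=wxx and E="4 * (E * G)"])
    have l1: "(\<lambda>n. h (c n *\<^sub>R x)) \<longlonglongrightarrow> 1" for x
    proof -
      have "(\<lambda>n. h (c n *\<^sub>R x)) \<longlonglongrightarrow> h (0 *\<^sub>R x)"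
        by (rule continuous_on_tendsto_compose[OF smooth_continuous[OF sh]])
          (auto simp del: scaleR_zero_left intro!: tendsto_scaleR cl)
      then show ?thesis by (simp add: h0)
    qed
    have l2: "(\<lambda>n. c n * y n) \<longlonglongrightarrow> 0" if "\<And>n. \<bar>y n\<bar> \<le> G" for y
    proof (rule Lim_null_comparison[OF _ tendsto_mult_left_zero[OF cl, of G]])
      show "\<forall>\<^sub>F n in sequentially. norm (c n * y n) \<le> c n * G"
        using that c(1) by (intro always_eventually allI) (simp add: abs_mult mult_left_mono less_imp_le)
    qed
    show "(\<lambda>n. wt n z) \<longlonglongrightarrow> vt z" for z
      unfolding wt_def using tendsto_mult[OF tendsto_const l1, of "vt z" "snd z"] by simp
    show "(\<lambda>n. wx n i z) \<longlonglongrightarrow> vx i z" for i z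
      unfolding wx_def
      using tendsto_add[OF tendsto_mult[OF tendsto_const l1] tendsto_mult[OF tendsto_const l2[of "\<lambda>n. hx i (c n *\<^sub>R snd z)"]], of "vx i z" "snd z" "v z"] G2
      by simp
    show "(\<lambda>n. wxx n i j z) \<longlonglongrightarrow> vxx i j z" for i j z
      unfolding wxx_def
      using tendsto_add[OF tendsto_add[OF tendsto_mult[OF tendsto_const l1] tendsto_mult[OF tendsto_const l2[of "\<lambda>n. hx i (c n *\<^sub>R snd z)"]], of "vxx i j z" "snd z" "vx j z"]
          tendsto_add[OF tendsto_mult[OF tendsto_const l2[of "\<lambda>n. hx j (c n *\<^sub>R snd z)"], of "vx i z"]
             tendsto_mult[OF tendsto_const l2[of "\<lambda>n. c n * hxx i j (c n *\<^sub>R snd z)"], of "v z"]]]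
         G2 cG[OF G3]
      by simp
    have EG: "0 \<le> E * G" using E0 G0 by simp
    show "\<bar>wt n z\<bar> \<le> 4 * (E * G)" for n z
      using bnd[OF bd(2)[of z] G1[of "c n *\<^sub>R snd z"]] EG unfolding wt_def by linarith
    show "\<bar>wx n i z\<bar> \<le> 4 * (E * G)" for n i z
      using bnd[OF bd(3)[of i z] G1[of "c n *\<^sub>R snd z"]] bnd[OF bd(1)[of z] cG[OF G2[of i "c n *\<^sub>R snd z"]], of n] EG
      unfolding wx_def by linarith
    show "\<bar>wxx n i j z\<bar> \<le> 4 * (E * G)" for n i j z
      using bnd[OF bd(4)[of i j z] G1[of "c n *\<^sub>R snd z"]] bnd[OF bd(3)[of j z] cG[OF G2[of i "c n *\<^sub>R snd z"]], of n]
        bnd[OF bd(3)[of i z] cG[OF G2[of j "c n *\<^sub>R snd z"]], of n]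
        bnd[OF bd(1)[of z] cG[OF cG[OF G3[of i j "c n *\<^sub>R snd z"]]], of n n] EG
      unfolding wxx_def by linarith
    fix n
    let ?K = "{s1..s2} \<times> cball (0::real^'n) (inverse (c n))"
    have out: "fst z \<notin> {s1..s2} \<or> c n *\<^sub>R snd z \<notin> cball 0 1" if "z \<notin> ?K" for z
      using that c(1)[of n] by (cases z) (auto simp: field_simps)
    show "(\<integral>z. generator (wt n) (wx n) (wxx n) z * R (fst z) (snd z) \<partial>lborel) = 0"
    proof (rule weak_C12_compact[where K="?K" and v="w n"])
      show "compact ?K" by (intro compact_Times) auto
      show "?K \<subseteq> {0<..<1} \<times> UNIV" using s by auto
      show "w n z = 0" "wt n z = 0" "wx n i z = 0" "wxx n i j z = 0" if "z \<notin> ?K" for z i j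
        using out[OF that] supp[of z] hK hxK hxxK unfolding w_def wt_def wx_def wxx_def by auto
      fix z i j
      show "((\<lambda>s. w n (z + s *\<^sub>R (1, 0))) has_real_derivative wt n z) (at 0)"
        using DERIV_cmult_right[OF deriv(1)[of z], of "h (c n *\<^sub>R snd z)"] unfolding w_def wt_def by simp
      show "((\<lambda>s. w n (z + s *\<^sub>R (0, axis i 1))) has_real_derivative wx n i z) (at 0)"
        using DERIV_mult[OF deriv(2)[of z i] hd[OF sh, of n z i]] unfolding w_def wx_def hx_def
        by (simp add: algebra_simps zero_prod_def[symmetric])
      have "((\<lambda>s. vx j (z + s *\<^sub>R (0, axis i 1)) * h (c n *\<^sub>R snd (z + s *\<^sub>R (0, axis i 1)))) has_real_derivative
          vxx i j z * h (c n *\<^sub>R snd z) + vx j z * (c n * hx i (c n *\<^sub>R snd z))) (at 0)"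
        using DERIV_mult[OF deriv(3)[of j z i] hd[OF sh, of n z i]] unfolding hx_def
        by (simp add: algebra_simps zero_prod_def[symmetric])
      moreover have "((\<lambda>s. v (z + s *\<^sub>R (0, axis i 1)) * (c n * hx j (c n *\<^sub>R snd (z + s *\<^sub>R (0, axis i 1))))) has_real_derivative
          vx i z * (c n * hx j (c n *\<^sub>R snd z)) + v z * (c n * (c n * hxx i j (c n *\<^sub>R snd z)))) (at 0)"
        using DERIV_mult[OF deriv(2)[of z i] DERIV_cmult[OF hd[OF shx[of j], of n z i], of "c n"]] unfolding hxx_def
        by (simp add: algebra_simps zero_prod_def[symmetric])
      ultimately show "((\<lambda>s. wx n j (z + s *\<^sub>R (0, axis i 1))) has_real_derivative wxx n i j z) (at 0)"
        unfolding wx_def wxx_def by (rule DERIV_add)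
    qed (rule wc)+
  qed (intro borel_measurable_continuous_onI wc cont)+
qed

text \<open>The kernel is controlled only up to its terminal time, so bounds on \<open>u\<close> are
  required only where \<theta> lives. The product rule in time contributes the additional term
  \<open>\<kappa> u\<close>.\<close>

lemma weak_time_cutoff:
  fixes u ut :: "real \<times> (real^'n) \<Rightarrow> real"
  assumes s: "0 < s1" "s2 < 1"
    and th: "\<And>t. (\<theta> has_real_derivative \<kappa> t) (at t)" "continuous_on UNIV \<kappa>"
      "\<And>t. t \<notin> {s1..s2} \<Longrightarrow> \<theta> t = 0" "\<And>t. t \<notin> {s1..s2} \<Longrightarrow> \<kappa> t = 0"
    and cont: "continuous_on UNIV u" "continuous_on UNIV ut" "\<And>i. continuous_on UNIV (ux i)"
      "\<And>i j. continuous_on UNIV (uxx i j)"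
    and bd: "\<And>z. fst z \<in> {s1..s2} \<Longrightarrow> \<bar>u z\<bar> \<le> E" "\<And>z. fst z \<in> {s1..s2} \<Longrightarrow> \<bar>ut z\<bar> \<le> E"
      "\<And>i z. fst z \<in> {s1..s2} \<Longrightarrow> \<bar>ux i z\<bar> \<le> E" "\<And>i j z. fst z \<in> {s1..s2} \<Longrightarrow> \<bar>uxx i j z\<bar> \<le> E"
    and deriv: "\<And>z. ((\<lambda>s. u (z + s *\<^sub>R (1, 0))) has_real_derivative ut z) (at 0)"
      "\<And>z i. ((\<lambda>s. u (z + s *\<^sub>R (0, axis i 1))) has_real_derivative ux i z) (at 0)"
      "\<And>z i j. ((\<lambda>s. ux j (z + s *\<^sub>R (0, axis i 1))) has_real_derivative uxx i j z) (at 0)"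
  shows "(\<integral>z. (\<kappa> (fst z) * u z + \<theta> (fst z) * generator ut ux uxx z) * R (fst z) (snd z) \<partial>lborel) = 0"
proof -
  have thc: "continuous_on UNIV \<theta>"
    using th(1) DERIV_isCont continuous_at_imp_continuous_on by blast
  obtain b1 where b1: "b1 \<ge> 0" "\<And>t. \<bar>\<theta> t\<bar> \<le> b1"
    using bounded_of_compact_support[OF thc, of "{s1..s2}"] th(3) by auto
  obtain b2 where b2: "b2 \<ge> 0" "\<And>t. \<bar>\<kappa> t\<bar> \<le> b2"
    using bounded_of_compact_support[OF th(2), of "{s1..s2}"] th(4) by auto
  have tc: "continuous_on UNIV (\<lambda>z :: real \<times> (real^'n). \<theta> (fst z))" "continuous_on UNIV (\<lambda>z :: real \<times> (real^'n). \<kappa> (fst z))"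
    by (intro continuous_on_compose2[OF thc] continuous_on_compose2[OF th(2)] continuous_intros; simp)+
  have bnd: "\<bar>\<theta> (fst z) * y\<bar> \<le> b1 * \<bar>E\<bar>" if "fst z \<in> {s1..s2} \<Longrightarrow> \<bar>y\<bar> \<le> E" for z :: "real \<times> (real^'n)" and y
  proof (cases "fst z \<in> {s1..s2}")
    case True
    then show ?thesis unfolding abs_mult using that b1 by (intro mult_mono) auto
  qed (simp add: th(3) b1(1))
  have bnd2: "\<bar>\<kappa> (fst z) * u z\<bar> \<le> b2 * \<bar>E\<bar>" for z
  proof (cases "fst z \<in> {s1..s2}")
    case True
    then show ?thesis unfolding abs_mult using bd(1)[OF True] b2 by (intro mult_mono) auto
  qed (simp add: th(4) b2(1))
  have nn: "0 \<le> b1 * \<bar>E\<bar>" "0 \<le> b2 * \<bar>E\<bar>" using b1 b2 by simp_all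
  have "(\<integral>z. generator (\<lambda>z. \<kappa> (fst z) * u z + \<theta> (fst z) * ut z) (\<lambda>i z. \<theta> (fst z) * ux i z)
      (\<lambda>i j z. \<theta> (fst z) * uxx i j z) z * R (fst z) (snd z) \<partial>lborel) = 0"
  proof (rule weak_C12[OF s, where v="\<lambda>z. \<theta> (fst z) * u z" and E="b1 * \<bar>E\<bar> + b2 * \<bar>E\<bar>"])
    fix z :: "real \<times> (real^'n)" and i j
    show "\<bar>\<theta> (fst z) * u z\<bar> \<le> b1 * \<bar>E\<bar> + b2 * \<bar>E\<bar>" using bnd[of z "u z"] bd(1)[of z] nn by linarith
    show "\<bar>\<theta> (fst z) * ux i z\<bar> \<le> b1 * \<bar>E\<bar> + b2 * \<bar>E\<bar>" using bnd[of z "ux i z"] bd(3)[of z i] nn by linarith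
    show "\<bar>\<theta> (fst z) * uxx i j z\<bar> \<le> b1 * \<bar>E\<bar> + b2 * \<bar>E\<bar>" using bnd[of z "uxx i j z"] bd(4)[of z i j] nn by linarith
    show "\<bar>\<kappa> (fst z) * u z + \<theta> (fst z) * ut z\<bar> \<le> b1 * \<bar>E\<bar> + b2 * \<bar>E\<bar>"
      using bnd[of z "ut z"] bd(2)[of z] bnd2[of z] by linarith
    have "((\<lambda>s. \<theta> (fst z + s)) has_real_derivative \<kappa> (fst z)) (at 0)"
      using DERIV_shift[of \<theta> "\<kappa> (fst z)" 0 "fst z"] th(1)[of "fst z"] by (simp add: add.commute)
    then have "((\<lambda>s. \<theta> (fst (z + s *\<^sub>R (1, 0)))) has_real_derivative \<kappa> (fst z)) (at 0)" by simp
    from DERIV_mult[OF this deriv(1)[of z]]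
    show "((\<lambda>s. \<theta> (fst (z + s *\<^sub>R (1, 0))) * u (z + s *\<^sub>R (1, 0))) has_real_derivative
        \<kappa> (fst z) * u z + \<theta> (fst z) * ut z) (at 0)"
      by (simp add: algebra_simps zero_prod_def[symmetric])
    show "((\<lambda>s. \<theta> (fst (z + s *\<^sub>R (0, axis i 1))) * u (z + s *\<^sub>R (0, axis i 1))) has_real_derivative
        \<theta> (fst z) * ux i z) (at 0)" using DERIV_cmult[OF deriv(2)[of z i], of "\<theta> (fst z)"] by simp
    show "((\<lambda>s. \<theta> (fst (z + s *\<^sub>R (0, axis i 1))) * ux j (z + s *\<^sub>R (0, axis i 1))) has_real_derivative
        \<theta> (fst z) * uxx i j z) (at 0)" using DERIV_cmult[OF deriv(3)[of j z i], of "\<theta> (fst z)"] by simp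
  qed (use th(3,4) in \<open>auto intro!: continuous_intros cont tc\<close>)
  moreover have "generator (\<lambda>z. \<kappa> (fst z) * u z + \<theta> (fst z) * ut z) (\<lambda>i z. \<theta> (fst z) * ux i z)
      (\<lambda>i j z. \<theta> (fst z) * uxx i j z) z = \<kappa> (fst z) * u z + \<theta> (fst z) * generator ut ux uxx z" for z
    unfolding generator_def by (simp add: distrib_left sum_distrib_left mult_ac)
  ultimately show ?thesis by simp
qed

end

section \<open>Gaussian integrals\<close>

lemma exp_norm_eq_prod:
  "exp (- (c * (x \<bullet> x))) = (\<Prod>b\<in>Basis. exp (- (c * (x \<bullet> b)\<^sup>2)))" for x :: "'a::euclidean_space"
  by (simp add: exp_sum[symmetric] sum_negf sum_distrib_left[symmetric] power2_eq_square euclidean_inner[of x x])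

lemma nn_integral_exp_square_finite: "(\<integral>\<^sup>+s. ennreal (exp (- s\<^sup>2)) \<partial>(lborel :: real measure)) < \<infinity>"
proof -
  have "integrable lborel (\<lambda>s::real. exp (- s\<^sup>2))"
  proof -
    have "integrable lborel (\<lambda>s. sqrt pi * normal_density 0 (1 / sqrt 2) s)"
      by (intro integrable_mult_right integrable_normal_density) simp
    then show ?thesis by (simp add: normal_density_def real_sqrt_divide power_divide)
  qed
  then show ?thesis by (simp add: integrable_iff_bounded)
qed

text \<open>The value is pi^(d/2), but it is carried along as an opaque positive constant.\<close>

definition gauss_total :: "'a::euclidean_space itself \<Rightarrow> real" where
  "gauss_total _ = (\<integral>x. exp (- (x \<bullet> x)) \<partial>(lborel :: 'a measure))"

lemma integrable_exp_norm: "integrable lborel (\<lambda>x::'a::euclidean_space. exp (- (x \<bullet> x)))"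
proof (rule integrableI_nonneg)
  have "(\<integral>\<^sup>+x. ennreal (exp (- (x \<bullet> x))) \<partial>(lborel :: 'a measure))
      = (\<integral>\<^sup>+x. (\<Prod>b\<in>Basis. ennreal (exp (- (x \<bullet> b)\<^sup>2))) \<partial>(lborel :: 'a measure))"
    using exp_norm_eq_prod[of 1, where 'a='a] by (simp add: prod_ennreal)
  also have "\<dots> = (\<Prod>b\<in>(Basis :: 'a set). \<integral>\<^sup>+s. ennreal (exp (- s\<^sup>2)) \<partial>lborel)"
    by (rule nn_integral_lborel_prod) auto
  also have "\<dots> < \<infinity>"
    using nn_integral_exp_square_finite by (simp add: power_less_top_ennreal)
  finally show "(\<integral>\<^sup>+x. ennreal (exp (- (x \<bullet> x))) \<partial>(lborel :: 'a measure)) < \<infinity>" .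
qed auto

lemma gauss_total_pos: "0 < gauss_total TYPE('a::euclidean_space)"
proof (rule ccontr)
  assume "\<not> ?thesis"
  then have "gauss_total TYPE('a) = 0"
    unfolding gauss_total_def by (intro antisym integral_nonneg_AE) auto
  then have "AE x in (lborel :: 'a measure). exp (- (x \<bullet> x)) = 0"
    unfolding gauss_total_def
    using integral_nonneg_eq_0_iff_AE[OF integrable_exp_norm[where 'a='a]] by simp
  then have "AE x in (lborel :: 'a measure). False" by eventually_elim simp
  then show False by (simp add: AE_iff_null_sets[of UNIV] trivial_limit_def[symmetric] ae_filter_eq_bot_iff emeasure_lborel_UNIV)
qed

lemma nn_integral_gauss:
  assumes "0 < c"
  shows "(\<integral>\<^sup>+x. ennreal (exp (- (c * ((x - y) \<bullet> (x - y))))) \<partial>(lborel :: 'a::euclidean_space measure))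
      = ennreal (c powr (- (real DIM('a) / 2)) * gauss_total TYPE('a))"
proof -
  \<comment> \<open>The substitution \<open>y + r x\<close> with \<open>c r^2 = 1\<close> normalises
    the exponent; its Jacobian \<open>r^d\<close> is the power of \<open>c\<close> in the
    claim.\<close>
  let ?r = "c powr (-1/2)"
  have r: "?r > 0" using assms by simp
  have rc: "c * (?r * ?r) = 1" using assms by (simp add: powr_add[symmetric] powr_minus field_simps)
  have rd: "\<bar>?r\<bar> ^ DIM('a) = c powr (- (real DIM('a) / 2))"
    using assms by (simp add: powr_realpow[symmetric] powr_powr)
  have "(\<integral>\<^sup>+x. ennreal (exp (- (c * ((x - y) \<bullet> (x - y))))) \<partial>(lborel :: 'a measure))
     = (\<integral>\<^sup>+x. ennreal (exp (- (c * ((x - y) \<bullet> (x - y)))))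
         \<partial>density (distr lborel borel (\<lambda>x. y + ?r *\<^sub>R x)) (\<lambda>_. \<bar>?r\<bar> ^ DIM('a)))"
    using lborel_affine[of ?r y] r by simp
  also have "\<dots> = (\<integral>\<^sup>+x. ennreal (\<bar>?r\<bar> ^ DIM('a)) * ennreal (exp (- (c * (?r * ?r) * (x \<bullet> x)))) \<partial>(lborel :: 'a measure))"
    by (simp add: nn_integral_density nn_integral_distr mult_ac)
  also have "\<dots> = ennreal (\<bar>?r\<bar> ^ DIM('a)) * (\<integral>\<^sup>+x. ennreal (exp (- (x \<bullet> x))) \<partial>(lborel :: 'a measure))"
    unfolding rc by (subst nn_integral_cmult) auto
  also have "(\<integral>\<^sup>+x. ennreal (exp (- (x \<bullet> x))) \<partial>(lborel :: 'a measure)) = ennreal (gauss_total TYPE('a))"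
    unfolding gauss_total_def by (rule nn_integral_eq_integral[OF integrable_exp_norm]) auto
  finally show ?thesis unfolding rd by (simp add: ennreal_mult' gauss_total_pos less_imp_le)
qed

lemma integrable_gauss:
  assumes "0 < c"
  shows "integrable lborel (\<lambda>x::'a::euclidean_space. exp (- (c * ((x - y) \<bullet> (x - y)))))"
  by (rule integrableI_nonneg) (auto simp: nn_integral_gauss[OF assms])

lemma integral_gauss:
  assumes "0 < c"
  shows "(\<integral>x. exp (- (c * ((x - y) \<bullet> (x - y)))) \<partial>(lborel :: 'a::euclidean_space measure))
      = c powr (- (real DIM('a) / 2)) * gauss_total TYPE('a)"
  by (rule integral_eq_nn_integral[THEN trans]) 
     (auto simp: nn_integral_gauss[OF assms] gauss_total_pos less_imp_le)

text \<open>Used to trade polynomial factors for a part of the Gaussian decay. For s > 1 the power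
  is raised to \<open>(s^2)^m\<close>, which is a multiple of one term of the exponential series at
  \<open>c s^2\<close>.\<close>

lemma power_mult_exp_bounded:
  fixes s :: real
  assumes "0 < c" and s: "0 \<le> s" shows "s ^ m * exp (- (c * s\<^sup>2)) \<le> 1 + fact m / c ^ m"
proof -
  let ?K = "(1 + fact m / c ^ m)"
  have "s ^ m \<le> ?K * exp (c * s\<^sup>2)"
  proof (cases "s \<le> 1")
    case True
    have "s ^ m \<le> 1" using s True by (simp add: power_le_one)
    also have "1 \<le> ?K * exp (c * s\<^sup>2)" using assms mult_mono[of 1 ?K 1 "exp (c * s\<^sup>2)"] by simp
    finally show ?thesis .
  next
    case False
    have "s ^ m \<le> (s\<^sup>2) ^ m" using False by (intro power_mono) (auto simp: power2_eq_square)
    also have "\<dots> = fact m / c ^ m * ((c * s\<^sup>2) ^ m / fact m)" using assms by (simp add: power_mult_distrib)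
    also have "\<dots> \<le> fact m / c ^ m * exp (c * s\<^sup>2)"
      using assms by (intro mult_left_mono exp_ge_power_over_fact) auto
    also have "\<dots> \<le> ?K * exp (c * s\<^sup>2)" by (intro mult_right_mono) auto
    finally show ?thesis .
  qed
  then show ?thesis by (simp add: exp_minus field_simps)
qed

section \<open>Symmetric matrices depending on time\<close>

lemma inner_matrix_symmetric:
  fixes A :: "real^'n^'n" assumes "transpose A = A" shows "x \<bullet> (A *v y) = (A *v x) \<bullet> y"
  using dot_lmul_matrix[of x A y] transpose_matrix_vector[of A x] assms by simp

lemma norm_matrix_vector_le:
  fixes A :: "real^'n^'n" assumes "\<And>i j. \<bar>A $ i $ j\<bar> \<le> c"
  shows "norm (A *v x) \<le> (real CARD('n))\<^sup>2 * c * norm x"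
proof -
  have "norm (A *v x) \<le> (\<Sum>i\<in>UNIV. \<bar>(A *v x) $ i\<bar>)" by (rule norm_le_l1_cart)
  also have "\<dots> \<le> (\<Sum>i\<in>(UNIV::'n set). \<Sum>j\<in>(UNIV::'n set). c * norm x)"
  proof (rule sum_mono)
    fix i
    have "\<bar>(A *v x) $ i\<bar> \<le> (\<Sum>j\<in>UNIV. \<bar>A $ i $ j * x $ j\<bar>)"
      unfolding matrix_vector_mult_def by (simp only: vec_lambda_beta sum_abs)
    also have "\<dots> \<le> (\<Sum>j\<in>(UNIV::'n set). c * norm x)"
      unfolding abs_mult
      by (intro sum_mono mult_mono assms component_le_norm_cart order_trans[OF abs_ge_zero assms]) auto
    finally show "\<bar>(A *v x) $ i\<bar> \<le> (\<Sum>j\<in>(UNIV::'n set). c * norm x)" .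
  qed
  also have "\<dots> = (real CARD('n))\<^sup>2 * c * norm x" by (simp add: power2_eq_square)
  finally show ?thesis .
qed

lemma inner_matrix_eq_sum:
  fixes A :: "real^'n^'n" shows "x \<bullet> (A *v y) = (\<Sum>i\<in>UNIV. \<Sum>j\<in>UNIV. A $ i $ j * (x $ i * y $ j))"
  by (simp add: inner_vec_def matrix_vector_mult_def sum_distrib_left mult_ac)

lemma global_antiderivative:
  fixes f :: "real \<Rightarrow> 'a::euclidean_space"
  assumes "continuous_on UNIV f" obtains F where "\<And>t. (F has_vector_derivative f t) (at t)"
  using einterval_antiderivative[of "-\<infinity>" "\<infinity>" f] assms by (auto simp: continuous_on_eq_continuous_at)

text \<open>\<open>S(t)\<close> is the covariance of a backward heat kernel with diffusion matrix \<open>M(t)\<close>; in the next locale,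
  \<open>g' = tr (M S\<^sup>-\<^sup>1)\<close> makes \<open>Q = exp (g - z \<cdot> S\<^sup>-\<^sup>1 z / 2)\<close> a solution of \<open>\<partial>\<^sub>t Q + tr (M D\<^sup>2 Q) = 0\<close>.\<close>

locale inverse_family =
  fixes S M :: "real \<Rightarrow> real^'n::finite^'n" and s0 :: real
  assumes S_deriv: "\<And>t. (S has_vector_derivative (- 2) *\<^sub>R M t) (at t)"
    and M_cont: "continuous_on UNIV M"
    and S_sym: "\<And>t. transpose (S t) = S t"
    and s0_pos: "0 < s0" and S_lower: "\<And>t x. s0 * (x \<bullet> x) \<le> x \<bullet> (S t *v x)"
begin

definition P :: "real \<Rightarrow> real^'n^'n" where "P t = matrix_inv (S t)"

lemma S_cont: "continuous_on UNIV S"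
  using S_deriv by (meson continuous_at_imp_continuous_on has_vector_derivative_continuous)

lemma invertible_S: "invertible (S t)"
  unfolding invertible_left_inverse matrix_left_invertible_ker
proof (intro allI impI)
  fix x assume "S t *v x = 0"
  then have "s0 * (x \<bullet> x) \<le> 0" using S_lower[of x t] by simp
  then show "x = 0" using s0_pos by (simp add: mult_le_0_iff)
     (metis inner_ge_zero inner_eq_zero_iff antisym)
qed

lemma S_P: "S t *v (P t *v x) = x" and P_S: "P t *v (S t *v x) = x"
proof -
  have "S t ** P t = mat 1 \<and> P t ** S t = mat 1"
    using invertible_S[of t] unfolding invertible_def P_def matrix_inv_def by (rule someI_ex)
  then show "S t *v (P t *v x) = x" "P t *v (S t *v x) = x"
    by (simp_all add: matrix_vector_mul_assoc)
qed

lemma P_inner: "x \<bullet> (P t *v y) = (P t *v x) \<bullet> y"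
  using inner_matrix_symmetric[OF S_sym, of "P t *v x" t "P t *v y"] by (simp add: S_P)

text \<open>The lower bound \<open>s\<close> is a parameter besides \<open>s0\<close>: while
  \<open>s0\<close> guarantees invertibility at all times, the estimates at a given time use a bound
  proportional to the time left before the pole.\<close>

lemma norm_P_le:
  assumes "0 < s" "\<And>x. s * (x \<bullet> x) \<le> x \<bullet> (S t *v x)" shows "norm (P t *v y) \<le> norm y / s"
proof -
  let ?x = "P t *v y"
  have "s * (norm ?x)\<^sup>2 \<le> ?x \<bullet> y" using assms(2)[of ?x] by (simp add: S_P power2_norm_eq_inner)
  also have "\<dots> \<le> norm ?x * norm y" by (rule norm_cauchy_schwarz)
  finally have *: "norm ?x * (s * norm ?x) \<le> norm ?x * norm y" by (simp add: power2_eq_square mult_ac)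
  then have "s * norm ?x \<le> norm y" by (cases "?x = 0") auto
  then show ?thesis using assms(1) by (simp add: pos_le_divide_eq mult.commute)
qed

lemma P_entry_le:
  assumes "0 < s" "\<And>x. s * (x \<bullet> x) \<le> x \<bullet> (S t *v x)" shows "\<bar>P t $ i $ j\<bar> \<le> 1 / s"
proof -
  have "P t $ i $ j = (P t *v axis j 1) $ i" by (simp add: matrix_vector_mult_basis column_def)
  then show ?thesis using component_le_norm_cart[of "P t *v axis j 1" i] norm_P_le[OF assms, of "axis j 1"] by simp
qed

lemma P_quadratic_upper:
  assumes "0 < s" "\<And>x. s * (x \<bullet> x) \<le> x \<bullet> (S t *v x)" shows "y \<bullet> (P t *v y) \<le> (y \<bullet> y) / s"
proof -
  have "y \<bullet> (P t *v y) \<le> norm y * norm (P t *v y)" by (rule norm_cauchy_schwarz)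
  also have "\<dots> \<le> norm y * (norm y / s)" by (intro mult_left_mono norm_P_le assms) auto
  finally show ?thesis by (simp add: power2_norm_eq_inner[symmetric] power2_eq_square)
qed

text \<open>With x = P y, the form y \<bullet> P y equals x \<bullet> S x, which is at least s
  |x|^2, and |x| is at least |y| / s'. If s and s' are both of order \<tau>, the constant is of
  order 1/\<tau>, as for a heat kernel.\<close>

lemma P_quadratic_lower:
  assumes "0 < s" "\<And>x. s * (x \<bullet> x) \<le> x \<bullet> (S t *v x)" "0 < s'" "\<And>x. norm (S t *v x) \<le> s' * norm x"
  shows "s / s'\<^sup>2 * (y \<bullet> y) \<le> y \<bullet> (P t *v y)"
proof -
  let ?x = "P t *v y"
  have "norm y \<le> s' * norm ?x" using assms(4)[of ?x] by (simp add: S_P)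
  then have "y \<bullet> y \<le> s'\<^sup>2 * (?x \<bullet> ?x)"
    using power_mono[of "norm y" "s' * norm ?x" 2] by (simp add: power_mult_distrib power2_norm_eq_inner)
  then have "s / s'\<^sup>2 * (y \<bullet> y) \<le> s / s'\<^sup>2 * (s'\<^sup>2 * (?x \<bullet> ?x))"
    using assms by (intro mult_left_mono) auto
  also have "\<dots> = s * (?x \<bullet> ?x)" using assms by simp
  also have "\<dots> \<le> y \<bullet> ?x" using assms(2)[of ?x] by (simp add: S_P inner_commute)
  finally show ?thesis .
qed

text \<open>The resolvent identity P' - P = P' (S - S') P. It yields both continuity and the
  derivative of P.\<close>

lemma P_diff: "y \<bullet> (P t' *v w) - y \<bullet> (P t *v w) = (P t' *v y) \<bullet> ((S t - S t') *v (P t *v w))"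
  by (simp add: matrix_vector_mult_diff_rdistrib inner_diff_right S_P P_inner)
     (metis P_inner P_S S_P inner_matrix_symmetric S_sym)

lemma tendsto_matrix_vector:
  "(X \<longlongrightarrow> X') F \<Longrightarrow> ((\<lambda>t. X t *v (x::real^'n)) \<longlongrightarrow> X' *v x) F" for X :: "'b \<Rightarrow> real^'n^'n"
  unfolding matrix_vector_mult_def by (intro tendsto_intros tendsto_vec_lambda)

lemma P_cont: "isCont (\<lambda>t. P t *v y) t"
proof -
  have "((\<lambda>t'. P t' *v y - P t *v y) \<longlongrightarrow> 0) (at t)"
  proof (rule Lim_null_comparison)
    have eq: "P t' *v y - P t *v y = P t' *v ((S t - S t') *v (P t *v y))" for t'
      by (simp add: matrix_vector_mult_diff_rdistrib matrix_vector_mult_diff_distrib S_P P_S)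
    show "\<forall>\<^sub>F t' in at t. norm (P t' *v y - P t *v y) \<le> norm ((S t - S t') *v (P t *v y)) / s0"
      unfolding eq by (intro always_eventually allI norm_P_le s0_pos S_lower)
    have "(S \<longlongrightarrow> S t) (at t)" using S_cont by (simp add: continuous_on_eq_continuous_at isCont_def)
    then have "((\<lambda>t'. S t - S t') \<longlongrightarrow> 0) (at t)" using tendsto_diff[OF tendsto_const, of S "S t" "at t" "S t"] by simp
    from tendsto_matrix_vector[OF this, of "P t *v y"]
    show "((\<lambda>t'. norm ((S t - S t') *v (P t *v y)) / s0) \<longlongrightarrow> 0) (at t)"
      by (auto intro!: tendsto_eq_intros simp: s0_pos less_imp_neq[symmetric] dest: tendsto_norm)
  qed
  then show ?thesis unfolding isCont_def by (rule LIM_zero_cancel)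
qed

text \<open>Dividing the resolvent identity by t' - t and using that P is continuous gives the
  derivative - P S' P, where S' = - 2 M.\<close>

lemma P_deriv: "((\<lambda>t. y \<bullet> (P t *v w)) has_real_derivative 2 * ((P t *v y) \<bullet> (M t *v (P t *v w)))) (at t)"
proof -
  let ?v = "P t *v w"
  have S: "((\<lambda>t'. ((S t' *v ?v) $ i - (S t *v ?v) $ i) / (t' - t)) \<longlongrightarrow> ((-2) *\<^sub>R M t *v ?v) $ i) (at t)" for i
  proof -
    have "bounded_linear (\<lambda>X :: real^'n^'n. (X *v ?v) $ i)"
      by (rule linear_conv_bounded_linear[THEN iffD1], rule linearI)
        (simp_all add: matrix_vector_mult_add_rdistrib scaleR_matrix_vector_assoc[symmetric])
    from bounded_linear.has_vector_derivative[OF this S_deriv[of t]]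
    show ?thesis by (simp add: has_real_derivative_iff_has_vector_derivative[symmetric] has_field_derivative_iff)
  qed
  have Pc: "((\<lambda>t'. (P t' *v y) $ i) \<longlongrightarrow> (P t *v y) $ i) (at t)" for i
    using P_cont[where y=y and t=t] unfolding isCont_def by (rule tendsto_vec_nth)
  have "((\<lambda>t'. - (\<Sum>i\<in>UNIV. (P t' *v y) $ i * (((S t' *v ?v) $ i - (S t *v ?v) $ i) / (t' - t)))) \<longlongrightarrow>
      - (\<Sum>i\<in>UNIV. (P t *v y) $ i * ((-2) *\<^sub>R M t *v ?v) $ i)) (at t)"
    by (intro tendsto_intros S Pc)
  moreover have "- (\<Sum>i\<in>UNIV. (P t *v y) $ i * ((-2) *\<^sub>R M t *v ?v) $ i) = 2 * ((P t *v y) \<bullet> (M t *v ?v))"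
  proof -
    have "(-2) *\<^sub>R M t *v ?v = (-2) *\<^sub>R (M t *v ?v)" by (simp only: scaleR_matrix_vector_assoc)
    then show ?thesis
      by (simp add: inner_vec_def sum_negf[symmetric] sum_distrib_left mult_ac)
  qed
  moreover have "(y \<bullet> (P t' *v w) - y \<bullet> (P t *v w)) / (t' - t)
      = - (\<Sum>i\<in>UNIV. (P t' *v y) $ i * (((S t' *v ?v) $ i - (S t *v ?v) $ i) / (t' - t)))" for t'
    unfolding P_diff
    by (simp add: inner_vec_def matrix_vector_mult_diff_rdistrib sum_divide_distrib sum_negf[symmetric] diff_divide_distrib algebra_simps)
  ultimately show ?thesis by (simp add: has_field_derivative_iff)
qed

end

lemma integrable_gauss_dominated:
  fixes f :: "'a::euclidean_space \<Rightarrow> real"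
  assumes "f \<in> borel_measurable borel" "0 < c" "\<And>z. \<bar>f z\<bar> \<le> K * exp (- (c * (z \<bullet> z)))"
  shows "integrable lborel f"
proof (rule Bochner_Integration.integrable_bound)
  show "integrable lborel (\<lambda>z::'a. K * exp (- (c * (z \<bullet> z))))"
    using integrable_gauss[OF assms(2), of "0::'a"] by simp
  show "AE x in lborel. norm (f x) \<le> norm (K * exp (- (c * (x \<bullet> x))))"
    using assms(3) by (intro AE_I2) (metis abs_ge_self order_trans real_norm_def)
qed (use assms(1) in simp)

context inverse_family begin

lemma P_entry: "P t $ i $ j = axis i 1 \<bullet> (P t *v axis j 1)"
  by (simp add: matrix_vector_mult_basis column_def inner_axis')

lemma P_entry_cont: "continuous_on UNIV (\<lambda>t. P t $ i $ j)"
proof -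
  have "isCont (\<lambda>t. axis i 1 \<bullet> (P t *v axis j 1)) t" for t
    by (rule DERIV_isCont[OF P_deriv])
  then show ?thesis unfolding P_entry by (simp add: continuous_at_imp_continuous_on)
qed

lemma PV_cont: "continuous_on UNIV (\<lambda>z. P (fst z) *v snd z)"
  unfolding matrix_vector_mult_def
  by (intro continuous_on_vec_lambda continuous_on_sum continuous_on_mult
      continuous_on_compose2[OF P_entry_cont] continuous_intros) auto

definition p :: "real \<Rightarrow> real" where "p t = (\<Sum>i\<in>UNIV. \<Sum>j\<in>UNIV. M t $ i $ j * P t $ i $ j)"

lemma M_entry_cont: "continuous_on UNIV (\<lambda>t. M t $ i $ j)"
  by (intro continuous_intros M_cont)

lemma p_cont: "continuous_on UNIV p"
  unfolding p_def[abs_def] by (intro continuous_intros P_entry_cont M_entry_cont)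

end

section \<open>Gaussian solutions of the backward heat equation\<close>

locale gauss_family = inverse_family S M s0
  for S M :: "real \<Rightarrow> real^'n::finite^'n" and s0 :: real +
  fixes g :: "real \<Rightarrow> real"
  assumes g_deriv: "\<And>t. (g has_real_derivative p t) (at t)"
begin

definition Q :: "real \<Rightarrow> real^'n \<Rightarrow> real" where "Q t z = exp (g t - (z \<bullet> (P t *v z)) / 2)"

definition Qt :: "real \<Rightarrow> real^'n \<Rightarrow> real" where
  "Qt t z = (p t - (P t *v z) \<bullet> (M t *v (P t *v z))) * Q t z"

definition Qx :: "'n \<Rightarrow> real \<Rightarrow> real^'n \<Rightarrow> real" where "Qx i t z = - (P t *v z) $ i * Q t z"

definition Qxx :: "'n \<Rightarrow> 'n \<Rightarrow> real \<Rightarrow> real^'n \<Rightarrow> real" where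
  "Qxx i j t z = ((P t *v z) $ i * (P t *v z) $ j - P t $ i $ j) * Q t z"

lemma Q_pos: "0 < Q t z" by (simp add: Q_def)

lemma Q_dt: "((\<lambda>t. Q t z) has_real_derivative Qt t z) (at t)"
  unfolding Q_def Qt_def
  by (auto intro!: derivative_eq_intros g_deriv P_deriv simp: algebra_simps diff_divide_distrib)

lemma Q_dx: "((\<lambda>s. Q t (z + s *\<^sub>R axis i 1)) has_real_derivative Qx i t z) (at 0)"
proof -
  let ?v = "axis i (1::real)"
  \<comment> \<open>By the symmetry of P the exponent is a quadratic polynomial in \<open>s\<close>
    along the line, so only a scalar function has to be differentiated.\<close>
  have "(z + s *\<^sub>R ?v) \<bullet> (P t *v (z + s *\<^sub>R ?v))
      = z \<bullet> (P t *v z) + 2 * s * (P t *v z) $ i + s\<^sup>2 * (?v \<bullet> (P t *v ?v))" for s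
    by (simp add: matrix_vector_right_distrib matrix_vector_mult_scaleR inner_add_left inner_add_right
        P_inner[of z t ?v] inner_axis inner_axis' power2_eq_square algebra_simps)
  then have "(\<lambda>s. Q t (z + s *\<^sub>R ?v)) = (\<lambda>s. exp (g t -
      (z \<bullet> (P t *v z) + 2 * s * (P t *v z) $ i + s\<^sup>2 * (?v \<bullet> (P t *v ?v))) / 2))"
    unfolding Q_def by simp
  moreover have "((\<lambda>s. exp (g t -
      (z \<bullet> (P t *v z) + 2 * s * (P t *v z) $ i + s\<^sup>2 * (?v \<bullet> (P t *v ?v))) / 2)) has_real_derivative Qx i t z) (at 0)"
    unfolding Qx_def Q_def by (auto intro!: derivative_eq_intros)
  ultimately show ?thesis by simp
qed

lemma Q_dxx: "((\<lambda>s. Qx j t (z + s *\<^sub>R axis i 1)) has_real_derivative Qxx i j t z) (at 0)"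
proof -
  let ?v = "axis i (1::real)"
  have e: "(P t *v (z + s *\<^sub>R ?v)) $ j = (P t *v z) $ j + s * P t $ i $ j" for s
  proof -
    have "(P t *v ?v) $ j = P t $ i $ j"
      using P_inner[of "axis i 1" t "axis j 1"] by (simp add: P_entry inner_axis)
    then show ?thesis by (simp add: matrix_vector_right_distrib matrix_vector_mult_scaleR)
  qed
  have "((\<lambda>s. - ((P t *v z) $ j + s * P t $ i $ j)) has_real_derivative - P t $ i $ j) (at 0)"
    by (auto intro!: derivative_eq_intros)
  from DERIV_mult[OF this Q_dx[of t z i]]
  show ?thesis unfolding Qx_def e by (simp add: Qxx_def Qx_def algebra_simps)
qed

text \<open>The trace part of M D^2 Q is cancelled by g' = p, and its quadratic part by the
  derivative 2 P M P of the exponent.\<close>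

lemma heat: "Qt t z + (\<Sum>i\<in>UNIV. \<Sum>j\<in>UNIV. M t $ i $ j * Qxx i j t z) = 0"
proof -
  have "(\<Sum>i\<in>UNIV. \<Sum>j\<in>UNIV. M t $ i $ j * Qxx i j t z)
      = ((P t *v z) \<bullet> (M t *v (P t *v z)) - p t) * Q t z"
    unfolding Qxx_def inner_matrix_eq_sum p_def
    by (simp add: left_diff_distrib right_diff_distrib sum_distrib_left sum_distrib_right sum_subtractf mult_ac)
  then show ?thesis by (simp add: Qt_def algebra_simps)
qed

lemma g_cont: "continuous_on UNIV g"
  using g_deriv DERIV_isCont continuous_at_imp_continuous_on by blast

lemma Q_cont: "continuous_on UNIV (\<lambda>z. Q (fst z) (snd z))"
  unfolding Q_def by (intro continuous_intros PV_cont continuous_on_compose2[OF g_cont]) auto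

lemma Qx_cont: "continuous_on UNIV (\<lambda>z. Qx i (fst z) (snd z))"
  unfolding Qx_def by (intro continuous_intros PV_cont Q_cont)

lemma Qxx_cont: "continuous_on UNIV (\<lambda>z. Qxx i j (fst z) (snd z))"
  unfolding Qxx_def by (intro continuous_intros PV_cont Q_cont continuous_on_compose2[OF P_entry_cont]) auto

lemma Qt_eq: "Qt t z = - (\<Sum>i\<in>UNIV. \<Sum>j\<in>UNIV. M t $ i $ j * Qxx i j t z)"
  using heat[of t z] by linarith

lemma Qt_cont: "continuous_on UNIV (\<lambda>z. Qt (fst z) (snd z))"
  unfolding Qt_eq by (intro continuous_intros Qxx_cont continuous_on_compose2[OF M_entry_cont]) auto

lemma slice_cont: "continuous_on UNIV (\<lambda>z. f (fst z) (snd z)) \<Longrightarrow> continuous_on UNIV (f t)"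
  for f :: "real \<Rightarrow> real^'n \<Rightarrow> real"
  using continuous_on_compose2[of UNIV "\<lambda>z. f (fst z) (snd z)" UNIV "\<lambda>x. (t, x)"]
    continuous_on_Pair[OF continuous_on_const continuous_on_id, of UNIV t]
  by auto

lemma slice_measurable [measurable]: "Q t \<in> borel_measurable borel" "Qt t \<in> borel_measurable borel"
   "Qx i t \<in> borel_measurable borel" "Qxx i j t \<in> borel_measurable borel"
  by (rule borel_measurable_continuous_onI, rule slice_cont, rule Q_cont Qt_cont Qx_cont Qxx_cont)+

context
  fixes s s' t
  assumes s: "0 < s" "\<And>x. s * (x \<bullet> x) \<le> x \<bullet> (S t *v x)" "0 < s'" "\<And>x. norm (S t *v x) \<le> s' * norm x"
begin

lemma Q_le: "Q t z \<le> exp (g t) * exp (- (s / s'\<^sup>2 / 2 * (z \<bullet> z)))"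
  using P_quadratic_lower[OF s, of z] by (simp add: Q_def exp_add[symmetric] field_simps)

lemma Qx_le: "\<bar>Qx i t z\<bar> \<le> norm z / s * Q t z"
  unfolding Qx_def abs_mult using Q_pos[of t z] component_le_norm_cart[of "P t *v z" i] norm_P_le[OF s(1,2), of z]
  by (intro mult_mono) auto

lemma Qxx_le: "\<bar>Qxx i j t z\<bar> \<le> ((norm z)\<^sup>2 / s\<^sup>2 + 1 / s) * Q t z"
proof -
  have c: "\<bar>(P t *v z) $ i\<bar> \<le> norm z / s" for i
    using component_le_norm_cart[of "P t *v z" i] norm_P_le[OF s(1,2), of z] by linarith
  have "\<bar>(P t *v z) $ i * (P t *v z) $ j\<bar> \<le> norm z / s * (norm z / s)"
    unfolding abs_mult using s(1) by (intro mult_mono c) auto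
  then have "\<bar>(P t *v z) $ i * (P t *v z) $ j - P t $ i $ j\<bar> \<le> (norm z)\<^sup>2 / s\<^sup>2 + 1 / s"
    using P_entry_le[OF s(1,2), of i j] by (simp add: power2_eq_square)
  then show ?thesis unfolding Qxx_def abs_mult using Q_pos[of t z] by (intro mult_mono) auto
qed

lemma Q_integrable: "integrable lborel (Q t)"
  by (rule integrable_gauss_dominated[where c="s / s'\<^sup>2 / 2"])
    (use s Q_le Q_pos in \<open>auto simp: abs_of_pos\<close>)

text \<open>Half of the exponent of \<open>Q_le\<close> absorbs the power of |z|; hence 4 instead of
  2 in the denominator.\<close>

lemma norm_power_Q_le:
  obtains H where "0 < H" "\<And>z. norm z ^ m * Q t z \<le> H * exp (g t) * exp (- (s / s'\<^sup>2 / 4 * (z \<bullet> z)))"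
proof -
  have c: "0 < s / s'\<^sup>2 / 4" using s by simp
  define H where "H = 1 + fact m / (s / s'\<^sup>2 / 4) ^ m"
  have H: "0 < H" "\<And>r. 0 \<le> r \<Longrightarrow> r ^ m * exp (- (s / s'\<^sup>2 / 4 * r\<^sup>2)) \<le> H"
    unfolding H_def using power_mult_exp_bounded[OF c, of _ m] c by (auto intro!: add_pos_nonneg)
  show ?thesis
  proof (rule that[OF H(1)])
    fix z :: "real^'n"
    have "norm z ^ m * Q t z \<le> norm z ^ m * (exp (g t) * exp (- (s / s'\<^sup>2 / 2 * (z \<bullet> z))))"
      by (intro mult_left_mono Q_le) auto
    also have "exp (- (s / s'\<^sup>2 / 2 * (z \<bullet> z))) = exp (- (s / s'\<^sup>2 / 4 * (norm z)\<^sup>2)) * exp (- (s / s'\<^sup>2 / 4 * (z \<bullet> z)))"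
      by (simp add: exp_add[symmetric] power2_norm_eq_inner)
    also have "norm z ^ m * (exp (g t) * \<dots>) = (norm z ^ m * exp (- (s / s'\<^sup>2 / 4 * (norm z)\<^sup>2))) * (exp (g t) * exp (- (s / s'\<^sup>2 / 4 * (z \<bullet> z))))"
      by (simp only: mult_ac)
    also have "\<dots> \<le> H * (exp (g t) * exp (- (s / s'\<^sup>2 / 4 * (z \<bullet> z))))"
      by (intro mult_right_mono H) auto
    finally show "norm z ^ m * Q t z \<le> H * exp (g t) * exp (- (s / s'\<^sup>2 / 4 * (z \<bullet> z)))" by (simp add: mult_ac)
  qed
qed

lemma Qx_integrable: "integrable lborel (Qx i t)"
proof -
  obtain H where H: "\<And>z. norm z ^ 1 * Q t z \<le> H * exp (g t) * exp (- (s / s'\<^sup>2 / 4 * (z \<bullet> z)))"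
    using norm_power_Q_le[of 1] by blast
  show ?thesis
  proof (rule integrable_gauss_dominated[where c="s / s'\<^sup>2 / 4"])
    show "\<bar>Qx i t z\<bar> \<le> (H * exp (g t) / s) * exp (- (s / s'\<^sup>2 / 4 * (z \<bullet> z)))" for z
      using Qx_le[of i z] divide_right_mono[OF H[of z], of s] s(1) by simp
  qed (use s in auto)
qed

lemma Qxx_gauss_le:
  obtains H where "0 < H" "\<And>i j z. \<bar>Qxx i j t z\<bar> \<le> H * exp (g t) * exp (- (s / s'\<^sup>2 / 4 * (z \<bullet> z)))"
proof -
  obtain H0 where H0: "0 < H0" "\<And>z. norm z ^ 0 * Q t z \<le> H0 * exp (g t) * exp (- (s / s'\<^sup>2 / 4 * (z \<bullet> z)))"
    using norm_power_Q_le[of 0] by blast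
  obtain H2 where H2: "0 < H2" "\<And>z. norm z ^ 2 * Q t z \<le> H2 * exp (g t) * exp (- (s / s'\<^sup>2 / 4 * (z \<bullet> z)))"
    using norm_power_Q_le[of 2] by blast
  show ?thesis
  proof (rule that[of "H2 / s\<^sup>2 + H0 / s"])
    show "0 < H2 / s\<^sup>2 + H0 / s" using H0 H2 s by (simp add: add_pos_pos)
    fix i j z
    have "\<bar>Qxx i j t z\<bar> \<le> ((norm z)\<^sup>2 / s\<^sup>2 + 1 / s) * Q t z" by (rule Qxx_le)
    also have "\<dots> = (norm z ^ 2 * Q t z) / s\<^sup>2 + (norm z ^ 0 * Q t z) / s" by (simp add: algebra_simps)
    also have "\<dots> \<le> (H2 * exp (g t) * exp (- (s / s'\<^sup>2 / 4 * (z \<bullet> z)))) / s\<^sup>2 + (H0 * exp (g t) * exp (- (s / s'\<^sup>2 / 4 * (z \<bullet> z)))) / s"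
      using s by (intro add_mono divide_right_mono H0 H2) auto
    also have "\<dots> = (H2 / s\<^sup>2 + H0 / s) * exp (g t) * exp (- (s / s'\<^sup>2 / 4 * (z \<bullet> z)))" by (simp add: algebra_simps)
    finally show "\<bar>Qxx i j t z\<bar> \<le> (H2 / s\<^sup>2 + H0 / s) * exp (g t) * exp (- (s / s'\<^sup>2 / 4 * (z \<bullet> z)))" .
  qed
qed

text \<open>\<open>Qxx i j\<close> is the derivative of the integrable function \<open>Qx j\<close>
  along an axis, so its integral over the whole space vanishes.\<close>

lemma integral_Qxx: "(\<integral>z. Qxx i j t z \<partial>lborel) = 0" and Qxx_integrable: "integrable lborel (Qxx i j t)"
proof -
  obtain H where "0 < H" and H: "\<And>i j z. \<bar>Qxx i j t z\<bar> \<le> H * exp (g t) * exp (- (s / s'\<^sup>2 / 4 * (z \<bullet> z)))"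
    by (rule Qxx_gauss_le) (rule that)
  show i: "integrable lborel (Qxx i j t)"
    by (rule integrable_gauss_dominated[OF _ _ H])
      (use s in auto)
  show "(\<integral>z. Qxx i j t z \<partial>lborel) = 0"
    by (rule integral_directional_derivative_eq_0[OF Qx_integrable[of j] i slice_cont[OF Qxx_cont] Q_dxx])
qed

end

text \<open>By the heat equation Qt is a combination of second derivatives, whose space integrals
  vanish; Fubini turns this into equality of the masses at \<open>a\<close> and \<open>b\<close>.
  This is how the prefactor exp g is later estimated without computing the determinant of S.\<close>

lemma mass_conservation:
  assumes ab: "a \<le> b" and s: "0 < s" "\<And>t x. t \<in> {a..b} \<Longrightarrow> s * (x \<bullet> x) \<le> x \<bullet> (S t *v x)"
    "0 < s'" "\<And>t x. t \<in> {a..b} \<Longrightarrow> norm (S t *v x) \<le> s' * norm x"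
  shows "(\<integral>z. Q a z \<partial>lborel) = (\<integral>z. Q b z \<partial>lborel)"
proof -
  let ?f = "\<lambda>t z. indicator {a..b} t * Qt t z"
  define c where "c = s / s'\<^sup>2 / 4"
  have c: "0 < c" using s by (simp add: c_def)
  \<comment> \<open>Fubini on the slab needs a Gaussian bound on Qt that is uniform over
    [a, b].\<close>
  obtain H where H: "0 \<le> H" "\<And>t z. t \<in> {a..b} \<Longrightarrow> \<bar>Qt t z\<bar> \<le> H * exp (- (c * (z \<bullet> z)))"
  proof -
    have cpt: "\<exists>B\<ge>0. \<forall>t\<in>{a..b}. \<bar>f t\<bar> \<le> B" if "continuous_on UNIV f" for f :: "real \<Rightarrow> real"
    proof -
      have "bounded (f ` {a..b})"
        by (intro compact_imp_bounded compact_continuous_image continuous_on_subset[OF that]) auto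
      then obtain B where "\<forall>t\<in>{a..b}. \<bar>f t\<bar> \<le> B" unfolding bounded_real by blast
      then show ?thesis by (intro exI[of _ "max B 0"]) (auto simp: le_max_iff_disj)
    qed
    obtain g1 where g1: "\<And>t. t \<in> {a..b} \<Longrightarrow> \<bar>g t\<bar> \<le> g1" using cpt[OF g_cont] by blast
    obtain p1 where p1: "p1 \<ge> 0" "\<And>t. t \<in> {a..b} \<Longrightarrow> \<bar>p t\<bar> \<le> p1" using cpt[OF p_cont] by blast
    have "\<exists>B\<ge>0. \<forall>t\<in>{a..b}. \<bar>M t $ i $ j\<bar> \<le> B" for i j by (rule cpt[OF M_entry_cont])
    then obtain m1 where m1: "\<And>i j t. t \<in> {a..b} \<Longrightarrow> \<bar>M t $ i $ j\<bar> \<le> m1 i j" by metis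
    define m where "m = Max (range (\<lambda>(i, j). m1 i j))"
    have "m1 i j \<le> m" for i j unfolding m_def by (rule Max_ge) auto
    then have m: "\<And>i j t. t \<in> {a..b} \<Longrightarrow> \<bar>M t $ i $ j\<bar> \<le> m" using m1 order_trans by blast
    have m0: "0 \<le> m" using m[of a undefined undefined] ab abs_ge_zero order_trans by fastforce
    have c4: "0 < s / s'\<^sup>2 / 4" using s by simp
    define K where "K = 1 + fact 2 / (s / s'\<^sup>2 / 4) ^ 2"
    have K: "0 < K" "\<And>r. 0 \<le> r \<Longrightarrow> r ^ 2 * exp (- (s / s'\<^sup>2 / 4 * r\<^sup>2)) \<le> K"
      unfolding K_def using power_mult_exp_bounded[OF c4, of _ 2] c4 by (auto intro!: add_pos_nonneg)
    define m2 where "m2 = (real CARD('n))\<^sup>2 * m / s\<^sup>2"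
    have m2: "0 \<le> m2" using m0 by (simp add: m2_def)
    show ?thesis
    proof (rule that[of "(p1 + m2 * K) * exp g1"])
      show "0 \<le> (p1 + m2 * K) * exp g1" using p1 m2 K by simp
      fix t z assume t: "t \<in> {a..b}"
      let ?y = "P t *v z" and ?E = "exp (- (s / s'\<^sup>2 / 4 * (z \<bullet> z)))"
      have "\<bar>?y \<bullet> (M t *v ?y)\<bar> \<le> norm ?y * norm (M t *v ?y)" by (rule Cauchy_Schwarz_ineq2)
      also have "\<dots> \<le> norm ?y * ((real CARD('n))\<^sup>2 * m * norm ?y)"
        by (intro mult_left_mono norm_matrix_vector_le m t) auto
      also have "\<dots> = (real CARD('n))\<^sup>2 * m * (norm ?y)\<^sup>2" by (simp add: power2_eq_square mult_ac)
      also have "\<dots> \<le> (real CARD('n))\<^sup>2 * m * (norm z / s)\<^sup>2"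
        using m0 by (intro mult_left_mono power_mono norm_P_le s t) auto
      finally have "\<bar>?y \<bullet> (M t *v ?y)\<bar> \<le> m2 * (norm z)\<^sup>2" by (simp add: m2_def power_divide)
      then have 1: "\<bar>p t - ?y \<bullet> (M t *v ?y)\<bar> \<le> p1 + m2 * (norm z)\<^sup>2" using p1(2)[OF t] by linarith
      have "Q t z \<le> exp (g t) * exp (- (s / s'\<^sup>2 / 2 * (z \<bullet> z)))"
        by (rule Q_le) (use s t in auto)
      also have "\<dots> \<le> exp g1 * exp (- (s / s'\<^sup>2 / 2 * (z \<bullet> z)))"
        using g1[OF t] by (intro mult_right_mono) auto
      also have "exp (- (s / s'\<^sup>2 / 2 * (z \<bullet> z))) = ?E * ?E" by (simp add: exp_add[symmetric])
      finally have 2: "Q t z \<le> exp g1 * (?E * ?E)" .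
      have "\<bar>Qt t z\<bar> \<le> (p1 + m2 * (norm z)\<^sup>2) * (exp g1 * (?E * ?E))"
        unfolding Qt_def abs_mult using 1 2 Q_pos[of t z] p1(1) m2 by (intro mult_mono) auto
      also have "\<dots> = (p1 * ?E + m2 * ((norm z)\<^sup>2 * ?E)) * (exp g1 * ?E)" by (simp add: algebra_simps)
      also have "\<dots> \<le> (p1 * 1 + m2 * K) * (exp g1 * ?E)"
        using K(2)[of "norm z"] p1(1) m2 s
        by (intro mult_right_mono add_mono mult_left_mono) (auto simp: power2_norm_eq_inner)
      finally show "\<bar>Qt t z\<bar> \<le> (p1 + m2 * K) * exp g1 * exp (- (c * (z \<bullet> z)))"
        by (simp add: c_def mult_ac)
    qed
  qed
  have Qtm: "(\<lambda>z. Qt (fst z) (snd z)) \<in> borel_measurable (lborel \<Otimes>\<^sub>M lborel)"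
    using borel_measurable_continuous_onI[OF Qt_cont] by (simp add: borel_prod[symmetric] cong: measurable_cong_sets)
  have Qti: "integrable lborel (Qt t)" if "t \<in> {a..b}" for t
    by (rule integrable_gauss_dominated[OF _ c H(2)[OF that]]) simp
  have int: "integrable (lborel \<Otimes>\<^sub>M lborel) (\<lambda>(t, z). ?f t z)"
  proof (rule lborel_pair.Fubini_integrable)
    show "(\<lambda>(t, z). ?f t z) \<in> borel_measurable (lborel \<Otimes>\<^sub>M lborel)"
      using Qtm unfolding split_beta' by measurable
    show "AE t in lborel. integrable lborel (\<lambda>z. case (t, z) of (t, z) \<Rightarrow> ?f t z)"
      using Qti by (auto simp: indicator_def)
    let ?W = "H * (\<integral>z. exp (- (c * (z \<bullet> z))) \<partial>(lborel :: (real^'n) measure))"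
    show "integrable lborel (\<lambda>t. \<integral>z. norm (case (t, z) of (t, z) \<Rightarrow> ?f t z) \<partial>lborel)"
    proof (rule Bochner_Integration.integrable_bound)
      show "integrable lborel (\<lambda>t::real. indicator {a..b} t * ?W)"
        by (intro integrable_mult_left integrable_real_indicator) (simp_all add: ab)
      show "(\<lambda>t. \<integral>z. norm (case (t, z) of (t, z) \<Rightarrow> ?f t z) \<partial>lborel) \<in> borel_measurable lborel"
        using Qtm unfolding split_beta' by measurable
      show "AE t in lborel. norm (\<integral>z. norm (case (t, z) of (t, z) \<Rightarrow> ?f t z) \<partial>lborel) \<le> norm (indicator {a..b} t * ?W)"
      proof (rule AE_I2)
        fix t
        show "norm (\<integral>z. norm (case (t, z) of (t, z) \<Rightarrow> ?f t z) \<partial>lborel) \<le> norm (indicator {a..b} t * ?W)"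
        proof (cases "t \<in> {a..b}")
          case True
          have "(\<integral>z. norm (Qt t z) \<partial>lborel) \<le> (\<integral>z. H * exp (- (c * (z \<bullet> z))) \<partial>(lborel :: (real^'n) measure))"
          proof (rule Bochner_Integration.integral_mono)
            show "integrable lborel (\<lambda>z::real^'n. H * exp (- (c * (z \<bullet> z))))"
              using integrable_gauss[OF c, of "0::real^'n"] by simp
          qed (use H(2)[OF True] Qti[OF True] in auto)
          moreover have "0 \<le> (\<integral>z. norm (Qt t z) \<partial>lborel)" by simp
          ultimately show ?thesis using True by simp
        qed simp
      qed
    qed
  qed
  have ftc: "(\<integral>t. ?f t z \<partial>lborel) = Q b z - Q a z" for z
  proof -
    have "(\<integral>t. indicator {a..b} t *\<^sub>R Qt t z \<partial>lborel) = Q b z - Q a z"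
    proof (rule integral_FTC_Icc[OF ab])
      show "((\<lambda>t. Q t z) has_vector_derivative Qt t z) (at t within {a..b})" for t
        using Q_dt[of z t] by (simp add: has_real_derivative_iff_has_vector_derivative has_vector_derivative_at_within)
      show "continuous_on {a..b} (\<lambda>t. Qt t z)"
      proof -
        have "continuous_on {a..b} (\<lambda>t. (t, z))"
          by (intro continuous_on_Pair continuous_on_id continuous_on_const)
        from continuous_on_compose2[OF Qt_cont this] show ?thesis by simp
      qed
    qed
    then show ?thesis by simp
  qed
  have inner: "(\<integral>z. ?f t z \<partial>lborel) = 0" for t
  proof (cases "t \<in> {a..b}")
    case True
    have i: "integrable lborel (Qxx i j t)" and z: "(\<integral>z. Qxx i j t z \<partial>lborel) = 0" for i j
      using Qxx_integrable[of s t s'] integral_Qxx[of s t s'] s True by auto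
    have "(\<integral>z. Qt t z \<partial>lborel) = 0" unfolding Qt_eq using i z by simp
    then show ?thesis by simp
  qed simp
  have "(\<integral>z. Q b z - Q a z \<partial>lborel) = (\<integral>z. (\<integral>t. ?f t z \<partial>lborel) \<partial>lborel)" by (simp add: ftc)
  also have "\<dots> = (\<integral>t. (\<integral>z. ?f t z \<partial>lborel) \<partial>lborel)" by (rule lborel_pair.Fubini_integral[OF int])
  also have "\<dots> = 0" unfolding inner by simp
  finally have "(\<integral>z. Q b z - Q a z \<partial>lborel) = 0" .
  moreover have "integrable lborel (Q a)" "integrable lborel (Q b)"
    using Q_integrable[of s a s'] Q_integrable[of s b s'] s ab by auto
  ultimately show ?thesis by simp
qed

end

section \<open>The backward heat kernel with frozen coefficients\<close>

text \<open>The comparison kernel of all later bounds: a heat kernel at time \<tau> up to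
  normalisation. Its mass is \<open>hk_mass\<close> at every positive time.\<close>

definition hk :: "real \<Rightarrow> real \<Rightarrow> real^'n \<Rightarrow> real" where
  "hk \<kappa> \<tau> z = \<tau> powr (- (real CARD('n) / 2)) * exp (- (\<kappa> * (z \<bullet> z) / \<tau>))"

text \<open>The density of the centred normal law with covariance \<delta> times the
  identity.\<close>

definition gauss_density :: "real \<Rightarrow> real^'n \<Rightarrow> real" where
  "gauss_density \<delta> z = (2 * \<delta>) powr (- (real CARD('n) / 2)) / gauss_total TYPE(real^'n) * exp (- ((z \<bullet> z) / (2 * \<delta>)))"

lemma DERIV_mono_le:
  fixes f :: "real \<Rightarrow> real"
  assumes "a \<le> b" "\<And>x. a \<le> x \<Longrightarrow> x \<le> b \<Longrightarrow> (f has_real_derivative f' x) (at x)"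
    "\<And>x. a \<le> x \<Longrightarrow> x \<le> b \<Longrightarrow> f' x \<le> c"
  shows "f b - f a \<le> c * (b - a)"
proof -
  have "f b - c * b \<le> f a - c * a"
  proof (rule DERIV_nonpos_imp_nonincreasing[OF assms(1)])
    fix x assume x: "a \<le> x" "x \<le> b"
    then have "((\<lambda>x. f x - c * x) has_real_derivative f' x - c) (at x)"
      by (auto intro!: derivative_eq_intros assms)
    then show "\<exists>y. ((\<lambda>x. f x - c * x) has_real_derivative y) (at x) \<and> y \<le> 0"
      using assms(3)[OF x] by (intro exI[of _ "f' x - c"]) simp
  qed
  then show ?thesis by (simp add: algebra_simps)
qed

lemma DERIV_mono_ge:
  fixes f :: "real \<Rightarrow> real"
  assumes "a \<le> b" "\<And>x. a \<le> x \<Longrightarrow> x \<le> b \<Longrightarrow> (f has_real_derivative f' x) (at x)"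
    "\<And>x. a \<le> x \<Longrightarrow> x \<le> b \<Longrightarrow> c \<le> f' x"
  shows "c * (b - a) \<le> f b - f a"
  using DERIV_mono_le[OF assms(1) DERIV_minus[OF assms(2)], of "- c"] assms(3) by simp

lemma bounded_linear_matrix_entry: "bounded_linear (\<lambda>X :: real^'n^'m. X $ i $ j)"
  by (rule linear_conv_bounded_linear[THEN iffD1], rule linearI) simp_all

lemma bounded_linear_matrix_quadratic: "bounded_linear (\<lambda>X :: real^'n^'n. x \<bullet> (X *v y))"
  by (rule linear_conv_bounded_linear[THEN iffD1], rule linearI)
    (simp_all add: matrix_vector_mult_add_rdistrib scaleR_matrix_vector_assoc[symmetric] inner_add_right)

text \<open>\<open>N\<close> is a continuous stand-in for \<open>A(., x0)\<close>, so that
  antiderivatives in time are classical. The covariance \<delta> at time T replaces the point mass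
  at the pole and keeps the kernel bounded.\<close>

locale frozen =
  fixes N :: "real \<Rightarrow> real^'n::finite^'n" and C \<alpha> T \<delta> :: real
  assumes N_cont: "continuous_on UNIV N" and N_sym: "\<And>t. transpose (N t) = N t"
    and N_bound: "\<And>t i j. \<bar>N t $ i $ j\<bar> \<le> C"
    and N_elliptic: "\<And>t x. \<alpha> * (x \<bullet> x) \<le> x \<bullet> (N t *v x)" and alpha: "0 < \<alpha>"
    and T: "0 < T" "T < 1" and delta: "0 < \<delta>" "\<delta> \<le> 1"
begin

lemma C0: "0 \<le> C" using N_bound[of 0 undefined undefined] abs_ge_zero order_trans by blast

definition D :: real where "D = (real CARD('n))\<^sup>2 * C"

lemma D0: "0 \<le> D" using C0 by (simp add: D_def)

lemma N_upper: "x \<bullet> (N t *v x) \<le> D * (x \<bullet> x)"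
proof -
  have "x \<bullet> (N t *v x) \<le> norm x * norm (N t *v x)" by (rule norm_cauchy_schwarz)
  also have "\<dots> \<le> norm x * (D * norm x)"
    unfolding D_def by (intro mult_left_mono norm_matrix_vector_le N_bound) auto
  finally show ?thesis by (simp add: power2_norm_eq_inner[symmetric] power2_eq_square mult_ac)
qed

text \<open>Chosen so that 2 D \<eta> \<le> \<delta> / 2: the covariance keeps at least half of
  \<delta> after T.\<close>

definition \<eta> :: real where "\<eta> = \<delta> / (4 * (D + 1))"

lemma eta_pos: "0 < \<eta>" using delta D0 by (simp add: \<eta>_def)

text \<open>\<open>N\<close> is switched off shortly after the terminal time \<open>T\<close>, so that the covariance stays positive
  definite and the kernel is defined for all times; only times up to \<open>T\<close> matter.\<close>

definition h :: "real \<Rightarrow> real" where "h t = max 0 (1 - max 0 (t - T) / \<eta>)"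

lemma h_bounds: "0 \<le> h t" "h t \<le> 1" using eta_pos by (auto simp: h_def)

lemma h_eq_1: "t \<le> T \<Longrightarrow> h t = 1" by (simp add: h_def)

lemma h_eq_0: "T + \<eta> \<le> t \<Longrightarrow> h t = 0" using eta_pos by (simp add: h_def field_simps)

definition M :: "real \<Rightarrow> real^'n^'n" where "M t = h t *\<^sub>R N t"

lemma M_cont: "continuous_on UNIV M"
  unfolding M_def[abs_def] h_def using eta_pos by (intro continuous_intros N_cont) auto

definition F :: "real \<Rightarrow> real^'n^'n" where "F = (SOME F. \<forall>t. (F has_vector_derivative 2 *\<^sub>R M t) (at t))"

lemma F_deriv: "(F has_vector_derivative 2 *\<^sub>R M t) (at t)"
proof -
  have "continuous_on UNIV (\<lambda>t. 2 *\<^sub>R M t)" by (intro continuous_intros M_cont)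
  then have "\<exists>F. \<forall>t. (F has_vector_derivative 2 *\<^sub>R M t) (at t)"
    by (rule global_antiderivative) blast
  then show ?thesis unfolding F_def by (rule someI2_ex) blast
qed

lemma F_entry_deriv: "((\<lambda>t. F t $ i $ j) has_real_derivative 2 * h t * N t $ i $ j) (at t)"
  using bounded_linear.has_vector_derivative[OF bounded_linear_matrix_entry F_deriv[of t], of i j]
  by (simp add: has_real_derivative_iff_has_vector_derivative M_def)

lemma F_quadratic_deriv: "((\<lambda>t. x \<bullet> (F t *v x)) has_real_derivative 2 * h t * (x \<bullet> (N t *v x))) (at t)"
  using bounded_linear.has_vector_derivative[OF bounded_linear_matrix_quadratic F_deriv[of t], of x x]
  by (simp add: has_real_derivative_iff_has_vector_derivative M_def scaleR_matrix_vector_assoc[symmetric])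

text \<open>For t \<le> T this is \<delta> I plus twice the integral of N over [t, T].\<close>

definition S :: "real \<Rightarrow> real^'n^'n" where "S t = \<delta> *\<^sub>R mat 1 + (F T - F t)"

lemma S_quadratic: "x \<bullet> (S t *v x) = \<delta> * (x \<bullet> x) + (x \<bullet> (F T *v x) - x \<bullet> (F t *v x))"
  by (simp add: S_def matrix_vector_mult_add_rdistrib matrix_vector_mult_diff_rdistrib
      scaleR_matrix_vector_assoc[symmetric] inner_add_right inner_diff_right)

lemma S_deriv: "(S has_vector_derivative (- 2) *\<^sub>R M t) (at t)"
  unfolding S_def[abs_def] by (auto intro!: derivative_eq_intros F_deriv)

lemma S_T: "S T = \<delta> *\<^sub>R mat 1" by (simp add: S_def)

lemma S_sym: "transpose (S t) = S t"
proof -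
  have "S t $ i $ j - S t $ j $ i = 0" for i j
  proof -
    have "N t $ i $ j = N t $ j $ i" for t
      using N_sym[of t] unfolding transpose_def by (metis vec_lambda_beta)
    then have "((\<lambda>t. F t $ i $ j - F t $ j $ i) has_real_derivative 0) (at t)" for t
      using DERIV_diff[OF F_entry_deriv[of i j t] F_entry_deriv[of j i t]] by simp
    then have "F T $ i $ j - F T $ j $ i = F t $ i $ j - F t $ j $ i"
      by (intro DERIV_isconst_all) auto
    then show ?thesis by (simp add: S_def mat_def)
  qed
  then show ?thesis by (simp add: transpose_def vec_eq_iff)
qed

text \<open>\<open>sl\<close> and \<open>su\<close> compare S(t) with the time T + \<delta> - t.
  They involve only \<alpha>, C and the dimension, which makes the kernel bounds uniform in N, T and
  \<delta>.\<close>

definition sl :: real where "sl = min 1 (2 * \<alpha>)"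

definition su :: real where "su = (real CARD('n))\<^sup>2 * (1 + 2 * C)"

lemma sl_pos: "0 < sl" using alpha by (simp add: sl_def)

lemma su_pos: "0 < su" using C0 by (simp add: su_def add_pos_nonneg)

lemma S_lower_time:
  assumes "t \<le> T" shows "sl * (T + \<delta> - t) * (x \<bullet> x) \<le> x \<bullet> (S t *v x)"
proof -
  have "2 * \<alpha> * (x \<bullet> x) * (T - t) \<le> x \<bullet> (F T *v x) - x \<bullet> (F t *v x)"
    by (rule DERIV_mono_ge[OF assms F_quadratic_deriv]) (use N_elliptic h_eq_1 in simp)
  then have 1: "\<delta> * (x \<bullet> x) + 2 * \<alpha> * (x \<bullet> x) * (T - t) \<le> x \<bullet> (S t *v x)" by (simp add: S_quadratic)
  have "sl * \<delta> \<le> 1 * \<delta>" "sl * (T - t) \<le> 2 * \<alpha> * (T - t)"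
    using assms delta by (intro mult_right_mono; simp add: sl_def)+
  then have "sl * (T + \<delta> - t) * (x \<bullet> x) \<le> (\<delta> + 2 * \<alpha> * (T - t)) * (x \<bullet> x)"
    by (intro mult_right_mono) (auto simp: algebra_simps)
  then show ?thesis using 1 by (simp add: algebra_simps)
qed

text \<open>Up to T the quadratic form of F does not decrease; on [T, T + \<eta>] it grows at a rate
  of at most 2 D; afterwards h = 0 keeps it from growing.\<close>

lemma S_lower: "\<delta> / 2 * (x \<bullet> x) \<le> x \<bullet> (S t *v x)"
proof -
  let ?f = "\<lambda>t. x \<bullet> (F t *v x)"
  have xx: "0 \<le> x \<bullet> x" by simp
  have "?f t - ?f T \<le> \<delta> / 2 * (x \<bullet> x)"
  proof -
    have up: "2 * h s * (x \<bullet> (N s *v x)) \<le> 2 * D * (x \<bullet> x)" for s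
    proof -
      have "h s * (x \<bullet> (N s *v x)) \<le> 1 * (D * (x \<bullet> x))"
        using h_bounds[of s] N_upper[of x s] D0 N_elliptic[of x s] alpha
        by (intro mult_mono) (auto intro: order_trans[of 0 "\<alpha> * (x \<bullet> x)"])
      then show ?thesis by simp
    qed
    have eta: "2 * D * (x \<bullet> x) * \<eta> \<le> \<delta> / 2 * (x \<bullet> x)"
    proof -
      have "D * \<eta> \<le> \<delta> / 4" using D0 delta by (simp add: \<eta>_def field_simps)
      then have "2 * (D * \<eta>) * (x \<bullet> x) \<le> 2 * (\<delta> / 4) * (x \<bullet> x)" by (intro mult_right_mono) auto
      then show ?thesis by (simp add: mult_ac)
    qed
    consider "t \<le> T" | "T \<le> t" "t \<le> T + \<eta>" | "T + \<eta> \<le> t" by linarith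
    then show ?thesis
    proof cases
      case 1
      then have "0 * (T - t) \<le> ?f T - ?f t"
        by (intro DERIV_mono_ge[OF 1 F_quadratic_deriv])
          (use h_bounds N_elliptic alpha in \<open>auto intro!: mult_nonneg_nonneg intro: order_trans[of 0 "\<alpha> * (x \<bullet> x)"]\<close>)
      moreover have "0 \<le> \<delta> / 2 * (x \<bullet> x)" using delta by simp
      ultimately show ?thesis by simp
    next
      case 2
      have "?f t - ?f T \<le> 2 * D * (x \<bullet> x) * (t - T)"
        by (rule DERIV_mono_le[OF 2(1) F_quadratic_deriv up])
      also have "\<dots> \<le> 2 * D * (x \<bullet> x) * \<eta>" using 2 D0 by (intro mult_left_mono) auto
      finally show ?thesis using eta by linarith
    next
      case 3
      have "?f (T + \<eta>) - ?f T \<le> 2 * D * (x \<bullet> x) * (T + \<eta> - T)"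
        by (rule DERIV_mono_le[OF _ F_quadratic_deriv up]) (use eta_pos in simp)
      moreover have "?f t - ?f (T + \<eta>) \<le> 0 * (t - (T + \<eta>))"
        by (rule DERIV_mono_le[OF 3 F_quadratic_deriv]) (simp add: h_eq_0)
      ultimately show ?thesis using eta by simp
    qed
  qed
  then show ?thesis unfolding S_quadratic by linarith
qed

lemma S_upper_time:
  assumes "t \<le> T" shows "norm (S t *v x) \<le> su * (T + \<delta> - t) * norm x"
proof -
  have "\<bar>S t $ i $ j\<bar> \<le> (1 + 2 * C) * (T + \<delta> - t)" for i j
  proof -
    have "F T $ i $ j - F t $ i $ j \<le> 2 * C * (T - t)"
      by (rule DERIV_mono_le[OF assms F_entry_deriv]) (use N_bound h_eq_1 in \<open>auto simp: abs_le_iff\<close>)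
    moreover have "(- 2 * C) * (T - t) \<le> F T $ i $ j - F t $ i $ j"
      by (rule DERIV_mono_ge[OF assms F_entry_deriv])
        (use N_bound h_eq_1 in \<open>auto simp: abs_le_iff minus_le_iff\<close>)
    ultimately have "\<bar>F T $ i $ j - F t $ i $ j\<bar> \<le> 2 * C * (T - t)" by (simp add: abs_le_iff)
    then have "\<bar>S t $ i $ j\<bar> \<le> \<delta> + 2 * C * (T - t)"
      using delta by (auto simp: S_def mat_def)
    also have "\<dots> \<le> (1 + 2 * C) * (T + \<delta> - t)"
      using assms delta mult_nonneg_nonneg[OF C0, of \<delta>] by (simp add: algebra_simps)
    finally show ?thesis .
  qed
  from norm_matrix_vector_le[OF this] show ?thesis by (simp add: su_def mult_ac)
qed

end

sublocale frozen \<subseteq> inverse_family S M "\<delta> / 2"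
  by standard (use S_deriv M_cont S_sym delta S_lower in auto)

context frozen begin

definition g0 :: "real \<Rightarrow> real" where "g0 = (SOME g. \<forall>t. (g has_vector_derivative p t) (at t))"

lemma g0_deriv: "(g0 has_real_derivative p t) (at t)"
proof -
  have "\<exists>g. \<forall>t. (g has_vector_derivative p t) (at t)"
    by (rule global_antiderivative[OF p_cont]) blast
  then show ?thesis unfolding g0_def has_real_derivative_iff_has_vector_derivative
    by (rule someI2_ex) blast
qed

text \<open>The additive constant turns the kernel at time T into the normal density of covariance
  \<delta> I, which has mass 1.\<close>

definition g :: "real \<Rightarrow> real" where
  "g t = g0 t - g0 T + ln ((2 * \<delta>) powr (- (real CARD('n) / 2)) / gauss_total TYPE(real^'n))"

lemma g_deriv: "(g has_real_derivative p t) (at t)"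
  unfolding g_def by (auto intro!: derivative_eq_intros g0_deriv)

lemma exp_g_T: "exp (g T) = (2 * \<delta>) powr (- (real CARD('n) / 2)) / gauss_total TYPE(real^'n)"
  using delta gauss_total_pos[where 'a="real^'n"] by (simp add: g_def)

end

sublocale frozen \<subseteq> gauss_family S M "\<delta> / 2" g
  by standard (rule g_deriv)

section \<open>Bounds of the kernel by a fixed heat kernel\<close>

context frozen begin

lemma Q_T: "Q T z = gauss_density \<delta> z"
proof -
  have *: "S T *v ((1 / \<delta>) *\<^sub>R z) = z"
    using delta by (simp add: S_T scaleR_matrix_vector_assoc[symmetric] matrix_vector_mult_scaleR)
  have P: "P T *v z = (1 / \<delta>) *\<^sub>R z" using P_S[of T "(1 / \<delta>) *\<^sub>R z"] unfolding * .
  have "g T - (z \<bullet> ((1 / \<delta>) *\<^sub>R z)) / 2 = g T + - ((z \<bullet> z) / (2 * \<delta>))" by simp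
  then show ?thesis unfolding Q_def P gauss_density_def by (simp only: exp_add exp_g_T)
qed

lemma Q_mass: "t \<in> {0..T} \<Longrightarrow> (\<integral>z. Q t z \<partial>lborel) = 1"
proof -
  assume t: "t \<in> {0..T}"
  have "(\<integral>z. Q t z \<partial>lborel) = (\<integral>z. Q T z \<partial>lborel)"
  \<comment> \<open>The factor 2 bounds the time T + \<delta> - r, since T < 1 and \<delta> \<le>
    1.\<close>
  proof (rule mass_conservation[where s="\<delta> / 2" and s'="su * 2"])
    show "norm (S r *v x) \<le> su * 2 * norm x" if "r \<in> {t..T}" for r x
    proof -
      have "norm (S r *v x) \<le> su * (T + \<delta> - r) * norm x" using that by (intro S_upper_time) simp
      also have "\<dots> \<le> su * 2 * norm x"
        using that t T delta su_pos by (intro mult_right_mono mult_left_mono) auto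
      finally show ?thesis .
    qed
  qed (use t delta S_lower su_pos in auto)
  also have "\<dots> = (2 * \<delta>) powr (- (real CARD('n) / 2)) / gauss_total TYPE(real^'n) *
      (\<integral>z. exp (- ((1 / (2 * \<delta>)) * ((z - 0) \<bullet> (z - 0)))) \<partial>(lborel :: (real^'n) measure))"
    by (simp add: Q_T gauss_density_def[abs_def])
  also have "\<dots> = 1"
    using delta gauss_total_pos[where 'a="real^'n"]
    by (subst integral_gauss) (simp_all add: powr_minus powr_divide)
  finally show ?thesis .
qed

definition K0 :: real where "K0 = (2 * sl) powr (- (real CARD('n) / 2)) / gauss_total TYPE(real^'n)"

text \<open>Half of the decay rate that \<open>Q_le\<close> provides; the other half is spent on
  powers of |z| / sqrt \<tau>.\<close>

definition \<kappa> :: real where "\<kappa> = sl / su\<^sup>2 / 4"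

lemma K0_pos: "0 < K0" using sl_pos gauss_total_pos[where 'a="real^'n"] by (simp add: K0_def)

lemma kappa_pos: "0 < \<kappa>" using sl_pos su_pos by (simp add: \<kappa>_def)

definition Hm :: "nat \<Rightarrow> real" where "Hm m = 1 + fact m / \<kappa> ^ m"

lemma Hm_pos: "0 < Hm m" using kappa_pos by (simp add: Hm_def add_pos_nonneg)

context
  fixes t assumes t: "t \<in> {0..T}"
begin

definition \<tau> :: real where "\<tau> = T + \<delta> - t"

lemma tau: "0 < \<tau>" "\<delta> \<le> \<tau>" using t delta by (auto simp: \<tau>_def)

lemma s: "0 < sl * \<tau>" "\<And>x. sl * \<tau> * (x \<bullet> x) \<le> x \<bullet> (S t *v x)"
  using sl_pos tau t S_lower_time by (auto simp: \<tau>_def)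

lemma s': "0 < su * \<tau>" "\<And>x. norm (S t *v x) \<le> su * \<tau> * norm x"
  using su_pos tau t S_upper_time by (auto simp: \<tau>_def)

text \<open>Q lies above exp g times an explicit Gaussian and has mass 1, so exp g is at most the
  inverse of the mass of that Gaussian.\<close>

lemma exp_g_le: "exp (g t) \<le> K0 * \<tau> powr (- (real CARD('n) / 2))"
proof -
  let ?c = "1 / (2 * (sl * \<tau>))"
  have c: "0 < ?c" using s(1) by simp
  have pos: "0 < ?c powr (- (real CARD('n) / 2)) * gauss_total TYPE(real^'n)"
    using sl_pos tau gauss_total_pos[where 'a="real^'n"] by (intro mult_pos_pos) simp_all
  have "exp (g t) * (?c powr (- (real CARD('n) / 2)) * gauss_total TYPE(real^'n))
      = (\<integral>z. exp (g t) * exp (- (?c * ((z - 0) \<bullet> (z - 0)))) \<partial>(lborel :: (real^'n) measure))"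
    using integral_gauss[OF c, of "0::real^'n"] sl_pos tau by simp
  also have "\<dots> \<le> (\<integral>z. Q t z \<partial>lborel)"
  proof (rule Bochner_Integration.integral_mono)
    show "integrable lborel (\<lambda>z::real^'n. exp (g t) * exp (- (?c * ((z - 0) \<bullet> (z - 0)))))"
      using integrable_gauss[OF c, of "0::real^'n"] by simp
    show "integrable lborel (Q t)" by (rule Q_integrable[OF s s'])
    show "exp (g t) * exp (- (?c * ((z - 0) \<bullet> (z - 0)))) \<le> Q t z" for z
      using P_quadratic_upper[OF s, of z] by (simp add: Q_def exp_add[symmetric])
  qed
  also have "\<dots> = 1" by (rule Q_mass[OF t])
  finally have "exp (g t) \<le> 1 / (?c powr (- (real CARD('n) / 2)) * gauss_total TYPE(real^'n))"
    unfolding pos_le_divide_eq[OF pos] .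
  also have "?c powr (- (real CARD('n) / 2)) = 1 / ((2 * sl) powr (- (real CARD('n) / 2)) * \<tau> powr (- (real CARD('n) / 2)))"
  proof -
    have "(2 * (sl * \<tau>)) powr e = (2 * sl) powr e * \<tau> powr e" for e
      using powr_mult[of "2 * sl" \<tau> e] sl_pos tau by (simp add: mult.assoc)
    then show ?thesis using sl_pos tau by (simp add: powr_divide powr_minus inverse_eq_divide)
  qed
  finally show ?thesis by (simp add: K0_def)
qed

lemma Q_le_hk2: "Q t z \<le> K0 * \<tau> powr (- (real CARD('n) / 2)) * (exp (- (\<kappa> * (z \<bullet> z) / \<tau>)) * exp (- (\<kappa> * (z \<bullet> z) / \<tau>)))"
proof -
  have "Q t z \<le> exp (g t) * exp (- (sl * \<tau> / (su * \<tau>)\<^sup>2 / 2 * (z \<bullet> z)))"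
    by (rule Q_le[OF s s'])
  also have "sl * \<tau> / (su * \<tau>)\<^sup>2 / 2 * (z \<bullet> z) = \<kappa> * (z \<bullet> z) / \<tau> + \<kappa> * (z \<bullet> z) / \<tau>"
    using su_pos tau by (simp add: \<kappa>_def power2_eq_square field_simps)
  also have "exp (g t) * exp (- \<dots>) \<le> K0 * \<tau> powr (- (real CARD('n) / 2)) * exp (- (\<kappa> * (z \<bullet> z) / \<tau> + \<kappa> * (z \<bullet> z) / \<tau>))"
    by (intro mult_right_mono exp_g_le) auto
  finally show ?thesis by (simp add: exp_add[symmetric])
qed

text \<open>In the variable |z| / sqrt \<tau> powers cost only a constant. The negative powers of
  \<tau> in the derivative bounds come from passing to this variable.\<close>

lemma norm_power_Q_le_hk: "(norm z / sqrt \<tau>) ^ m * Q t z \<le> Hm m * K0 * hk \<kappa> \<tau> z"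
proof -
  let ?r = "norm z / sqrt \<tau>" and ?E = "exp (- (\<kappa> * (z \<bullet> z) / \<tau>))"
  have r2: "\<kappa> * ?r\<^sup>2 = \<kappa> * (z \<bullet> z) / \<tau>" using tau by (simp add: power_divide power2_norm_eq_inner)
  have "?r ^ m * exp (- (\<kappa> * ?r\<^sup>2)) \<le> Hm m"
    unfolding Hm_def by (rule power_mult_exp_bounded[OF kappa_pos]) (use tau in simp)
  then have r: "?r ^ m * ?E \<le> Hm m" unfolding r2 .
  have "?r ^ m * Q t z \<le> ?r ^ m * (K0 * \<tau> powr (- (real CARD('n) / 2)) * (?E * ?E))"
    by (intro mult_left_mono Q_le_hk2) (use tau in simp)
  also have "\<dots> = (?r ^ m * ?E) * (K0 * hk \<kappa> \<tau> z)" by (simp add: hk_def mult_ac)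
  also have "\<dots> \<le> Hm m * (K0 * hk \<kappa> \<tau> z)"
    by (intro mult_right_mono r) (use K0_pos in \<open>simp add: hk_def\<close>)
  finally show ?thesis by (simp add: mult.assoc)
qed

lemma Q_le_hk: "Q t z \<le> Hm 0 * K0 * hk \<kappa> \<tau> z"
  using norm_power_Q_le_hk[of z 0] by simp

lemma Qx_le_hk: "\<bar>Qx i t z\<bar> \<le> \<tau> powr (-1/2) * (Hm 1 / sl * K0 * hk \<kappa> \<tau> z)"
proof -
  have "\<bar>Qx i t z\<bar> \<le> norm z / (sl * \<tau>) * Q t z"
    by (rule Qx_le[OF s s'])
  also have "\<dots> = \<tau> powr (-1/2) / sl * ((norm z / sqrt \<tau>) ^ 1 * Q t z)"
    using tau by (simp add: powr_minus powr_half_sqrt field_simps)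
  also have "\<dots> \<le> \<tau> powr (-1/2) / sl * (Hm 1 * K0 * hk \<kappa> \<tau> z)"
    by (intro mult_left_mono norm_power_Q_le_hk) (use sl_pos in simp)
  finally show ?thesis by simp
qed

lemma Qxx_scaled: "\<bar>Qxx i j t z\<bar> \<le> 1 / \<tau> * (((norm z / sqrt \<tau>) ^ 2 * Q t z) / sl\<^sup>2 + Q t z / sl)"
proof -
  have "\<bar>Qxx i j t z\<bar> \<le> ((norm z)\<^sup>2 / (sl * \<tau>)\<^sup>2 + 1 / (sl * \<tau>)) * Q t z"
    by (rule Qxx_le[OF s s'])
  also have "(norm z)\<^sup>2 / (sl * \<tau>)\<^sup>2 = 1 / \<tau> * ((norm z / sqrt \<tau>) ^ 2 / sl\<^sup>2)"
    using tau sl_pos by (simp add: power_divide power_mult_distrib power2_eq_square[of \<tau>] field_simps)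
  finally show ?thesis by (simp add: algebra_simps)
qed

text \<open>D^2 Q alone is of order 1/\<tau>, which is not integrable in time as \<delta> tends to
  0. The factor |z|, supplied later by the Lipschitz bound on A, is worth sqrt \<tau> and makes the
  singularity integrable.\<close>

lemma norm_Qxx_le_hk: "norm z * \<bar>Qxx i j t z\<bar> \<le> \<tau> powr (-1/2) * ((Hm 3 / sl\<^sup>2 + Hm 1 / sl) * K0 * hk \<kappa> \<tau> z)"
proof -
  let ?r = "norm z / sqrt \<tau>"
  have "norm z * \<bar>Qxx i j t z\<bar> \<le> norm z * (1 / \<tau> * ((?r ^ 2 * Q t z) / sl\<^sup>2 + Q t z / sl))"
    by (intro mult_left_mono Qxx_scaled) auto
  also have "\<dots> = (norm z / \<tau>) * ((?r ^ 2 * Q t z) / sl\<^sup>2 + Q t z / sl)" by simp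
  also have "norm z / \<tau> = \<tau> powr (-1/2) * ?r"
    using tau by (simp add: powr_minus powr_half_sqrt field_simps)
  also have "\<tau> powr (-1/2) * ?r * ((?r ^ 2 * Q t z) / sl\<^sup>2 + Q t z / sl)
      = \<tau> powr (-1/2) * ((?r ^ 3 * Q t z) / sl\<^sup>2 + (?r ^ 1 * Q t z) / sl)"
    by (simp add: algebra_simps power2_eq_square power3_eq_cube)
  also have "\<dots> \<le> \<tau> powr (-1/2) * ((Hm 3 * K0 * hk \<kappa> \<tau> z) / sl\<^sup>2 + (Hm 1 * K0 * hk \<kappa> \<tau> z) / sl)"
    by (intro mult_left_mono add_mono divide_right_mono norm_power_Q_le_hk) (use sl_pos in auto)
  finally show ?thesis by (simp add: algebra_simps)
qed

end

end

text \<open>A smooth step from 0 to 1 across [-r, r]. A difference of two shifted steps serves as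
  cutoff in time.\<close>

lemma mol_antiderivative:
  assumes r: "0 < r"
  obtains \<Phi> :: "real \<Rightarrow> real" where "\<And>t. (\<Phi> has_real_derivative mol r t) (at t)"
    "\<And>t. t \<le> - r \<Longrightarrow> \<Phi> t = 0" "\<And>t. r \<le> t \<Longrightarrow> \<Phi> t = 1" "\<And>t. 0 \<le> \<Phi> t" "\<And>t. \<Phi> t \<le> 1"
proof -
  have c: "continuous_on UNIV (mol r :: real \<Rightarrow> real)" by (intro smooth_continuous smooth_mol)
  obtain G where G: "\<And>t. (G has_vector_derivative mol r t) (at t)"
    using global_antiderivative[OF c] by blast
  define \<Phi> where "\<Phi> t = G t - G (- r)" for t
  have d: "(\<Phi> has_real_derivative mol r t) (at t)" for t
    unfolding \<Phi>_def using G[of t]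
    by (auto intro!: derivative_eq_intros simp: has_real_derivative_iff_has_vector_derivative)
  have mono: "\<Phi> s \<le> \<Phi> t" if "s \<le> t" for s t
    by (rule DERIV_nonneg_imp_nondecreasing[OF that]) (use d mol_nonneg[OF r] in blast)
  have const: "\<Phi> s = \<Phi> t" if "s \<le> t" "\<And>x. s \<le> x \<Longrightarrow> x \<le> t \<Longrightarrow> r \<le> \<bar>x\<bar>" for s t
  proof (rule antisym[OF mono[OF that(1)]])
    show "\<Phi> t \<le> \<Phi> s"
      by (rule DERIV_nonpos_imp_nonincreasing[OF that(1)])
        (metis d mol_eq_0[OF r] order_refl real_norm_def that(2))
  qed
  have "(\<integral>x. indicator {-r..r} x *\<^sub>R mol r x \<partial>lborel) = \<Phi> r - \<Phi> (- r)"
    using d r by (intro integral_FTC_Icc continuous_on_subset[OF c])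
      (auto simp: has_real_derivative_iff_has_vector_derivative has_vector_derivative_at_within)
  moreover have "(\<lambda>x. indicator {-r..r} x *\<^sub>R mol r x) = (mol r :: real \<Rightarrow> real)"
  proof
    show "indicator {-r..r} x *\<^sub>R mol r x = mol r x" for x :: real
      by (cases "x \<in> {-r..r}") (auto intro!: mol_eq_0[OF r])
  qed
  ultimately have "\<Phi> r - \<Phi> (- r) = 1" using integral_mol[OF r, where 'a=real] by simp
  moreover have 0: "\<Phi> (- r) = 0" by (simp add: \<Phi>_def)
  ultimately have 1: "\<Phi> r = 1" by simp
  have lo: "\<Phi> t = 0" if "t \<le> - r" for t using const[OF that] 0 r by force
  have hi: "\<Phi> t = 1" if "r \<le> t" for t using const[OF that] 1 r by force
  have "0 \<le> \<Phi> t" "\<Phi> t \<le> 1" for t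
    using mono[of "- r" t] mono[of t r] lo[of t] hi[of t] 0 1 by linarith+
  with d lo hi show ?thesis using that by blast
qed

text \<open>The initial condition speaks only of smooth compactly supported functions. This uniform
  approximation transfers it to continuous functions vanishing at infinity, such as Gaussian
  kernels.\<close>

lemma test_function_approx:
  fixes \<psi> :: "'a::euclidean_space \<Rightarrow> real"
  assumes c: "continuous_on UNIV \<psi>" and lim: "\<And>e. 0 < e \<Longrightarrow> \<exists>b. \<forall>x. b \<le> norm x \<longrightarrow> \<bar>\<psi> x\<bar> \<le> e" and e: "0 < e"
  shows "\<exists>\<zeta>\<in>test_functions UNIV. \<forall>x. \<bar>\<zeta> x - \<psi> x\<bar> \<le> e"
proof -
  obtain b where b: "\<And>x. b \<le> norm x \<Longrightarrow> \<bar>\<psi> x\<bar> \<le> e / 2"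
    using lim[of "e / 2"] e by auto
  \<comment> \<open>A continuous cutoff, equal to 1 on the ball of radius \<open>b\<close> and to 0
    outside the ball of radius \<open>b + 1\<close>.\<close>
  define k where "k x = max 0 (min 1 (b + 1 - norm x))" for x :: 'a
  define f where "f x = \<psi> x * k x" for x
  have kc: "continuous_on UNIV k" unfolding k_def by (intro continuous_intros)
  have fc: "continuous_on UNIV f" unfolding f_def by (intro continuous_intros kc c)
  have f0: "f x = 0" if "x \<notin> cball 0 (b + 1)" for x using that by (simp add: f_def k_def)
  have k01: "0 \<le> k x" "k x \<le> 1" for x by (auto simp: k_def)
  have f1: "\<bar>f x - \<psi> x\<bar> \<le> e / 2" for x
  proof (cases "b \<le> norm x")
    case True
    have "f x - \<psi> x = \<psi> x * (k x - 1)" by (simp add: f_def right_diff_distrib)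
    then have "\<bar>f x - \<psi> x\<bar> = \<bar>\<psi> x\<bar> * (1 - k x)"
      using k01(2)[of x] by (simp add: abs_mult)
    also have "\<dots> \<le> \<bar>\<psi> x\<bar> * 1" using k01[of x] by (intro mult_left_mono) auto
    finally show ?thesis using b[OF True] by simp
  qed (use e in \<open>simp add: f_def k_def\<close>)
  \<comment> \<open>Points at distance less than 1 either both lie in this ball or both lie where
    \<open>f\<close> vanishes: the case distinction is made at norm \<open>b + 2\<close>.\<close>
  let ?K = "cball (0::'a) (b + 3)"
  have "uniformly_continuous_on ?K f"
    by (intro compact_uniformly_continuous continuous_on_subset[OF fc]) auto
  then obtain d where d: "d > 0" "\<And>x y. x \<in> ?K \<Longrightarrow> y \<in> ?K \<Longrightarrow> dist y x < d \<Longrightarrow> dist (f y) (f x) < e / 2"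
    using e unfolding uniformly_continuous_on_def by (metis half_gt_zero)
  define r where "r = min d 1"
  have r: "0 < r" using d by (simp add: r_def)
  have close: "\<bar>f w - f z\<bar> \<le> e / 2" if w: "norm (z - w) < r" for z w
  proof (cases "norm z \<le> b + 2")
    case True
    have "norm w \<le> norm z + norm (z - w)" using norm_triangle_ineq4[of z "z - w"] by simp
    then have "w \<in> ?K" "z \<in> ?K" using True w by (auto simp: r_def)
    moreover have "dist w z < d" using w by (simp add: r_def dist_norm norm_minus_commute)
    ultimately show ?thesis using d(2)[of z w] by (simp add: dist_real_def)
  next
    case False
    have "norm z \<le> norm w + norm (z - w)" using norm_triangle_ineq[of w "z - w"] by simp
    then have "b + 1 < norm w" using False w by (simp add: r_def)
    then show ?thesis using f0[of z] f0[of w] False e by simp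
  qed
  have "\<bar>conv f (mol r) z - f z\<bar> \<le> e / 2" for z
    by (rule conv_mol_close[OF fc compact_cball[of 0 "b + 1"] f0 r close])
  then have "\<bar>conv f (mol r) z - \<psi> z\<bar> \<le> e" for z using f1[of z] by (smt (verit) field_sum_of_halves)
  moreover have "conv f (mol r) \<in> test_functions UNIV"
    by (rule conv_mol_test_function[OF fc compact_cball[of 0 "b + 1"] f0 r]) simp_all
  ultimately show ?thesis by blast
qed

lemma hk_nonneg: "0 \<le> hk \<kappa> \<tau> z" by (simp add: hk_def)

lemma hk_le: "0 < \<kappa> \<Longrightarrow> 0 < \<tau> \<Longrightarrow> hk \<kappa> \<tau> z \<le> \<tau> powr (- (real CARD('n) / 2))" for z :: "real^'n"
  by (simp add: hk_def mult_le_cancel_left1)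

text \<open>Used for \<tau>' close to \<tau>, where the loss factor is close to 1.\<close>

lemma hk_time_le:
  fixes z :: "real^'n"
  assumes "0 < \<kappa>" "0 < \<tau>'" "\<tau>' \<le> \<tau>"
  shows "hk \<kappa> \<tau>' z \<le> (\<tau> / \<tau>') powr (real CARD('n) / 2) * hk \<kappa> \<tau> z"
proof -
  have "\<kappa> * (z \<bullet> z) / \<tau> \<le> \<kappa> * (z \<bullet> z) / \<tau>'" using assms by (intro divide_left_mono) auto
  then have "hk \<kappa> \<tau>' z \<le> \<tau>' powr (- (real CARD('n) / 2)) * exp (- (\<kappa> * (z \<bullet> z) / \<tau>))"
    unfolding hk_def by (intro mult_left_mono) auto
  also have "\<tau>' powr (- (real CARD('n) / 2)) = (\<tau> / \<tau>') powr (real CARD('n) / 2) * \<tau> powr (- (real CARD('n) / 2))"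
    using assms by (simp add: powr_divide powr_minus field_simps)
  finally show ?thesis by (simp add: hk_def mult.assoc)
qed

lemma hk_cont: "0 < \<tau> \<Longrightarrow> continuous_on UNIV (hk \<kappa> \<tau> :: real^'n \<Rightarrow> real)"
  unfolding hk_def[abs_def] by (intro continuous_intros) auto

lemma hk_vanishes:
  fixes x0 :: "real^'n"
  assumes "0 < \<kappa>" "0 < \<tau>" "0 < e"
  shows "\<exists>b. \<forall>y. b \<le> norm y \<longrightarrow> \<bar>hk \<kappa> \<tau> (y - x0)\<bar> \<le> e"
proof -
  define c where "c = \<tau> powr (- (real CARD('n) / 2))"
  have c: "0 < c" using assms by (simp add: c_def)
  \<comment> \<open>Large enough for the crude estimate u \<le> exp u to suffice. The summand 1
    makes the distance to \<open>x0\<close> at least 1, hence bounded by its square.\<close>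
  define b where "b = norm x0 + 1 + c * \<tau> / (\<kappa> * e)"
  have "\<bar>hk \<kappa> \<tau> (y - x0)\<bar> \<le> e" if y: "b \<le> norm y" for y
  proof -
    let ?r = "norm (y - x0)"
    have "norm y - norm x0 \<le> ?r" by (rule norm_triangle_ineq2)
    then have r: "1 \<le> ?r" "c * \<tau> / (\<kappa> * e) \<le> ?r"
      using y assms c by (auto simp: b_def intro: order_trans[of _ "1 + c * \<tau> / (\<kappa> * e)"])
    then have "?r * 1 \<le> ?r * ?r" by (intro mult_left_mono) auto
    then have "c * \<tau> / (\<kappa> * e) \<le> ?r * ?r" using r by linarith
    then have "c / e \<le> \<kappa> * (?r * ?r) / \<tau>"
      using assms by (simp add: field_simps)
    also have "\<dots> \<le> exp (\<kappa> * (?r * ?r) / \<tau>)" using exp_ge_add_one_self[of "\<kappa> * (?r * ?r) / \<tau>"] by linarith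
    finally have "c \<le> e * exp (\<kappa> * (?r * ?r) / \<tau>)" using assms by (simp add: field_simps)
    then have "c * exp (- (\<kappa> * (?r * ?r) / \<tau>)) \<le> e" by (simp add: exp_minus field_simps)
    then show ?thesis by (simp add: hk_def c_def dot_square_norm power2_eq_square)
  qed
  then show ?thesis by blast
qed

context parabolic_density begin

lemma bounded_R_integrable:
  assumes [measurable]: "f \<in> borel_measurable borel" and "\<And>z. \<bar>f z\<bar> \<le> c"
  shows "integrable lborel (\<lambda>z. f z * R (fst z) (snd z))"
proof (rule Bochner_Integration.integrable_bound)
  show "integrable lborel (\<lambda>z. c * R (fst z) (snd z))" using R_integrable by simp
  show "AE z in lborel. norm (f z * R (fst z) (snd z)) \<le> norm (c * R (fst z) (snd z))"
    using assms(2) R_nonneg by (intro AE_I2) (auto simp: abs_mult intro!: mult_right_mono order_trans[OF _ abs_ge_self])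
qed (use R_meas in auto)

lemma bounded_R_slice_integrable:
  assumes [measurable]: "f \<in> borel_measurable borel" and "\<And>x. \<bar>f x\<bar> \<le> c"
  shows "integrable lborel (\<lambda>x. f x * R t x)"
proof (rule Bochner_Integration.integrable_bound)
  show "integrable lborel (\<lambda>x. c * R t x)" using R_slice_integrable by simp
  show "AE x in lborel. norm (f x * R t x) \<le> norm (c * R t x)"
    using assms(2) R_nonneg by (intro AE_I2) (auto simp: abs_mult intro!: mult_right_mono order_trans[OF _ abs_ge_self])
qed auto

lemma R_integral_eq_1: "t \<in> {0<..<1} \<Longrightarrow> (\<integral>x. R t x \<partial>lborel) = 1"
  using R_prob[of t] R_nonneg nn_integral_eq_integral[OF R_slice_integrable, of t] by simp

lemma iterated_integral:
  fixes f :: "real \<times> (real^'n) \<Rightarrow> real"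
  assumes "integrable lborel f" shows "(\<integral>z. f z \<partial>lborel) = (\<integral>t. \<integral>x. f (t, x) \<partial>lborel \<partial>lborel)"
  using lborel_pair.integral_fst'[of f] assms by (simp add: lborel_prod)

lemma r0_integrable: "integrable lborel r0"
  using r0_meas r0_nonneg r0_prob by (intro integrableI_nonneg) auto

text \<open>The error \<open>e / 3\<close> arises three times: from the approximation at time t,
  from the limit, and from the approximation at time 0. Since the densities have mass at most 1, a
  uniform error of the integrand is an error of the integral.\<close>

lemma init_vanishing:
  assumes c: "continuous_on UNIV \<psi>" and lim: "\<And>e. 0 < e \<Longrightarrow> \<exists>b. \<forall>x. b \<le> norm x \<longrightarrow> \<bar>\<psi> x\<bar> \<le> e"
    and bd: "\<And>x. \<bar>\<psi> x\<bar> \<le> c0" and e: "0 < e"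
  shows "\<forall>\<^sub>F t in at_right 0. (\<integral>x. \<psi> x * R t x \<partial>lborel) \<le> (\<integral>x. \<psi> x * r0 x \<partial>lborel) + e"
proof -
  obtain \<zeta> where \<zeta>: "\<zeta> \<in> test_functions UNIV" "\<And>x. \<bar>\<zeta> x - \<psi> x\<bar> \<le> e / 3"
    using test_function_approx[OF c lim, of "e / 3"] e by auto
  have [measurable]: "\<psi> \<in> borel_measurable borel" by (rule borel_measurable_continuous_onI[OF c])
  have "smooth \<zeta>" using \<zeta>(1) by (simp add: test_functions_def)
  then have [measurable]: "\<zeta> \<in> borel_measurable borel"
    by (intro borel_measurable_continuous_onI smooth_continuous)
  have zb: "\<bar>\<zeta> x\<bar> \<le> c0 + e" for x using \<zeta>(2)[of x] bd[of x] e by linarith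
  have "\<forall>\<^sub>F t in at_right 0. dist (\<integral>x. \<zeta> x * R t x \<partial>lborel) (\<integral>x. \<zeta> x * r0 x \<partial>lborel) < e / 3"
    using init[OF \<zeta>(1)] e by (intro tendstoD) auto
  then show ?thesis
  proof eventually_elim
    case (elim t)
    have i1: "integrable lborel (\<lambda>x. \<zeta> x * R t x)" by (rule bounded_R_slice_integrable[OF _ zb]) simp
    have i2: "integrable lborel (\<lambda>x. \<psi> x * R t x)" by (rule bounded_R_slice_integrable[OF _ bd]) simp
    have i3: "integrable lborel (\<lambda>x. \<zeta> x * r0 x)"
      by (rule Bochner_Integration.integrable_bound[OF integrable_mult_right[OF r0_integrable, of "c0 + e"]])
        (use r0_meas zb r0_nonneg in \<open>auto simp: abs_mult intro!: mult_right_mono order_trans[OF _ abs_ge_self]\<close>)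
    have i4: "integrable lborel (\<lambda>x. \<psi> x * r0 x)"
      by (rule Bochner_Integration.integrable_bound[OF integrable_mult_right[OF r0_integrable, of c0]])
        (use r0_meas bd r0_nonneg in \<open>auto simp: abs_mult intro!: mult_right_mono order_trans[OF _ abs_ge_self]\<close>)
    have r01: "(\<integral>x. r0 x \<partial>lborel) = 1"
      using r0_prob r0_nonneg nn_integral_eq_integral[OF r0_integrable] by simp
    have "(\<integral>x. \<psi> x * R t x \<partial>lborel) \<le> (\<integral>x. \<zeta> x * R t x + e / 3 * R t x \<partial>lborel)"
    proof (rule Bochner_Integration.integral_mono)
      show "\<psi> x * R t x \<le> \<zeta> x * R t x + e / 3 * R t x" for x
      proof -
        have "\<psi> x \<le> \<zeta> x + e / 3" using abs_le_D2[OF \<zeta>(2)[of x]] by linarith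
        from mult_right_mono[OF this R_nonneg[of t x]] show ?thesis by (simp only: distrib_right)
      qed
    qed (use i1 i2 R_slice_integrable in auto)
    also have "\<dots> = (\<integral>x. \<zeta> x * R t x \<partial>lborel) + e / 3 * (\<integral>x. R t x \<partial>lborel)"
      using i1 R_slice_integrable[of t] by simp
    also have "\<dots> \<le> (\<integral>x. \<zeta> x * R t x \<partial>lborel) + e / 3"
      using R_integral_le_1[of t] e by (simp add: mult_le_cancel_left1)
    finally have 1: "(\<integral>x. \<psi> x * R t x \<partial>lborel) \<le> (\<integral>x. \<zeta> x * R t x \<partial>lborel) + e / 3" .
    have "(\<integral>x. \<zeta> x * r0 x \<partial>lborel) \<le> (\<integral>x. \<psi> x * r0 x + e / 3 * r0 x \<partial>lborel)"
    proof (rule Bochner_Integration.integral_mono)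
      show "\<zeta> x * r0 x \<le> \<psi> x * r0 x + e / 3 * r0 x" for x
      proof -
        have "\<zeta> x \<le> \<psi> x + e / 3" using abs_le_D1[OF \<zeta>(2)[of x]] by linarith
        from mult_right_mono[OF this r0_nonneg[of x]] show ?thesis by (simp only: distrib_right)
      qed
    qed (use i3 i4 r0_integrable in auto)
    also have "\<dots> = (\<integral>x. \<psi> x * r0 x \<partial>lborel) + e / 3"
      using i4 r0_integrable by (simp add: r01)
    finally show ?case using 1 elim unfolding dist_real_def by linarith
  qed
qed

lemma A_matrix_measurable: "(\<lambda>t. A t x0) \<in> borel_measurable borel"
proof -
  have "(\<lambda>t. A t x0 $ i $ j) \<in> borel_measurable borel" for i j
    using measurable_compose[OF _ A_meas[of i j], of "\<lambda>t. (t, x0)" borel] by simp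
  then show ?thesis
    by (subst borel_measurable_euclidean_space) (auto simp: Basis_vec_def inner_axis axis_eq_axis)
qed

text \<open>\<open>A(\<cdot>, x\<^sub>0)\<close> is only measurable in time, while the kernel needs a continuous matrix \<open>N\<close>. Projecting
  continuous approximations to the closed convex set of admissible matrices keeps all bounds.\<close>

lemma freeze_continuous:
  assumes "0 < e"
  obtains N where "continuous_on UNIV N" "\<And>t. transpose (N t) = N t" "\<And>t i j. \<bar>N t $ i $ j\<bar> \<le> C"
    "\<And>t \<xi>. \<alpha> * (\<xi> \<bullet> \<xi>) \<le> \<xi> \<bullet> (N t *v \<xi>)"
    "(\<integral>t. indicator {0<..<1} t * (\<Sum>i\<in>UNIV. \<Sum>j\<in>UNIV. \<bar>A t x0 $ i $ j - N t $ i $ j\<bar>) \<partial>lborel) \<le> e"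
proof -
  define X :: "(real^'n^'n) set" where "X = {Y. (\<forall>i j. Y $ i $ j = Y $ j $ i) \<and> (\<forall>i j. \<bar>Y $ i $ j\<bar> \<le> C) \<and> (\<forall>\<xi>. \<alpha> * (\<xi> \<bullet> \<xi>) \<le> \<xi> \<bullet> (Y *v \<xi>))}"
  have X_eq: "X = (\<Inter>i. \<Inter>j. {Y. Y $ i $ j = Y $ j $ i}) \<inter> (\<Inter>i. \<Inter>j. {Y. \<bar>Y $ i $ j\<bar> \<le> C})
      \<inter> (\<Inter>\<xi>. {Y. \<alpha> * (\<xi> \<bullet> \<xi>) \<le> \<xi> \<bullet> (Y *v \<xi>)})"
    by (auto simp: X_def)
  have quad: "continuous_on UNIV (\<lambda>Y :: real^'n^'n. \<xi> \<bullet> (Y *v \<xi>))" for \<xi>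
    by (rule linear_continuous_on[OF bounded_linear_matrix_quadratic])
  have X_closed: "closed X"
    unfolding X_eq by (intro closed_Int closed_INT ballI closed_Collect_eq closed_Collect_le continuous_intros quad)
  have X_convex: "convex X"
  proof (rule convexI)
    fix Y Z :: "real^'n^'n" and u v :: real
    assume Y: "Y \<in> X" and Z: "Z \<in> X" and uv: "0 \<le> u" "0 \<le> v" "u + v = 1"
    have "\<bar>u * Y $ i $ j + v * Z $ i $ j\<bar> \<le> C" for i j
    proof -
      have "\<bar>u * Y $ i $ j + v * Z $ i $ j\<bar> \<le> u * \<bar>Y $ i $ j\<bar> + v * \<bar>Z $ i $ j\<bar>"
        using uv by (intro order_trans[OF abs_triangle_ineq]) (simp add: abs_mult)
      also have "\<dots> \<le> u * C + v * C" using Y Z uv by (intro add_mono mult_left_mono) (auto simp: X_def)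
      also have "\<dots> = C" using uv by (simp add: distrib_right[symmetric])
      finally show ?thesis .
    qed
    moreover have "\<alpha> * (\<xi> \<bullet> \<xi>) \<le> \<xi> \<bullet> ((u *\<^sub>R Y + v *\<^sub>R Z) *v \<xi>)" for \<xi>
    proof -
      have "u * (\<alpha> * (\<xi> \<bullet> \<xi>)) + v * (\<alpha> * (\<xi> \<bullet> \<xi>)) \<le> u * (\<xi> \<bullet> (Y *v \<xi>)) + v * (\<xi> \<bullet> (Z *v \<xi>))"
        using Y Z uv by (intro add_mono mult_left_mono) (auto simp: X_def)
      moreover have "u * (\<alpha> * (\<xi> \<bullet> \<xi>)) + v * (\<alpha> * (\<xi> \<bullet> \<xi>)) = \<alpha> * (\<xi> \<bullet> \<xi>)"
        using uv by (simp add: distrib_right[symmetric])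
      ultimately show ?thesis
        by (simp add: matrix_vector_mult_add_rdistrib scaleR_matrix_vector_assoc[symmetric] inner_add_right)
    qed
    ultimately show "u *\<^sub>R Y + v *\<^sub>R Z \<in> X" using Y Z by (simp add: X_def)
  qed
  have A_X: "A t x \<in> X" for t x
    using A_sym[of t x] A_bound A_elliptic unfolding X_def transpose_def by (auto simp: vec_eq_iff)
  then have X_ne: "X \<noteq> {}" by blast
  have "(\<lambda>t. A t x0) \<in> borel_measurable lebesgue"
    using A_matrix_measurable measurable_completion by (metis measurable_lborel1 measurable_lborel2)
  then have "(\<lambda>t. A t x0) measurable_on UNIV"
    by (subst measurable_on_iff_borel_measurable) auto
  \<comment> \<open>A Lebesgue measurable function is an almost everywhere limit of continuous
    ones.\<close>
  then obtain Z g where Z: "negligible Z" and g: "\<And>n. continuous_on UNIV (g n)"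
    and lim: "\<And>t. t \<notin> Z \<Longrightarrow> (\<lambda>n. g n t) \<longlonglongrightarrow> A t x0"
    unfolding measurable_on_def by auto
  define N where "N n t = closest_point X (g n t)" for n :: nat and t
  have cpc: "continuous_on UNIV (closest_point X)" by (rule continuous_on_closest_point[OF X_convex X_closed X_ne])
  have Nc: "continuous_on UNIV (N n)" for n
    unfolding N_def by (rule continuous_on_compose2[OF cpc g]) auto
  have NX: "N n t \<in> X" for n t unfolding N_def by (rule closest_point_in_set[OF X_closed X_ne])
  have Nlim: "(\<lambda>n. N n t) \<longlonglongrightarrow> A t x0" if "t \<notin> Z" for t
  proof -
    \<comment> \<open>The projection is continuous and fixes the admissible matrix
      \<open>A t x0\<close>, so the limit is unchanged.\<close>
    have "(\<lambda>n. closest_point X (g n t)) \<longlonglongrightarrow> closest_point X (A t x0)"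
      by (rule continuous_on_tendsto_compose[OF cpc lim[OF that]]) auto
    then show ?thesis by (simp add: N_def closest_point_self[OF A_X])
  qed
  have AEZ: "AE t in lborel. t \<notin> Z"
  proof -
    have "AE t in lebesgue. t \<notin> Z" using Z by (intro AE_not_in) (simp add: negligible_iff_null_sets)
    then show ?thesis by (simp add: AE_completion_iff)
  qed
  let ?s = "\<lambda>n t. indicator {0<..<1::real} t * (\<Sum>i\<in>UNIV. \<Sum>j\<in>UNIV. \<bar>A t x0 $ i $ j - N n t $ i $ j\<bar>)"
  have [measurable]: "(\<lambda>t. A t x0 $ i $ j) \<in> borel_measurable borel" for i j
    using measurable_compose[OF _ A_meas[of i j], of "\<lambda>t. (t, x0)" borel] by simp
  have [measurable]: "(\<lambda>t. N n t $ i $ j) \<in> borel_measurable borel" for n i j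
    by (intro borel_measurable_continuous_onI continuous_intros Nc)
  have "(\<lambda>n. \<integral>t. ?s n t \<partial>lborel) \<longlonglongrightarrow> (\<integral>t. 0 \<partial>(lborel :: real measure))"
  proof (rule integral_dominated_convergence[where w="\<lambda>t. indicator {0<..<1} t * ((real CARD('n))\<^sup>2 * (2 * C))"])
    show "integrable lborel (\<lambda>t. indicator {0<..<1::real} t * ((real CARD('n))\<^sup>2 * (2 * C)))"
      by (intro integrable_mult_left integrable_real_indicator) auto
    show "AE t in lborel. (\<lambda>n. ?s n t) \<longlonglongrightarrow> 0"
      using AEZ
    proof eventually_elim
      case (elim t)
      have "(\<lambda>n. ?s n t) \<longlonglongrightarrow> indicator {0<..<1} t * (\<Sum>i\<in>UNIV. \<Sum>j\<in>UNIV. \<bar>A t x0 $ i $ j - A t x0 $ i $ j\<bar>)"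
        by (intro tendsto_intros Nlim elim)
      then show ?case by simp
    qed
    show "AE t in lborel. norm (?s n t) \<le> indicator {0<..<1} t * ((real CARD('n))\<^sup>2 * (2 * C))" for n
    proof (rule AE_I2)
      fix t
      have "\<bar>A t x0 $ i $ j - N n t $ i $ j\<bar> \<le> 2 * C" for i j
        using A_bound[of t x0 i j] NX[of n t] unfolding X_def by (smt (verit) mem_Collect_eq)
      then have "(\<Sum>i\<in>UNIV. \<Sum>j\<in>UNIV. \<bar>A t x0 $ i $ j - N n t $ i $ j\<bar>) \<le> (\<Sum>i\<in>(UNIV::'n set). \<Sum>j\<in>(UNIV::'n set). 2 * C)"
        by (intro sum_mono)
      moreover have "(\<Sum>i\<in>(UNIV::'n set). \<Sum>j\<in>(UNIV::'n set). 2 * C) = (real CARD('n))\<^sup>2 * (2 * C)"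
        by (simp add: power2_eq_square)
      ultimately have le: "(\<Sum>i\<in>UNIV. \<Sum>j\<in>UNIV. \<bar>A t x0 $ i $ j - N n t $ i $ j\<bar>) \<le> (real CARD('n))\<^sup>2 * (2 * C)"
        by linarith
      have "norm (?s n t) = ?s n t" by (simp only: real_norm_def) (intro abs_of_nonneg mult_nonneg_nonneg sum_nonneg; simp)
      also have "\<dots> \<le> indicator {0<..<1} t * ((real CARD('n))\<^sup>2 * (2 * C))" by (intro mult_left_mono le) simp
      finally show "norm (?s n t) \<le> indicator {0<..<1} t * ((real CARD('n))\<^sup>2 * (2 * C))" .
    qed
  qed measurable
  then have "\<forall>\<^sub>F n in sequentially. (\<integral>t. ?s n t \<partial>lborel) < e"
    using assms by (intro order_tendstoD) auto
  then obtain n where n: "(\<integral>t. ?s n t \<partial>lborel) < e" by (auto dest: eventually_happens)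
  show ?thesis
  proof (rule that[of "N n"])
    show "transpose (N n t) = N n t" for t
      using NX[of n t] by (auto simp: X_def transpose_def vec_eq_iff)
  qed (use Nc NX n in \<open>auto simp: X_def\<close>)
qed

end

section \<open>Kernel bounds with a common constant\<close>

context frozen begin

text \<open>One constant for Q, DQ and |z| D^2 Q together. It depends on the dimension, C and
  \<alpha> only.\<close>

definition KK :: real where "KK = K0 * (Hm 0 + Hm 1 / sl + (Hm 3 / sl\<^sup>2 + Hm 1 / sl))"

definition Exx :: real where
  "Exx = 1 / \<delta> * ((Hm 2 * K0 * \<delta> powr (- (real CARD('n) / 2))) / sl\<^sup>2 + (Hm 0 * K0 * \<delta> powr (- (real CARD('n) / 2))) / sl)"

text \<open>A crude uniform bound on [0, T] for Q and all derivatives in the equation. It may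
  explode as \<delta> tends to 0, so it occurs only in front of errors that are made small with
  \<delta> fixed.\<close>

definition EE :: real where
  "EE = KK * \<delta> powr (- (real CARD('n) / 2)) + \<delta> powr (-1/2) * (KK * \<delta> powr (- (real CARD('n) / 2)))
      + (Exx + (real CARD('n))\<^sup>2 * C * Exx)"

lemma Hm_sl_nonneg: "0 \<le> Hm m / sl" "0 \<le> Hm m / sl\<^sup>2"
  using Hm_pos[of m] sl_pos by simp_all

lemma KK_pos: "0 < KK"
  unfolding KK_def using K0_pos Hm_pos[of 0] Hm_sl_nonneg by (intro mult_pos_pos add_pos_nonneg add_nonneg_nonneg) auto

lemma Exx_nonneg: "0 \<le> Exx"
  unfolding Exx_def using delta K0_pos Hm_pos sl_pos
  by (intro mult_nonneg_nonneg add_nonneg_nonneg divide_nonneg_nonneg) (auto intro: less_imp_le)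

context
  fixes t assumes t: "t \<in> {0..T}"
begin

lemma hk_delta_le: "hk \<kappa> (T + \<delta> - t) z \<le> \<delta> powr (- (real CARD('n) / 2))" for z :: "real^'n"
proof -
  have "hk \<kappa> (T + \<delta> - t) z \<le> (T + \<delta> - t) powr (- (real CARD('n) / 2))"
    using t delta by (intro hk_le kappa_pos) auto
  also have "\<dots> \<le> \<delta> powr (- (real CARD('n) / 2))"
    using t delta by (intro powr_mono2') auto
  finally show ?thesis .
qed

lemma Q_le_KK: "Q t z \<le> KK * hk \<kappa> (T + \<delta> - t) z"
proof -
  have "Q t z \<le> Hm 0 * K0 * hk \<kappa> (T + \<delta> - t) z" using Q_le_hk[OF t, of z] by (simp add: \<tau>_def[OF t])
  also have "\<dots> \<le> KK * hk \<kappa> (T + \<delta> - t) z"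
  proof (intro mult_right_mono hk_nonneg)
    have "K0 * Hm 0 \<le> KK" unfolding KK_def
      using K0_pos Hm_sl_nonneg[of 1] Hm_sl_nonneg[of 3] by (intro mult_left_mono) linarith+
    then show "Hm 0 * K0 \<le> KK" by (simp add: mult.commute)
  qed
  finally show ?thesis .
qed

lemma Qx_le_KK: "\<bar>Qx i t z\<bar> \<le> (T + \<delta> - t) powr (-1/2) * (KK * hk \<kappa> (T + \<delta> - t) z)"
proof -
  have "\<bar>Qx i t z\<bar> \<le> (T + \<delta> - t) powr (-1/2) * (Hm 1 / sl * K0 * hk \<kappa> (T + \<delta> - t) z)"
    using Qx_le_hk[OF t, of i z] by (simp add: \<tau>_def[OF t])
  also have "\<dots> \<le> (T + \<delta> - t) powr (-1/2) * (KK * hk \<kappa> (T + \<delta> - t) z)"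
  proof (intro mult_left_mono mult_right_mono hk_nonneg)
    have "K0 * (Hm 1 / sl) \<le> KK" unfolding KK_def
      using K0_pos Hm_pos[of 0] Hm_sl_nonneg[of 1] Hm_sl_nonneg[of 3] by (intro mult_left_mono) linarith+
    then show "Hm 1 / sl * K0 \<le> KK" by (simp add: mult.commute)
  qed simp
  finally show ?thesis .
qed

lemma norm_Qxx_le_KK: "norm z * \<bar>Qxx i j t z\<bar> \<le> (T + \<delta> - t) powr (-1/2) * (KK * hk \<kappa> (T + \<delta> - t) z)"
proof -
  have "norm z * \<bar>Qxx i j t z\<bar> \<le> (T + \<delta> - t) powr (-1/2) * ((Hm 3 / sl\<^sup>2 + Hm 1 / sl) * K0 * hk \<kappa> (T + \<delta> - t) z)"
    using norm_Qxx_le_hk[OF t, of z i j] by (simp add: \<tau>_def[OF t])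
  also have "\<dots> \<le> (T + \<delta> - t) powr (-1/2) * (KK * hk \<kappa> (T + \<delta> - t) z)"
  proof (intro mult_left_mono mult_right_mono hk_nonneg)
    have "K0 * (Hm 3 / sl\<^sup>2 + Hm 1 / sl) \<le> KK" unfolding KK_def
      using K0_pos Hm_pos[of 0] Hm_sl_nonneg[of 1] by (intro mult_left_mono) linarith+
    then show "(Hm 3 / sl\<^sup>2 + Hm 1 / sl) * K0 \<le> KK" by (simp add: mult.commute)
  qed simp
  finally show ?thesis .
qed

lemma Qxx_le_Exx: "\<bar>Qxx i j t z\<bar> \<le> Exx"
proof -
  let ?\<tau> = "T + \<delta> - t"
  have d: "\<delta> \<le> ?\<tau>" using t by simp
  have hd: "Hm m * K0 * hk \<kappa> ?\<tau> z \<le> Hm m * K0 * \<delta> powr (- (real CARD('n) / 2))" for m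
    using K0_pos Hm_pos[of m] by (intro mult_left_mono hk_delta_le) auto
  have q: "(norm z / sqrt ?\<tau>) ^ m * Q t z \<le> Hm m * K0 * \<delta> powr (- (real CARD('n) / 2))" for m
    using norm_power_Q_le_hk[OF t, of z m] hd[of m] by (simp add: \<tau>_def[OF t])
  have "\<bar>Qxx i j t z\<bar> \<le> 1 / ?\<tau> * (((norm z / sqrt ?\<tau>) ^ 2 * Q t z) / sl\<^sup>2 + Q t z / sl)"
    using Qxx_scaled[OF t, of i j z] by (simp add: \<tau>_def[OF t])
  also have "\<dots> \<le> Exx"
    unfolding Exx_def
  proof (rule mult_mono)
    have "Q t z \<le> Hm 0 * K0 * \<delta> powr (- (real CARD('n) / 2))" using q[of 0] by simp
    then show "(norm z / sqrt ?\<tau>) ^ 2 * Q t z / sl\<^sup>2 + Q t z / sl \<le>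
        Hm 2 * K0 * \<delta> powr (- (real CARD('n) / 2)) / sl\<^sup>2 + Hm 0 * K0 * \<delta> powr (- (real CARD('n) / 2)) / sl"
      using sl_pos by (intro add_mono divide_right_mono q) auto
    show "1 / ?\<tau> \<le> 1 / \<delta>" using d delta by (intro divide_left_mono) auto
    show "0 \<le> (norm z / sqrt ?\<tau>)\<^sup>2 * Q t z / sl\<^sup>2 + Q t z / sl"
      using Q_pos[of t z] sl_pos by (intro add_nonneg_nonneg) auto
  qed (use delta in simp)
  finally show ?thesis .
qed

lemma EE_parts: "0 \<le> KK * \<delta> powr (- (real CARD('n) / 2))" "0 \<le> \<delta> powr (-1/2) * (KK * \<delta> powr (- (real CARD('n) / 2)))"
  "0 \<le> (real CARD('n))\<^sup>2 * C * Exx"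
  using KK_pos Exx_nonneg C0 by simp_all

lemma Q_le_EE: "\<bar>Q t z\<bar> \<le> EE"
proof -
  have "Q t z \<le> KK * \<delta> powr (- (real CARD('n) / 2))"
    by (rule order_trans[OF Q_le_KK mult_left_mono[OF hk_delta_le]]) (use KK_pos in simp)
  then show ?thesis unfolding EE_def using EE_parts Exx_nonneg Q_pos[of t z] by linarith
qed

lemma Qx_le_EE: "\<bar>Qx i t z\<bar> \<le> EE"
proof -
  have kk: "0 \<le> KK * hk \<kappa> (T + \<delta> - t) z"
    using KK_pos hk_nonneg[of \<kappa> "T + \<delta> - t" z] by simp
  have "(T + \<delta> - t) powr (-1/2) \<le> \<delta> powr (-1/2)" using t delta by (intro powr_mono2') auto
  then have "\<bar>Qx i t z\<bar> \<le> \<delta> powr (-1/2) * (KK * \<delta> powr (- (real CARD('n) / 2)))"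
    by (intro order_trans[OF Qx_le_KK] mult_mono mult_left_mono hk_delta_le) (use KK_pos kk in auto)
  then show ?thesis unfolding EE_def using EE_parts Exx_nonneg by linarith
qed

lemma Qxx_le_EE: "\<bar>Qxx i j t z\<bar> \<le> EE"
  using Qxx_le_Exx[of i j z] EE_parts unfolding EE_def by linarith

lemma Qt_le_EE: "\<bar>Qt t z\<bar> \<le> EE"
proof -
  have "\<bar>Qt t z\<bar> \<le> (\<Sum>i\<in>(UNIV::'n set). \<Sum>j\<in>(UNIV::'n set). C * Exx)"
    unfolding Qt_eq abs_minus_cancel
  proof (intro order_trans[OF sum_abs] sum_mono)
    show "\<bar>M t $ i $ j * Qxx i j t z\<bar> \<le> C * Exx" for i j
      unfolding abs_mult using t h_eq_1[of t] N_bound[of t i j] C0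
      by (intro mult_mono Qxx_le_Exx) (auto simp: M_def)
  qed
  also have "\<dots> = (real CARD('n))\<^sup>2 * C * Exx" by (simp add: power2_eq_square)
  finally show ?thesis unfolding EE_def using EE_parts Exx_nonneg by linarith
qed

end

lemma EE_nonneg: "0 \<le> EE" using Q_le_EE[of 0 0] T abs_ge_zero order_trans by fastforce

lemma Qt_le_EE': "t \<in> {0..T} \<Longrightarrow> Qt t z \<le> EE" using Qt_le_EE[of t z] by linarith

text \<open>Integrating the bound on Qt from t to T replaces the kernel by its terminal Gaussian at
  a cost proportional to the length of the time window.\<close>

lemma Q_near_T: "t \<in> {0..T} \<Longrightarrow> gauss_density \<delta> z \<le> Q t z + EE * (T - t)"
proof -
  assume t: "t \<in> {0..T}"
  have "Q T z - Q t z \<le> EE * (T - t)"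
  proof (rule DERIV_mono_le)
    show "((\<lambda>t. Q t z) has_real_derivative Qt s z) (at s)" for s by (rule Q_dt)
  qed (use t Qt_le_EE' in auto)
  then show ?thesis by (simp add: Q_T)
qed

end

section \<open>Duhamel inequality for time averages\<close>

lemma fst_measurable_borel [measurable]: "(fst :: real \<times> (real^'n) \<Rightarrow> real) \<in> borel_measurable borel"
  and snd_measurable_borel [measurable]: "(snd :: real \<times> (real^'n) \<Rightarrow> real^'n) \<in> borel_measurable borel"
  by (intro borel_measurable_continuous_onI continuous_intros)+

lemma mol_measurable [measurable]: "mol r \<in> borel_measurable borel"
  by (intro borel_measurable_continuous_onI smooth_continuous smooth_mol)

lemma gauss_density_measurable [measurable]: "(gauss_density \<delta> :: real^'n \<Rightarrow> real) \<in> borel_measurable borel"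
  unfolding gauss_density_def by measurable

lemma hk_shift_measurable [measurable]:
  "(\<lambda>z :: real \<times> (real^'n). hk \<kappa> (c - fst z) (snd z - x0)) \<in> borel_measurable borel"
  unfolding hk_def by measurable

lemma mol_bounded: "0 < r \<Longrightarrow> \<exists>b. \<forall>z. \<bar>mol r z\<bar> \<le> b"
  using bounded_of_compact_support[OF smooth_continuous[OF smooth_mol[of r]] compact_cball[of 0 r]] mol_eq_0[of r]
  by (metis less_imp_le mem_cball_0 not_le)

context parabolic_density begin

lemma R_measurable' [measurable]: "(\<lambda>z. R (fst z) (snd z)) \<in> borel_measurable borel"
  by (rule R_meas)

lemma B_measurable' [measurable]: "(\<lambda>z. B (fst z) (snd z)) \<in> borel_measurable borel"
  by (rule B_meas_vec)

lemma A_time_measurable [measurable]: "(\<lambda>t. A t x0 $ i $ j) \<in> borel_measurable borel"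
  using measurable_compose[OF _ A_meas[of i j], of "\<lambda>t. (t, x0)" borel] by simp

lemma dominated_R_integrable:
  assumes [measurable]: "f \<in> borel_measurable borel" and "\<And>z. \<bar>f z\<bar> \<le> c1 + c2 * norm (B (fst z) (snd z))"
  shows "integrable lborel (\<lambda>z. f z * R (fst z) (snd z))"
proof (rule Bochner_Integration.integrable_bound)
  show "integrable lborel (\<lambda>z. c1 * R (fst z) (snd z) + c2 * (norm (B (fst z) (snd z)) * R (fst z) (snd z)))"
    using R_integrable BR_integrable by simp
  show "AE z in lborel. norm (f z * R (fst z) (snd z))
      \<le> norm (c1 * R (fst z) (snd z) + c2 * (norm (B (fst z) (snd z)) * R (fst z) (snd z)))"
  proof (rule AE_I2)
    fix z
    have "\<bar>f z\<bar> * R (fst z) (snd z) \<le> (c1 + c2 * norm (B (fst z) (snd z))) * R (fst z) (snd z)"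
      by (intro mult_right_mono assms R_nonneg)
    then show "norm (f z * R (fst z) (snd z))
      \<le> norm (c1 * R (fst z) (snd z) + c2 * (norm (B (fst z) (snd z)) * R (fst z) (snd z)))"
      using R_nonneg[of "fst z" "snd z"] by (simp add: abs_mult algebra_simps)
  qed
qed measurable

lemma R_integral_indicator: "(\<integral>x. R t x \<partial>lborel) = indicator {0<..<1} t"
  using R_integral_eq_1[of t] R_eq_0[of t] by (cases "t \<in> {0<..<1}") auto

lemma integral_time_R:
  assumes [measurable]: "f \<in> borel_measurable borel" and "\<And>t. \<bar>f t\<bar> \<le> c"
  shows "(\<integral>z. f (fst z) * R (fst z) (snd z) \<partial>lborel) = (\<integral>t. indicator {0<..<1} t * f t \<partial>lborel)"
proof -
  have "integrable lborel (\<lambda>z. f (fst z) * R (fst z) (snd z))"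
    by (rule bounded_R_integrable[where c=c]) (use assms in auto)
  from iterated_integral[OF this] show ?thesis by (simp add: R_integral_indicator mult.commute)
qed

text \<open>Common majorant of the two error terms, up to the density: the 1 in
  \<open>1 + norm B\<close> stands for the variation of A in x, the norm for the drift. With
  \<delta> = 0 it is the singular kernel of the final inequality.\<close>

definition drift_part :: "real \<Rightarrow> real \<Rightarrow> real \<Rightarrow> real \<Rightarrow> real^'n \<Rightarrow> real \<times> (real^'n) \<Rightarrow> real" where
  "drift_part k \<kappa> \<delta> T x0 z = indicator {0<..T} (fst z) * (k * ((T + \<delta> - fst z) powr (-1/2) *
     (hk \<kappa> (T + \<delta> - fst z) (snd z - x0) * (1 + norm (B (fst z) (snd z))))))"

lemma drift_part_measurable [measurable]: "drift_part k \<kappa> \<delta> T x0 \<in> borel_measurable borel"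
  unfolding drift_part_def by measurable

lemma drift_part_bound:
  assumes "0 \<le> k" "0 < \<kappa>" "0 < \<delta>"
  shows "\<exists>c. \<forall>z. \<bar>drift_part k \<kappa> \<delta> T x0 z\<bar> \<le> c + c * norm (B (fst z) (snd z))"
proof (intro exI allI)
  fix z
  let ?c = "k * (\<delta> powr (-1/2) * \<delta> powr (- (real CARD('n) / 2)))"
  show "\<bar>drift_part k \<kappa> \<delta> T x0 z\<bar> \<le> ?c + ?c * norm (B (fst z) (snd z))"
  proof (cases "fst z \<in> {0<..T}")
    case True
    then have d: "\<delta> \<le> T + \<delta> - fst z" by simp
    have "hk \<kappa> (T + \<delta> - fst z) (snd z - x0) \<le> (T + \<delta> - fst z) powr (- (real CARD('n) / 2))"
      using assms d by (intro hk_le) auto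
    also have "\<dots> \<le> \<delta> powr (- (real CARD('n) / 2))" using assms d by (intro powr_mono2') auto
    finally have h: "hk \<kappa> (T + \<delta> - fst z) (snd z - x0) \<le> \<delta> powr (- (real CARD('n) / 2))" .
    have p: "(T + \<delta> - fst z) powr (-1/2) \<le> \<delta> powr (-1/2)" using assms d by (intro powr_mono2') auto
    have "drift_part k \<kappa> \<delta> T x0 z \<le> k * (\<delta> powr (-1/2) * (\<delta> powr (- (real CARD('n) / 2)) * (1 + norm (B (fst z) (snd z)))))"
      unfolding drift_part_def using True assms h p
      by (auto intro!: mult_left_mono mult_mono mult_nonneg_nonneg hk_nonneg)
    moreover have "0 \<le> drift_part k \<kappa> \<delta> T x0 z"
      unfolding drift_part_def using assms by (intro mult_nonneg_nonneg hk_nonneg) auto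
    ultimately show ?thesis by (simp add: algebra_simps)
  qed (use assms in \<open>simp add: drift_part_def\<close>)
qed

lemma frozenI:
  assumes "continuous_on UNIV N" "\<And>t. transpose (N t) = N t" "\<And>t i j. \<bar>N t $ i $ j\<bar> \<le> C"
    "\<And>t \<xi>. \<alpha> * (\<xi> \<bullet> \<xi>) \<le> \<xi> \<bullet> (N t *v \<xi>)" "0 < T" "T < 1" "0 < \<delta>" "\<delta> \<le> 1"
  shows "frozen N C \<alpha> T \<delta>"
  by standard (use assms alpha_pos in auto)

text \<open>The weak equation is tested with \<open>\<theta>(t) Q(t, x - x\<^sub>0)\<close>, where \<open>\<theta>\<close> rises from 0 to 1 on \<open>[\<epsilon>', 2\<epsilon>']\<close> and falls
  back to 0 on \<open>[T - \<epsilon>, T]\<close>. The two mollifiers below are the rising and falling parts of \<open>\<theta>'\<close>.\<close>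

lemma duhamel_frozen:
  fixes x0 :: "real^'n"
  assumes N: "continuous_on UNIV N" "\<And>t. transpose (N t) = N t" "\<And>t i j. \<bar>N t $ i $ j\<bar> \<le> C"
    "\<And>t \<xi>. \<alpha> * (\<xi> \<bullet> \<xi>) \<le> \<xi> \<bullet> (N t *v \<xi>)"
    and e: "(\<integral>t. indicator {0<..<1} t * (\<Sum>i\<in>UNIV. \<Sum>j\<in>UNIV. \<bar>A t x0 $ i $ j - N t $ i $ j\<bar>) \<partial>lborel) \<le> e"
    and T: "0 < T" "T < 1" and \<delta>: "0 < \<delta>" "\<delta> \<le> 1"
    and eps: "0 < \<epsilon>" "0 < \<epsilon>'" "2 * \<epsilon>' \<le> T - \<epsilon>"
  defines "KC \<equiv> frozen.KK TYPE('n) C \<alpha>" and "kC \<equiv> frozen.\<kappa> TYPE('n) C \<alpha>" and "EC \<equiv> frozen.EE TYPE('n) C \<alpha> \<delta>"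
  defines "Kd \<equiv> KC * ((real CARD('n))\<^sup>2 * lam + real CARD('n))"
  shows "(\<integral>z. mol (\<epsilon> / 2) (fst z - T + \<epsilon> / 2) * gauss_density \<delta> (snd z - x0) * R (fst z) (snd z) \<partial>lborel)
    \<le> EC * \<epsilon> + KC * (\<integral>z. mol (\<epsilon>' / 2) (fst z - 3 * \<epsilon>' / 2) * hk kC (T + \<delta> - fst z) (snd z - x0) * R (fst z) (snd z) \<partial>lborel)
      + (\<integral>z. drift_part Kd kC \<delta> T x0 z * R (fst z) (snd z) \<partial>lborel) + EC * e"
proof -
  interpret fz: frozen N C \<alpha> T \<delta> by (rule frozenI[OF N T \<delta>])
  have KC: "0 < KC" using fz.KK_pos by (simp add: KC_def)
  have EC: "0 \<le> EC" using fz.EE_nonneg by (simp add: EC_def)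
  have kC: "0 < kC" using fz.kappa_pos by (simp add: kC_def)
  have Kd: "0 \<le> Kd" using KC lam_nonneg by (simp add: Kd_def)
  define k1 where "k1 t = mol (\<epsilon>' / 2) (t - 3 * \<epsilon>' / 2)" for t :: real
  define k2 where "k2 t = mol (\<epsilon> / 2) (t - T + \<epsilon> / 2)" for t :: real
  have k1_0: "k1 t = 0" if "t \<notin> {\<epsilon>'..2 * \<epsilon>'}" for t
    unfolding k1_def using that eps by (intro mol_eq_0) (auto simp: abs_if field_simps)
  have k2_0: "k2 t = 0" if "t \<notin> {T - \<epsilon>..T}" for t
    unfolding k2_def using that eps by (intro mol_eq_0) (auto simp: abs_if field_simps)
  have k_nn: "0 \<le> k1 t" "0 \<le> k2 t" for t unfolding k1_def k2_def using eps by (auto intro!: mol_nonneg)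
  have k_meas [measurable]: "k1 \<in> borel_measurable borel" "k2 \<in> borel_measurable borel"
    unfolding k1_def k2_def by measurable
  have kc: "continuous_on UNIV k1" "continuous_on UNIV k2"
    unfolding k1_def k2_def
    by (intro continuous_on_compose2[OF smooth_continuous[OF smooth_mol]] continuous_intros; simp)+
  obtain b1 where b1: "\<And>t. \<bar>k1 t\<bar> \<le> b1"
    using mol_bounded[of "\<epsilon>' / 2", where 'a=real] eps unfolding k1_def by auto
  obtain b2 where b2: "\<And>t. \<bar>k2 t\<bar> \<le> b2"
    using mol_bounded[of "\<epsilon> / 2", where 'a=real] eps unfolding k2_def by auto
  have b_nn: "0 \<le> b1" "0 \<le> b2" using b1[of 0] b2[of 0] by linarith+
  obtain \<Phi>1 where P1: "\<And>t. (\<Phi>1 has_real_derivative mol (\<epsilon>' / 2) t) (at t)" "\<And>t. t \<le> - (\<epsilon>' / 2) \<Longrightarrow> \<Phi>1 t = 0"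
    "\<And>t. \<epsilon>' / 2 \<le> t \<Longrightarrow> \<Phi>1 t = 1" "\<And>t. 0 \<le> \<Phi>1 t" "\<And>t. \<Phi>1 t \<le> 1"
    using mol_antiderivative[of "\<epsilon>' / 2"] eps by auto
  obtain \<Phi>2 where P2: "\<And>t. (\<Phi>2 has_real_derivative mol (\<epsilon> / 2) t) (at t)" "\<And>t. t \<le> - (\<epsilon> / 2) \<Longrightarrow> \<Phi>2 t = 0"
    "\<And>t. \<epsilon> / 2 \<le> t \<Longrightarrow> \<Phi>2 t = 1" "\<And>t. 0 \<le> \<Phi>2 t" "\<And>t. \<Phi>2 t \<le> 1"
    using mol_antiderivative[of "\<epsilon> / 2"] eps by auto
  define \<theta> where "\<theta> t = \<Phi>1 (t - 3 * \<epsilon>' / 2) - \<Phi>2 (t - T + \<epsilon> / 2)" for t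
  have th_deriv: "(\<theta> has_real_derivative k1 t - k2 t) (at t)" for t
  proof -
    have "((\<lambda>t. \<Phi>1 (t - 3 * \<epsilon>' / 2)) has_real_derivative k1 t * 1) (at t)"
      unfolding k1_def by (rule DERIV_chain2[OF P1(1)]) (auto intro!: derivative_eq_intros)
    moreover have "((\<lambda>t. \<Phi>2 (t - T + \<epsilon> / 2)) has_real_derivative k2 t * 1) (at t)"
      unfolding k2_def by (rule DERIV_chain2[OF P2(1)]) (auto intro!: derivative_eq_intros)
    ultimately show ?thesis unfolding \<theta>_def using DERIV_diff by fastforce
  qed
  have th_0: "\<theta> t = 0" if "t \<notin> {\<epsilon>'..T}" for t
  proof (cases "t < \<epsilon>'")
    case True
    then have "\<Phi>1 (t - 3 * \<epsilon>' / 2) = 0" "\<Phi>2 (t - T + \<epsilon> / 2) = 0"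
      using eps by (auto intro!: P1(2) P2(2) simp: field_simps)
    then show ?thesis by (simp add: \<theta>_def)
  next
    case False
    then have "\<Phi>1 (t - 3 * \<epsilon>' / 2) = 1" "\<Phi>2 (t - T + \<epsilon> / 2) = 1"
      using eps that by (auto intro!: P1(3) P2(3) simp: field_simps)
    then show ?thesis by (simp add: \<theta>_def)
  qed
  have th_bounds: "0 \<le> \<theta> t" "\<theta> t \<le> 1" for t
  proof -
    show "\<theta> t \<le> 1" unfolding \<theta>_def using P1(5)[of "t - 3 * \<epsilon>' / 2"] P2(4)[of "t - T + \<epsilon> / 2"] by linarith
    show "0 \<le> \<theta> t"
    proof (cases "t \<le> T - \<epsilon>")
      case True
      then have "\<Phi>2 (t - T + \<epsilon> / 2) = 0" by (auto intro!: P2(2))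
      then show ?thesis unfolding \<theta>_def using P1(4) by simp
    next
      case False
      then have "\<Phi>1 (t - 3 * \<epsilon>' / 2) = 1" using eps by (auto intro!: P1(3) simp: field_simps)
      then show ?thesis unfolding \<theta>_def using P2(5) by simp
    qed
  qed
  have th_cont: "continuous_on UNIV \<theta>"
    using th_deriv DERIV_isCont continuous_at_imp_continuous_on by blast
  have th_meas [measurable]: "\<theta> \<in> borel_measurable borel" by (rule borel_measurable_continuous_onI[OF th_cont])
  define u where "u z = fz.Q (fst z) (snd z - x0)" for z
  define ut where "ut z = fz.Qt (fst z) (snd z - x0)" for z
  define ux where "ux i z = fz.Qx i (fst z) (snd z - x0)" for i z
  define uxx where "uxx i j z = fz.Qxx i j (fst z) (snd z - x0)" for i j z
  have shift: "continuous_on UNIV (\<lambda>z. f (fst z) (snd z - x0))"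
    if "continuous_on UNIV (\<lambda>z. f (fst z) (snd z))" for f :: "real \<Rightarrow> real^'n \<Rightarrow> real"
  proof -
    have "continuous_on UNIV (\<lambda>z :: real \<times> (real^'n). (fst z, snd z - x0))"
      by (intro continuous_on_Pair continuous_intros)
    from continuous_on_compose2[OF that this] show ?thesis by simp
  qed
  have cont: "continuous_on UNIV u" "continuous_on UNIV ut" "continuous_on UNIV (ux i)" "continuous_on UNIV (uxx i j)" for i j
    unfolding u_def[abs_def] ut_def[abs_def] ux_def[abs_def] uxx_def[abs_def]
    by (rule shift, rule fz.Q_cont fz.Qt_cont fz.Qx_cont fz.Qxx_cont)+
  have meas [measurable]: "u \<in> borel_measurable borel" "ut \<in> borel_measurable borel" "ux i \<in> borel_measurable borel"
    "uxx i j \<in> borel_measurable borel" for i j by (intro borel_measurable_continuous_onI cont)+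
  have bd: "\<bar>u z\<bar> \<le> EC" "\<bar>ut z\<bar> \<le> EC" "\<bar>ux i z\<bar> \<le> EC" "\<bar>uxx i j z\<bar> \<le> EC" if "fst z \<in> {0..T}" for z i j
    unfolding u_def ut_def ux_def uxx_def EC_def
    using fz.Q_le_EE[OF that] fz.Qt_le_EE[OF that] fz.Qx_le_EE[OF that] fz.Qxx_le_EE[OF that] by auto
  have sub: "fst z \<in> {0..T}" if "fst z \<in> {\<epsilon>'..T}" for z :: "real \<times> (real^'n)" using that eps by simp
  let ?gen = "generator ut ux uxx"
  have weak0: "(\<integral>z. ((k1 (fst z) - k2 (fst z)) * u z + \<theta> (fst z) * ?gen z) * R (fst z) (snd z) \<partial>lborel) = 0"
  proof (rule weak_time_cutoff[where ?s1.0="\<epsilon>'" and ?s2.0=T and E=EC and \<theta>=\<theta> and \<kappa>="\<lambda>t. k1 t - k2 t"])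
    show "k1 t - k2 t = 0" if "t \<notin> {\<epsilon>'..T}" for t using k1_0[of t] k2_0[of t] that eps by auto
    show "((\<lambda>s. u (z + s *\<^sub>R (1, 0))) has_real_derivative ut z) (at 0)" for z
      using DERIV_shift[of "\<lambda>t. fz.Q t (snd z - x0)" "ut z" 0 "fst z"] fz.Q_dt[of "snd z - x0" "fst z"]
      unfolding u_def ut_def by (simp add: add.commute)
    show "((\<lambda>s. u (z + s *\<^sub>R (0, axis i 1))) has_real_derivative ux i z) (at 0)" for z i
      using fz.Q_dx[of "fst z" "snd z - x0" i] unfolding u_def ux_def by (simp add: algebra_simps)
    show "((\<lambda>s. ux j (z + s *\<^sub>R (0, axis i 1))) has_real_derivative uxx i j z) (at 0)" for z i j
      using fz.Q_dxx[of j "fst z" "snd z - x0" i] unfolding ux_def uxx_def by (simp add: algebra_simps)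
  qed (use eps T th_deriv th_0 cont bd sub kc in \<open>auto intro!: continuous_intros\<close>)
  define ad where "ad t = (\<Sum>i\<in>UNIV. \<Sum>j\<in>UNIV. \<bar>A t x0 $ i $ j - N t $ i $ j\<bar>)" for t
  have N_meas [measurable]: "(\<lambda>t. N t $ i $ j) \<in> borel_measurable borel" for i j
    by (intro borel_measurable_continuous_onI continuous_intros N)
  have ad_meas [measurable]: "ad \<in> borel_measurable borel" unfolding ad_def by measurable
  have ad_nn: "0 \<le> ad t" for t unfolding ad_def by (intro sum_nonneg) auto
  have ad_le: "ad t \<le> (real CARD('n))\<^sup>2 * (2 * C)" for t
  proof -
    have "ad t \<le> (\<Sum>i\<in>(UNIV::'n set). \<Sum>j\<in>(UNIV::'n set). 2 * C)"
      unfolding ad_def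
    proof (intro sum_mono)
      show "\<bar>A t x0 $ i $ j - N t $ i $ j\<bar> \<le> 2 * C" for i j
        using A_bound[of t x0 i j] N(3)[of t i j] by linarith
    qed
    also have "\<dots> = (real CARD('n))\<^sup>2 * (2 * C)" by (simp add: power2_eq_square)
    finally show ?thesis .
  qed
  let ?D = "drift_part Kd kC \<delta> T x0"
  have D_nn: "0 \<le> ?D z" for z
    unfolding drift_part_def using Kd by (intro mult_nonneg_nonneg hk_nonneg) auto
  have gen_le: "\<theta> (fst z) * ?gen z \<le> ?D z + EC * ad (fst z)" if t: "fst z \<in> {0<..<1}" for z
  proof (cases "fst z \<in> {\<epsilon>'..T}")
    case False
    then show ?thesis using th_0[of "fst z"] D_nn[of z] ad_nn[of "fst z"] EC by simp
  next
    case True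
    define s where "s = fst z"
    define y where "y = snd z - x0"
    define H where "H = (T + \<delta> - s) powr (-1/2) * (KC * hk kC (T + \<delta> - s) y)"
    define nb where "nb = norm (B s (snd z))"
    have s: "s \<in> {0..T}" "s \<le> T" using True eps by (auto simp: s_def)
    have H0: "0 \<le> H" unfolding H_def using KC by (intro mult_nonneg_nonneg hk_nonneg) auto
    \<comment> \<open>The heat equation cancels the time derivative and the part with N, since the
      switch-off factor is 1 up to T; only A - N and the drift remain.\<close>
    have "?gen z = (\<Sum>i\<in>UNIV. \<Sum>j\<in>UNIV. (A s (snd z) $ i $ j - N s $ i $ j) * fz.Qxx i j s y) + (\<Sum>i\<in>UNIV. B s (snd z) $ i * fz.Qx i s y)"
      using fz.heat[of s y] fz.h_eq_1[OF s(2)]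
      by (simp add: generator_def ut_def ux_def uxx_def s_def[symmetric] y_def[symmetric] fz.M_def left_diff_distrib sum_subtractf)
    moreover have "\<bar>\<Sum>i\<in>UNIV. \<Sum>j\<in>UNIV. (A s (snd z) $ i $ j - N s $ i $ j) * fz.Qxx i j s y\<bar>
        \<le> (\<Sum>i\<in>(UNIV::'n set). \<Sum>j\<in>(UNIV::'n set). lam * H + EC * \<bar>A s x0 $ i $ j - N s $ i $ j\<bar>)"
    proof (rule order_trans[OF sum_abs], rule sum_mono, rule order_trans[OF sum_abs], rule sum_mono)
      fix i j
      \<comment> \<open>A(x) - N splits at A(x0). The Lipschitz part is paired with |z| D^2 Q and
        keeps a uniform constant; the approximation error is paired with the crude bound
        \<open>EC\<close>.\<close>
      have "\<bar>A s (snd z) $ i $ j - N s $ i $ j\<bar> \<le> lam * norm y + \<bar>A s x0 $ i $ j - N s $ i $ j\<bar>"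
        using A_lipschitz[of s "snd z" i j x0] unfolding y_def by linarith
      then have "\<bar>(A s (snd z) $ i $ j - N s $ i $ j) * fz.Qxx i j s y\<bar>
          \<le> (lam * norm y + \<bar>A s x0 $ i $ j - N s $ i $ j\<bar>) * \<bar>fz.Qxx i j s y\<bar>"
        unfolding abs_mult by (intro mult_right_mono) auto
      also have "\<dots> = lam * (norm y * \<bar>fz.Qxx i j s y\<bar>) + \<bar>A s x0 $ i $ j - N s $ i $ j\<bar> * \<bar>fz.Qxx i j s y\<bar>"
        by (simp add: algebra_simps)
      also have "\<dots> \<le> lam * H + \<bar>A s x0 $ i $ j - N s $ i $ j\<bar> * EC"
        using fz.norm_Qxx_le_KK[OF s(1), of y i j] fz.Qxx_le_EE[OF s(1), of i j y] lam_nonneg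
        unfolding H_def KC_def kC_def EC_def by (intro add_mono mult_left_mono) auto
      finally show "\<bar>(A s (snd z) $ i $ j - N s $ i $ j) * fz.Qxx i j s y\<bar> \<le> lam * H + EC * \<bar>A s x0 $ i $ j - N s $ i $ j\<bar>"
        by (simp add: mult.commute)
    qed
    moreover have "(\<Sum>i\<in>(UNIV::'n set). \<Sum>j\<in>(UNIV::'n set). lam * H + EC * \<bar>A s x0 $ i $ j - N s $ i $ j\<bar>)
        = (real CARD('n))\<^sup>2 * lam * H + EC * ad s"
      by (simp add: sum.distrib sum_distrib_left ad_def power2_eq_square)
    moreover have "\<bar>\<Sum>i\<in>UNIV. B s (snd z) $ i * fz.Qx i s y\<bar> \<le> real CARD('n) * (nb * H)"
    proof -
      have "\<bar>\<Sum>i\<in>UNIV. B s (snd z) $ i * fz.Qx i s y\<bar> \<le> (\<Sum>i\<in>(UNIV::'n set). nb * H)"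
      proof (rule order_trans[OF sum_abs], rule sum_mono)
        show "\<bar>B s (snd z) $ i * fz.Qx i s y\<bar> \<le> nb * H" for i
          using fz.Qx_le_KK[OF s(1), of i y] component_le_norm_cart[of "B s (snd z)" i]
          unfolding abs_mult H_def KC_def kC_def nb_def by (intro mult_mono) auto
      qed
      then show ?thesis by simp
    qed
    ultimately have g: "\<bar>?gen z\<bar> \<le> (real CARD('n))\<^sup>2 * lam * H + real CARD('n) * (nb * H) + EC * ad s"
      by linarith
    have "\<theta> s * ?gen z \<le> \<theta> s * \<bar>?gen z\<bar>"
      using th_bounds(1)[of s] by (intro mult_left_mono) auto
    also have "\<dots> \<le> 1 * \<bar>?gen z\<bar>" using th_bounds[of s] by (intro mult_right_mono) auto
    also have "\<dots> \<le> (real CARD('n))\<^sup>2 * lam * H + real CARD('n) * (nb * H) + EC * ad s" using g by simp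
    also have "(real CARD('n))\<^sup>2 * lam * H + real CARD('n) * (nb * H)
        \<le> ((real CARD('n))\<^sup>2 * lam + real CARD('n)) * (H * (1 + nb))"
    proof -
      have "(real CARD('n))\<^sup>2 * lam * H \<le> (real CARD('n))\<^sup>2 * lam * (H * (1 + nb))"
        using lam_nonneg H0 by (intro mult_left_mono) (auto simp: nb_def mult_le_cancel_left1)
      moreover have "real CARD('n) * (nb * H) \<le> real CARD('n) * (H * (1 + nb))"
        using H0 by (intro mult_left_mono) (auto simp: algebra_simps)
      ultimately show ?thesis unfolding distrib_right by (rule add_mono)
    qed
    also have "((real CARD('n))\<^sup>2 * lam + real CARD('n)) * (H * (1 + nb)) = ?D z"
      using True eps unfolding drift_part_def H_def Kd_def nb_def y_def s_def by (simp add: mult_ac)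
    finally show ?thesis by (simp add: s_def)
  qed
  have u_low: "k2 (fst z) * gauss_density \<delta> (snd z - x0) \<le> k2 (fst z) * (u z + EC * \<epsilon>)" for z
  proof (cases "fst z \<in> {T - \<epsilon>..T}")
    case True
    then have t: "fst z \<in> {0..T}" using eps by auto
    have "gauss_density \<delta> (snd z - x0) \<le> u z + EC * (T - fst z)"
      using fz.Q_near_T[OF t] unfolding u_def EC_def .
    also have "\<dots> \<le> u z + EC * \<epsilon>" using True EC by (intro add_left_mono mult_left_mono) auto
    finally show ?thesis using k_nn by (intro mult_left_mono)
  qed (simp add: k2_0)
  have u_up: "k1 (fst z) * u z \<le> k1 (fst z) * (KC * hk kC (T + \<delta> - fst z) (snd z - x0))" for z
  proof (cases "fst z \<in> {\<epsilon>'..2 * \<epsilon>'}")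
    case True
    then have t: "fst z \<in> {0..T}" using eps by auto
    show ?thesis using fz.Q_le_KK[OF t, of "snd z - x0"] k_nn unfolding u_def KC_def kC_def by (intro mult_left_mono)
  qed (simp add: k1_0)
  let ?r = "\<lambda>z. R (fst z) (snd z)"
  let ?w = "\<lambda>z. (k1 (fst z) - k2 (fst z)) * u z + \<theta> (fst z) * ?gen z"
  let ?f1 = "\<lambda>z. k1 (fst z) * hk kC (T + \<delta> - fst z) (snd z - x0)"
  have i1: "integrable lborel (\<lambda>z. ?w z * ?r z)"
  proof (rule dominated_R_integrable)
    show "?w \<in> borel_measurable borel" using generator_measurable[of ut ux uxx] by measurable
    fix z
    show "\<bar>?w z\<bar> \<le> ((b1 + b2) * EC + (EC + real CARD('n)^2 * C * EC)) + (real CARD('n) * EC) * norm (B (fst z) (snd z))"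
    proof (cases "fst z \<in> {\<epsilon>'..T}")
      case True
      note t = sub[OF True]
      have "\<bar>(k1 (fst z) - k2 (fst z)) * u z\<bar> \<le> (b1 + b2) * EC"
        unfolding abs_mult using b1[of "fst z"] b2[of "fst z"] bd(1)[OF t] b_nn by (intro mult_mono) auto
      moreover have "\<bar>\<theta> (fst z) * ?gen z\<bar> \<le> 1 * (EC + real CARD('n)^2 * C * EC + real CARD('n) * EC * norm (B (fst z) (snd z)))"
        unfolding abs_mult using th_bounds[of "fst z"] bd[OF t] EC
        by (intro mult_mono generator_bound) auto
      ultimately have "\<bar>?w z\<bar> \<le> (b1 + b2) * EC + 1 * (EC + real CARD('n)^2 * C * EC + real CARD('n) * EC * norm (B (fst z) (snd z)))"
        by (rule order_trans[OF abs_triangle_ineq add_mono])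
      then show ?thesis by (simp only: mult_1 add.assoc)
    next
      case False
      then have "k1 (fst z) = 0" "k2 (fst z) = 0" "\<theta> (fst z) = 0"
        using k1_0[of "fst z"] k2_0[of "fst z"] th_0 eps by auto
      then show ?thesis using b_nn EC C_nonneg by simp
    qed
  qed
  have i2: "integrable lborel (\<lambda>z. ?f1 z * ?r z)"
  proof (rule bounded_R_integrable)
    show "?f1 \<in> borel_measurable borel" by measurable
    show "\<bar>?f1 z\<bar> \<le> b1 * \<delta> powr (- (real CARD('n) / 2))" for z
    proof (cases "fst z \<in> {\<epsilon>'..2 * \<epsilon>'}")
      case True
      then have t: "fst z \<in> {0..T}" using eps by auto
      show ?thesis unfolding abs_mult
        using b1[of "fst z"] fz.hk_delta_le[OF t, of "snd z - x0"] hk_nonneg[of kC "T + \<delta> - fst z" "snd z - x0"] b_nn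
        unfolding kC_def by (intro mult_mono) auto
    qed (use b_nn in \<open>simp add: k1_0\<close>)
  qed
  have i3: "integrable lborel (\<lambda>z. k2 (fst z) * ?r z)"
    by (rule bounded_R_integrable[where c=b2]) (use b2 in auto)
  obtain cD where "\<forall>z. \<bar>?D z\<bar> \<le> cD + cD * norm (B (fst z) (snd z))"
    using drift_part_bound[OF Kd kC \<delta>(1)] by blast
  then have i4: "integrable lborel (\<lambda>z. ?D z * ?r z)"
    by (intro dominated_R_integrable[where ?c1.0=cD and ?c2.0=cD]) auto
  have i5: "integrable lborel (\<lambda>z. ad (fst z) * ?r z)"
    by (rule bounded_R_integrable) (use ad_le ad_nn in \<open>auto simp: abs_of_nonneg\<close>)
  have gm: "gauss_density \<delta> y \<le> EC * 2 + EC" for y :: "real^'n"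
  proof -
    have "gauss_density \<delta> y \<le> fz.Q T y + EC * (T - T)" using fz.Q_near_T[of T y] T unfolding EC_def by simp
    then show ?thesis using fz.Q_le_EE[of T y] T EC unfolding EC_def[symmetric] by simp
  qed
  \<comment> \<open>The term \<open>?w\<close> integrates to 0 against R by the weak equation.
    Subtracting it turns the claim into a pointwise inequality of integrands.\<close>
  have "(\<integral>z. mol (\<epsilon> / 2) (fst z - T + \<epsilon> / 2) * gauss_density \<delta> (snd z - x0) * ?r z \<partial>lborel)
     \<le> (\<integral>z. - (?w z * ?r z) + KC * (?f1 z * ?r z) + EC * \<epsilon> * (k2 (fst z) * ?r z) + ?D z * ?r z + EC * (ad (fst z) * ?r z) \<partial>lborel)"
    unfolding k2_def[symmetric]
  proof (rule Bochner_Integration.integral_mono)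
    show "integrable lborel (\<lambda>z. k2 (fst z) * gauss_density \<delta> (snd z - x0) * ?r z)"
    proof (rule bounded_R_integrable)
      show "\<bar>k2 (fst z) * gauss_density \<delta> (snd z - x0)\<bar> \<le> b2 * (EC * 2 + EC)" for z
        unfolding abs_mult using b2[of "fst z"] gm[of "snd z - x0"] b_nn gauss_total_pos[where 'a="real^'n"]
        by (intro mult_mono) (auto simp: gauss_density_def)
    qed measurable
    show "integrable lborel (\<lambda>z. - (?w z * ?r z) + KC * (?f1 z * ?r z) + EC * \<epsilon> * (k2 (fst z) * ?r z) + ?D z * ?r z + EC * (ad (fst z) * ?r z))"
      by (intro Bochner_Integration.integrable_add integrable_minus integrable_mult_right i1 i2 i3 i4 i5)
    fix z
    show "k2 (fst z) * gauss_density \<delta> (snd z - x0) * ?r z \<le>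
      - (?w z * ?r z) + KC * (?f1 z * ?r z) + EC * \<epsilon> * (k2 (fst z) * ?r z) + ?D z * ?r z + EC * (ad (fst z) * ?r z)"
    proof (cases "fst z \<in> {0<..<1}")
      case True
      have "k2 (fst z) * gauss_density \<delta> (snd z - x0) \<le> - ?w z + KC * ?f1 z + EC * \<epsilon> * k2 (fst z) + ?D z + EC * ad (fst z)"
        using u_low[of z] u_up[of z] gen_le[OF True] by (simp add: algebra_simps)
      note le = mult_right_mono[OF this R_nonneg[of "fst z" "snd z"]]
      have aux: "(- w + c * f + e * k + D + E * a) * r = - (w * r) + c * (f * r) + e * (k * r) + D * r + E * (a * r)"
        for w c f e k D E a r :: real by (simp add: algebra_simps)
      show ?thesis using le unfolding aux .
    qed (simp add: R_eq_0)
  qed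
  also have "\<dots> = - (\<integral>z. ?w z * ?r z \<partial>lborel) + KC * (\<integral>z. ?f1 z * ?r z \<partial>lborel)
      + EC * \<epsilon> * (\<integral>z. k2 (fst z) * ?r z \<partial>lborel) + (\<integral>z. ?D z * ?r z \<partial>lborel) + EC * (\<integral>z. ad (fst z) * ?r z \<partial>lborel)"
    using i1 i2 i3 i4 i5 by simp
  also have "(\<integral>z. ?w z * ?r z \<partial>lborel) = 0" by (rule weak0)
  also have "(\<integral>z. ad (fst z) * ?r z \<partial>lborel) = (\<integral>t. indicator {0<..<1} t * ad t \<partial>lborel)"
    by (rule integral_time_R[OF ad_meas]) (use ad_le ad_nn in \<open>auto simp: abs_of_nonneg\<close>)
  \<comment> \<open>The falling part of the time cutoff has integral 1, and each slice of R has mass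
    at most 1.\<close>
  also have "EC * \<epsilon> * (\<integral>z. k2 (fst z) * ?r z \<partial>lborel) \<le> EC * \<epsilon> * 1"
  proof (intro mult_left_mono)
    have i: "integrable lborel k2" "(\<integral>t. k2 t \<partial>lborel) = 1"
    proof -
      have eq: "k2 = (\<lambda>t. mol (\<epsilon> / 2) ((\<epsilon> / 2 - T) + t))" by (auto simp: k2_def fun_eq_iff algebra_simps)
      show "integrable lborel k2" unfolding eq using eps by (intro integrable_lborel_translate integrable_mol) simp
      show "(\<integral>t. k2 t \<partial>lborel) = 1" unfolding eq using eps by (subst integral_lborel_translate) (auto simp: integral_mol)
    qed
    have "(\<integral>z. k2 (fst z) * ?r z \<partial>lborel) = (\<integral>t. indicator {0<..<1} t * k2 t \<partial>lborel)"
      by (rule integral_time_R[OF k_meas(2) b2])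
    also have "\<dots> \<le> (\<integral>t. k2 t \<partial>lborel)"
      using i(1) k_nn(2) by (intro integral_mono') (auto simp: indicator_def)
    finally show "(\<integral>z. k2 (fst z) * ?r z \<partial>lborel) \<le> 1" using i by simp
  qed (use EC eps in simp)
  also have "EC * (\<integral>t. indicator {0<..<1} t * ad t \<partial>lborel) \<le> EC * e"
    using e EC unfolding ad_def by (intro mult_left_mono)
  finally show ?thesis unfolding k1_def by simp
qed

end

context parabolic_density begin

text \<open>With \<delta> and \<epsilon> fixed, the freezing error and the initial time window are
  sent to 0, and the initial condition produces the term with r0.\<close>

lemma duhamel_average:
  fixes x0 :: "real^'n"
  assumes T: "0 < T" "T < 1" and \<delta>: "0 < \<delta>" "\<delta> \<le> 1" and eps: "0 < \<epsilon>" "\<epsilon> < T"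
  defines "KC \<equiv> frozen.KK TYPE('n) C \<alpha>" and "kC \<equiv> frozen.\<kappa> TYPE('n) C \<alpha>" and "EC \<equiv> frozen.EE TYPE('n) C \<alpha> \<delta>"
  defines "Kd \<equiv> KC * ((real CARD('n))\<^sup>2 * lam + real CARD('n))"
  assumes pos: "0 < KC" "0 < kC" "0 \<le> EC"
  shows "(\<integral>z. mol (\<epsilon> / 2) (fst z - T + \<epsilon> / 2) * gauss_density \<delta> (snd z - x0) * R (fst z) (snd z) \<partial>lborel)
    \<le> EC * \<epsilon> + KC * (\<integral>y. hk kC (T + \<delta>) (y - x0) * r0 y \<partial>lborel)
      + (\<integral>z. drift_part Kd kC \<delta> T x0 z * R (fst z) (snd z) \<partial>lborel)" (is "?L \<le> EC * \<epsilon> + KC * ?I + ?J")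
proof (rule field_le_epsilon)
  fix \<eta> :: real assume \<eta>: "0 < \<eta>"
  \<comment> \<open>The errors add up to \<open>(2 * KC + EC) * e\<close>: twice \<open>KC\<close>
    from the initial term, \<open>EC\<close> from freezing. The summand 1 in the denominator gives
    some slack.\<close>
  define e where "e = \<eta> / (2 * KC + EC + 1)"
  have d: "0 < 2 * KC + EC + 1" using pos by linarith
  have e1: "0 < e" unfolding e_def using \<eta> d by (rule divide_pos_pos)
  have "(2 * KC + EC) * e \<le> (2 * KC + EC + 1) * e" using e1 by (intro mult_right_mono) auto
  also have "\<dots> = \<eta>" unfolding e_def using d by simp
  finally have e2: "(2 * KC + EC) * e \<le> \<eta>" .
  note e = e1 e2
  obtain N where N: "continuous_on UNIV N" "\<And>t. transpose (N t) = N t" "\<And>t i j. \<bar>N t $ i $ j\<bar> \<le> C"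
    "\<And>t \<xi>. \<alpha> * (\<xi> \<bullet> \<xi>) \<le> \<xi> \<bullet> (N t *v \<xi>)"
    "(\<integral>t. indicator {0<..<1} t * (\<Sum>i\<in>UNIV. \<Sum>j\<in>UNIV. \<bar>A t x0 $ i $ j - N t $ i $ j\<bar>) \<partial>lborel) \<le> e"
    by (rule freeze_continuous[OF e(1), of x0]) (rule that)
  let ?\<psi> = "\<lambda>y. hk kC (T + \<delta>) (y - x0)"
  have Td: "0 < T + \<delta>" using T \<delta> by simp
  have \<psi>c: "continuous_on UNIV ?\<psi>"
    by (rule continuous_on_compose2[OF hk_cont[OF Td]]) (auto intro!: continuous_intros)
  have \<psi>m [measurable]: "?\<psi> \<in> borel_measurable borel" by (rule borel_measurable_continuous_onI[OF \<psi>c])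
  have \<psi>b: "\<bar>?\<psi> y\<bar> \<le> (T + \<delta>) powr (- (real CARD('n) / 2))" for y
    using hk_le[OF pos(2) Td, of "y - x0"] hk_nonneg[of kC "T + \<delta>" "y - x0"] by simp
  have I0: "0 \<le> ?I" by (intro integral_nonneg_AE AE_I2 mult_nonneg_nonneg hk_nonneg r0_nonneg)
  have "\<forall>\<^sub>F t in at_right 0. (\<integral>x. ?\<psi> x * R t x \<partial>lborel) \<le> ?I + e"
    by (rule init_vanishing[OF \<psi>c hk_vanishes[OF pos(2) Td] \<psi>b e(1)])
  then obtain b where b: "b > 0" "\<And>t. 0 < t \<Longrightarrow> t < b \<Longrightarrow> (\<integral>x. ?\<psi> x * R t x \<partial>lborel) \<le> ?I + e"
    unfolding eventually_at_right_field by auto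
  \<comment> \<open>The price of replacing T + \<delta> - t by T + \<delta> in the kernel for t
    \<le> 2 s; it tends to 1.\<close>
  define ratio where "ratio s = ((T + \<delta>) / (T + \<delta> - 2 * s)) powr (real CARD('n) / 2)" for s
  have "((\<lambda>s. ratio s * (?I + e)) \<longlongrightarrow> ((T + \<delta>) / (T + \<delta> - 2 * 0)) powr (real CARD('n) / 2) * (?I + e)) (at_right 0)"
    unfolding ratio_def using Td by (intro tendsto_intros) auto
  then have "((\<lambda>s. ratio s * (?I + e)) \<longlongrightarrow> ?I + e) (at_right 0)" using Td by simp
  then have "\<forall>\<^sub>F s in at_right 0. ratio s * (?I + e) < ?I + 2 * e"
    using e by (intro order_tendstoD(2)) auto
  then obtain b' where b': "b' > 0" "\<And>s. 0 < s \<Longrightarrow> s < b' \<Longrightarrow> ratio s * (?I + e) < ?I + 2 * e"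
    unfolding eventually_at_right_field by auto
  \<comment> \<open>The three bounds make the ratio harmless, put [s, 2 s] within reach of the
    initial condition, and end the rise of the time cutoff before its fall begins.\<close>
  define s where "s = Min {b' / 2, b / 4, (T - \<epsilon>) / 2}"
  have s: "0 < s" "s < b'" "2 * s < b" "2 * s \<le> T - \<epsilon>"
    using b b' eps by (auto simp: s_def min_def)
  have R2: "ratio s * (?I + e) \<le> ?I + 2 * e" using b'(2)[OF s(1,2)] by simp
  let ?k1 = "\<lambda>t::real. mol (s / 2) (t - 3 * s / 2)"
  have k1_0: "?k1 t = 0" if "t \<notin> {s..2 * s}" for t
    using that s by (intro mol_eq_0) (auto simp: abs_if field_simps)
  have k1_nn: "0 \<le> ?k1 t" for t using s by (intro mol_nonneg) simp
  obtain b1 where b1: "\<And>t. \<bar>?k1 t\<bar> \<le> b1"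
    using mol_bounded[of "s / 2", where 'a=real] s by auto
  have eq: "?k1 = (\<lambda>t. mol (s / 2) (- (3 * s / 2) + t))" by (auto simp: fun_eq_iff algebra_simps)
  have k1_int: "integrable lborel ?k1"
    unfolding eq using s by (intro integrable_lborel_translate integrable_mol) simp
  have k1_1: "(\<integral>t. ?k1 t \<partial>lborel) = 1"
    unfolding eq using s by (subst integral_lborel_translate) (auto simp: integral_mol)
  have ratio0: "0 \<le> ratio s" by (simp add: ratio_def)
  have bnd: "integrable lborel (\<lambda>z. ?k1 (fst z) * ?\<psi> (snd z) * R (fst z) (snd z))"
  proof (rule bounded_R_integrable)
    show "\<bar>?k1 (fst z) * ?\<psi> (snd z)\<bar> \<le> b1 * (T + \<delta>) powr (- (real CARD('n) / 2))" for z
      unfolding abs_mult using b1[of 0] by (intro mult_mono b1 \<psi>b) auto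
  qed measurable
  have "(\<integral>z. ?k1 (fst z) * hk kC (T + \<delta> - fst z) (snd z - x0) * R (fst z) (snd z) \<partial>lborel)
      \<le> (\<integral>z. ratio s * (?k1 (fst z) * ?\<psi> (snd z) * R (fst z) (snd z)) \<partial>lborel)"
  proof (rule integral_mono')
    show "integrable lborel (\<lambda>z. ratio s * (?k1 (fst z) * ?\<psi> (snd z) * R (fst z) (snd z)))"
      using bnd by simp
    fix z :: "real \<times> (real^'n)"
    show "0 \<le> ratio s * (?k1 (fst z) * ?\<psi> (snd z) * R (fst z) (snd z))"
      by (intro mult_nonneg_nonneg ratio0 k1_nn hk_nonneg R_nonneg)
    show "?k1 (fst z) * hk kC (T + \<delta> - fst z) (snd z - x0) * R (fst z) (snd z)
      \<le> ratio s * (?k1 (fst z) * ?\<psi> (snd z) * R (fst z) (snd z))"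
    proof (cases "fst z \<in> {s..2 * s}")
      case True
      have lt: "0 < T + \<delta> - 2 * s" using s eps \<delta> by simp
      have "hk kC (T + \<delta> - fst z) (snd z - x0)
          \<le> ((T + \<delta>) / (T + \<delta> - fst z)) powr (real CARD('n) / 2) * ?\<psi> (snd z)"
        using True s lt by (intro hk_time_le pos) auto
      also have "\<dots> \<le> ratio s * ?\<psi> (snd z)"
        unfolding ratio_def using True s lt Td
        by (intro mult_right_mono powr_mono2 divide_left_mono hk_nonneg) auto
      finally have "?k1 (fst z) * hk kC (T + \<delta> - fst z) (snd z - x0) * R (fst z) (snd z)
          \<le> ?k1 (fst z) * (ratio s * ?\<psi> (snd z)) * R (fst z) (snd z)"
        by (intro mult_right_mono mult_left_mono k1_nn R_nonneg)
      then show ?thesis by (simp only: mult_ac)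
    qed (simp add: k1_0)
  qed
  also have "\<dots> = ratio s * (\<integral>t. \<integral>x. ?k1 t * ?\<psi> x * R t x \<partial>lborel \<partial>lborel)"
    using iterated_integral[OF bnd] by simp
  also have "(\<integral>t. \<integral>x. ?k1 t * ?\<psi> x * R t x \<partial>lborel \<partial>lborel) \<le> (\<integral>t. ?k1 t * (?I + e) \<partial>lborel)"
  proof (rule integral_mono')
    show "integrable lborel (\<lambda>t. ?k1 t * (?I + e))" by (intro integrable_mult_left k1_int)
    show "0 \<le> ?k1 t * (?I + e)" for t using k1_nn I0 e by (intro mult_nonneg_nonneg) auto
    show "(\<integral>x. ?k1 t * ?\<psi> x * R t x \<partial>lborel) \<le> ?k1 t * (?I + e)" for t
    proof (cases "t \<in> {s..2 * s}")
      case True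
      have "(\<integral>x. ?k1 t * ?\<psi> x * R t x \<partial>lborel) = ?k1 t * (\<integral>x. ?\<psi> x * R t x \<partial>lborel)"
        by (simp add: mult.assoc)
      also have "\<dots> \<le> ?k1 t * (?I + e)" using True s by (intro mult_left_mono b k1_nn) auto
      finally show ?thesis .
    qed (simp add: k1_0)
  qed
  also have "(\<integral>t. ?k1 t * (?I + e) \<partial>lborel) = ?I + e"
    using k1_1 by simp
  finally have k1_le: "(\<integral>z. ?k1 (fst z) * hk kC (T + \<delta> - fst z) (snd z - x0) * R (fst z) (snd z) \<partial>lborel) \<le> ?I + 2 * e"
    using R2 ratio0 by (simp add: mult_left_mono)
  have "?L \<le> EC * \<epsilon> + KC * (\<integral>z. ?k1 (fst z) * hk kC (T + \<delta> - fst z) (snd z - x0) * R (fst z) (snd z) \<partial>lborel) + ?J + EC * e"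
    using duhamel_frozen[OF N T \<delta> eps(1) s(1) s(4)] unfolding KC_def kC_def EC_def Kd_def .
  also have "\<dots> \<le> EC * \<epsilon> + KC * (?I + 2 * e) + ?J + EC * e"
    using pos k1_le by (intro add_mono mult_left_mono) auto
  also have "\<dots> = EC * \<epsilon> + KC * ?I + ?J + (2 * KC + EC) * e" by (simp add: algebra_simps)
  finally show "?L \<le> EC * \<epsilon> + KC * ?I + ?J + \<eta>" using e(2) by linarith
qed

end

section \<open>The pointwise majorant of the density\<close>

text \<open>The inequality is tested with continuous approximations of the indicator of the set E
  where it fails; the cutoffs \<open>k n\<close> make their supports compact. In the limit the
  integral of f over E is at most that of V, which is finite, so E is a null set.\<close>

lemma AE_le_by_duality:
  fixes f :: "'a::euclidean_space \<Rightarrow> real" and V :: "'a \<Rightarrow> ennreal"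
  assumes f: "integrable lborel f" "\<And>z. 0 \<le> f z" and V [measurable]: "V \<in> borel_measurable borel"
    and \<Omega>: "open \<Omega>" and Vfin: "(\<integral>\<^sup>+z. V z * indicator \<Omega> z \<partial>lborel) < \<infinity>"
    and cut: "\<And>n. continuous_on UNIV (k n)" "\<And>n. compact (K n)" "\<And>n. K n \<subseteq> \<Omega>" "\<And>n z. z \<notin> K n \<Longrightarrow> k n z = 0"
      "\<And>n z. 0 \<le> k n z" "\<And>n z. k n z \<le> (1::real)" "\<And>z. z \<in> \<Omega> \<Longrightarrow> (\<lambda>n. k n z) \<longlonglongrightarrow> 1"
    and dual: "\<And>\<psi> K. continuous_on UNIV \<psi> \<Longrightarrow> compact K \<Longrightarrow> K \<subseteq> \<Omega> \<Longrightarrow> (\<And>z. z \<notin> K \<Longrightarrow> \<psi> z = 0) \<Longrightarrow> (\<And>z. 0 \<le> \<psi> z)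
      \<Longrightarrow> (\<integral>\<^sup>+z. ennreal (f z) * ennreal (\<psi> z) \<partial>lborel) \<le> (\<integral>\<^sup>+z. V z * ennreal (\<psi> z) \<partial>lborel)"
  shows "AE z in lborel. z \<in> \<Omega> \<longrightarrow> ennreal (f z) \<le> V z"
proof -
  have fm [measurable]: "f \<in> borel_measurable borel" using f(1) by auto
  have \<Omega>m [measurable]: "\<Omega> \<in> sets borel" using \<Omega> by auto
  define E where "E = {z. z \<in> \<Omega> \<and> V z < ennreal (f z)}"
  have Em [measurable]: "E \<in> sets borel" unfolding E_def by measurable
  have "(indicator E :: 'a \<Rightarrow> real) \<in> borel_measurable lebesgue"
    by (intro borel_measurable_indicator) (use Em in auto)
  then have "(indicator E :: 'a \<Rightarrow> real) measurable_on UNIV"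
    by (subst measurable_on_iff_borel_measurable) auto
  \<comment> \<open>Continuous functions converging almost everywhere to the indicator of E;
    truncation to [0, 1] follows.\<close>
  then obtain Z g where Z: "negligible Z" and g: "\<And>n. continuous_on UNIV (g n)"
    and lim: "\<And>z. z \<notin> Z \<Longrightarrow> (\<lambda>n. g n z) \<longlonglongrightarrow> (indicator E z :: real)"
    unfolding measurable_on_def by auto
  have AEZ: "AE z in lborel. z \<notin> Z"
  proof -
    have "AE z in lebesgue. z \<notin> Z" using Z by (intro AE_not_in) (simp add: negligible_iff_null_sets)
    then show ?thesis by (simp add: AE_completion_iff)
  qed
  define \<psi> where "\<psi> n z = max 0 (min 1 (g n z)) * k n z" for n z
  have \<psi>c: "continuous_on UNIV (\<psi> n)" for n
    unfolding \<psi>_def by (intro continuous_intros g cut)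
  have \<psi>01: "0 \<le> \<psi> n z" "\<psi> n z \<le> 1" for n z
    unfolding \<psi>_def using cut(5,6)[of n z] by (auto intro!: mult_le_one)
  have \<psi>0: "\<psi> n z = 0" if "z \<notin> K n" for n z using cut(4)[OF that] by (simp add: \<psi>_def)
  have [measurable]: "\<psi> n \<in> borel_measurable borel" for n by (rule borel_measurable_continuous_onI[OF \<psi>c])
  have \<psi>lim: "(\<lambda>n. ennreal (\<psi> n z)) \<longlonglongrightarrow> indicator E z" if z: "z \<notin> Z" for z
  proof (cases "z \<in> \<Omega>")
    case True
    have "(\<lambda>n. \<psi> n z) \<longlonglongrightarrow> max 0 (min 1 (indicator E z)) * 1"
      unfolding \<psi>_def by (intro tendsto_intros lim z cut True)
    then have "(\<lambda>n. \<psi> n z) \<longlonglongrightarrow> indicator E z" by (simp add: indicator_def)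
    then have "(\<lambda>n. ennreal (\<psi> n z)) \<longlonglongrightarrow> ennreal (indicator E z)" by (rule tendsto_ennrealI)
    then show ?thesis by (cases "z \<in> E") auto
  next
    case False
    then have "\<psi> n z = 0" for n using cut(3) \<psi>0 by blast
    then show ?thesis using False by (simp add: E_def)
  qed
  have ffin: "(\<integral>\<^sup>+z. ennreal (f z) \<partial>lborel) < \<infinity>"
    using f by (simp add: integrable_iff_bounded)
  have ind_le: "ennreal (\<psi> n z) \<le> indicator \<Omega> z" for n z
  proof (cases "z \<in> \<Omega>")
    case True
    then show ?thesis using ennreal_leI[OF \<psi>01(2)[of n z]] by simp
  next
    case False
    then have "\<psi> n z = 0" using cut(3) \<psi>0 by blast
    then show ?thesis by simp
  qed
  have lf: "(\<lambda>n. \<integral>\<^sup>+z. ennreal (f z) * ennreal (\<psi> n z) \<partial>lborel) \<longlonglongrightarrow> (\<integral>\<^sup>+z. ennreal (f z) * indicator E z \<partial>lborel)"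
  proof (rule nn_integral_dominated_convergence[where w="\<lambda>z. ennreal (f z)"])
    show "AE z in lborel. ennreal (f z) * ennreal (\<psi> n z) \<le> ennreal (f z)" for n
    proof (rule AE_I2)
      fix z
      have "ennreal (f z) * ennreal (\<psi> n z) \<le> ennreal (f z) * 1"
        using ennreal_leI[OF \<psi>01(2)[of n z]] by (intro mult_left_mono) auto
      then show "ennreal (f z) * ennreal (\<psi> n z) \<le> ennreal (f z)" by simp
    qed
    show "AE z in lborel. (\<lambda>n. ennreal (f z) * ennreal (\<psi> n z)) \<longlonglongrightarrow> ennreal (f z) * indicator E z"
      using AEZ by eventually_elim (intro ennreal_tendsto_cmult \<psi>lim, simp_all)
  qed (use ffin in auto)
  have lV: "(\<lambda>n. \<integral>\<^sup>+z. V z * ennreal (\<psi> n z) \<partial>lborel) \<longlonglongrightarrow> (\<integral>\<^sup>+z. V z * indicator E z \<partial>lborel)"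
  proof (rule nn_integral_dominated_convergence[where w="\<lambda>z. V z * indicator \<Omega> z"])
    show "AE z in lborel. V z * ennreal (\<psi> n z) \<le> V z * indicator \<Omega> z" for n
      by (intro AE_I2 mult_left_mono ind_le) auto
    have "AE z in lborel. V z * indicator \<Omega> z \<noteq> \<infinity>"
      by (rule nn_integral_PInf_AE) (use Vfin in auto)
    then show "AE z in lborel. (\<lambda>n. V z * ennreal (\<psi> n z)) \<longlonglongrightarrow> V z * indicator E z"
      using AEZ
    proof eventually_elim
      case (elim z)
      show ?case
      proof (cases "z \<in> \<Omega>")
        case True
        then have "V z < top" using elim(1) by (simp add: less_top)
        then show ?thesis using elim(2) by (intro ennreal_tendsto_cmult \<psi>lim)
      next
        case False
        then have "\<psi> n z = 0" for n using cut(3) \<psi>0 by blast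
        then show ?thesis using False by (simp add: E_def)
      qed
    qed
  qed (use Vfin in auto)
  have le: "(\<integral>\<^sup>+z. ennreal (f z) * indicator E z \<partial>lborel) \<le> (\<integral>\<^sup>+z. V z * indicator E z \<partial>lborel)"
    by (rule LIMSEQ_le[OF lf lV]) (use dual[OF \<psi>c cut(2,3) \<psi>0 \<psi>01(1)] in blast)
  have fin: "(\<integral>\<^sup>+z. V z * indicator E z \<partial>lborel) < \<infinity>"
  proof -
    have "(\<integral>\<^sup>+z. V z * indicator E z \<partial>lborel) \<le> (\<integral>\<^sup>+z. V z * indicator \<Omega> z \<partial>lborel)"
      by (intro nn_integral_mono mult_left_mono) (auto simp: E_def indicator_def)
    then show ?thesis using Vfin by simp
  qed
  \<comment> \<open>The difference is positive on E, yet its integral is 0. Finiteness of the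
    integral of V over E makes the subtraction legitimate.\<close>
  have "(\<integral>\<^sup>+z. ennreal (f z) * indicator E z - V z * indicator E z \<partial>lborel)
      = (\<integral>\<^sup>+z. ennreal (f z) * indicator E z \<partial>lborel) - (\<integral>\<^sup>+z. V z * indicator E z \<partial>lborel)"
    by (rule nn_integral_diff) (use fin in \<open>auto simp: E_def indicator_def intro!: AE_I2\<close>)
  also have "\<dots> = 0" by (rule diff_eq_0_ennreal) (use le le_less_trans[OF le fin] in auto)
  finally have "AE z in lborel. ennreal (f z) * indicator E z - V z * indicator E z = 0"
    by (subst (asm) nn_integral_0_iff_AE) auto
  then show ?thesis
  proof eventually_elim
    case (elim z)
    show ?case
    proof (rule impI, rule ccontr)
      assume "z \<in> \<Omega>" "\<not> ennreal (f z) \<le> V z"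
      then have "z \<in> E" by (simp add: E_def not_le)
      then have "ennreal (f z) - V z = 0" "V z < ennreal (f z)" using elim by (auto simp: E_def)
      then show False by (metis diff_eq_0_iff_ennreal not_less_iff_gr_or_eq order_less_trans leD)
    qed
  qed
qed

lemma nn_integral_powr_from_0:
  assumes "- 1 < a" "0 \<le> c"
  shows "(\<integral>\<^sup>+r. ennreal (indicator {0..c} r * r powr a) \<partial>lborel) = ennreal (c powr (a + 1) / (a + 1))"
proof -
  have eq: "(\<lambda>r. indicator {0..c} r * r powr a) = (\<lambda>r. if r \<in> {0..c} then r powr a else 0)"
    by (auto simp: fun_eq_iff)
  have "((\<lambda>r. indicator {0..c} r * r powr a) has_integral (c powr (a + 1) / (a + 1))) UNIV"
    unfolding eq has_integral_restrict_UNIV by (rule has_integral_powr_from_0[OF assms])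
  then show ?thesis by (intro nn_integral_has_integral_lborel) auto
qed

lemma nn_integral_gauss_density:
  assumes "0 < \<delta>" shows "(\<integral>\<^sup>+z. ennreal (gauss_density \<delta> z) \<partial>(lborel :: (real^'n) measure)) = 1"
proof -
  have g: "0 < gauss_total TYPE(real^'n)" by (rule gauss_total_pos)
  have c: "0 < 1 / (2 * \<delta>)" using assms by simp
  let ?a = "(2 * \<delta>) powr (- (real CARD('n) / 2)) / gauss_total TYPE(real^'n)"
  have "(\<integral>\<^sup>+z. ennreal (gauss_density \<delta> z) \<partial>(lborel :: (real^'n) measure))
    = (\<integral>\<^sup>+z. ennreal ?a * ennreal (exp (- (1 / (2 * \<delta>) * ((z - 0) \<bullet> (z - 0))))) \<partial>(lborel :: (real^'n) measure))"
    using g by (simp add: gauss_density_def ennreal_mult'[symmetric])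
  also have "\<dots> = ennreal ?a * ennreal ((1 / (2 * \<delta>)) powr (- (real CARD('n) / 2)) * gauss_total TYPE(real^'n))"
    using nn_integral_gauss[OF c, of "0::real^'n"] by (simp add: nn_integral_cmult)
  also have "\<dots> = ennreal (?a * ((1 / (2 * \<delta>)) powr (- (real CARD('n) / 2)) * gauss_total TYPE(real^'n)))"
    using g by (simp add: ennreal_mult'[symmetric])
  also have "?a * ((1 / (2 * \<delta>)) powr (- (real CARD('n) / 2)) * gauss_total TYPE(real^'n)) = 1"
    using g assms by (simp add: powr_minus powr_divide)
  finally show ?thesis by simp
qed

definition hk_mass :: "'n::finite itself \<Rightarrow> real \<Rightarrow> real" where
  "hk_mass _ \<kappa> = \<kappa> powr (- (real CARD('n) / 2)) * gauss_total TYPE(real^'n)"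

lemma hk_mass_pos: "0 < \<kappa> \<Longrightarrow> 0 < hk_mass TYPE('n::finite) \<kappa>"
  using gauss_total_pos[where 'a="real^'n"] by (simp add: hk_mass_def)

lemma hk_sym: "hk \<kappa> \<tau> (x - y) = hk \<kappa> \<tau> (y - x)"
proof -
  have "(x - y) \<bullet> (x - y) = (y - x) \<bullet> (y - x)" by (simp add: inner_diff_left inner_diff_right inner_commute)
  then show ?thesis by (simp add: hk_def)
qed

lemma nn_integral_hk:
  fixes y :: "real^'n"
  assumes "0 < \<kappa>" "0 < \<tau>"
  shows "(\<integral>\<^sup>+x. ennreal (hk \<kappa> \<tau> (x - y)) \<partial>lborel) = ennreal (hk_mass TYPE('n) \<kappa>)"
proof -
  have c: "0 < \<kappa> / \<tau>" using assms by simp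
  have "(\<integral>\<^sup>+x. ennreal (hk \<kappa> \<tau> (x - y)) \<partial>lborel)
     = (\<integral>\<^sup>+x. ennreal (\<tau> powr (- (real CARD('n) / 2))) * ennreal (exp (- (\<kappa> / \<tau> * ((x - y) \<bullet> (x - y))))) \<partial>lborel)"
    by (simp add: hk_def ennreal_mult'[symmetric])
  also have "\<dots> = ennreal (\<tau> powr (- (real CARD('n) / 2))) * ennreal ((\<kappa> / \<tau>) powr (- (real CARD('n) / 2)) * gauss_total TYPE(real^'n))"
    using nn_integral_gauss[OF c, of y] by (simp add: nn_integral_cmult)
  also have "\<dots> = ennreal (\<tau> powr (- (real CARD('n) / 2)) * ((\<kappa> / \<tau>) powr (- (real CARD('n) / 2)) * gauss_total TYPE(real^'n)))"
    by (simp add: ennreal_mult'[symmetric])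
  also have "\<tau> powr (- (real CARD('n) / 2)) * ((\<kappa> / \<tau>) powr (- (real CARD('n) / 2)) * gauss_total TYPE(real^'n)) = hk_mass TYPE('n) \<kappa>"
    using assms by (simp add: hk_mass_def powr_minus powr_divide inverse_eq_divide)
  finally show ?thesis .
qed

lemma nn_integral_lborel_translate:
  fixes f :: "'a::euclidean_space \<Rightarrow> ennreal"
  assumes [measurable]: "f \<in> borel_measurable borel"
  shows "(\<integral>\<^sup>+z. f (c + z) \<partial>lborel) = (\<integral>\<^sup>+z. f z \<partial>lborel)"
  using nn_integral_distr[of "(+) c" lborel borel f] by (simp add: lborel_distr_plus)

lemma nn_integral_lborel_reflect:
  fixes f :: "'a::euclidean_space \<Rightarrow> ennreal"
  assumes [measurable]: "f \<in> borel_measurable borel"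
  shows "(\<integral>\<^sup>+z. f (c - z) \<partial>lborel) = (\<integral>\<^sup>+z. f z \<partial>lborel)"
  using nn_integral_distr[of "\<lambda>z. c - z" lborel borel f] by (simp add: lborel_reflect)

lemma nn_integral_mol:
  "0 < r \<Longrightarrow> (\<integral>\<^sup>+z. ennreal (mol r z) \<partial>(lborel :: 'a::euclidean_space measure)) = 1"
  using nn_integral_eq_integral[OF integrable_mol[of r, where 'a='a]] mol_nonneg[of r, where 'a='a] integral_mol[of r, where 'a='a]
  by simp

lemma gauss_density_nonneg: "0 \<le> gauss_density \<delta> z" for z :: "real^'n"
  using gauss_total_pos[where 'a="real^'n"] by (simp add: gauss_density_def less_imp_le)

text \<open>Moves \<delta> from the kernel into the argument of \<open>f\<close>, so that limits in
  \<delta> take place over one fixed Gaussian weight.\<close>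

lemma nn_integral_gauss_density_scale:
  fixes f :: "real^'n \<Rightarrow> ennreal" and y :: "real^'n"
  assumes [measurable]: "f \<in> borel_measurable borel" and d: "0 < \<delta>"
  shows "(\<integral>\<^sup>+x. ennreal (gauss_density \<delta> (y - x)) * f x \<partial>lborel)
       = (\<integral>\<^sup>+v. ennreal (gauss_density 1 v) * f (y + sqrt \<delta> *\<^sub>R v) \<partial>lborel)"
proof -
  let ?r = "sqrt \<delta>"
  have r: "?r > 0" using d by simp
  have "(\<integral>\<^sup>+x. ennreal (gauss_density \<delta> (y - x)) * f x \<partial>lborel)
     = (\<integral>\<^sup>+x. ennreal (gauss_density \<delta> (y - x)) * f x
         \<partial>density (distr lborel borel (\<lambda>x. y + ?r *\<^sub>R x)) (\<lambda>_. \<bar>?r\<bar> ^ DIM(real^'n)))"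
    using lborel_affine[of ?r y] r by simp
  also have "\<dots> = (\<integral>\<^sup>+v. ennreal (\<bar>?r\<bar> ^ DIM(real^'n)) * (ennreal (gauss_density \<delta> (- (?r *\<^sub>R v))) * f (y + ?r *\<^sub>R v)) \<partial>lborel)"
    by (simp add: nn_integral_density nn_integral_distr)
  also have "\<dots> = (\<integral>\<^sup>+v. ennreal (gauss_density 1 v) * f (y + sqrt \<delta> *\<^sub>R v) \<partial>lborel)"
  proof (rule nn_integral_cong)
    fix v :: "real^'n"
    have p: "?r ^ CARD('n) = \<delta> powr (real CARD('n) / 2)"
      using d by (simp add: powr_realpow[symmetric] powr_half_sqrt[symmetric] powr_powr)
    have "\<bar>?r\<bar> ^ DIM(real^'n) * gauss_density \<delta> (- (?r *\<^sub>R v)) = gauss_density 1 v"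
      using d by (simp add: gauss_density_def p powr_mult powr_minus field_simps)
    then show "ennreal (\<bar>?r\<bar> ^ DIM(real^'n)) * (ennreal (gauss_density \<delta> (- (?r *\<^sub>R v))) * f (y + ?r *\<^sub>R v))
        = ennreal (gauss_density 1 v) * f (y + sqrt \<delta> *\<^sub>R v)"
      using gauss_density_nonneg[of \<delta> "- (?r *\<^sub>R v)"] by (simp only: mult.assoc[symmetric]) (simp add: ennreal_mult'[symmetric])
  qed
  finally show ?thesis .
qed

text \<open>The smeared test function \<open>\<psi>\<close> dominates \<open>\<psi>\<close> in the limit; Fatou is applied in the Gaussian variable.\<close>

lemma smeared_liminf:
  fixes \<psi> :: "real \<times> (real^'n) \<Rightarrow> real"
  assumes \<psi>: "continuous_on UNIV \<psi>" "\<And>z. 0 \<le> \<psi> z"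
    and \<delta>: "\<And>n. 0 < \<delta> n" "\<delta> \<longlonglongrightarrow> 0" and \<epsilon>: "\<And>n. 0 < \<epsilon> n" "\<epsilon> \<longlonglongrightarrow> 0"
  shows "ennreal (\<psi> w) \<le> liminf (\<lambda>n. \<integral>\<^sup>+z. ennreal (\<psi> z) *
     ennreal (mol (\<epsilon> n / 2) (fst w - fst z + \<epsilon> n / 2) * gauss_density (\<delta> n) (snd w - snd z)) \<partial>lborel)"
proof -
  have [measurable]: "\<psi> \<in> borel_measurable borel" by (rule borel_measurable_continuous_onI[OF \<psi>(1)])
  have \<psi>m [measurable]: "(\<lambda>z. \<psi> (fst z, snd z)) \<in> borel_measurable borel" by simp
  obtain t y where w: "w = (t, y)" by (cases w)
  have pair [measurable]: "(\<lambda>p. \<psi> (f p, g p)) \<in> borel_measurable M"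
    if "f \<in> borel_measurable M" "g \<in> borel_measurable M" for f :: "'c \<Rightarrow> real" and g :: "'c \<Rightarrow> real^'n" and M
    using measurable_compose[OF borel_measurable_Pair[OF that], of \<psi> borel] by simp
  \<comment> \<open>The average over time alone, at a fixed value \<open>v\<close> of the Gaussian
    variable. It is bounded below near the limit by continuity of \<psi>, though not uniformly in
    \<open>v\<close>; hence Fatou.\<close>
  define \<phi> where "\<phi> n v = (\<integral>\<^sup>+r. ennreal (mol (\<epsilon> n / 2) r) * ennreal (\<psi> (t + \<epsilon> n / 2 - r, y + sqrt (\<delta> n) *\<^sub>R v)) \<partial>lborel)"
    for n and v :: "real^'n"
  have \<phi>m [measurable]: "\<phi> n \<in> borel_measurable borel" for n
    unfolding \<phi>_def by measurable
  have eq: "(\<integral>\<^sup>+z. ennreal (\<psi> z) * ennreal (mol (\<epsilon> n / 2) (fst w - fst z + \<epsilon> n / 2) * gauss_density (\<delta> n) (snd w - snd z)) \<partial>lborel)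
      = (\<integral>\<^sup>+v. ennreal (gauss_density 1 v) * \<phi> n v \<partial>lborel)" for n
  proof -
    have e2: "0 < \<epsilon> n / 2" using \<epsilon>(1)[of n] by simp
    have "(\<integral>\<^sup>+z. ennreal (\<psi> z) * ennreal (mol (\<epsilon> n / 2) (fst w - fst z + \<epsilon> n / 2) * gauss_density (\<delta> n) (snd w - snd z)) \<partial>lborel)
      = (\<integral>\<^sup>+z. ennreal (\<psi> (fst z, snd z)) * ennreal (mol (\<epsilon> n / 2) (t - fst z + \<epsilon> n / 2) * gauss_density (\<delta> n) (y - snd z)) \<partial>lborel)"
      by (simp add: w)
    also have "\<dots> = (\<integral>\<^sup>+T. \<integral>\<^sup>+x. ennreal (\<psi> (T, x)) * ennreal (mol (\<epsilon> n / 2) (t - T + \<epsilon> n / 2) * gauss_density (\<delta> n) (y - x)) \<partial>lborel \<partial>lborel)"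
      by (rule nn_integral_prod_lborel) measurable
    also have "\<dots> = (\<integral>\<^sup>+T. ennreal (mol (\<epsilon> n / 2) (t + \<epsilon> n / 2 - T)) *
        (\<integral>\<^sup>+x. ennreal (gauss_density (\<delta> n) (y - x)) * ennreal (\<psi> (T, x)) \<partial>lborel) \<partial>lborel)"
    proof (rule nn_integral_cong)
      fix T
      have "ennreal (\<psi> (T, x)) * ennreal (mol (\<epsilon> n / 2) (t - T + \<epsilon> n / 2) * gauss_density (\<delta> n) (y - x))
        = ennreal (mol (\<epsilon> n / 2) (t + \<epsilon> n / 2 - T)) * (ennreal (gauss_density (\<delta> n) (y - x)) * ennreal (\<psi> (T, x)))" for x
        using mol_nonneg[OF e2, of "t + \<epsilon> n / 2 - T"] gauss_density_nonneg[of "\<delta> n" "y - x"]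
        by (simp add: ennreal_mult' algebra_simps)
      then show "(\<integral>\<^sup>+x. ennreal (\<psi> (T, x)) * ennreal (mol (\<epsilon> n / 2) (t - T + \<epsilon> n / 2) * gauss_density (\<delta> n) (y - x)) \<partial>lborel)
        = ennreal (mol (\<epsilon> n / 2) (t + \<epsilon> n / 2 - T)) * (\<integral>\<^sup>+x. ennreal (gauss_density (\<delta> n) (y - x)) * ennreal (\<psi> (T, x)) \<partial>lborel)"
        by (simp add: nn_integral_cmult)
    qed
    also have "\<dots> = (\<integral>\<^sup>+T. ennreal (mol (\<epsilon> n / 2) (t + \<epsilon> n / 2 - T)) *
        (\<integral>\<^sup>+v. ennreal (gauss_density 1 v) * ennreal (\<psi> (T, y + sqrt (\<delta> n) *\<^sub>R v)) \<partial>lborel) \<partial>lborel)"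
      using \<delta>(1) by (intro nn_integral_cong arg_cong2[where f="(*)"] nn_integral_gauss_density_scale) auto
    also have "\<dots> = (\<integral>\<^sup>+r. ennreal (mol (\<epsilon> n / 2) r) *
        (\<integral>\<^sup>+v. ennreal (gauss_density 1 v) * ennreal (\<psi> (t + \<epsilon> n / 2 - r, y + sqrt (\<delta> n) *\<^sub>R v)) \<partial>lborel) \<partial>lborel)"
      by (subst nn_integral_lborel_reflect[of _ "t + \<epsilon> n / 2", symmetric]) simp_all
    also have "\<dots> = (\<integral>\<^sup>+r. \<integral>\<^sup>+v. ennreal (mol (\<epsilon> n / 2) r) *
        (ennreal (gauss_density 1 v) * ennreal (\<psi> (t + \<epsilon> n / 2 - r, y + sqrt (\<delta> n) *\<^sub>R v))) \<partial>lborel \<partial>lborel)"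
      by (simp add: nn_integral_cmult)
    also have "\<dots> = (\<integral>\<^sup>+v. \<integral>\<^sup>+r. ennreal (mol (\<epsilon> n / 2) r) *
        (ennreal (gauss_density 1 v) * ennreal (\<psi> (t + \<epsilon> n / 2 - r, y + sqrt (\<delta> n) *\<^sub>R v))) \<partial>lborel \<partial>lborel)"
      by (rule lborel_pair.Fubini'[symmetric]) measurable
    also have "\<dots> = (\<integral>\<^sup>+v. ennreal (gauss_density 1 v) * \<phi> n v \<partial>lborel)"
      unfolding \<phi>_def by (intro nn_integral_cong) (simp add: nn_integral_cmult[symmetric] mult.left_commute)
    finally show ?thesis .
  qed
  have lim: "ennreal (\<psi> w) \<le> liminf (\<lambda>n. \<phi> n v)" for v
    unfolding le_Liminf_iff
  proof (intro allI impI)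
    fix q assume "q < ennreal (\<psi> w)"
    then obtain q' where q': "q < q'" "q' < ennreal (\<psi> w)" using dense by blast
    then obtain c where c: "q' = ennreal c" "0 \<le> c" by (metis ennreal_cases top.not_eq_extremum order_less_trans less_imp_neq ennreal_less_top)
    have cw: "c < \<psi> w" using q' c by (metis ennreal_less_iff)
    have "isCont \<psi> w" using \<psi>(1) continuous_on_eq_continuous_at[OF open_UNIV, of \<psi>] by blast
    then have "(\<psi> \<longlongrightarrow> \<psi> w) (nhds w)" by (simp add: isCont_def tendsto_at_iff_tendsto_nhds)
    then have "\<forall>\<^sub>F z in nhds w. c < \<psi> z" using cw by (rule order_tendstoD)
    then obtain d where d: "d > 0" "\<And>z. dist z w < d \<Longrightarrow> c < \<psi> z"
      unfolding eventually_nhds_metric by blast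
    \<comment> \<open>This bounds the distance from \<open>w\<close> of every point that enters the
      average, the time shift \<epsilon>/2 included.\<close>
    have "(\<lambda>n. \<epsilon> n + sqrt (\<delta> n) * norm v) \<longlonglongrightarrow> 0 + sqrt 0 * norm v" by (intro tendsto_intros \<delta> \<epsilon>)
    then have "\<forall>\<^sub>F n in sequentially. \<epsilon> n + sqrt (\<delta> n) * norm v < d"
      using d(1) by (intro order_tendstoD) auto
    then show "\<forall>\<^sub>F n in sequentially. q < \<phi> n v"
    proof eventually_elim
      case (elim n)
      have e2: "0 < \<epsilon> n / 2" using \<epsilon>(1)[of n] by simp
      have "ennreal c = (\<integral>\<^sup>+r. ennreal (mol (\<epsilon> n / 2) r) * ennreal c \<partial>(lborel :: real measure))"
        by (simp add: nn_integral_multc nn_integral_mol[OF e2])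
      also have "\<dots> \<le> \<phi> n v"
        unfolding \<phi>_def
      proof (rule nn_integral_mono)
        fix r :: real
        show "ennreal (mol (\<epsilon> n / 2) r) * ennreal c \<le> ennreal (mol (\<epsilon> n / 2) r) * ennreal (\<psi> (t + \<epsilon> n / 2 - r, y + sqrt (\<delta> n) *\<^sub>R v))"
        proof (cases "\<bar>r\<bar> < \<epsilon> n / 2")
          case True
          have "dist (t + \<epsilon> n / 2 - r, y + sqrt (\<delta> n) *\<^sub>R v) w \<le> \<bar>\<epsilon> n / 2 - r\<bar> + norm (sqrt (\<delta> n) *\<^sub>R v)"
            unfolding w dist_prod_def using sqrt_sum_squares_le_sum_abs[of "\<epsilon> n / 2 - r" "norm (sqrt (\<delta> n) *\<^sub>R v)"]
            by (simp add: dist_norm dist_real_def algebra_simps)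
          also have "\<dots> \<le> \<epsilon> n + sqrt (\<delta> n) * norm v" using True \<delta>(1)[of n] by (simp add: abs_if split: if_splits)
          finally have "c < \<psi> (t + \<epsilon> n / 2 - r, y + sqrt (\<delta> n) *\<^sub>R v)" using elim by (intro d) simp
          then show ?thesis by (intro mult_left_mono ennreal_leI) auto
        qed (simp add: mol_eq_0[OF e2])
      qed
      finally show ?case using q'(1) c by simp
    qed
  qed
  have "ennreal (\<psi> w) = (\<integral>\<^sup>+v. ennreal (gauss_density 1 v) * ennreal (\<psi> w) \<partial>(lborel :: (real^'n) measure))"
    by (simp add: nn_integral_multc nn_integral_gauss_density)
  also have "\<dots> \<le> (\<integral>\<^sup>+v. liminf (\<lambda>n. ennreal (gauss_density 1 v) * \<phi> n v) \<partial>lborel)"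
  proof (rule nn_integral_mono)
    fix v :: "real^'n"
    have "ennreal (gauss_density 1 v) * ennreal (\<psi> w) \<le> ennreal (gauss_density 1 v) * liminf (\<lambda>n. \<phi> n v)"
      by (intro mult_left_mono lim) simp
    also have "\<dots> = liminf (\<lambda>n. ennreal (gauss_density 1 v) * \<phi> n v)"
      by (rule Liminf_compose_continuous_mono[symmetric, where f="\<lambda>x. ennreal (gauss_density 1 v) * x"])
        (auto simp: continuous_on_def intro!: ennreal_tendsto_cmult tendsto_ident_at monoI mult_left_mono)
    finally show "ennreal (gauss_density 1 v) * ennreal (\<psi> w) \<le> liminf (\<lambda>n. ennreal (gauss_density 1 v) * \<phi> n v)" .
  qed
  also have "\<dots> \<le> liminf (\<lambda>n. \<integral>\<^sup>+v. ennreal (gauss_density 1 v) * \<phi> n v \<partial>lborel)"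
    by (rule nn_integral_liminf) measurable
  finally show ?thesis unfolding eq .
qed

section \<open>The majorant and its integrability\<close>

context parabolic_density begin

text \<open>The right-hand side of the limiting Duhamel inequality. It takes extended values,
  because for \<delta> = 0 finiteness is known only almost everywhere, through
  \<open>majorant_integral_finite\<close>.\<close>

definition majorant :: "real \<Rightarrow> real \<Rightarrow> real \<times> (real^'n) \<Rightarrow> ennreal" where
  "majorant K \<kappa> z = ennreal K * (\<integral>\<^sup>+y. ennreal (hk \<kappa> (fst z) (y - snd z) * r0 y) \<partial>lborel)
     + (\<integral>\<^sup>+w. ennreal (drift_part K \<kappa> 0 (fst z) (snd z) w * R (fst w) (snd w)) \<partial>lborel)"

lemma r0_measurable' [measurable]: "r0 \<in> borel_measurable borel" by (rule r0_meas)

lemma hk_pair_measurable [measurable]: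
  "(\<lambda>p. hk \<kappa> (f p) (g p :: real^'n)) \<in> borel_measurable M" if "f \<in> borel_measurable M" "g \<in> borel_measurable M"
  using that unfolding hk_def by measurable

lemma hk_r0_measurable: "(\<lambda>(z :: real \<times> (real^'n), y). ennreal (hk \<kappa> (fst z) (y - snd z) * r0 y)) \<in> borel_measurable (borel \<Otimes>\<^sub>M lborel)"
  by measurable

lemma drift_pair_measurable:
  "(\<lambda>(z :: real \<times> (real^'n), w). ennreal (drift_part K \<kappa> c (fst z) (snd z) w * R (fst w) (snd w))) \<in> borel_measurable (borel \<Otimes>\<^sub>M lborel)"
proof -
  have [measurable]: "(\<lambda>p :: (real \<times> (real^'n)) \<times> (real \<times> (real^'n)). indicator {0<..fst (fst p)} (fst (snd p)) :: real) \<in> borel_measurable (borel \<Otimes>\<^sub>M lborel)"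
  proof -
    \<comment> \<open>An indicator whose interval moves with \<open>p\<close> is a comparison of
      coordinates, which is visibly measurable.\<close>
    have "(\<lambda>p :: (real \<times> (real^'n)) \<times> (real \<times> (real^'n)). indicator {0<..fst (fst p)} (fst (snd p)) :: real)
      = (\<lambda>p. if 0 < fst (snd p) \<and> fst (snd p) \<le> fst (fst p) then 1 else 0)" by (auto simp: fun_eq_iff)
    then show ?thesis by simp measurable
  qed
  show ?thesis unfolding drift_part_def split_beta' by measurable
qed

lemma majorant_measurable [measurable]: "majorant K \<kappa> \<in> borel_measurable borel"
proof -
  have [measurable]: "(\<lambda>z :: real \<times> (real^'n). \<integral>\<^sup>+y. ennreal (hk \<kappa> (fst z) (y - snd z) * r0 y) \<partial>lborel) \<in> borel_measurable borel"
    by (rule lborel.borel_measurable_nn_integral[OF hk_r0_measurable])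
  have [measurable]: "(\<lambda>z. \<integral>\<^sup>+w. ennreal (drift_part K \<kappa> 0 (fst z) (snd z) w * R (fst w) (snd w)) \<partial>lborel) \<in> borel_measurable borel"
    by (rule lborel.borel_measurable_nn_integral[OF drift_pair_measurable])
  show ?thesis unfolding majorant_def[abs_def] by measurable
qed

lemma nn_integral_hk_le:
  fixes y :: "real^'n"
  assumes "0 < \<kappa>" and that: "0 \<le> \<tau>"
  shows "(\<integral>\<^sup>+x. ennreal (\<tau> powr (-1/2) * hk \<kappa> \<tau> (y - x)) \<partial>lborel) \<le> ennreal (hk_mass TYPE('n) \<kappa>) * ennreal (\<tau> powr (-1/2))"
\<comment> \<open>Both sides vanish at \<tau> = 0, since \<open>0 powr\<close> any exponent is
  0.\<close>
proof (cases "\<tau> = 0")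
  case False
  then have \<tau>: "0 < \<tau>" using that by simp
  have "(\<integral>\<^sup>+x. ennreal (\<tau> powr (-1/2) * hk \<kappa> \<tau> (y - x)) \<partial>lborel)
      = (\<integral>\<^sup>+x. ennreal (\<tau> powr (-1/2)) * ennreal (hk \<kappa> \<tau> (x - y)) \<partial>lborel)"
    by (simp add: ennreal_mult' hk_sym[of \<kappa> \<tau> y])
  also have "\<dots> = ennreal (\<tau> powr (-1/2)) * ennreal (hk_mass TYPE('n) \<kappa>)"
    by (simp add: nn_integral_cmult nn_integral_hk[OF assms(1) \<tau>])
  finally show ?thesis by (simp add: mult.commute)
qed simp

text \<open>The integral over the pole (T, x) is taken first: the kernel has constant mass in x, and
  (T - s)^(-1/2) is integrable in T. The strip reaches up to time 2 because the majorant will be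
  evaluated at times T + \<delta> with \<delta> \<le> 1.\<close>

lemma majorant_integral_finite:
  assumes \<kappa>: "0 < \<kappa>" and K: "0 \<le> K"
  shows "(\<integral>\<^sup>+z. majorant K \<kappa> z * indicator ({0<..<2} \<times> UNIV) z \<partial>lborel) < \<infinity>"
proof -
  let ?i = "\<lambda>z :: real \<times> (real^'n). indicator ({0<..<2} \<times> UNIV) z :: ennreal"
  have i_eq: "?i z = indicator {0<..<2} (fst z)" for z
    by (cases z) (auto simp: indicator_def)
  have im [measurable]: "?i \<in> borel_measurable borel"
    unfolding i_eq by measurable
  note m1 = hk_r0_measurable[of \<kappa>] and m2 = drift_pair_measurable[of K \<kappa> 0]
  have [measurable]: "(\<lambda>p. ennreal (hk \<kappa> (fst (fst p)) (snd p - snd (fst p :: real \<times> (real^'n))) * r0 (snd p))) \<in> borel_measurable (lborel \<Otimes>\<^sub>M lborel)"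
    using m1 by (simp add: split_beta' cong: measurable_cong_sets)
  have [measurable]: "(\<lambda>p. ennreal (drift_part K \<kappa> 0 (fst (fst p)) (snd (fst p)) (snd p) * R (fst (snd p)) (snd (snd p)))) \<in> borel_measurable (lborel \<Otimes>\<^sub>M lborel)"
    using m2 by (simp add: split_beta' cong: measurable_cong_sets)
  have 1: "(\<integral>\<^sup>+z. (\<integral>\<^sup>+y. ennreal (hk \<kappa> (fst z) (y - snd z) * r0 y) \<partial>lborel) * ?i z \<partial>lborel) \<le> ennreal (2 * hk_mass TYPE('n) \<kappa>)"
  proof -
    have "(\<integral>\<^sup>+z. (\<integral>\<^sup>+y. ennreal (hk \<kappa> (fst z) (y - snd z) * r0 y) \<partial>lborel) * ?i z \<partial>lborel)
       = (\<integral>\<^sup>+z. (\<integral>\<^sup>+y. ennreal (hk \<kappa> (fst z) (y - snd z) * r0 y) * ?i z \<partial>lborel) \<partial>lborel)"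
      by (intro nn_integral_cong nn_integral_multc[symmetric]) measurable
    also have "\<dots> = (\<integral>\<^sup>+y. (\<integral>\<^sup>+z. ennreal (hk \<kappa> (fst z) (y - snd z) * r0 y) * ?i z \<partial>lborel) \<partial>lborel)"
      by (rule lborel_pair.Fubini'[symmetric]) (simp add: split_beta', measurable)
    also have "\<dots> \<le> (\<integral>\<^sup>+y. ennreal (r0 y) * ennreal (2 * hk_mass TYPE('n) \<kappa>) \<partial>lborel)"
    proof (rule nn_integral_mono)
      fix y :: "real^'n"
      have "(\<integral>\<^sup>+z. ennreal (hk \<kappa> (fst z) (y - snd z) * r0 y) * ?i z \<partial>lborel)
          = (\<integral>\<^sup>+T. \<integral>\<^sup>+x. ennreal (hk \<kappa> T (y - x) * r0 y) * indicator {0<..<2} T \<partial>lborel \<partial>lborel)"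
        unfolding i_eq by (rule nn_integral_prod_lborel) measurable
      also have "\<dots> \<le> (\<integral>\<^sup>+T. ennreal (r0 y) * ennreal (hk_mass TYPE('n) \<kappa>) * indicator {0<..<2::real} T \<partial>lborel)"
      proof (rule nn_integral_mono)
        fix T :: real
        show "(\<integral>\<^sup>+x. ennreal (hk \<kappa> T (y - x) * r0 y) * indicator {0<..<2} T \<partial>lborel) \<le> ennreal (r0 y) * ennreal (hk_mass TYPE('n) \<kappa>) * indicator {0<..<2} T"
        proof (cases "T \<in> {0<..<2}")
          case True
          then have "(\<integral>\<^sup>+x. ennreal (hk \<kappa> T (y - x) * r0 y) \<partial>lborel) = (\<integral>\<^sup>+x. ennreal (hk \<kappa> T (x - y)) * ennreal (r0 y) \<partial>lborel)"
            using r0_nonneg by (simp add: ennreal_mult'' hk_sym[of \<kappa> T y])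
          also have "\<dots> = ennreal (hk_mass TYPE('n) \<kappa>) * ennreal (r0 y)"
            using True by (simp add: nn_integral_multc nn_integral_hk[OF \<kappa>])
          finally show ?thesis using True by (simp add: mult.commute)
        qed simp
      qed
      also have "\<dots> = ennreal (r0 y) * ennreal (hk_mass TYPE('n) \<kappa>) * 2"
        by (simp add: nn_integral_cmult)
      also have "\<dots> = ennreal (r0 y) * ennreal (2 * hk_mass TYPE('n) \<kappa>)"
        using hk_mass_pos[OF \<kappa>, where 'n='n] by (simp add: ennreal_mult mult_ac)
      finally show "(\<integral>\<^sup>+z. ennreal (hk \<kappa> (fst z) (y - snd z) * r0 y) * ?i z \<partial>lborel) \<le> ennreal (r0 y) * ennreal (2 * hk_mass TYPE('n) \<kappa>)" .
    qed
    also have "\<dots> = ennreal (2 * hk_mass TYPE('n) \<kappa>)" by (simp add: nn_integral_multc r0_prob)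
    finally show ?thesis .
  qed
  \<comment> \<open>The last factor is the integral of the power -1/2 over [0, 2].\<close>
  define G where "G = K * hk_mass TYPE('n) \<kappa> * (2 powr (-1/2 + 1) / (-1/2 + 1))"
  have G: "0 \<le> G" using K hk_mass_pos[OF \<kappa>, where 'n='n] by (simp add: G_def)
  have 2: "(\<integral>\<^sup>+z. (\<integral>\<^sup>+w. ennreal (drift_part K \<kappa> 0 (fst z) (snd z) w * R (fst w) (snd w)) \<partial>lborel) * ?i z \<partial>lborel)
     \<le> (\<integral>\<^sup>+w. ennreal G * ennreal ((1 + norm (B (fst w) (snd w))) * R (fst w) (snd w)) \<partial>lborel)"
  proof -
    have "(\<integral>\<^sup>+z. (\<integral>\<^sup>+w. ennreal (drift_part K \<kappa> 0 (fst z) (snd z) w * R (fst w) (snd w)) \<partial>lborel) * ?i z \<partial>lborel)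
       = (\<integral>\<^sup>+z. (\<integral>\<^sup>+w. ennreal (drift_part K \<kappa> 0 (fst z) (snd z) w * R (fst w) (snd w)) * ?i z \<partial>lborel) \<partial>lborel)"
      by (intro nn_integral_cong nn_integral_multc[symmetric]) measurable
    also have "\<dots> = (\<integral>\<^sup>+w. (\<integral>\<^sup>+z. ennreal (drift_part K \<kappa> 0 (fst z) (snd z) w * R (fst w) (snd w)) * ?i z \<partial>lborel) \<partial>lborel)"
      by (rule lborel_pair.Fubini'[symmetric]) (simp add: split_beta', measurable)
    also have "\<dots> \<le> (\<integral>\<^sup>+w. ennreal G * ennreal ((1 + norm (B (fst w) (snd w))) * R (fst w) (snd w)) \<partial>lborel)"
    proof (rule nn_integral_mono)
      fix w :: "real \<times> (real^'n)"
      obtain s y where w: "w = (s, y)" by (cases w)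
      define q where "q = (1 + norm (B s y)) * R s y"
      have q: "0 \<le> q" using R_nonneg by (simp add: q_def)
      have sm: "(\<lambda>z. drift_part K \<kappa> 0 (fst z) (snd z) w) \<in> borel_measurable borel"
      proof -
        have "(\<lambda>z :: real \<times> (real^'n). indicator {0<..fst z} s :: real) = (\<lambda>z. if 0 < s \<and> s \<le> fst z then 1 else 0)"
          by (auto simp: fun_eq_iff)
        moreover have "(\<lambda>z :: real \<times> (real^'n). if 0 < s \<and> s \<le> fst z then 1 else 0 :: real) \<in> borel_measurable borel"
          by measurable
        ultimately have [measurable]: "(\<lambda>z :: real \<times> (real^'n). indicator {0<..fst z} s :: real) \<in> borel_measurable borel" by simp
        show ?thesis unfolding drift_part_def w fst_conv snd_conv by measurable
      qed
      have [measurable]: "(\<lambda>z. drift_part K \<kappa> 0 (fst z) (snd z) (s, y)) \<in> borel_measurable borel"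
        using sm by (simp only: w)
      have "(\<integral>\<^sup>+z. ennreal (drift_part K \<kappa> 0 (fst z) (snd z) w * R (fst w) (snd w)) * ?i z \<partial>lborel)
          = (\<integral>\<^sup>+T. \<integral>\<^sup>+x. ennreal (drift_part K \<kappa> 0 T x w * R s y) * indicator {0<..<2} T \<partial>lborel \<partial>lborel)"
        unfolding i_eq w fst_conv snd_conv by (rule nn_integral_prod_lborel) measurable
      also have "\<dots> \<le> (\<integral>\<^sup>+T. ennreal (K * q * hk_mass TYPE('n) \<kappa>) * ennreal (indicator {0..2} (- s + T) * (- s + T) powr (-1/2)) \<partial>lborel)"
      proof (rule nn_integral_mono)
        fix T :: real
        show "(\<integral>\<^sup>+x. ennreal (drift_part K \<kappa> 0 T x w * R s y) * indicator {0<..<2} T \<partial>lborel)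
          \<le> ennreal (K * q * hk_mass TYPE('n) \<kappa>) * ennreal (indicator {0..2} (- s + T) * (- s + T) powr (-1/2))"
        proof (cases "T \<in> {0<..<2} \<and> 0 < s \<and> s \<le> T")
          case True
          have "(\<integral>\<^sup>+x. ennreal (drift_part K \<kappa> 0 T x w * R s y) * indicator {0<..<2} T \<partial>lborel)
             = (\<integral>\<^sup>+x. ennreal (K * q) * ennreal ((T - s) powr (-1/2) * hk \<kappa> (T - s) (y - x)) \<partial>lborel)"
            using True K q by (intro nn_integral_cong) (simp add: drift_part_def w q_def ennreal_mult'[symmetric] mult_ac)
          also have "\<dots> = ennreal (K * q) * (\<integral>\<^sup>+x. ennreal ((T - s) powr (-1/2) * hk \<kappa> (T - s) (y - x)) \<partial>lborel)"
            by (rule nn_integral_cmult) measurable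
          also have "\<dots> \<le> ennreal (K * q) * (ennreal (hk_mass TYPE('n) \<kappa>) * ennreal ((T - s) powr (-1/2)))"
            using True by (intro mult_left_mono nn_integral_hk_le \<kappa>) auto
          also have "\<dots> = ennreal (K * q * hk_mass TYPE('n) \<kappa>) * ennreal (indicator {0..2} (- s + T) * (- s + T) powr (-1/2))"
            using True K q hk_mass_pos[OF \<kappa>, where 'n='n] by (simp add: ennreal_mult mult_ac)
          finally show ?thesis .
        next
          case False
          then have "(\<integral>\<^sup>+x. ennreal (drift_part K \<kappa> 0 T x w * R s y) * indicator {0<..<2} T \<partial>lborel) = 0"
            by (auto simp: drift_part_def w indicator_def)
          then show ?thesis by simp
        qed
      qed
      also have "\<dots> = ennreal (K * q * hk_mass TYPE('n) \<kappa>) * (\<integral>\<^sup>+T. ennreal (indicator {0..2} (- s + T) * (- s + T) powr (-1/2)) \<partial>lborel)"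
        by (rule nn_integral_cmult) measurable
      also have "(\<integral>\<^sup>+T. ennreal (indicator {0..2} (- s + T) * (- s + T) powr (-1/2)) \<partial>lborel) = ennreal (2 powr (-1/2 + 1) / (-1/2 + 1))"
        using nn_integral_lborel_translate[of "\<lambda>T. ennreal (indicator {0..2} T * T powr (-1/2))" "- s"] nn_integral_powr_from_0[of "-1/2" 2]
        by simp
      also have "ennreal (K * q * hk_mass TYPE('n) \<kappa>) * \<dots> = ennreal G * ennreal q"
        using K q hk_mass_pos[OF \<kappa>, where 'n='n] by (simp add: G_def ennreal_mult'[symmetric] mult_ac)
      finally show "(\<integral>\<^sup>+z. ennreal (drift_part K \<kappa> 0 (fst z) (snd z) w * R (fst w) (snd w)) * ?i z \<partial>lborel)
         \<le> ennreal G * ennreal ((1 + norm (B (fst w) (snd w))) * R (fst w) (snd w))" by (simp add: q_def w)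
    qed
    finally show ?thesis .
  qed
  have 3: "(\<integral>\<^sup>+w. ennreal ((1 + norm (B (fst w) (snd w))) * R (fst w) (snd w)) \<partial>lborel) < \<infinity>"
  proof -
    have "integrable lborel (\<lambda>w. (1 + norm (B (fst w) (snd w))) * R (fst w) (snd w))"
      using R_integrable BR_integrable by (simp add: distrib_right)
    then show ?thesis using R_nonneg by (simp add: integrable_iff_bounded abs_mult)
  qed
  have meas1 [measurable]: "(\<lambda>z :: real \<times> (real^'n). \<integral>\<^sup>+y. ennreal (hk \<kappa> (fst z) (y - snd z) * r0 y) \<partial>lborel) \<in> borel_measurable borel"
    by (rule lborel.borel_measurable_nn_integral[OF m1])
  have meas2 [measurable]: "(\<lambda>z. \<integral>\<^sup>+w. ennreal (drift_part K \<kappa> 0 (fst z) (snd z) w * R (fst w) (snd w)) \<partial>lborel) \<in> borel_measurable borel"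
    by (rule lborel.borel_measurable_nn_integral[OF m2])
  have "(\<integral>\<^sup>+z. majorant K \<kappa> z * ?i z \<partial>lborel)
    = ennreal K * (\<integral>\<^sup>+z. (\<integral>\<^sup>+y. ennreal (hk \<kappa> (fst z) (y - snd z) * r0 y) \<partial>lborel) * ?i z \<partial>lborel)
     + (\<integral>\<^sup>+z. (\<integral>\<^sup>+w. ennreal (drift_part K \<kappa> 0 (fst z) (snd z) w * R (fst w) (snd w)) \<partial>lborel) * ?i z \<partial>lborel)"
    unfolding majorant_def distrib_right mult.assoc
    by (subst nn_integral_add, measurable, subst nn_integral_cmult, measurable)
  also have "\<dots> \<le> ennreal K * ennreal (2 * hk_mass TYPE('n) \<kappa>) + ennreal G * (\<integral>\<^sup>+w. ennreal ((1 + norm (B (fst w) (snd w))) * R (fst w) (snd w)) \<partial>lborel)"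
    using 2 by (intro add_mono mult_left_mono 1) (simp_all add: nn_integral_cmult)
  also have "\<dots> < \<infinity>" using 3 by (simp add: ennreal_mult_less_top ennreal_add_less_top less_top[symmetric] ennreal_mult_eq_top_iff)
  finally show ?thesis .
qed

end

section \<open>From averaged estimates to an almost everywhere bound\<close>

context parabolic_density begin

lemma constants_pos:
  shows "0 < frozen.KK TYPE('n) C \<alpha>" "0 < frozen.\<kappa> TYPE('n) C \<alpha>"
    and "0 < \<delta> \<Longrightarrow> \<delta> \<le> 1 \<Longrightarrow> 0 \<le> frozen.EE TYPE('n) C \<alpha> \<delta>"
proof -
  have f: "frozen (\<lambda>_. A 0 0) C \<alpha> (1 / 2) d" if "0 < d" "d \<le> 1" for d
    using that by (intro frozenI A_sym A_bound A_elliptic) auto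
  show "0 < frozen.KK TYPE('n) C \<alpha>" by (rule frozen.KK_pos[OF f[of 1]]) auto
  show "0 < frozen.\<kappa> TYPE('n) C \<alpha>" by (rule frozen.kappa_pos[OF f[of 1]]) auto
  show "0 < \<delta> \<Longrightarrow> \<delta> \<le> 1 \<Longrightarrow> 0 \<le> frozen.EE TYPE('n) C \<alpha> \<delta>"
    by (rule frozen.EE_nonneg[OF f]) auto
qed

text \<open>Dominates the constants of both the initial term and the drift term in
  \<open>duhamel_average\<close>.\<close>

definition Kmaj :: real where
  "Kmaj = frozen.KK TYPE('n) C \<alpha> * (1 + ((real CARD('n))\<^sup>2 * lam + real CARD('n)))"

lemma Kmaj_ge: "frozen.KK TYPE('n) C \<alpha> \<le> Kmaj"
    "frozen.KK TYPE('n) C \<alpha> * ((real CARD('n))\<^sup>2 * lam + real CARD('n)) \<le> Kmaj" "0 < Kmaj"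
proof -
  have nn: "0 \<le> (real CARD('n))\<^sup>2 * lam + real CARD('n)" using lam_nonneg by simp
  have "0 \<le> frozen.KK TYPE('n) C \<alpha> * ((real CARD('n))\<^sup>2 * lam + real CARD('n))"
    using constants_pos(1) nn by (intro mult_nonneg_nonneg) auto
  then show "frozen.KK TYPE('n) C \<alpha> \<le> Kmaj"
    "frozen.KK TYPE('n) C \<alpha> * ((real CARD('n))\<^sup>2 * lam + real CARD('n)) \<le> Kmaj" "0 < Kmaj"
    using constants_pos(1) unfolding Kmaj_def distrib_left[of _ 1] by linarith+
qed

lemma drift_part_nonneg: "0 \<le> k \<Longrightarrow> 0 \<le> drift_part k \<kappa> \<delta> T x0 z"
  unfolding drift_part_def by (intro mult_nonneg_nonneg hk_nonneg) auto

text \<open>Smearing the pole by \<delta> amounts to moving it to time T + \<delta>. Hence \<delta>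
  enters only as a time shift of one fixed majorant, and no convergence of kernels has to be
  shown.\<close>

lemma drift_part_shift_le:
  assumes "0 \<le> k" "k \<le> K" "0 < \<delta>"
  shows "drift_part k \<kappa> \<delta> T x0 z \<le> drift_part K \<kappa> 0 (T + \<delta>) x0 z"
proof -
  let ?q = "(T + \<delta> - fst z) powr (-1/2) * (hk \<kappa> (T + \<delta> - fst z) (snd z - x0) * (1 + norm (B (fst z) (snd z))))"
  have q: "0 \<le> ?q" by (intro mult_nonneg_nonneg hk_nonneg) auto
  have "indicator {0<..T} (fst z) * (k * ?q) \<le> indicator {0<..T + \<delta>} (fst z) * (K * ?q)"
    using assms q by (intro mult_mono mult_right_mono) (auto simp: indicator_def)
  then show ?thesis by (simp add: drift_part_def)
qed

lemma duhamel_majorant: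
  assumes T: "0 < T" "T < 1" and \<delta>: "0 < \<delta>" "\<delta> \<le> 1" and eps: "0 < \<epsilon>" "\<epsilon> < T"
  shows "(\<integral>\<^sup>+z. ennreal (mol (\<epsilon> / 2) (fst z - T + \<epsilon> / 2) * gauss_density \<delta> (snd z - x0) * R (fst z) (snd z)) \<partial>lborel)
     \<le> ennreal (frozen.EE TYPE('n) C \<alpha> \<delta> * \<epsilon>) + majorant Kmaj (frozen.\<kappa> TYPE('n) C \<alpha>) (T + \<delta>, x0)"
proof -
  let ?KC = "frozen.KK TYPE('n) C \<alpha>" and ?kC = "frozen.\<kappa> TYPE('n) C \<alpha>" and ?EC = "frozen.EE TYPE('n) C \<alpha> \<delta>"
  let ?Kd = "?KC * ((real CARD('n))\<^sup>2 * lam + real CARD('n))"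
  have EC: "0 \<le> ?EC" by (rule constants_pos(3)[OF \<delta>])
  have Kd: "0 \<le> ?Kd" using constants_pos(1) lam_nonneg by (intro mult_nonneg_nonneg add_nonneg_nonneg) auto
  let ?r = "\<lambda>z. R (fst z) (snd z)"
  have e2: "0 < \<epsilon> / 2" using eps by simp
  obtain b where b: "\<And>z::real. \<bar>mol (\<epsilon> / 2) z\<bar> \<le> b" using mol_bounded[OF e2, where 'a=real] by blast
  define G where "G = (2 * \<delta>) powr (- (real CARD('n) / 2)) / gauss_total TYPE(real^'n)"
  have G0: "0 \<le> G" using gauss_total_pos[where 'a="real^'n"] by (simp add: G_def)
  have G: "gauss_density \<delta> y \<le> G" for y :: "real^'n"
    using mult_left_mono[of "exp (- ((y \<bullet> y) / (2 * \<delta>)))" 1 G] G0 \<delta> by (simp add: gauss_density_def G_def)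
  have i1: "integrable lborel (\<lambda>z. mol (\<epsilon> / 2) (fst z - T + \<epsilon> / 2) * gauss_density \<delta> (snd z - x0) * ?r z)"
  proof (rule bounded_R_integrable)
    show "\<bar>mol (\<epsilon> / 2) (fst z - T + \<epsilon> / 2) * gauss_density \<delta> (snd z - x0)\<bar> \<le> b * G" for z
      unfolding abs_mult using G G0 gauss_density_nonneg[of \<delta> "snd z - x0"] b[of 0]
      by (intro mult_mono b) auto
  qed measurable
  have nn1: "0 \<le> mol (\<epsilon> / 2) (fst z - T + \<epsilon> / 2) * gauss_density \<delta> (snd z - x0) * ?r z" for z
    by (intro mult_nonneg_nonneg mol_nonneg e2 gauss_density_nonneg R_nonneg)
  have Td: "0 < T + \<delta>" using T \<delta> by simp
  have i2: "integrable lborel (\<lambda>y. hk ?kC (T + \<delta>) (y - x0) * r0 y)"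
  proof (rule Bochner_Integration.integrable_bound[OF integrable_mult_right[OF r0_integrable, of "(T + \<delta>) powr (- (real CARD('n) / 2))"]])
    show "AE y in lborel. norm (hk ?kC (T + \<delta>) (y - x0) * r0 y) \<le> norm ((T + \<delta>) powr (- (real CARD('n) / 2)) * r0 y)"
      using hk_le[OF constants_pos(2) Td] r0_nonneg
      by (intro AE_I2) (auto simp: abs_mult hk_nonneg abs_of_nonneg intro!: mult_right_mono)
  qed measurable
  obtain c where "\<forall>z. \<bar>drift_part ?Kd ?kC \<delta> T x0 z\<bar> \<le> c + c * norm (B (fst z) (snd z))"
    using drift_part_bound[OF Kd constants_pos(2) \<delta>(1)] by blast
  then have i3: "integrable lborel (\<lambda>z. drift_part ?Kd ?kC \<delta> T x0 z * ?r z)"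
    by (intro dominated_R_integrable[where ?c1.0=c and ?c2.0=c]) auto
  have nn3: "0 \<le> drift_part ?Kd ?kC \<delta> T x0 z * ?r z" for z
    by (intro mult_nonneg_nonneg drift_part_nonneg Kd R_nonneg)
  have nn2: "0 \<le> hk ?kC (T + \<delta>) (y - x0) * r0 y" for y by (intro mult_nonneg_nonneg hk_nonneg r0_nonneg)
  have I2: "0 \<le> (\<integral>y. hk ?kC (T + \<delta>) (y - x0) * r0 y \<partial>lborel)" using nn2 by simp
  have I3: "0 \<le> (\<integral>z. drift_part ?Kd ?kC \<delta> T x0 z * ?r z \<partial>lborel)" using nn3 by simp
  have "(\<integral>\<^sup>+z. ennreal (mol (\<epsilon> / 2) (fst z - T + \<epsilon> / 2) * gauss_density \<delta> (snd z - x0) * ?r z) \<partial>lborel)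
    = ennreal (\<integral>z. mol (\<epsilon> / 2) (fst z - T + \<epsilon> / 2) * gauss_density \<delta> (snd z - x0) * ?r z \<partial>lborel)"
    by (rule nn_integral_eq_integral[OF i1]) (use nn1 in auto)
  also have "\<dots> \<le> ennreal (?EC * \<epsilon> + ?KC * (\<integral>y. hk ?kC (T + \<delta>) (y - x0) * r0 y \<partial>lborel)
      + (\<integral>z. drift_part ?Kd ?kC \<delta> T x0 z * ?r z \<partial>lborel))"
    by (intro ennreal_leI duhamel_average T \<delta> eps constants_pos EC)
  also have "\<dots> = ennreal (?EC * \<epsilon>) + (ennreal ?KC * ennreal (\<integral>y. hk ?kC (T + \<delta>) (y - x0) * r0 y \<partial>lborel)
      + ennreal (\<integral>z. drift_part ?Kd ?kC \<delta> T x0 z * ?r z \<partial>lborel))"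
    using EC eps I2 I3 constants_pos(1) by (simp add: ennreal_plus ennreal_mult add.assoc)
  also have "ennreal (\<integral>y. hk ?kC (T + \<delta>) (y - x0) * r0 y \<partial>lborel) = (\<integral>\<^sup>+y. ennreal (hk ?kC (T + \<delta>) (y - x0) * r0 y) \<partial>lborel)"
    by (rule nn_integral_eq_integral[OF i2, symmetric]) (use nn2 in auto)
  also have "ennreal (\<integral>z. drift_part ?Kd ?kC \<delta> T x0 z * ?r z \<partial>lborel) = (\<integral>\<^sup>+z. ennreal (drift_part ?Kd ?kC \<delta> T x0 z * ?r z) \<partial>lborel)"
    by (rule nn_integral_eq_integral[OF i3, symmetric]) (use nn3 in auto)
  also have "ennreal ?KC * (\<integral>\<^sup>+y. ennreal (hk ?kC (T + \<delta>) (y - x0) * r0 y) \<partial>lborel)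
       + (\<integral>\<^sup>+z. ennreal (drift_part ?Kd ?kC \<delta> T x0 z * ?r z) \<partial>lborel) \<le> majorant Kmaj ?kC (T + \<delta>, x0)"
    unfolding majorant_def fst_conv snd_conv using Kmaj_ge Kd \<delta>
    by (intro add_mono mult_right_mono nn_integral_mono ennreal_leI drift_part_shift_le R_nonneg) auto
  finally show ?thesis by (simp add: add_left_mono)
qed

text \<open>\<open>duhamel_majorant\<close> is averaged over its pole with weight \<psi>. On the
  left Fubini puts the smearing on \<psi>, and \<open>smeared_liminf\<close> with Fatou recovers
  \<psi>; on the right the time shift disappears by dominated convergence.\<close>

lemma majorant_dual:
  fixes \<psi> :: "real \<times> (real^'n) \<Rightarrow> real"
  assumes \<psi>: "continuous_on UNIV \<psi>" and K: "compact K" "K \<subseteq> {0<..<1} \<times> UNIV" and supp: "\<And>z. z \<notin> K \<Longrightarrow> \<psi> z = 0"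
    and nn: "\<And>z. 0 \<le> \<psi> z"
  shows "(\<integral>\<^sup>+z. ennreal (R (fst z) (snd z)) * ennreal (\<psi> z) \<partial>lborel)
    \<le> (\<integral>\<^sup>+z. majorant Kmaj (frozen.\<kappa> TYPE('n) C \<alpha>) z * ennreal (\<psi> z) \<partial>lborel)"
proof -
  let ?V = "majorant Kmaj (frozen.\<kappa> TYPE('n) C \<alpha>)"
  have [measurable]: "\<psi> \<in> borel_measurable borel" by (rule borel_measurable_continuous_onI[OF \<psi>])
  have pair [measurable]: "(\<lambda>p. \<psi> (f p, g p)) \<in> borel_measurable M"
    if "f \<in> borel_measurable M" "g \<in> borel_measurable M" for f :: "'c \<Rightarrow> real" and g :: "'c \<Rightarrow> real^'n" and M
    using measurable_compose[OF borel_measurable_Pair[OF that], of \<psi> borel] by simp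
  have "open ({0<..<1::real} \<times> (UNIV :: (real^'n) set))" by (intro open_Times) auto
  then obtain e where e: "e > 0" "(\<Union>w\<in>K. cball w e) \<subseteq> {0<..<1} \<times> UNIV"
    using compact_subset_open_imp_cball_epsilon_subset[OF K(1) _ K(2)] by blast
  have Kt: "e < fst w" "fst w < 1" if "w \<in> K" for w
  proof -
    obtain t y where w: "w = (t, y)" by (cases w)
    have "(t - e, y) \<in> cball w e" using e(1) by (simp add: w dist_prod_def dist_real_def)
    then have "(t - e, y) \<in> {0<..<1} \<times> UNIV" using e(2) that by blast
    then show "e < fst w" "fst w < 1" using K(2) that by (auto simp: w)
  qed
  obtain P where P: "P \<ge> 0" "\<And>z. \<bar>\<psi> z\<bar> \<le> P" using bounded_of_compact_support[OF \<psi> K(1) supp] by auto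
  define \<delta> where "\<delta> n = inverse (real (Suc n))" for n
  have d: "0 < \<delta> n" "\<delta> n \<le> 1" for n by (auto simp: \<delta>_def inverse_le_1_iff)
  have dl: "\<delta> \<longlonglongrightarrow> 0" unfolding \<delta>_def by (rule LIMSEQ_inverse_real_of_nat)
  define E where "E n = frozen.EE TYPE('n) C \<alpha> (\<delta> n)" for n
  have E: "0 \<le> E n" for n unfolding E_def by (rule constants_pos(3)[OF d])
  \<comment> \<open>The bound \<open>E n\<close> may explode as \<delta> n tends to 0, so the time
    window shrinks fast enough for \<open>E n * \<epsilon> n\<close> to vanish. The term
    \<open>e / 2\<close> keeps the window inside (0, T) for every pole in \<open>K\<close>.\<close>
  define \<epsilon> where "\<epsilon> n = min (e / 2) (\<delta> n / (E n + 1))" for n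
  have ep: "0 < \<epsilon> n" "\<epsilon> n < e" "\<epsilon> n \<le> \<delta> n" "E n * \<epsilon> n \<le> \<delta> n" for n
  proof -
    have 1: "0 < E n + 1" using E[of n] by linarith
    show "0 < \<epsilon> n" "\<epsilon> n < e" using e(1) d(1)[of n] 1 by (auto simp: \<epsilon>_def)
    have a: "\<epsilon> n \<le> \<delta> n / (E n + 1)" by (simp add: \<epsilon>_def)
    have "\<delta> n / (E n + 1) \<le> \<delta> n" using E[of n] d(1)[of n] 1 by (simp add: pos_divide_le_eq)
    then show "\<epsilon> n \<le> \<delta> n" using a by linarith
    have "E n * \<epsilon> n \<le> (E n + 1) * (\<delta> n / (E n + 1))"
      using a E[of n] \<open>0 < \<epsilon> n\<close> by (intro mult_mono) auto
    also have "\<dots> = \<delta> n" using 1 by simp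
    finally show "E n * \<epsilon> n \<le> \<delta> n" .
  qed
  have el: "\<epsilon> \<longlonglongrightarrow> 0"
    by (rule tendsto_sandwich[OF _ _ tendsto_const dl]) (use ep in \<open>auto intro!: always_eventually less_imp_le\<close>)
  let ?k = "\<lambda>n w z. mol (\<epsilon> n / 2) (fst w - fst z + \<epsilon> n / 2) * gauss_density (\<delta> n) (snd w - snd z)"
  have k_nn: "0 \<le> ?k n w z" for n w z
    using ep(1)[of n] by (intro mult_nonneg_nonneg mol_nonneg gauss_density_nonneg) simp
  have km: "(\<lambda>(w, z). ennreal (R (fst w) (snd w)) * (ennreal (\<psi> z) * ennreal (?k n w z))) \<in> borel_measurable (lborel \<Otimes>\<^sub>M lborel)" for n
  proof -
    have [measurable]: "(\<lambda>p. \<psi> (snd p)) \<in> borel_measurable (lborel \<Otimes>\<^sub>M (lborel :: (real \<times> (real^'n)) measure))" for n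
      by measurable
    show ?thesis unfolding split_beta' by measurable
  qed
  have kmw: "(\<lambda>z. ennreal (\<psi> z) * ennreal (?k n w z)) \<in> borel_measurable borel" for n w by measurable
  have "(\<integral>\<^sup>+w. ennreal (R (fst w) (snd w)) * ennreal (\<psi> w) \<partial>lborel)
      \<le> (\<integral>\<^sup>+w. liminf (\<lambda>n. ennreal (R (fst w) (snd w)) * (\<integral>\<^sup>+z. ennreal (\<psi> z) * ennreal (?k n w z) \<partial>lborel)) \<partial>lborel)"
  proof (rule nn_integral_mono)
    fix w :: "real \<times> (real^'n)"
    have "ennreal (R (fst w) (snd w)) * ennreal (\<psi> w)
        \<le> ennreal (R (fst w) (snd w)) * liminf (\<lambda>n. \<integral>\<^sup>+z. ennreal (\<psi> z) * ennreal (?k n w z) \<partial>lborel)"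
      by (intro mult_left_mono smeared_liminf \<psi> nn d dl ep el) simp
    also have "\<dots> = liminf (\<lambda>n. ennreal (R (fst w) (snd w)) * (\<integral>\<^sup>+z. ennreal (\<psi> z) * ennreal (?k n w z) \<partial>lborel))"
      by (rule Liminf_compose_continuous_mono[symmetric, where f="\<lambda>x. ennreal (R (fst w) (snd w)) * x"])
        (auto simp: continuous_on_def intro!: ennreal_tendsto_cmult tendsto_ident_at monoI mult_left_mono)
    finally show "ennreal (R (fst w) (snd w)) * ennreal (\<psi> w) \<le> \<dots>" .
  qed
  also have "\<dots> \<le> liminf (\<lambda>n. \<integral>\<^sup>+w. ennreal (R (fst w) (snd w)) * (\<integral>\<^sup>+z. ennreal (\<psi> z) * ennreal (?k n w z) \<partial>lborel) \<partial>lborel)"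
  proof (rule nn_integral_liminf)
    show "(\<lambda>w. ennreal (R (fst w) (snd w)) * (\<integral>\<^sup>+z. ennreal (\<psi> z) * ennreal (?k n w z) \<partial>lborel)) \<in> borel_measurable lborel" for n
    proof -
      have "(\<lambda>w. \<integral>\<^sup>+z. ennreal (R (fst w) (snd w)) * (ennreal (\<psi> z) * ennreal (?k n w z)) \<partial>lborel) \<in> borel_measurable lborel"
        by (rule lborel.borel_measurable_nn_integral[OF km])
      then show ?thesis using kmw by (simp add: nn_integral_cmult)
    qed
  qed
  also have "\<dots> \<le> liminf (\<lambda>n. ennreal (\<delta> n) * (\<integral>\<^sup>+z. ennreal (\<psi> z) \<partial>lborel) + (\<integral>\<^sup>+z. ?V z * ennreal (\<psi> (fst z - \<delta> n, snd z)) \<partial>lborel))"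
  proof (rule Liminf_mono, rule always_eventually, rule allI)
    fix n
    have "(\<integral>\<^sup>+w. ennreal (R (fst w) (snd w)) * (\<integral>\<^sup>+z. ennreal (\<psi> z) * ennreal (?k n w z) \<partial>lborel) \<partial>lborel)
      = (\<integral>\<^sup>+w. \<integral>\<^sup>+z. ennreal (R (fst w) (snd w)) * (ennreal (\<psi> z) * ennreal (?k n w z)) \<partial>lborel \<partial>lborel)"
      using kmw by (simp add: nn_integral_cmult)
    also have "\<dots> = (\<integral>\<^sup>+z. \<integral>\<^sup>+w. ennreal (R (fst w) (snd w)) * (ennreal (\<psi> z) * ennreal (?k n w z)) \<partial>lborel \<partial>lborel)"
      by (rule lborel_pair.Fubini'[symmetric]) (rule km)
    also have "\<dots> \<le> (\<integral>\<^sup>+z. ennreal (\<delta> n) * ennreal (\<psi> z) + ?V ((\<delta> n, 0) + z) * ennreal (\<psi> z) \<partial>lborel)"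
    proof (rule nn_integral_mono)
      fix z :: "real \<times> (real^'n)"
      show "(\<integral>\<^sup>+w. ennreal (R (fst w) (snd w)) * (ennreal (\<psi> z) * ennreal (?k n w z)) \<partial>lborel)
        \<le> ennreal (\<delta> n) * ennreal (\<psi> z) + ?V ((\<delta> n, 0) + z) * ennreal (\<psi> z)"
      proof (cases "z \<in> K")
        case True
        note t = Kt[OF True]
        have "(\<integral>\<^sup>+w. ennreal (R (fst w) (snd w)) * (ennreal (\<psi> z) * ennreal (?k n w z)) \<partial>lborel)
          = (\<integral>\<^sup>+w. ennreal (\<psi> z) * ennreal (?k n w z * R (fst w) (snd w)) \<partial>lborel)"
          by (intro nn_integral_cong) (simp only: ennreal_mult[OF k_nn R_nonneg], simp only: mult_ac)
        also have "\<dots> = ennreal (\<psi> z) * (\<integral>\<^sup>+w. ennreal (?k n w z * R (fst w) (snd w)) \<partial>lborel)"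
          by (rule nn_integral_cmult) measurable
        also have "\<dots> \<le> ennreal (\<psi> z) * (ennreal (E n * \<epsilon> n) + ?V (fst z + \<delta> n, snd z))"
          unfolding E_def using t ep[of n] e(1) by (intro mult_left_mono duhamel_majorant d) auto
        also have "\<dots> \<le> ennreal (\<psi> z) * (ennreal (\<delta> n) + ?V (fst z + \<delta> n, snd z))"
          by (intro mult_left_mono add_right_mono ennreal_leI ep) auto
        also have "(fst z + \<delta> n, snd z) = (\<delta> n, 0) + z" by (cases z) (simp add: add.commute)
        finally show ?thesis by (simp add: distrib_left mult.commute)
      qed (simp add: supp)
    qed
    also have "\<dots> = ennreal (\<delta> n) * (\<integral>\<^sup>+z. ennreal (\<psi> z) \<partial>lborel) + (\<integral>\<^sup>+z. ?V ((\<delta> n, 0) + z) * ennreal (\<psi> z) \<partial>lborel)"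
      by (subst nn_integral_add, measurable, subst nn_integral_cmult, measurable)
    \<comment> \<open>Translation moves the shift from the majorant, for which only measurability is
      known, to the continuous function \<psi>.\<close>
    also have "(\<integral>\<^sup>+z. ?V ((\<delta> n, 0) + z) * ennreal (\<psi> z) \<partial>lborel) = (\<integral>\<^sup>+z. ?V z * ennreal (\<psi> (fst z - \<delta> n, snd z)) \<partial>lborel)"
    proof -
      have "(fst ((\<delta> n, 0) + z) - \<delta> n, snd ((\<delta> n, 0) + z)) = z" for z :: "real \<times> (real^'n)" by (cases z) simp
      then show ?thesis
        using nn_integral_lborel_translate[of "\<lambda>z. ?V z * ennreal (\<psi> (fst z - \<delta> n, snd z))" "(\<delta> n, 0)"] by simp
    qed
    finally show "(\<integral>\<^sup>+w. ennreal (R (fst w) (snd w)) * (\<integral>\<^sup>+z. ennreal (\<psi> z) * ennreal (?k n w z) \<partial>lborel) \<partial>lborel)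
      \<le> ennreal (\<delta> n) * (\<integral>\<^sup>+z. ennreal (\<psi> z) \<partial>lborel) + (\<integral>\<^sup>+z. ?V z * ennreal (\<psi> (fst z - \<delta> n, snd z)) \<partial>lborel)" .
  qed
  also have "\<dots> = 0 * (\<integral>\<^sup>+z. ennreal (\<psi> z) \<partial>lborel) + (\<integral>\<^sup>+z. ?V z * ennreal (\<psi> z) \<partial>lborel)"
  proof (rule lim_imp_Liminf)
    have fin: "(\<integral>\<^sup>+z. ennreal (\<psi> z) \<partial>lborel) < \<infinity>"
      using integrable_compact_support[OF \<psi> K(1) supp] nn by (simp add: integrable_iff_bounded)
    have "(\<lambda>n. ennreal (\<delta> n)) \<longlonglongrightarrow> ennreal 0" by (rule tendsto_ennrealI[OF dl])
    then have "(\<lambda>n. (\<integral>\<^sup>+z. ennreal (\<psi> z) \<partial>lborel) * ennreal (\<delta> n)) \<longlonglongrightarrow> (\<integral>\<^sup>+z. ennreal (\<psi> z) \<partial>lborel) * ennreal 0"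
      by (rule ennreal_tendsto_cmult[rotated]) (use fin in simp)
    then have 1: "(\<lambda>n. ennreal (\<delta> n) * (\<integral>\<^sup>+z. ennreal (\<psi> z) \<partial>lborel)) \<longlonglongrightarrow> 0 * (\<integral>\<^sup>+z. ennreal (\<psi> z) \<partial>lborel)"
      unfolding mult.commute[of "\<integral>\<^sup>+z. ennreal (\<psi> z) \<partial>lborel"] ennreal_0 .
    have Vfin: "(\<integral>\<^sup>+z. ?V z * indicator ({0<..<2} \<times> UNIV) z \<partial>lborel) < \<infinity>"
      using Kmaj_ge(3) by (intro majorant_integral_finite constants_pos) simp
    have Vm: "(\<lambda>z. ?V z * indicator ({0<..<2} \<times> UNIV) z) \<in> borel_measurable lborel"
      by (intro borel_measurable_times_ennreal borel_measurable_indicator) (auto intro!: borel_open open_Times)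
    have out: "\<psi> (fst z - \<delta> n, snd z) = 0" if "z \<notin> {0<..<2} \<times> UNIV" for z n
    proof (rule supp)
      show "(fst z - \<delta> n, snd z) \<notin> K"
      proof
        assume "(fst z - \<delta> n, snd z) \<in> K"
        then have "e < fst z - \<delta> n" "fst z - \<delta> n < 1" using Kt[of "(fst z - \<delta> n, snd z)"] by auto
        then show False using that e(1) d[of n] by (cases z) auto
      qed
    qed
    have 2: "(\<lambda>n. \<integral>\<^sup>+z. ?V z * ennreal (\<psi> (fst z - \<delta> n, snd z)) \<partial>lborel) \<longlonglongrightarrow> (\<integral>\<^sup>+z. ?V z * ennreal (\<psi> z) \<partial>lborel)"
    proof (rule nn_integral_dominated_convergence[where w="\<lambda>z. ennreal P * (?V z * indicator ({0<..<2} \<times> UNIV) z)"])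
      show "(\<lambda>z. ennreal P * (?V z * indicator ({0<..<2} \<times> UNIV) z)) \<in> borel_measurable lborel"
        using Vm by measurable
      show "AE z in lborel. ?V z * ennreal (\<psi> (fst z - \<delta> n, snd z)) \<le> ennreal P * (?V z * indicator ({0<..<2} \<times> UNIV) z)" for n
      proof (rule AE_I2)
        fix z :: "real \<times> (real^'n)"
        show "?V z * ennreal (\<psi> (fst z - \<delta> n, snd z)) \<le> ennreal P * (?V z * indicator ({0<..<2} \<times> UNIV) z)"
        proof (cases "z \<in> {0<..<2} \<times> UNIV")
          case True
          have "?V z * ennreal (\<psi> (fst z - \<delta> n, snd z)) \<le> ?V z * ennreal P"
            using P(2)[of "(fst z - \<delta> n, snd z)"] by (intro mult_left_mono ennreal_leI) auto
          then show ?thesis using True by (simp add: mult.commute)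
        qed (simp add: out)
      qed
      show "(\<integral>\<^sup>+z. ennreal P * (?V z * indicator ({0<..<2} \<times> UNIV) z) \<partial>lborel) < \<infinity>"
        using Vm Vfin by (simp add: nn_integral_cmult ennreal_mult_less_top)
      have "AE z in lborel. ?V z * indicator ({0<..<2} \<times> UNIV) z \<noteq> \<infinity>"
        by (rule nn_integral_PInf_AE[OF Vm]) (use Vfin in auto)
      then show "AE z in lborel. (\<lambda>n. ?V z * ennreal (\<psi> (fst z - \<delta> n, snd z))) \<longlonglongrightarrow> ?V z * ennreal (\<psi> z)"
      proof eventually_elim
        case (elim z)
        show ?case
        proof (cases "z \<in> {0<..<2} \<times> UNIV")
          case True
          then have V: "?V z < top" using elim by (simp add: less_top)
          have "(\<lambda>n. \<psi> (fst z - \<delta> n, snd z)) \<longlonglongrightarrow> \<psi> (fst z - 0, snd z)"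
            by (rule continuous_on_tendsto_compose[OF \<psi>]) (intro tendsto_Pair tendsto_intros dl, auto)
          then show ?thesis by (intro ennreal_tendsto_cmult V tendsto_ennrealI) simp
        next
          case False
          have "z \<notin> K" using False K(2) by (cases z) auto
          then show ?thesis using out[OF False] supp by simp
        qed
      qed
    qed measurable
    show "(\<lambda>n. ennreal (\<delta> n) * (\<integral>\<^sup>+z. ennreal (\<psi> z) \<partial>lborel) + (\<integral>\<^sup>+z. ?V z * ennreal (\<psi> (fst z - \<delta> n, snd z)) \<partial>lborel))
      \<longlonglongrightarrow> 0 * (\<integral>\<^sup>+z. ennreal (\<psi> z) \<partial>lborel) + (\<integral>\<^sup>+z. ?V z * ennreal (\<psi> z) \<partial>lborel)"
      by (rule tendsto_add[OF 1 2])
  qed simp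
  finally show ?thesis by simp
qed

theorem R_le_majorant:
  "AE z in lborel. z \<in> {0<..<1} \<times> UNIV \<longrightarrow> ennreal (R (fst z) (snd z)) \<le> majorant Kmaj (frozen.\<kappa> TYPE('n) C \<alpha>) z"
proof -
  \<comment> \<open>The first factor is 0 when t is within 1/(n + 3) of an endpoint of the time
    interval and 1 beyond distance 2/(n + 3); the second cuts off large x.\<close>
  define k where "k n z = max 0 (min 1 (real (n + 3) * min (fst z) (1 - fst z) - 1)) * max 0 (min 1 (real n + 1 - norm (snd z)))"
    for n and z :: "real \<times> (real^'n)"
  let ?K = "\<lambda>n. {1 / real (n + 3)..1 - 1 / real (n + 3)} \<times> cball (0::real^'n) (real n + 1)"
  show ?thesis
  proof (rule AE_le_by_duality[where k=k and K="?K"])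
    show "continuous_on UNIV (k n)" for n unfolding k_def by (intro continuous_intros)
    show "compact (?K n)" for n by (intro compact_Times) auto
    show "?K n \<subseteq> {0<..<1} \<times> UNIV" for n
    proof -
      define c where "c = 1 / real (n + 3)"
      have "0 < c" by (simp add: c_def)
      then show ?thesis unfolding c_def[symmetric] by auto
    qed
    show "k n z = 0" if "z \<notin> ?K n" for n z
    proof -
      have "fst z < 1 / real (n + 3) \<or> 1 - fst z < 1 / real (n + 3) \<or> real n + 1 < norm (snd z)"
        using that by (cases z) auto
      moreover have "real (n + 3) * min (fst z) (1 - fst z) \<le> real (n + 3) * fst z"
        "real (n + 3) * min (fst z) (1 - fst z) \<le> real (n + 3) * (1 - fst z)"
        by (intro mult_left_mono; simp)+
      moreover have "a < 1 / real (n + 3) \<Longrightarrow> real (n + 3) * a < 1" for a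
        by (simp only: pos_less_divide_eq of_nat_0_less_iff) (simp add: mult.commute)
      ultimately have "real (n + 3) * min (fst z) (1 - fst z) \<le> 1 \<or> real n + 1 < norm (snd z)"
        by (meson less_imp_le order_trans)
      then show ?thesis by (auto simp: k_def)
    qed
    show "0 \<le> k n z" "k n z \<le> 1" for n z by (auto simp: k_def intro!: mult_le_one)
    show "(\<lambda>n. k n z) \<longlonglongrightarrow> 1" if "z \<in> {0<..<1} \<times> UNIV" for z
    proof (rule tendsto_eventually)
      have m: "0 < min (fst z) (1 - fst z)" using that by (cases z) auto
      obtain N1 where N1: "2 / min (fst z) (1 - fst z) < real N1" using reals_Archimedean2 by blast
      obtain N2 where N2: "norm (snd z) < real N2" using reals_Archimedean2 by blast
      have "k n z = 1" if "n \<ge> max N1 N2" for n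
      proof -
        have "2 / min (fst z) (1 - fst z) \<le> real (n + 3)" using N1 that by linarith
        then have "2 \<le> real (n + 3) * min (fst z) (1 - fst z)" using m by (simp only: pos_divide_le_eq)
        moreover have "norm (snd z) \<le> real n" using N2 that by linarith
        ultimately show ?thesis by (simp add: k_def)
      qed
      then show "\<forall>\<^sub>F n in sequentially. k n z = 1" unfolding eventually_sequentially by blast
    qed
    show "(\<integral>\<^sup>+z. majorant Kmaj (frozen.\<kappa> TYPE('n) C \<alpha>) z * indicator ({0<..<1} \<times> UNIV) z \<partial>lborel) < \<infinity>"
    proof (rule le_less_trans)
      show "(\<integral>\<^sup>+z. majorant Kmaj (frozen.\<kappa> TYPE('n) C \<alpha>) z * indicator ({0<..<1} \<times> UNIV) z \<partial>lborel)
        \<le> (\<integral>\<^sup>+z. majorant Kmaj (frozen.\<kappa> TYPE('n) C \<alpha>) z * indicator ({0<..<2} \<times> UNIV) z \<partial>lborel)"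
        by (intro nn_integral_mono mult_left_mono) (auto simp: indicator_def)
      show "\<dots> < \<infinity>" using Kmaj_ge(3) by (intro majorant_integral_finite constants_pos) simp
    qed
  qed (use R_integrable R_nonneg majorant_dual in \<open>auto intro!: open_Times\<close>)
qed

end

section \<open>Powers of extended nonnegative reals\<close>

lemma epowr_ennreal: "0 \<le> x \<Longrightarrow> epowr (ennreal x) r = ennreal (x powr r)"
  by (simp add: epowr_def)

lemma epowr_top [simp]: "epowr top r = top"
  by (simp add: epowr_def)

lemma epowr_0 [simp]: "epowr 0 r = 0"
  by (simp add: epowr_def)

lemma epowr_mono: "x \<le> y \<Longrightarrow> 0 \<le> r \<Longrightarrow> epowr x r \<le> epowr y r"
  by (cases x; cases y) (auto simp: epowr_ennreal top_unique intro!: ennreal_leI powr_mono2)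

lemma epowr_eq_0: "epowr x r = 0 \<Longrightarrow> x = 0"
  by (cases x) (auto simp: epowr_ennreal)

lemma epowr_cmult:
  assumes "0 < c" shows "epowr (ennreal c * x) r = ennreal (c powr r) * epowr x r"
proof (cases x)
  case (real y)
  then have eq: "ennreal c * x = ennreal (c * y)" using assms by (simp add: ennreal_mult)
  have "epowr (ennreal (c * y)) r = ennreal (c powr r * y powr r)"
    using real assms by (subst epowr_ennreal) (simp_all add: powr_mult)
  then show ?thesis unfolding eq using real by (simp add: epowr_ennreal ennreal_mult)
next
  case top
  then show ?thesis using assms by (simp add: ennreal_mult_top)
qed

lemma epowr_measurable [measurable]:
  assumes [measurable]: "f \<in> borel_measurable M" shows "(\<lambda>x. epowr (f x) r) \<in> borel_measurable M"
  unfolding epowr_def by measurable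

lemma epowr_add_le:
  assumes "0 \<le> r" shows "epowr (x + y) r \<le> ennreal (2 powr r) * (epowr x r + epowr y r)"
proof -
  have "x + y \<le> ennreal 2 * max x y"
    by (cases "x \<le> y") (auto simp: max_def mult_2 intro!: add_mono)
  then have "epowr (x + y) r \<le> ennreal (2 powr r) * epowr (max x y) r"
    using epowr_mono[OF _ assms, of "x + y" "ennreal 2 * max x y"] epowr_cmult[of 2 "max x y" r] by simp
  also have "epowr (max x y) r \<le> epowr x r + epowr y r"
    by (simp add: max_def)
  finally show ?thesis by (simp add: mult_left_mono)
qed

text \<open>x^P = x^r (x^r)^(P/r - 1): an L^r bound and a bound on the supremum combine into an L^P
  bound.\<close>

lemma epowr_interpolate:
  assumes le: "epowr x r \<le> ennreal c" and "0 < c" "0 < r" "r \<le> P"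
  shows "epowr x P \<le> epowr x r * ennreal (c powr (P / r - 1))"
proof (cases x)
  case (real y)
  have yc: "y powr r \<le> c" using le real assms by (simp add: epowr_ennreal)
  have e: "0 \<le> P / r - 1" using assms by simp
  have "y powr P = y powr r * (y powr r) powr (P / r - 1)"
    using assms real by (cases "y = 0") (simp_all add: powr_powr powr_add[symmetric] right_diff_distrib)
  also have "\<dots> \<le> y powr r * c powr (P / r - 1)"
    using yc e by (intro mult_left_mono powr_mono2) auto
  finally show ?thesis using real by (simp add: epowr_ennreal ennreal_mult[symmetric] ennreal_leI)
qed (use le in \<open>simp add: top_unique\<close>)

lemma Youngs_power:
  fixes y :: real
  assumes "0 \<le> y" "1 \<le> r" shows "y \<le> (1 - 1 / r) + y powr r / r"
proof (cases "y = 0")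
  case False
  then have y: "0 < y" using assms by simp
  have "1 powr (1 - 1 / r) * (y powr r) powr (1 / r) \<le> (1 - 1 / r) * 1 + 1 / r * (y powr r)"
    using assms y by (intro Youngs_inequality_0) auto
  then show ?thesis using assms y by (simp add: powr_powr)
qed (use assms in auto)

text \<open>The tangent of the r-th power at \<open>s\<close>, solved for \<open>x\<close>.\<close>

lemma Youngs_epowr:
  assumes "0 < s" "1 \<le> r"
  shows "x \<le> ennreal (s * (1 - 1 / r)) + ennreal (s powr (1 - r) / r) * epowr x r"
proof (cases x)
  case (real y)
  have "y / s \<le> (1 - 1 / r) + (y / s) powr r / r"
    by (rule Youngs_power) (use real assms in auto)
  then have "s * (y / s) \<le> s * ((1 - 1 / r) + (y / s) powr r / r)" using assms by (intro mult_left_mono) auto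
  also have "s * (y / s) = y" using assms by simp
  also have "s * ((1 - 1 / r) + (y / s) powr r / r) = s * (1 - 1 / r) + s powr (1 - r) / r * y powr r"
    using assms real by (simp add: powr_divide powr_diff distrib_left)
  finally have "y \<le> s * (1 - 1 / r) + s powr (1 - r) / r * y powr r" .
  then have "ennreal y \<le> ennreal (s * (1 - 1 / r) + s powr (1 - r) / r * y powr r)" by (rule ennreal_leI)
  also have "\<dots> = ennreal (s * (1 - 1 / r)) + ennreal (s powr (1 - r) / r) * epowr x r"
  proof -
    have "ennreal (a + b * q) = ennreal a + ennreal b * ennreal q" if "0 \<le> a" "0 \<le> b" "0 \<le> q" for a b q
      using that by (simp add: ennreal_plus ennreal_mult)
    from this[of "s * (1 - 1 / r)" "s powr (1 - r) / r" "y powr r"] show ?thesis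
      using assms real by (simp add: epowr_ennreal)
  qed
  finally show ?thesis using real by simp
next
  case top
  have "0 < s powr (1 - r) / r" using assms by simp
  then show ?thesis using top assms by (simp add: ennreal_mult_top)
qed

text \<open>Jensen's inequality for a weight of mass at most W. The tangent inequality at a suitable
  point is integrated; this avoids normalising the weight to a probability measure and allows
  infinite values of \<open>f\<close>.\<close>

lemma epowr_Jensen:
  assumes w [measurable]: "w \<in> borel_measurable M" and f [measurable]: "f \<in> borel_measurable M"
    and W: "(\<integral>\<^sup>+x. w x \<partial>M) \<le> ennreal W" "0 < W" and r: "1 \<le> r"
  shows "epowr (\<integral>\<^sup>+x. w x * f x \<partial>M) r \<le> ennreal (W powr (r - 1)) * (\<integral>\<^sup>+x. w x * epowr (f x) r \<partial>M)"
proof (cases "\<integral>\<^sup>+x. w x * epowr (f x) r \<partial>M")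
  case top
  then show ?thesis using W by (simp add: ennreal_mult_top)
next
  case (real z)
  show ?thesis
  proof (cases "z = 0")
    case True
    then have "(\<integral>\<^sup>+x. w x * epowr (f x) r \<partial>M) = 0" using real by simp
    then have "AE x in M. w x * epowr (f x) r = 0"
      by (subst (asm) nn_integral_0_iff_AE) auto
    then have "AE x in M. w x * f x = 0" by eventually_elim (auto dest: epowr_eq_0)
    then have "(\<integral>\<^sup>+x. w x * f x \<partial>M) = 0" by (subst nn_integral_0_iff_AE) auto
    then show ?thesis by simp
  next
    case False
    then have z: "0 < z" using real by simp
    \<comment> \<open>The tangent point is the r-th root of the mean of \<open>f^r\<close>, computed
      with W as total mass; there the integrated inequality collapses to
      \<open>s * W\<close>.\<close>
    define s where "s = (z / W) powr (1 / r)"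
    have s: "0 < s" using z W by (simp add: s_def)
    have sr: "s powr r = z / W" using z W r by (simp add: s_def powr_powr)
    have "(\<integral>\<^sup>+x. w x * f x \<partial>M) \<le> (\<integral>\<^sup>+x. ennreal (s * (1 - 1 / r)) * w x + ennreal (s powr (1 - r) / r) * (w x * epowr (f x) r) \<partial>M)"
    proof (rule nn_integral_mono)
      fix x
      have "w x * f x \<le> w x * (ennreal (s * (1 - 1 / r)) + ennreal (s powr (1 - r) / r) * epowr (f x) r)"
        by (intro mult_left_mono Youngs_epowr s r) simp
      then show "w x * f x \<le> ennreal (s * (1 - 1 / r)) * w x + ennreal (s powr (1 - r) / r) * (w x * epowr (f x) r)"
        by (simp add: distrib_left mult_ac)
    qed
    also have "\<dots> = ennreal (s * (1 - 1 / r)) * (\<integral>\<^sup>+x. w x \<partial>M) + ennreal (s powr (1 - r) / r) * ennreal z"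
      by (simp add: nn_integral_add nn_integral_cmult real)
    also have "\<dots> \<le> ennreal (s * (1 - 1 / r)) * ennreal W + ennreal (s powr (1 - r) / r) * ennreal z"
      by (intro add_mono mult_left_mono W) auto
    also have "\<dots> = ennreal (s * (1 - 1 / r) * W + s powr (1 - r) / r * z)"
    proof -
      have "0 \<le> s * (1 - 1 / r)" "0 \<le> s powr (1 - r) / r" using s r by auto
      then show ?thesis using W z by (subst ennreal_plus) (simp_all only: ennreal_mult mult_nonneg_nonneg less_imp_le)
    qed
    also have "s * (1 - 1 / r) * W + s powr (1 - r) / r * z = s * W"
    proof -
      have "s powr (1 - r) * z = s * W" using s sr z W by (simp add: powr_diff)
      then have "s powr (1 - r) / r * z = s * W / r" by simp
      then show ?thesis by (simp only:) (simp add: algebra_simps)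
    qed
    finally have "epowr (\<integral>\<^sup>+x. w x * f x \<partial>M) r \<le> epowr (ennreal (s * W)) r"
      using r by (intro epowr_mono) auto
    also have "\<dots> = ennreal (s powr r * W powr r)" using s W by (simp add: epowr_ennreal powr_mult)
    also have "s powr r * W powr r = W powr (r - 1) * z" using sr W by (simp add: powr_diff)
    finally show ?thesis using real by (simp add: ennreal_mult)
  qed
qed

section \<open>Smoothing by heat kernels\<close>

lemma hk_slice_measurable [measurable]: "(\<lambda>y :: real^'n. hk \<kappa> \<tau> (y - x)) \<in> borel_measurable borel"
   "(\<lambda>x :: real^'n. hk \<kappa> \<tau> (y - x)) \<in> borel_measurable borel"
  unfolding hk_def by measurable

definition heat :: "(real^'n \<Rightarrow> ennreal) \<Rightarrow> real \<Rightarrow> real \<Rightarrow> real^'n \<Rightarrow> ennreal" where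
  "heat f \<kappa> \<tau> x = (\<integral>\<^sup>+y. ennreal (hk \<kappa> \<tau> (y - x)) * f y \<partial>lborel)"

lemma heat_joint_measurable:
  assumes [measurable]: "g \<in> borel_measurable borel"
  shows "(\<lambda>(x :: real^'n, y). ennreal (hk \<kappa> \<tau> (y - x)) * g y) \<in> borel_measurable (lborel \<Otimes>\<^sub>M lborel)"
  unfolding hk_def by measurable

lemma heat_measurable [measurable]:
  assumes "f \<in> borel_measurable borel" shows "heat f \<kappa> \<tau> \<in> borel_measurable borel"
  unfolding heat_def[abs_def]
  using lborel.borel_measurable_nn_integral[OF heat_joint_measurable[OF assms]] by simp

context
  fixes f :: "real^'n::finite \<Rightarrow> ennreal" and \<kappa> \<tau> r F :: real
  assumes f [measurable]: "f \<in> borel_measurable borel" and k: "0 < \<kappa>" "0 < \<tau>" and r: "1 \<le> r"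
    and F: "(\<integral>\<^sup>+y. epowr (f y) r \<partial>lborel) \<le> ennreal F" "0 < F"
begin

lemma heat_Jensen:
  "epowr (heat f \<kappa> \<tau> x) r \<le> ennreal (hk_mass TYPE('n) \<kappa> powr (r - 1)) * (\<integral>\<^sup>+y. ennreal (hk \<kappa> \<tau> (y - x)) * epowr (f y) r \<partial>lborel)"
  unfolding heat_def using k r hk_mass_pos[OF k(1), where 'n='n]
  by (intro epowr_Jensen) (auto simp: nn_integral_hk)

text \<open>Jensen in the kernel variable, then Fubini: one factor of the kernel mass comes from
  each variable.\<close>

lemma heat_strong: "(\<integral>\<^sup>+x. epowr (heat f \<kappa> \<tau> x) r \<partial>lborel) \<le> ennreal (hk_mass TYPE('n) \<kappa> powr r * F)"
proof -
  let ?G = "hk_mass TYPE('n) \<kappa>"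
  have G: "0 < ?G" by (rule hk_mass_pos[OF k(1)])
  have m: "(\<lambda>(x :: real^'n, y). ennreal (hk \<kappa> \<tau> (y - x)) * epowr (f y) r) \<in> borel_measurable (lborel \<Otimes>\<^sub>M lborel)"
    by (rule heat_joint_measurable) measurable
  have "(\<integral>\<^sup>+x. epowr (heat f \<kappa> \<tau> x) r \<partial>lborel)
    \<le> (\<integral>\<^sup>+x. ennreal (?G powr (r - 1)) * (\<integral>\<^sup>+y. ennreal (hk \<kappa> \<tau> (y - x)) * epowr (f y) r \<partial>lborel) \<partial>lborel)"
    by (intro nn_integral_mono heat_Jensen)
  also have "\<dots> = ennreal (?G powr (r - 1)) * (\<integral>\<^sup>+x. \<integral>\<^sup>+y. ennreal (hk \<kappa> \<tau> (y - x)) * epowr (f y) r \<partial>lborel \<partial>lborel)"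
    by (rule nn_integral_cmult) (rule lborel.borel_measurable_nn_integral[OF m])
  also have "(\<integral>\<^sup>+x. \<integral>\<^sup>+y. ennreal (hk \<kappa> \<tau> (y - x)) * epowr (f y) r \<partial>lborel \<partial>lborel)
     = (\<integral>\<^sup>+y. \<integral>\<^sup>+x. ennreal (hk \<kappa> \<tau> (y - x)) * epowr (f y) r \<partial>lborel \<partial>lborel)"
    by (rule lborel_pair.Fubini'[symmetric]) (rule m)
  also have "\<dots> = (\<integral>\<^sup>+y. ennreal ?G * epowr (f y) r \<partial>lborel)"
  proof (rule nn_integral_cong)
    fix y :: "real^'n"
    have "(\<integral>\<^sup>+x. ennreal (hk \<kappa> \<tau> (y - x)) \<partial>lborel) = ennreal ?G"
      using nn_integral_hk[OF k, of y] by (simp add: hk_sym[of \<kappa> \<tau> y])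
    then show "(\<integral>\<^sup>+x. ennreal (hk \<kappa> \<tau> (y - x)) * epowr (f y) r \<partial>lborel) = ennreal ?G * epowr (f y) r"
      by (simp add: nn_integral_multc)
  qed
  also have "\<dots> \<le> ennreal ?G * ennreal F"
    using F(1) by (simp add: nn_integral_cmult mult_left_mono)
  finally have "(\<integral>\<^sup>+x. epowr (heat f \<kappa> \<tau> x) r \<partial>lborel) \<le> ennreal (?G powr (r - 1)) * (ennreal ?G * ennreal F)"
    by (simp add: mult_left_mono)
  also have "\<dots> = ennreal (?G powr r * F)"
    using G F by (simp add: ennreal_mult[symmetric] powr_diff)
  finally show ?thesis .
qed

text \<open>After Jensen the kernel is replaced by its maximum, which gives the power of
  \<tau>.\<close>

lemma heat_sup: "epowr (heat f \<kappa> \<tau> x) r \<le> ennreal (hk_mass TYPE('n) \<kappa> powr (r - 1) * F * \<tau> powr (- (real CARD('n) / 2)))"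
proof -
  have "(\<integral>\<^sup>+y. ennreal (hk \<kappa> \<tau> (y - x)) * epowr (f y) r \<partial>lborel)
      \<le> (\<integral>\<^sup>+y. ennreal (\<tau> powr (- (real CARD('n) / 2))) * epowr (f y) r \<partial>lborel)"
    by (intro nn_integral_mono mult_right_mono ennreal_leI hk_le k) auto
  also have "\<dots> \<le> ennreal (\<tau> powr (- (real CARD('n) / 2))) * ennreal F"
    using F(1) by (simp add: nn_integral_cmult mult_left_mono)
  finally have "epowr (heat f \<kappa> \<tau> x) r \<le> ennreal (hk_mass TYPE('n) \<kappa> powr (r - 1)) * (ennreal (\<tau> powr (- (real CARD('n) / 2))) * ennreal F)"
    by (intro order_trans[OF heat_Jensen] mult_left_mono) auto
  then show ?thesis using F by (simp add: ennreal_mult[symmetric] mult_ac)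
qed

text \<open>Young's convolution inequality for the heat kernel, interpolated between
  \<open>heat_strong\<close> and \<open>heat_sup\<close>. The power of \<tau> decides how much
  integrability can be gained.\<close>

lemma heat_higher:
  assumes "r \<le> P"
  shows "(\<integral>\<^sup>+x. epowr (heat f \<kappa> \<tau> x) P \<partial>lborel) \<le> ennreal (hk_mass TYPE('n) \<kappa> powr r * F *
    (hk_mass TYPE('n) \<kappa> powr (r - 1) * F) powr (P / r - 1) * \<tau> powr (- (real CARD('n) / 2) * (P / r - 1)))"
proof -
  let ?c = "hk_mass TYPE('n) \<kappa> powr (r - 1) * F" and ?t = "\<tau> powr (- (real CARD('n) / 2))"
  have c: "0 < ?c * ?t" using hk_mass_pos[OF k(1), where 'n='n] F k by simp
  have "(\<integral>\<^sup>+x. epowr (heat f \<kappa> \<tau> x) P \<partial>lborel) \<le> (\<integral>\<^sup>+x. epowr (heat f \<kappa> \<tau> x) r * ennreal ((?c * ?t) powr (P / r - 1)) \<partial>lborel)"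
    using r assms by (intro nn_integral_mono epowr_interpolate heat_sup c) auto
  also have "\<dots> = (\<integral>\<^sup>+x. epowr (heat f \<kappa> \<tau> x) r \<partial>lborel) * ennreal ((?c * ?t) powr (P / r - 1))"
    by (rule nn_integral_multc) measurable
  also have "\<dots> \<le> ennreal (hk_mass TYPE('n) \<kappa> powr r * F) * ennreal ((?c * ?t) powr (P / r - 1))"
    by (intro mult_right_mono heat_strong) auto
  also have "(?c * ?t) powr (P / r - 1) = ?c powr (P / r - 1) * \<tau> powr (- (real CARD('n) / 2) * (P / r - 1))"
    using F hk_mass_pos[OF k(1), where 'n='n] by (simp add: powr_mult powr_powr)
  finally show ?thesis using F hk_mass_pos[OF k(1), where 'n='n] by (simp add: ennreal_mult[symmetric] mult_ac)
qed

end

lemma powr_split_le: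
  fixes x y u :: real
  assumes "0 \<le> x" "0 \<le> y" "0 \<le> u" "u \<le> 1" shows "x powr u * y powr (1 - u) \<le> x + y"
proof -
  have "x powr u * y powr (1 - u) \<le> max x y powr u * max x y powr (1 - u)"
    using assms by (intro mult_mono powr_mono2) auto
  also have "\<dots> = max x y powr 1" by (subst powr_add[symmetric]) simp
  also have "\<dots> \<le> x + y" using assms by (simp add: max_def)
  finally show ?thesis .
qed

text \<open>A pointwise form of Hoelder's inequality between the drift integrated against the
  density and the density in L^p: the left side is the geometric mean of (1 + b)^d \<rho> and
  \<rho>^p with weights u and 1 - u.\<close>

lemma powr_drift_le:
  fixes b \<rho> d p r :: real
  assumes "0 \<le> b" "0 \<le> \<rho>" "1 \<le> d" "1 \<le> p" and r: "1 / r = 1 / d + (1 - 1 / d) / p" "0 < r"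
  shows "((1 + b) * \<rho>) powr r \<le> 2 powr d * (\<rho> + b powr d * \<rho>) + \<rho> powr p"
proof (cases "\<rho> = 0")
  case False
  then have \<rho>: "0 < \<rho>" using assms by simp
  \<comment> \<open>This weight gives 1 + b the exponent r; the relation defining \<open>r\<close>
    then makes the exponents of \<rho> add up to r as well.\<close>
  define u where "u = r / d"
  have u0: "0 \<le> u" using assms by (simp add: u_def)
  have one: "1 = u + (1 - 1 / d) * r / p"
  proof -
    have "1 = r * (1 / r)" using r(2) by simp
    also have "\<dots> = u + (1 - 1 / d) * r / p" unfolding r(1) u_def by (simp add: algebra_simps)
    finally show ?thesis .
  qed
  have "0 \<le> (1 - 1 / d) * r / p" using assms by simp
  then have u1: "u \<le> 1" using one by linarith
  have pu: "p * (1 - u) = r - u"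
  proof -
    have "1 - u = (1 - 1 / d) * r / p" using one by linarith
    then have "p * (1 - u) = (1 - 1 / d) * r" using assms by simp
    then show ?thesis by (simp add: u_def algebra_simps)
  qed
  have "((1 + b) * \<rho>) powr r = ((1 + b) powr d * \<rho>) powr u * (\<rho> powr p) powr (1 - u)"
  proof -
    have "((1 + b) powr d * \<rho>) powr u * (\<rho> powr p) powr (1 - u) = (1 + b) powr (d * u) * (\<rho> powr u * \<rho> powr (p * (1 - u)))"
      using \<rho> assms by (simp add: powr_mult powr_powr)
    also have "\<rho> powr u * \<rho> powr (p * (1 - u)) = \<rho> powr r" unfolding pu by (simp add: powr_add[symmetric])
    also have "d * u = r" using assms by (simp add: u_def)
    finally show ?thesis using \<rho> assms by (simp add: powr_mult)
  qed
  also have "\<dots> \<le> (1 + b) powr d * \<rho> + \<rho> powr p"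
    using \<rho> u0 u1 by (intro powr_split_le) auto
  also have "(1 + b) powr d \<le> 2 powr d * (1 + b powr d)"
  proof -
    have "(1 + b) powr d \<le> (2 * max 1 b) powr d" using assms by (intro powr_mono2) auto
    also have "\<dots> = 2 powr d * max 1 b powr d" by (simp add: powr_mult)
    also have "\<dots> \<le> 2 powr d * (1 + b powr d)" by (intro mult_left_mono) (auto simp: max_def)
    finally show ?thesis .
  qed
  then have "(1 + b) powr d * \<rho> + \<rho> powr p \<le> 2 powr d * (1 + b powr d) * \<rho> + \<rho> powr p"
    using \<rho> by (intro add_right_mono mult_right_mono) auto
  also have "\<dots> = 2 powr d * (\<rho> + b powr d * \<rho>) + \<rho> powr p" by (simp add: algebra_simps)
  finally show ?thesis using \<open>((1 + b) * \<rho>) powr r = _\<close> by simp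
qed (use assms in simp)

section \<open>Bootstrapping integrability\<close>

locale integrable_drift = parabolic_density A B R r0 C lam \<alpha> M1
  for A :: "real \<Rightarrow> real^'n \<Rightarrow> real^'n^'n" and B R r0 C lam \<alpha> M1 +
  fixes M2 :: real
  assumes M2_nonneg: "0 \<le> M2"
    and drift_bound: "\<And>t. (\<integral>\<^sup>+x. ennreal (norm (B t x) powr real CARD('n) * R t x) \<partial>lborel) \<le> ennreal M2"
    and r0_Lp: "\<And>p. 1 \<le> p \<Longrightarrow> (\<integral>\<^sup>+x. ennreal (r0 x powr p) \<partial>lborel) < \<infinity>"
begin

lemma drift_density_power:
  assumes p: "1 \<le> p" and r: "1 / r = 1 / real CARD('n) + (1 - 1 / real CARD('n)) / p" "0 < r"
    and Bp: "(\<integral>\<^sup>+x. ennreal (R t x powr p) \<partial>lborel) \<le> ennreal Bp" "0 \<le> Bp"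
  shows "(\<integral>\<^sup>+x. epowr (ennreal ((1 + norm (B t x)) * R t x)) r \<partial>lborel) \<le> ennreal (2 powr real CARD('n) * (1 + M2) + Bp)"
proof -
  let ?d = "real CARD('n)"
  have "(\<integral>\<^sup>+x. epowr (ennreal ((1 + norm (B t x)) * R t x)) r \<partial>lborel)
     \<le> (\<integral>\<^sup>+x. ennreal (2 powr ?d) * (ennreal (R t x) + ennreal (norm (B t x) powr ?d * R t x)) + ennreal (R t x powr p) \<partial>lborel)"
  proof (rule nn_integral_mono)
    fix x
    have "((1 + norm (B t x)) * R t x) powr r \<le> 2 powr ?d * (R t x + norm (B t x) powr ?d * R t x) + R t x powr p"
      by (rule powr_drift_le) (use R_nonneg p r in \<open>auto simp: Suc_le_eq zero_less_card_finite\<close>)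
    then have "ennreal (((1 + norm (B t x)) * R t x) powr r) \<le> ennreal (2 powr ?d * (R t x + norm (B t x) powr ?d * R t x) + R t x powr p)"
      by (rule ennreal_leI)
    also have "\<dots> = ennreal (2 powr ?d) * (ennreal (R t x) + ennreal (norm (B t x) powr ?d * R t x)) + ennreal (R t x powr p)"
      using R_nonneg by (subst ennreal_plus) (simp_all only: ennreal_plus ennreal_mult mult_nonneg_nonneg add_nonneg_nonneg powr_ge_zero norm_ge_zero)
    finally show "epowr (ennreal ((1 + norm (B t x)) * R t x)) r
      \<le> ennreal (2 powr ?d) * (ennreal (R t x) + ennreal (norm (B t x) powr ?d * R t x)) + ennreal (R t x powr p)"
      using R_nonneg by (subst epowr_ennreal) auto
  qed
  also have "\<dots> = ennreal (2 powr ?d) * ((\<integral>\<^sup>+x. ennreal (R t x) \<partial>lborel) + (\<integral>\<^sup>+x. ennreal (norm (B t x) powr ?d * R t x) \<partial>lborel))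
     + (\<integral>\<^sup>+x. ennreal (R t x powr p) \<partial>lborel)"
    by (simp add: nn_integral_add nn_integral_cmult)
  also have "\<dots> \<le> ennreal (2 powr ?d) * (ennreal 1 + ennreal M2) + ennreal Bp"
    using R_le_1[of t] drift_bound[of t] Bp(1) by (intro add_mono mult_left_mono) auto
  also have "\<dots> = ennreal (2 powr ?d * (1 + M2) + Bp)"
    using M2_nonneg Bp(2) by (simp only: ennreal_plus ennreal_mult mult_nonneg_nonneg add_nonneg_nonneg powr_ge_zero zero_le_one)
  finally show ?thesis .
qed

lemma initial_part_Lp:
  assumes P: "1 \<le> P" and \<kappa>: "0 < \<kappa>"
  obtains b where "0 \<le> b" "\<And>T. 0 < T \<Longrightarrow> (\<integral>\<^sup>+x. epowr (\<integral>\<^sup>+y. ennreal (hk \<kappa> T (y - x) * r0 y) \<partial>lborel) P \<partial>lborel) \<le> ennreal b"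
proof -
  have e: "epowr (ennreal (r0 y)) P = ennreal (r0 y powr P)" for y using r0_nonneg by (rule epowr_ennreal)
  obtain F where F: "0 \<le> F" "(\<integral>\<^sup>+x. epowr (ennreal (r0 x)) P \<partial>lborel) = ennreal F"
    using r0_Lp[OF P] unfolding e by (cases "\<integral>\<^sup>+x. ennreal (r0 x powr P) \<partial>lborel") auto
  show ?thesis
  proof (rule that)
    show "0 \<le> hk_mass TYPE('n) \<kappa> powr P * (F + 1)" using F by simp
    fix T :: real assume T: "0 < T"
    \<comment> \<open>\<open>heat_strong\<close> asks for a positive bound, hence F + 1.\<close>
    have le: "(\<integral>\<^sup>+x. epowr (ennreal (r0 x)) P \<partial>lborel) \<le> ennreal (F + 1)" "0 < F + 1"
      using F by (auto intro: ennreal_leI)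
    have "(\<integral>\<^sup>+x. epowr (heat (\<lambda>y. ennreal (r0 y)) \<kappa> T x) P \<partial>lborel) \<le> ennreal (hk_mass TYPE('n) \<kappa> powr P * (F + 1))"
      by (rule heat_strong[OF _ \<kappa> T P le]) measurable
    moreover have "heat (\<lambda>y. ennreal (r0 y)) \<kappa> T x = (\<integral>\<^sup>+y. ennreal (hk \<kappa> T (y - x) * r0 y) \<partial>lborel)" for x
      unfolding heat_def ennreal_mult[OF hk_nonneg r0_nonneg] by (rule refl)
    ultimately show "(\<integral>\<^sup>+x. epowr (\<integral>\<^sup>+y. ennreal (hk \<kappa> T (y - x) * r0 y) \<partial>lborel) P \<partial>lborel) \<le> ennreal (hk_mass TYPE('n) \<kappa> powr P * (F + 1))"
      by simp
  qed
qed

abbreviation (input) f where "f t y \<equiv> ennreal ((1 + norm (B t y)) * R t y)"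

text \<open>Integrating over space first displays the drift term as a superposition of heat flows
  with weight (T - t)^(-1/2).\<close>

lemma drift_integral_eq:
  assumes K: "0 \<le> K"
  shows "(\<integral>\<^sup>+w. ennreal (drift_part K \<kappa> 0 T x w * R (fst w) (snd w)) \<partial>lborel)
    = (\<integral>\<^sup>+t. ennreal (indicator {0<..T} t * (K * (T - t) powr (-1/2))) * heat (f t) \<kappa> (T - t) x \<partial>lborel)"
proof -
  have [measurable]: "(\<lambda>w. drift_part K \<kappa> 0 T x w * R (fst w) (snd w)) \<in> borel_measurable borel"
    by measurable
  have "(\<integral>\<^sup>+w. ennreal (drift_part K \<kappa> 0 T x w * R (fst w) (snd w)) \<partial>lborel)
    = (\<integral>\<^sup>+t. \<integral>\<^sup>+y. ennreal (drift_part K \<kappa> 0 T x (t, y) * R t y) \<partial>lborel \<partial>lborel)"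
    using nn_integral_prod_lborel[of "\<lambda>t y. ennreal (drift_part K \<kappa> 0 T x (t, y) * R t y)"] by simp
  also have "\<dots> = (\<integral>\<^sup>+t. ennreal (indicator {0<..T} t * (K * (T - t) powr (-1/2))) * heat (f t) \<kappa> (T - t) x \<partial>lborel)"
  proof (rule nn_integral_cong)
    fix t
    have "ennreal (drift_part K \<kappa> 0 T x (t, y) * R t y)
      = ennreal (indicator {0<..T} t * (K * (T - t) powr (-1/2))) * (ennreal (hk \<kappa> (T - t) (y - x)) * f t y)" for y
    proof -
      have "drift_part K \<kappa> 0 T x (t, y) * R t y
        = (indicator {0<..T} t * (K * (T - t) powr (-1/2))) * (hk \<kappa> (T - t) (y - x) * ((1 + norm (B t y)) * R t y))"
        by (simp add: drift_part_def mult_ac)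
      then show ?thesis
        using K R_nonneg[of t y] hk_nonneg[of \<kappa> "T - t" "y - x"] by (simp only:) (subst ennreal_mult; simp add: ennreal_mult)
    qed
    then show "(\<integral>\<^sup>+y. ennreal (drift_part K \<kappa> 0 T x (t, y) * R t y) \<partial>lborel)
      = ennreal (indicator {0<..T} t * (K * (T - t) powr (-1/2))) * heat (f t) \<kappa> (T - t) x"
      unfolding heat_def by (simp add: nn_integral_cmult)
  qed
  finally show ?thesis .
qed

lemma heat_time_measurable: "(\<lambda>(t, x). heat (f t) \<kappa> (T - t) x) \<in> borel_measurable (lborel \<Otimes>\<^sub>M lborel)"
proof -
  have Bm [measurable]: "(\<lambda>p. B (a p) (c p)) \<in> borel_measurable N"
    if "a \<in> borel_measurable N" "c \<in> borel_measurable N" for a c and N :: "'z measure"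
    using measurable_compose[OF borel_measurable_Pair[OF that] B_meas_vec] by simp
  have Rm [measurable]: "(\<lambda>p. R (a p) (c p)) \<in> borel_measurable N"
    if "a \<in> borel_measurable N" "c \<in> borel_measurable N" for a c and N :: "'z measure"
    using measurable_compose[OF borel_measurable_Pair[OF that] R_meas] by simp
  have m: "(\<lambda>(p :: real \<times> (real^'n), y). ennreal (hk \<kappa> (T - fst p) (y - snd p)) * f (fst p) y)
      \<in> borel_measurable ((lborel \<Otimes>\<^sub>M lborel) \<Otimes>\<^sub>M lborel)"
    unfolding split_beta' by measurable
  show ?thesis unfolding heat_def split_beta'
    using lborel.borel_measurable_nn_integral[OF m] by simp
qed

lemma time_power_integral:
  assumes T: "0 < T" "T \<le> 1" and e: "-1 < e"
  shows "(\<integral>\<^sup>+t. ennreal (indicator {0<..T} t * (T - t) powr e) \<partial>lborel) \<le> ennreal (1 / (e + 1))"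
proof -
  have "(\<integral>\<^sup>+t. ennreal (indicator {0<..T} t * (T - t) powr e) \<partial>lborel)
      \<le> (\<integral>\<^sup>+t. ennreal (indicator {0..T} (T - t) * (T - t) powr e) \<partial>lborel)"
    by (intro nn_integral_mono ennreal_leI mult_right_mono) (auto simp: indicator_def)
  also have "\<dots> = (\<integral>\<^sup>+t. ennreal (indicator {0..T} t * t powr e) \<partial>lborel)"
    by (subst nn_integral_real_affine[where c="-1" and t=T]) auto
  also have "\<dots> = ennreal (T powr (e + 1) / (e + 1))"
    by (rule nn_integral_powr_from_0) (use e T in auto)
  also have "\<dots> \<le> ennreal (1 / (e + 1))"
    using T e powr_mono2[of "e + 1" T 1] by (intro ennreal_leI divide_right_mono) auto
  finally show ?thesis .
qed

text \<open>The step that gains integrability. For each t the drift flux lies in L^r by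
  \<open>drift_density_power\<close> and is carried to L^P by \<open>heat_higher\<close>. Jensen in
  time, with an integrable power of T - t as weight, brings the P-th power inside the time
  integral.\<close>

lemma drift_part_Lp:
  assumes \<kappa>: "0 < \<kappa>" and K: "0 < K" and p: "1 \<le> p"
    and Bp: "AE t in lborel. (\<integral>\<^sup>+x. ennreal (R t x powr p) \<partial>lborel) \<le> ennreal Bp" "0 \<le> Bp"
  defines "P \<equiv> p * (1 + 1 / real CARD('n))"
  obtains b where "0 \<le> b" "\<And>T. 0 < T \<Longrightarrow> T < 1 \<Longrightarrow>
    (\<integral>\<^sup>+x. epowr (\<integral>\<^sup>+w. ennreal (drift_part K \<kappa> 0 T x w * R (fst w) (snd w)) \<partial>lborel) P \<partial>lborel) \<le> ennreal b"
proof -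
  let ?d = "real CARD('n)"
  define G where "G = hk_mass TYPE('n) \<kappa>"
  have d: "1 \<le> ?d" by (simp add: Suc_le_eq zero_less_card_finite)
  have G: "0 < G" unfolding G_def by (rule hk_mass_pos[OF \<kappa>])
  \<comment> \<open>The exponent that Hoelder allows for (1 + |B|) R.\<close>
  define r where "r = 1 / (1 / ?d + (1 - 1 / ?d) / p)"
  have den: "0 < 1 / ?d + (1 - 1 / ?d) / p" using d p by (intro add_pos_nonneg) auto
  have r0: "0 < r" using den by (simp add: r_def)
  have r_eq: "1 / r = 1 / ?d + (1 - 1 / ?d) / p" by (simp add: r_def)
  have r1: "1 \<le> r"
  proof -
    have "(1 - 1 / ?d) / p \<le> (1 - 1 / ?d) / 1" using d p by (intro divide_left_mono) auto
    then have "1 / r \<le> 1" unfolding r_eq by simp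
    then show ?thesis using r0 by (simp add: divide_le_eq)
  qed
  have P_ge: "p \<le> P" unfolding P_def using d p by (simp add: algebra_simps)
  have P1: "1 \<le> P" using P_ge p by linarith
  \<comment> \<open>The cost of the smoothing, as a power of T - t. The term P/2 cancels against the
    P-th power of (T - t)^(1/2 - k); the choice of P leaves the surplus 1/(2 d), of which P k takes
    only half.\<close>
  have Pr: "?d / 2 * (P / r - 1) = P / 2 - 1 / (2 * ?d)"
  proof -
    have "P / r = P * (1 / r)" by simp
    also have "\<dots> = P / ?d + (1 + 1 / ?d) * (1 - 1 / ?d)"
      unfolding r_eq P_def using d p by (simp add: field_simps)
    finally have "?d / 2 * (P / r - 1) = ?d / 2 * (P / ?d + (1 + 1 / ?d) * (1 - 1 / ?d) - 1)" by simp
    also have "\<dots> = P / 2 - 1 / (2 * ?d)" using d by (simp add: field_simps)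
    finally show ?thesis .
  qed
  have rP: "r \<le> P"
  proof -
    have "1 / ?d \<le> 1" using d by simp
    then have "1 / ?d \<le> P" using P1 by linarith
    then have "0 \<le> P / 2 - 1 / (2 * ?d)" using d by (simp add: field_simps)
    then have "0 \<le> P / r - 1" unfolding Pr[symmetric] using d by (simp add: zero_le_mult_iff)
    then show ?thesis using r0 by (simp add: field_simps)
  qed
  txt \<open>The weight \<open>(T - t)\<^bsup>k-1\<^esup>\<close>, split off for Jensen's inequality, is integrable for every \<open>k > 0\<close>; this
    \<open>k\<close> is small enough for the remaining power \<open>e\<close> of \<open>T - t\<close> to stay above \<open>-1\<close>.\<close>
  define k where "k = 1 / (4 * ?d * P)"
  have k: "0 < k" using d P1 by (simp add: k_def)
  have Pk: "P * k = 1 / (4 * ?d)" using d P1 by (simp add: k_def)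
  define e where "e = -1 + k + 1 / (4 * ?d)"
  have e: "-1 < e" using k d by (simp add: e_def add_pos_pos)
  have e_eq: "- (1 - k) + P * (1 / 2 - k) - ?d / 2 * (P / r - 1) = e"
    unfolding Pr e_def by (simp add: algebra_simps Pk)
  define F where "F = 2 powr ?d * (1 + M2) + Bp"
  have F: "0 < F" unfolding F_def using M2_nonneg Bp by (intro add_pos_nonneg mult_pos_pos) auto
  define H where "H = G powr r * F * (G powr (r - 1) * F) powr (P / r - 1)"
  have H: "0 \<le> H" unfolding H_def using F by simp
  define b where "b = (1 / k) powr (P - 1) * (K powr P * H * (1 / (e + 1)))"
  have beq: "ennreal b = ennreal ((1 / k) powr (P - 1)) * (ennreal (K powr P * H) * ennreal (1 / (e + 1)))"
  proof -
    have "0 \<le> 1 / (e + 1)" using e by simp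
    then show ?thesis unfolding b_def using H by (simp only: ennreal_mult mult_nonneg_nonneg powr_ge_zero)
  qed
  define w where "w T t = ennreal (indicator {0<..T} t * (T - t) powr (- (1 - k)))" for T t :: real
  define g where "g T t x = ennreal (K * (T - t) powr (1 / 2 - k)) * heat (f t) \<kappa> (T - t) x" for T t x
  have [measurable]: "w T \<in> borel_measurable borel" for T unfolding w_def by measurable
  have gm [measurable]: "(\<lambda>(t, x). g T t x) \<in> borel_measurable (lborel \<Otimes>\<^sub>M lborel)" for T
    unfolding g_def split_beta' using heat_time_measurable[of \<kappa> T] unfolding split_beta' by measurable
  show ?thesis
  proof (rule that)
    show "0 \<le> b" unfolding b_def using k K H e by simp
    fix T :: real assume T: "0 < T" "T < 1"
    have eq: "(\<integral>\<^sup>+w. ennreal (drift_part K \<kappa> 0 T x w * R (fst w) (snd w)) \<partial>lborel) = (\<integral>\<^sup>+t. w T t * g T t x \<partial>lborel)" for x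
    proof -
      have "ennreal (indicator {0<..T} t * (K * (T - t) powr (-1/2))) * h = w T t * (ennreal (K * (T - t) powr (1 / 2 - k)) * h)" for t h
      proof -
        have "indicator {0<..T} t * (K * (T - t) powr (-1/2))
          = (indicator {0<..T} t * (T - t) powr (- (1 - k))) * (K * (T - t) powr (1 / 2 - k))"
          by (simp add: powr_add[symmetric])
        then have "ennreal (indicator {0<..T} t * (K * (T - t) powr (-1/2))) = w T t * ennreal (K * (T - t) powr (1 / 2 - k))"
          unfolding w_def using K by (simp only:) (rule ennreal_mult; simp)
        then show ?thesis by (simp only: mult.assoc)
      qed
      then show ?thesis unfolding drift_integral_eq[OF less_imp_le[OF K]] g_def by simp
    qed
    have W: "(\<integral>\<^sup>+t. w T t \<partial>lborel) \<le> ennreal (1 / k)"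
      unfolding w_def using time_power_integral[of T "- (1 - k)"] T k by simp
    have gx: "(\<lambda>t. g T t x) \<in> borel_measurable lborel" for x
      using measurable_compose[OF measurable_Pair2'[of x lborel lborel] gm[of T]] by simp
    have gt: "g T t \<in> borel_measurable lborel" for t
      using measurable_compose[OF measurable_Pair1'[of t lborel lborel] gm[of T]] by simp
    have m: "(\<lambda>(x, t). w T t * epowr (g T t x) P) \<in> borel_measurable (lborel \<Otimes>\<^sub>M lborel)"
      using measurable_pair_swap[OF gm[of T]] unfolding split_beta' by measurable
    have "(\<integral>\<^sup>+x. epowr (\<integral>\<^sup>+w. ennreal (drift_part K \<kappa> 0 T x w * R (fst w) (snd w)) \<partial>lborel) P \<partial>lborel)
      \<le> (\<integral>\<^sup>+x. ennreal ((1 / k) powr (P - 1)) * (\<integral>\<^sup>+t. w T t * epowr (g T t x) P \<partial>lborel) \<partial>lborel)"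
      unfolding eq using k P1 by (intro nn_integral_mono epowr_Jensen W gx) auto
    also have "\<dots> = ennreal ((1 / k) powr (P - 1)) * (\<integral>\<^sup>+x. \<integral>\<^sup>+t. w T t * epowr (g T t x) P \<partial>lborel \<partial>lborel)"
      by (rule nn_integral_cmult) (rule lborel.borel_measurable_nn_integral[OF m])
    also have "(\<integral>\<^sup>+x. \<integral>\<^sup>+t. w T t * epowr (g T t x) P \<partial>lborel \<partial>lborel)
        = (\<integral>\<^sup>+t. \<integral>\<^sup>+x. w T t * epowr (g T t x) P \<partial>lborel \<partial>lborel)"
      by (rule lborel_pair.Fubini'[OF m, symmetric])
    also have "\<dots> = (\<integral>\<^sup>+t. w T t * (\<integral>\<^sup>+x. epowr (g T t x) P \<partial>lborel) \<partial>lborel)"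
      using gt by (intro nn_integral_cong nn_integral_cmult epowr_measurable)
    also have "\<dots> \<le> (\<integral>\<^sup>+t. ennreal (K powr P * H) * ennreal (indicator {0<..T} t * (T - t) powr e) \<partial>lborel)"
    proof (rule nn_integral_mono_AE, use Bp(1) in eventually_elim)
      fix t assume t: "(\<integral>\<^sup>+x. ennreal (R t x powr p) \<partial>lborel) \<le> ennreal Bp"
      show "w T t * (\<integral>\<^sup>+x. epowr (g T t x) P \<partial>lborel) \<le> ennreal (K powr P * H) * ennreal (indicator {0<..T} t * (T - t) powr e)"
      proof (cases "0 < t \<and> t < T")
        case False
        \<comment> \<open>At t = T the negative power is 0 by the convention for
          \<open>0 powr\<close>, so the endpoint does no harm.\<close>
        then have "w T t = 0" unfolding w_def by (cases "t = T") (auto simp: indicator_def)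
        then show ?thesis by simp
      next
        case True
        then have \<tau>: "0 < T - t" by simp
        have "(\<integral>\<^sup>+x. epowr (g T t x) P \<partial>lborel)
           = ennreal ((K * (T - t) powr (1 / 2 - k)) powr P) * (\<integral>\<^sup>+x. epowr (heat (f t) \<kappa> (T - t) x) P \<partial>lborel)"
          unfolding g_def using K \<tau> \<kappa> by (subst epowr_cmult) (auto intro!: nn_integral_cmult epowr_measurable heat_measurable)
        also have "\<dots> \<le> ennreal ((K * (T - t) powr (1 / 2 - k)) powr P) * ennreal (H * (T - t) powr (- (?d / 2) * (P / r - 1)))"
          unfolding H_def G_def
          by (intro mult_left_mono heat_higher[OF _ \<kappa> \<tau> r1 _ F rP] drift_density_power[OF p r_eq r0 t Bp(2), folded F_def]) auto
        finally have "w T t * (\<integral>\<^sup>+x. epowr (g T t x) P \<partial>lborel)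
          \<le> ennreal ((T - t) powr (- (1 - k))) * (ennreal ((K * (T - t) powr (1 / 2 - k)) powr P) * ennreal (H * (T - t) powr (- (?d / 2) * (P / r - 1))))"
          using True unfolding w_def by (intro mult_mono) auto
        also have "\<dots> = ennreal ((T - t) powr (- (1 - k)) * ((K * (T - t) powr (1 / 2 - k)) powr P * (H * (T - t) powr (- (?d / 2) * (P / r - 1)))))"
          using H by (simp add: ennreal_mult)
        also have "(T - t) powr (- (1 - k)) * ((K * (T - t) powr (1 / 2 - k)) powr P * (H * (T - t) powr (- (?d / 2) * (P / r - 1))))
          = K powr P * H * ((T - t) powr (- (1 - k)) * (T - t) powr (P * (1 / 2 - k)) * (T - t) powr (- (?d / 2) * (P / r - 1)))"
          using K by (simp add: powr_mult powr_powr mult_ac)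
        also have "(T - t) powr (- (1 - k)) * (T - t) powr (P * (1 / 2 - k)) * (T - t) powr (- (?d / 2) * (P / r - 1)) = (T - t) powr e"
          unfolding powr_add[symmetric] e_eq[symmetric] by (simp add: algebra_simps)
        finally show ?thesis using True H by (simp add: ennreal_mult)
      qed
    qed
    also have "\<dots> = ennreal (K powr P * H) * (\<integral>\<^sup>+t. ennreal (indicator {0<..T} t * (T - t) powr e) \<partial>lborel)"
      by (rule nn_integral_cmult) measurable
    also have "\<dots> \<le> ennreal (K powr P * H) * ennreal (1 / (e + 1))"
      using T e by (intro mult_left_mono time_power_integral) auto
    finally show "(\<integral>\<^sup>+x. epowr (\<integral>\<^sup>+w. ennreal (drift_part K \<kappa> 0 T x w * R (fst w) (snd w)) \<partial>lborel) P \<partial>lborel) \<le> ennreal b"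
      unfolding beq by (simp only: mult_left_mono zero_le)
  qed
qed

text \<open>By \<open>R_le_majorant\<close> it suffices to bound the two parts of the majorant in
  L^P: the initial part uses that r0 lies in every L^P, the drift part brings the gain. Bounds for
  almost every t suffice, because the drift part integrates over time.\<close>

lemma R_Lp_step:
  assumes p: "1 \<le> p" and Bp: "AE t in lborel. (\<integral>\<^sup>+x. ennreal (R t x powr p) \<partial>lborel) \<le> ennreal Bp" "0 \<le> Bp"
  defines "P \<equiv> p * (1 + 1 / real CARD('n))"
  shows "\<exists>Bq\<ge>0. AE t in lborel. (\<integral>\<^sup>+x. ennreal (R t x powr P) \<partial>lborel) \<le> ennreal Bq"
proof -
  define \<kappa> where "\<kappa> = frozen.\<kappa> TYPE('n) C \<alpha>"
  have \<kappa>: "0 < \<kappa>" unfolding \<kappa>_def by (rule constants_pos)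
  have K: "0 < Kmaj" by (rule Kmaj_ge)
  have P: "1 \<le> P" unfolding P_def using p by (simp add: mult_ge1_I)
  define I0 where "I0 T x = (\<integral>\<^sup>+y. ennreal (hk \<kappa> T (y - x) * r0 y) \<partial>lborel)" for T x
  define I1 where "I1 T x = (\<integral>\<^sup>+w. ennreal (drift_part Kmaj \<kappa> 0 T x w * R (fst w) (snd w)) \<partial>lborel)" for T x
  obtain b0 where b0: "0 \<le> b0" "\<And>T. 0 < T \<Longrightarrow> (\<integral>\<^sup>+x. epowr (I0 T x) P \<partial>lborel) \<le> ennreal b0"
    by (rule initial_part_Lp[OF P \<kappa>]) (rule that, simp_all add: I0_def)
  obtain b1 where b1: "0 \<le> b1" "\<And>T. 0 < T \<Longrightarrow> T < 1 \<Longrightarrow> (\<integral>\<^sup>+x. epowr (I1 T x) P \<partial>lborel) \<le> ennreal b1"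
    by (rule drift_part_Lp[OF \<kappa> K p Bp]) (rule that, simp_all add: I1_def P_def)
  have I0m: "I0 T \<in> borel_measurable borel" for T
  proof -
    have "I0 T = heat (\<lambda>y. ennreal (r0 y)) \<kappa> T"
      unfolding I0_def[abs_def] heat_def[abs_def] ennreal_mult[OF hk_nonneg r0_nonneg] by (rule refl)
    then show ?thesis by simp
  qed
  have I1m: "I1 T \<in> borel_measurable borel" for T
  proof -
    have h: "(\<lambda>(x, t). heat (f t) \<kappa> (T - t) x) \<in> borel_measurable (lborel \<Otimes>\<^sub>M lborel)"
      using measurable_pair_swap[OF heat_time_measurable[of \<kappa> T]] by (simp add: split_beta')
    have "(\<lambda>(x, t). ennreal (indicator {0<..T} t * (Kmaj * (T - t) powr (-1/2))) * heat (f t) \<kappa> (T - t) x)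
        \<in> borel_measurable (lborel \<Otimes>\<^sub>M lborel)"
      using h unfolding split_beta' by measurable
    from lborel.borel_measurable_nn_integral[OF this] show ?thesis
      unfolding I1_def[abs_def] drift_integral_eq[OF less_imp_le[OF K]] by simp
  qed
  have "AE z in lborel \<Otimes>\<^sub>M lborel. z \<in> {0<..<1} \<times> UNIV \<longrightarrow> ennreal (R (fst z) (snd z)) \<le> majorant Kmaj \<kappa> z"
    using R_le_majorant unfolding \<kappa>_def lborel_prod .
  from lborel_pair.AE_pair[OF this]
  \<comment> \<open>Fubini for null sets: for almost every time the majorant bounds the density for
    almost every x, so it may be used inside the slice integral.\<close>
  have "AE T in lborel. AE x in lborel. T \<in> {0<..<1} \<longrightarrow> ennreal (R T x) \<le> ennreal Kmaj * I0 T x + I1 T x"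
    by (simp add: majorant_def I0_def I1_def)
  then have "AE T in lborel. (\<integral>\<^sup>+x. ennreal (R T x powr P) \<partial>lborel) \<le> ennreal (2 powr P * (Kmaj powr P * b0 + b1))"
  proof eventually_elim
    fix T assume le: "AE x in lborel. T \<in> {0<..<1} \<longrightarrow> ennreal (R T x) \<le> ennreal Kmaj * I0 T x + I1 T x"
    show "(\<integral>\<^sup>+x. ennreal (R T x powr P) \<partial>lborel) \<le> ennreal (2 powr P * (Kmaj powr P * b0 + b1))"
    proof (cases "T \<in> {0<..<1}")
      case False
      then show ?thesis using P by (simp add: R_eq_0)
    next
      case True
      have "(\<integral>\<^sup>+x. ennreal (R T x powr P) \<partial>lborel)
         \<le> (\<integral>\<^sup>+x. ennreal (2 powr P) * (ennreal (Kmaj powr P) * epowr (I0 T x) P + epowr (I1 T x) P) \<partial>lborel)"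
      proof (rule nn_integral_mono_AE, use le in eventually_elim)
        fix x assume "T \<in> {0<..<1} \<longrightarrow> ennreal (R T x) \<le> ennreal Kmaj * I0 T x + I1 T x"
        then have "epowr (ennreal (R T x)) P \<le> epowr (ennreal Kmaj * I0 T x + I1 T x) P"
          using True P by (intro epowr_mono) auto
        also have "\<dots> \<le> ennreal (2 powr P) * (epowr (ennreal Kmaj * I0 T x) P + epowr (I1 T x) P)"
          using P by (intro epowr_add_le) simp
        finally show "ennreal (R T x powr P) \<le> ennreal (2 powr P) * (ennreal (Kmaj powr P) * epowr (I0 T x) P + epowr (I1 T x) P)"
          by (simp only: epowr_ennreal[OF R_nonneg] epowr_cmult[OF K])
      qed
      also have "\<dots> = ennreal (2 powr P) * (ennreal (Kmaj powr P) * (\<integral>\<^sup>+x. epowr (I0 T x) P \<partial>lborel) + (\<integral>\<^sup>+x. epowr (I1 T x) P \<partial>lborel))"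
        using I0m[of T] I1m[of T] by (simp add: nn_integral_add nn_integral_cmult)
      also have "\<dots> \<le> ennreal (2 powr P) * (ennreal (Kmaj powr P) * ennreal b0 + ennreal b1)"
        using True b0 b1 by (intro mult_left_mono add_mono) auto
      also have "\<dots> = ennreal (2 powr P * (Kmaj powr P * b0 + b1))"
        using b0 b1 by (simp only: ennreal_plus ennreal_mult mult_nonneg_nonneg add_nonneg_nonneg powr_ge_zero)
      finally show ?thesis .
    qed
  qed
  moreover have "0 \<le> 2 powr P * (Kmaj powr P * b0 + b1)" using b0 b1 by simp
  ultimately show ?thesis by blast
qed

text \<open>The step is iterated from mass 1 along the exponents c^k, which are unbounded; the
  exponents in between follow by interpolation with p = 1.\<close>

theorem R_Lp:
  assumes p: "1 \<le> p"
  shows "\<exists>Bp\<ge>0. AE t in lborel. (\<integral>\<^sup>+x. ennreal (R t x powr p) \<partial>lborel) \<le> ennreal Bp"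
proof -
  define c where "c = 1 + 1 / real CARD('n)"
  have c: "1 < c" by (simp add: c_def zero_less_card_finite)
  have pow: "\<exists>Bp\<ge>0. AE t in lborel. (\<integral>\<^sup>+x. ennreal (R t x powr (c ^ k)) \<partial>lborel) \<le> ennreal Bp" for k
  proof (induction k)
    case 0
    show ?case using R_le_1 R_nonneg by (intro exI[of _ 1]) simp
  next
    case (Suc k)
    then obtain Bp where "AE t in lborel. (\<integral>\<^sup>+x. ennreal (R t x powr (c ^ k)) \<partial>lborel) \<le> ennreal Bp" "0 \<le> Bp" by blast
    from R_Lp_step[OF _ this] show ?case using c unfolding c_def[symmetric] by (simp add: mult.commute)
  qed
  obtain k where k: "p < c ^ k" using real_arch_pow[OF c] by blast
  obtain Bp where Bp: "0 \<le> Bp" "AE t in lborel. (\<integral>\<^sup>+x. ennreal (R t x powr (c ^ k)) \<partial>lborel) \<le> ennreal Bp"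
    using pow by blast
  from Bp(2) have "AE t in lborel. (\<integral>\<^sup>+x. ennreal (R t x powr p) \<partial>lborel) \<le> ennreal (1 + Bp)"
  proof eventually_elim
    fix t assume t: "(\<integral>\<^sup>+x. ennreal (R t x powr (c ^ k)) \<partial>lborel) \<le> ennreal Bp"
    \<comment> \<open>Where R \<le> 1 the first power dominates, where R > 1 the higher one.\<close>
    have "R t x powr p \<le> R t x + R t x powr (c ^ k)" for x
    proof (cases "R t x \<le> 1")
      case True
      have "R t x powr p \<le> R t x powr 1" using True R_nonneg p by (intro powr_mono') auto
      moreover have "0 \<le> R t x powr (c ^ k)" by simp
      ultimately show ?thesis using R_nonneg[of t x] by (simp del: powr_ge_zero)
    next
      case False
      then have "R t x powr p \<le> R t x powr (c ^ k)" using k by (intro powr_mono) auto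
      then show ?thesis using R_nonneg[of t x] by linarith
    qed
    then have "(\<integral>\<^sup>+x. ennreal (R t x powr p) \<partial>lborel) \<le> (\<integral>\<^sup>+x. ennreal (R t x) + ennreal (R t x powr (c ^ k)) \<partial>lborel)"
      using R_nonneg by (intro nn_integral_mono) (simp add: ennreal_plus[symmetric] ennreal_leI del: ennreal_plus)
    also have "\<dots> = (\<integral>\<^sup>+x. ennreal (R t x) \<partial>lborel) + (\<integral>\<^sup>+x. ennreal (R t x powr (c ^ k)) \<partial>lborel)"
      by (rule nn_integral_add) measurable
    also have "\<dots> \<le> ennreal 1 + ennreal Bp" using R_le_1[of t] t by (intro add_mono) auto
    also have "\<dots> = ennreal (1 + Bp)" using Bp(1) by simp
    finally show "(\<integral>\<^sup>+x. ennreal (R t x powr p) \<partial>lborel) \<le> ennreal (1 + Bp)" .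
  qed
  then show ?thesis using Bp(1) by (intro exI[of _ "1 + Bp"]) simp
qed

end

section \<open>Coefficients on the time interval\<close>

context drift_density begin

lemma L_op_slice_measurable:
  assumes "u \<in> test_functions \<Omega>" shows "L_op A B u t \<in> borel_measurable borel"
  using measurable_compose[OF _ L_op_measurable[OF assms], of "Pair t" borel] by simp

end

text \<open>The data are measurable only over their time intervals; extension by a constant yields
  functions on the whole space, as the locales require.\<close>

lemma measurable_extend_time:
  fixes f :: "real \<Rightarrow> real^'n \<Rightarrow> real"
  assumes f: "(\<lambda>(t, x). f t x) \<in> borel_measurable (restrict_space borel (S \<times> UNIV))" and S: "T \<subseteq> S" "T \<in> sets borel"
  shows "(\<lambda>z. if fst z \<in> T then f (fst z) (snd z) else c) \<in> borel_measurable borel"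
proof -
  have T: "T \<times> UNIV = {z :: real \<times> (real^'n). fst z \<in> T}" by auto
  have "(\<lambda>z. f (fst z) (snd z)) \<in> borel_measurable (restrict_space borel {z. fst z \<in> T})"
    unfolding T[symmetric] using measurable_restrict_mono[OF f, of "T \<times> UNIV"] S(1) by (auto simp: split_beta')
  moreover have "{z :: real \<times> (real^'n). fst z \<in> T} \<in> sets borel"
    using measurable_sets[OF fst_measurable_borel S(2)] by (simp add: vimage_def)
  ultimately show ?thesis by (subst measurable_If_restrict_space_iff) auto
qed

lemma epowr_root_leD:
  assumes le: "epowr x (1 / d) \<le> ennreal s" and "0 < d" "0 \<le> s"
  shows "x \<le> ennreal (s powr d)"
proof (cases x)
  case (real y)
  then have "y powr (1 / d) \<le> s" using le assms by (simp add: epowr_ennreal)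
  then have "(y powr (1 / d)) powr d \<le> s powr d" using assms by (intro powr_mono2) auto
  then show ?thesis using real assms by (simp add: powr_powr)
qed (use le in \<open>simp add: top_unique\<close>)

lemma inner_mat_mult: "\<xi> \<bullet> (mat \<alpha> *v \<xi>) = \<alpha> * (\<xi> \<bullet> (\<xi> :: real^'n))"
proof -
  have "mat \<alpha> *v \<xi> = \<alpha> *\<^sub>R \<xi>"
    by (simp add: vec_eq_iff mat_def matrix_vector_mult_def if_distrib[of "\<lambda>c. c * _"] cong: if_cong)
  then show ?thesis by simp
qed

theorem theorem3p1:
  fixes a :: "real \<Rightarrow> real^'n \<Rightarrow> real^'n^'n"
    and b :: "real \<Rightarrow> real^'n \<Rightarrow> real^'n"
    and \<rho> :: "real \<Rightarrow> real^'n \<Rightarrow> real"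
    and \<alpha> lam :: real
  assumes coeff: "parabolic_coefficients a b"
    and rho_borel: "(\<lambda>(t, x). \<rho> t x) \<in> borel_measurable (restrict_space borel ({0..<1} \<times> UNIV))"
    and rho_density: "\<And>t. t \<in> {0..<1} \<Longrightarrow> prob_density (\<rho> t)"
    and solution: "weak_parabolic_solution a b (spacetime_measure \<rho>) (time_slice \<rho>)"
    and initial: "has_initial_condition (time_slice \<rho>) (time_slice \<rho> 0)"
    and a_bounded: "\<exists>C. \<forall>t\<in>{0..1}. \<forall>x i j. \<bar>a t x $ i $ j\<bar> \<le> C"
    and alpha_pos: "\<alpha> > 0"
    and a_elliptic: "\<And>t x \<xi>. t \<in> {0..1} \<Longrightarrow> \<alpha> * (\<xi> \<bullet> \<xi>) \<le> \<xi> \<bullet> (a t x *v \<xi>)"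
    and a_lipschitz: "\<And>t i j. t \<in> {0..1} \<Longrightarrow> lam-lipschitz_on UNIV (\<lambda>x. a t x $ i $ j)"
    and b_L2: "(\<lambda>(t, x). norm (b t x)) \<in> Lp_space 2 (spacetime_measure \<rho>)"
    and log_L2: "(\<lambda>(t, x). ln (max (norm x) 1)) \<in> Lp_space 2 (spacetime_measure \<rho>)"
    and entropy: "finite_entropy (\<rho> 0)"
    and b_Ld: "(SUP t\<in>{0..<1}. Lp_norm (real CARD('n)) (time_slice \<rho> t) (b t)) < \<infinity>"
    and rho0_Lp: "\<And>p. p \<ge> 1 \<Longrightarrow> \<rho> 0 \<in> Lp_space p lborel"
  shows "\<forall>p\<ge>1. \<forall>q\<ge>1. \<forall>\<tau>\<in>{0<..<1}. \<rho> \<in> Lpq_space p q \<tau>"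
proof -
  let ?d = "real CARD('n)"
  have d: "1 \<le> ?d" by (simp add: Suc_le_eq)
  obtain C where C: "\<And>t x i j. t \<in> {0..1} \<Longrightarrow> \<bar>a t x $ i $ j\<bar> \<le> C" using a_bounded by blast
  define A where "A t x = (if t \<in> {0..1} then a t x else mat \<alpha>)" for t x
  define B where "B t x = (if t \<in> {0<..<1} then b t x else 0)" for t x
  define R where "R t x = (if t \<in> {0<..<1} then \<rho> t x else 0)" for t x
  obtain s where s: "0 \<le> s" "(SUP t\<in>{0..<1}. Lp_norm ?d (time_slice \<rho> t) (b t)) = ennreal s"
    using b_Ld by (cases "SUP t\<in>{0..<1}. Lp_norm ?d (time_slice \<rho> t) (b t)") auto
  define M2 where "M2 = s powr ?d"
  have \<rho>: "\<rho> t \<in> borel_measurable borel" "\<And>x. 0 \<le> \<rho> t x" "(\<integral>\<^sup>+x. ennreal (\<rho> t x) \<partial>lborel) = 1" if "t \<in> {0..<1}" for t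
  proof -
    have "prob_density (\<rho> t)" using rho_density[OF that] .
    then show "\<rho> t \<in> borel_measurable borel" "\<And>x. 0 \<le> \<rho> t x" by (auto simp: prob_density_def)
    then show "(\<integral>\<^sup>+x. ennreal (\<rho> t x) \<partial>lborel) = 1"
      using prob_space.emeasure_space_1[of "density lborel (\<lambda>x. ennreal (\<rho> t x))"] \<open>prob_density (\<rho> t)\<close>
      by (simp add: prob_density_def emeasure_density)
  qed
  have am: "(\<lambda>z. A (fst z) (snd z) $ i $ j) \<in> borel_measurable borel" for i j
  proof -
    have "(\<lambda>z. if fst z \<in> {0..1} then a (fst z) (snd z) $ i $ j else mat \<alpha> $ i $ j) \<in> borel_measurable borel"
      by (rule measurable_extend_time[where S="{0..1}"]) (use coeff in \<open>auto simp: parabolic_coefficients_def\<close>)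
    moreover have "A (fst z) (snd z) $ i $ j = (if fst z \<in> {0..1} then a (fst z) (snd z) $ i $ j else mat \<alpha> $ i $ j)" for z
      by (simp add: A_def)
    ultimately show ?thesis by (simp only:)
  qed
  have bm: "(\<lambda>z. B (fst z) (snd z) $ i) \<in> borel_measurable borel" for i
  proof -
    have "(\<lambda>z. if fst z \<in> {0<..<1} then b (fst z) (snd z) $ i else 0) \<in> borel_measurable borel"
      by (rule measurable_extend_time[where S="{0..1}"]) (use coeff in \<open>auto simp: parabolic_coefficients_def\<close>)
    moreover have "B (fst z) (snd z) $ i = (if fst z \<in> {0<..<1} then b (fst z) (snd z) $ i else 0)" for z
      by (simp add: B_def)
    ultimately show ?thesis by (simp only:)
  qed
  have Rm: "(\<lambda>z. R (fst z) (snd z)) \<in> borel_measurable borel"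
    unfolding R_def by (rule measurable_extend_time[OF rho_borel]) auto
  have R_in: "R t x = \<rho> t x" if "t \<in> {0<..<1}" for t x using that by (simp only: R_def if_True)
  have R_out: "R t x = 0" if "t \<notin> {0<..<1}" for t x using that by (simp only: R_def if_False)
  have Rslice: "R t \<in> borel_measurable borel" for t
    using measurable_compose[OF _ Rm, of "Pair t" borel] by simp
  have Bslice: "B t \<in> borel_measurable borel" for t
  proof -
    have "(\<lambda>x. B t x $ i) \<in> borel_measurable borel" for i
      using measurable_compose[OF _ bm[of i], of "Pair t" borel] by simp
    then show ?thesis
      by (subst borel_measurable_euclidean_space) (auto simp: Basis_vec_def inner_axis)
  qed
  have drift: "(\<integral>\<^sup>+x. ennreal (norm (B t x) powr ?d * R t x) \<partial>lborel) \<le> ennreal M2" for t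
  proof (cases "t \<in> {0<..<1}")
    case True
    then have t: "t \<in> {0..<1}" by simp
    have "Lp_norm ?d (time_slice \<rho> t) (b t) \<le> ennreal s" unfolding s(2)[symmetric] by (rule SUP_upper[OF t])
    then have "(\<integral>\<^sup>+x. ennreal (norm (b t x) powr ?d) \<partial>time_slice \<rho> t) \<le> ennreal M2"
      unfolding Lp_norm_def M2_def using d s(1) by (intro epowr_root_leD) auto
    moreover have "(\<integral>\<^sup>+x. ennreal (norm (b t x) powr ?d) \<partial>time_slice \<rho> t) = (\<integral>\<^sup>+x. ennreal (norm (B t x) powr ?d * R t x) \<partial>lborel)"
    proof -
      have eq: "b t x = B t x" "\<rho> t x = R t x" for x using True by (simp_all add: B_def R_def)
      show ?thesis unfolding time_slice_def eq using Rslice[of t] Bslice[of t] \<rho>(2)[OF t]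
        by (subst nn_integral_density) (simp_all add: eq ennreal_mult mult.commute)
    qed
    ultimately show ?thesis by simp
  next
    case False
    show ?thesis unfolding R_out[OF False] by simp
  qed
  have Rmass: "(\<integral>\<^sup>+x. ennreal (R t x) \<partial>lborel) \<le> ennreal 1" for t
  proof (cases "t \<in> {0<..<1}")
    case True
    then show ?thesis unfolding R_in[OF True] using \<rho>(3)[of t] by simp
  next
    case False
    show ?thesis unfolding R_out[OF False] by simp
  qed
  \<comment> \<open>The bound must also cover the extension by \<open>mat \<alpha>\<close>, hence
    \<open>max C \<alpha>\<close>. The bound \<open>1 + M2\<close> comes from |B| \<le> 1 + |B|^d
    and from slices of mass at most 1.\<close>
  interpret drift_density A B R "\<rho> 0" "max C \<alpha>" lam \<alpha> "1 + M2"
  proof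
    show "(\<integral>\<^sup>+x. ennreal (norm (B t x) * R t x) \<partial>lborel) \<le> ennreal (1 + M2)" for t
    proof -
      have [measurable]: "R t \<in> borel_measurable borel" "B t \<in> borel_measurable borel"
        by (rule Rslice Bslice)+
      have R0: "0 \<le> R t x" for x using \<rho>(2)[of t] by (simp add: R_def)
      have "norm (B t x) * R t x \<le> R t x + norm (B t x) powr ?d * R t x" for x
      proof -
        have "norm (B t x) \<le> 1 + norm (B t x) powr ?d"
        proof (cases "norm (B t x) \<le> 1")
          case False
          then have "norm (B t x) powr 1 \<le> norm (B t x) powr ?d" using d by (intro powr_mono) auto
          then show ?thesis using False by simp
        qed (simp add: add_increasing2)
        from mult_right_mono[OF this R0] show ?thesis by (simp add: algebra_simps)
      qed
      then have "(\<integral>\<^sup>+x. ennreal (norm (B t x) * R t x) \<partial>lborel) \<le> (\<integral>\<^sup>+x. ennreal (R t x) + ennreal (norm (B t x) powr ?d * R t x) \<partial>lborel)"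
        using R0 by (intro nn_integral_mono) (simp add: ennreal_plus[symmetric] ennreal_leI del: ennreal_plus)
      also have "\<dots> = (\<integral>\<^sup>+x. ennreal (R t x) \<partial>lborel) + (\<integral>\<^sup>+x. ennreal (norm (B t x) powr ?d * R t x) \<partial>lborel)"
        by (rule nn_integral_add) measurable
      also have "\<dots> \<le> ennreal 1 + ennreal M2"
        by (intro add_mono drift Rmass)
      also have "\<dots> = ennreal (1 + M2)" by (simp add: M2_def)
      finally show ?thesis .
    qed
    show "\<bar>A t x $ i $ j\<bar> \<le> max C \<alpha>" for t x i j
      using C[of t x i j] alpha_pos by (simp add: A_def mat_def le_max_iff_disj)
    show "\<bar>A t x $ i $ j - A t y $ i $ j\<bar> \<le> lam * norm (x - y)" for t x y i j
      using lipschitz_onD[OF a_lipschitz[of t i j], of x y] lipschitz_on_nonneg[OF a_lipschitz[of 0 i j]]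
      by (simp add: A_def dist_norm)
    show "0 \<le> lam" using lipschitz_on_nonneg[OF a_lipschitz[of 0]] by simp
  qed (use am bm Rm \<rho> coeff a_elliptic alpha_pos in
      \<open>auto simp: R_def A_def M2_def parabolic_coefficients_def transpose_mat inner_mat_mult\<close>)
  have slice: "(\<integral>x. h x \<partial>time_slice \<rho> t) = (\<integral>x. h x * \<rho> t x \<partial>lborel)"
    if "t \<in> {0..<1}" "h \<in> borel_measurable borel" for h :: "real^'n \<Rightarrow> real" and t
    unfolding time_slice_def using that \<rho>[of t] by (subst integral_density) (auto simp: mult.commute)
  interpret integrable_drift A B R "\<rho> 0" "max C \<alpha>" lam \<alpha> "1 + M2" M2
  proof
    fix u :: "real \<times> (real^'n) \<Rightarrow> real" assume u: "u \<in> test_functions ({0<..<1} \<times> UNIV)"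
    \<comment> \<open>Inside (0,1) the extended data agree with the given ones; outside, R = 0
      reproduces the restriction of the time integral.\<close>
    have "(\<integral>x. L_op A B u t x * R t x \<partial>lborel) = indicator {0<..<1} t *\<^sub>R (\<integral>x. L_op a b u t x \<partial>time_slice \<rho> t)" for t
    proof (cases "t \<in> {0<..<1}")
      case True
      have eq: "L_op a b u t = L_op A B u t" using True by (simp add: L_op_def A_def B_def fun_eq_iff)
      show ?thesis unfolding eq using True L_op_slice_measurable[OF u, of t] by (simp add: slice R_def)
    next
      case False
      show ?thesis unfolding R_out[OF False] using False by (simp add: indicator_def)
    qed
    then show "(\<integral>z. L_op A B u (fst z) (snd z) * R (fst z) (snd z) \<partial>lborel) = 0"
      using solution u unfolding L_op_integral_iterated[OF u]
      by (simp add: weak_parabolic_solution_def set_lebesgue_integral_def)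
  next
    fix \<zeta> :: "real^'n \<Rightarrow> real" assume \<zeta>: "\<zeta> \<in> test_functions UNIV"
    then have [measurable]: "\<zeta> \<in> borel_measurable borel"
      by (intro borel_measurable_continuous_onI smooth_continuous) (simp add: test_functions_def)
    have "((\<lambda>t. \<integral>x. \<zeta> x \<partial>time_slice \<rho> t) \<longlongrightarrow> (\<integral>x. \<zeta> x * \<rho> 0 x \<partial>lborel)) (at_right 0)"
      using initial[unfolded has_initial_condition_def, THEN bspec, OF \<zeta>] slice[of 0 \<zeta>] by simp
    moreover have "\<forall>\<^sub>F t in at_right 0. (\<integral>x. \<zeta> x \<partial>time_slice \<rho> t) = (\<integral>x. \<zeta> x * R t x \<partial>lborel)"
      unfolding eventually_at_right[OF zero_less_one] by (intro exI[of _ 1]) (simp add: slice[of _ \<zeta>] R_in)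
    ultimately show "((\<lambda>t. \<integral>x. \<zeta> x * R t x \<partial>lborel) \<longlongrightarrow> (\<integral>x. \<zeta> x * \<rho> 0 x \<partial>lborel)) (at_right 0)"
      by (rule Lim_transform_eventually)
  next
    show "(\<integral>\<^sup>+x. ennreal (\<rho> 0 x powr p) \<partial>lborel) < \<infinity>" if "1 \<le> p" for p
    proof -
      have "Lp_norm p lborel (\<rho> 0) < \<infinity>" using rho0_Lp[OF that] by (simp add: Lp_space_def)
      moreover have "\<bar>\<rho> 0 x\<bar> = \<rho> 0 x" for x using \<rho>(2)[of 0] by simp
      ultimately show ?thesis by (auto simp: Lp_norm_def epowr_def less_top split: if_splits)
    qed
  qed (use drift in \<open>auto simp: M2_def\<close>)
  show ?thesis
  proof (intro allI impI ballI)
    fix p q \<tau> :: real assume p: "1 \<le> p" and q: "1 \<le> q" and \<tau>: "\<tau> \<in> {0<..<1}"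
    obtain Bp where Bp: "0 \<le> Bp" "AE t in lborel. (\<integral>\<^sup>+x. ennreal (R t x powr p) \<partial>lborel) \<le> ennreal Bp"
      using R_Lp[OF p] by blast
    have "(\<integral>\<^sup>+t\<in>{0..\<tau>}. epowr (\<integral>\<^sup>+x. ennreal (\<bar>\<rho> t x\<bar> powr p) \<partial>lborel) (q / p) \<partial>lborel)
      \<le> (\<integral>\<^sup>+t. ennreal (Bp powr (q / p)) * indicator {0..\<tau>} t \<partial>lborel)"
    \<comment> \<open>R is 0 at time 0 while \<rho> is not, so that single time is discarded as a
      null set.\<close>
    proof (rule nn_integral_mono_AE, use Bp(2) AE_lborel_singleton[of 0] in eventually_elim)
      fix t assume t: "(\<integral>\<^sup>+x. ennreal (R t x powr p) \<partial>lborel) \<le> ennreal Bp" "t \<noteq> 0"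
      show "epowr (\<integral>\<^sup>+x. ennreal (\<bar>\<rho> t x\<bar> powr p) \<partial>lborel) (q / p) * indicator {0..\<tau>} t
        \<le> ennreal (Bp powr (q / p)) * indicator {0..\<tau>} t"
      proof (cases "t \<in> {0..\<tau>}")
        case True
        then have "t \<in> {0<..<1}" using t(2) \<tau> by auto
        then have eq: "\<bar>\<rho> t x\<bar> = R t x" for x using \<rho>(2)[of t] by (simp add: R_def)
        have "epowr (\<integral>\<^sup>+x. ennreal (\<bar>\<rho> t x\<bar> powr p) \<partial>lborel) (q / p) \<le> epowr (ennreal Bp) (q / p)"
          unfolding eq using p q by (intro epowr_mono t) auto
        then show ?thesis using Bp(1) by (intro mult_right_mono) (simp_all add: epowr_ennreal)
      qed simp
    qed
    also have "\<dots> = ennreal (Bp powr (q / p)) * ennreal \<tau>"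
      using \<tau> by (simp add: nn_integral_cmult)
    also have "\<dots> < \<infinity>" by (simp add: ennreal_mult_less_top)
    finally have "(\<integral>\<^sup>+t\<in>{0..\<tau>}. epowr (\<integral>\<^sup>+x. ennreal (\<bar>\<rho> t x\<bar> powr p) \<partial>lborel) (q / p) \<partial>lborel) < \<infinity>" .
    moreover have "(\<lambda>(t, x). \<rho> t x) \<in> borel_measurable (restrict_space borel ({0..\<tau>} \<times> UNIV))"
      by (rule measurable_restrict_mono[OF rho_borel]) (use \<tau> in auto)
    ultimately show "\<rho> \<in> Lpq_space p q \<tau>" by (simp add: Lpq_space_def)
  qed
qed

end
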